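(* Let $A\in L_\infty(\mathbf R^n;\mathcal L(\mathbf C^{n+1}))$ be accretive and assume that $T_A$ satisfies quadratic estimates. Then (Reg-$A$) is well posed if and only if (Neu$^\perp$-$A^*$) is well posed.
   Context: Points of $\mathbf R^{n+1}$ ($n\ge 1$) are $(t,x)$, $t\in\mathbf R$, $x\in\mathbf R^n$, standard basis $e_0,\dots,e_n$; vectors are written $f=f_0e_0+f_\parallel$. $A$ depends only on $x$ and is accretive: there is $\kappa_A>0$ with $\mathrm{Re}(A(x)v,v)\ge\kappa_A|v|^2$ for all $v\in\mathbf C^{n+1}$, $x\in\mathbf R^n$. $A^*$ is the pointwise adjoint matrix. $\hat{\mathcal H}^1=\{f\in L_2(\mathbf R^n;\mathbf C^{n+1}):\mathrm{curl}_x f_\parallel=0\}$, where $\mathrm{curl}_xf_\parallel=0$ means $\partial_jf_i=\partial_if_j$, $1\le i,j\le n$. $T_A$ is the operator in $\hat{\mathcal H}^1$ $$T_Af=A_{00}^{-1}\Big(\sum_{j=1}^nA_{0j}\partial_jf_0+\mathrm{div}_x(Af)_\parallel\Big)e_0-\nabla_xf_0,\quad \mathrm D(T_A)=\{f\in\hat{\mathcal H}^1:\nabla_xf_0\in L_2,\ \mathrm{div}_x(Af)_\parallel\in L_2\}.$$ It is bisectorial, so $tT_A(1+t^2T_A^2)^{-1}$ is bounded for $t>0$; $T_A$ satisfies quadratic estimates if $\int_0^\infty\|tT_A(1+t^2T_A^2)^{-1}f\|^2\frac{dt}t\approx\|f\|^2$ for all $f\in\hat{\mathcal H}^1$. For a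 coefficient matrix $A$, in the problems (Reg-$A$) and (Neu$^\perp$-$A$) one seeks $F_t\in C^1((0,\infty);L_2(\mathbf R^n;\mathbf C^{n+1}))$ such that for each $t>0$, in the sense of distributions, $\mathrm{div}_x(AF_t)_\parallel=-(A\partial_tF_t)_0$, $\nabla_x(F_t)_0=\partial_t(F_t)_\parallel$, $\mathrm{curl}_x(F_t)_\parallel=0$, and $\lim_{t\to\infty}F_t=0$, $\lim_{t\to0}F_t=f$ in $L_2$ norm, with boundary condition - (Reg-$A$): $f_\parallel=\nabla_x\psi$, given $\psi:\mathbf R^n\to\mathbf C$ with $\nabla_x\psi\in L_2(\mathbf R^n;\mathbf C^n)$; - (Neu$^\perp$-$A$): $f_0=\phi$, given $\phi\in L_2(\mathbf R^n;\mathbf C)$. A problem is well posed if for each such boundary datum there is a unique solution $F$. *)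

theory Defs
  imports "HOL-Analysis.Analysis"
begin

section \<open>The Hilbert space of square integrable functions\<close>

definition square_integrable :: "('a::euclidean_space \<Rightarrow> 'b::euclidean_space) \<Rightarrow> bool" where
  "square_integrable f \<longleftrightarrow>
     f \<in> borel_measurable lebesgue \<and> integrable lebesgue (\<lambda>x. (norm (f x))\<^sup>2)"

lemma square_integrable_add:
  assumes "square_integrable f" "square_integrable g"
  shows "square_integrable (\<lambda>x. f x + g x)"
  unfolding square_integrable_def
proof
  have [measurable]: "f \<in> borel_measurable lebesgue" "g \<in> borel_measurable lebesgue"
    using assms by (auto simp: square_integrable_def)
  show "(\<lambda>x. f x + g x) \<in> borel_measurable lebesgue" by measurable
  have bound: "(norm (a + b))\<^sup>2 \<le> 2 * (norm a)\<^sup>2 + 2 * (norm b)\<^sup>2" for a b :: 'b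
  proof -
    have "(norm (a + b))\<^sup>2 \<le> (norm a + norm b)\<^sup>2"
      by (intro power_mono norm_triangle_ineq norm_ge_zero)
    also have "\<dots> \<le> 2 * (norm a)\<^sup>2 + 2 * (norm b)\<^sup>2"
      using sum_squares_bound[of "norm a" "norm b"] by (simp add: power2_sum)
    finally show ?thesis .
  qed
  show "integrable lebesgue (\<lambda>x. (norm (f x + g x))\<^sup>2)"
  proof (rule Bochner_Integration.integrable_bound)
    show "integrable lebesgue (\<lambda>x. 2 * (norm (f x))\<^sup>2 + 2 * (norm (g x))\<^sup>2)"
      using assms by (auto simp: square_integrable_def)
    show "(\<lambda>x. (norm (f x + g x))\<^sup>2) \<in> borel_measurable lebesgue" by measurable
    show "AE x in lebesgue. norm ((norm (f x + g x))\<^sup>2)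
        \<le> norm (2 * (norm (f x))\<^sup>2 + 2 * (norm (g x))\<^sup>2)"
      using bound by auto
  qed
qed

lemma square_integrable_scaleR:
  assumes "square_integrable f"
  shows "square_integrable (\<lambda>x. c *\<^sub>R f x)"
  using assms by (auto simp: square_integrable_def power_mult_distrib)

lemma square_integrable_zero: "square_integrable (\<lambda>x. 0)"
  by (simp add: square_integrable_def)

lemma square_integrable_minus:
  "square_integrable f \<Longrightarrow> square_integrable (\<lambda>x. - f x)"
  using square_integrable_scaleR[of f "-1"] by simp

lemma square_integrable_diff:
  "square_integrable f \<Longrightarrow> square_integrable g \<Longrightarrow> square_integrable (\<lambda>x. f x - g x)"
  using square_integrable_add[OF _ square_integrable_minus, of f g] by simp

lemma integrable_inner_square_integrable:
  assumes "square_integrable f" "square_integrable g"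
  shows "integrable lebesgue (\<lambda>x. f x \<bullet> g x)"
proof -
  have "integrable lebesgue
      (\<lambda>x. ((norm (f x + g x))\<^sup>2 - (norm (f x))\<^sup>2 - (norm (g x))\<^sup>2) / 2)"
    using assms square_integrable_add[OF assms] by (auto simp: square_integrable_def)
  then show ?thesis by (simp add: dot_norm)
qed

quotient_type (overloaded) ('a, 'b) L2 = "'a::euclidean_space \<Rightarrow> 'b::euclidean_space" /
  partial: "\<lambda>f g. square_integrable f \<and> square_integrable g \<and> (AE x in lebesgue. f x = g x)"
proof (rule part_equivpI)
  show "\<exists>f :: 'a \<Rightarrow> 'b. square_integrable f \<and> square_integrable f \<and> (AE x in lebesgue. f x = f x)"
    by (intro exI[of _ "\<lambda>x. 0"]) (simp add: square_integrable_zero)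
qed (auto simp: symp_def transp_def elim: eventually_elim2 eventually_mono)

instantiation L2 :: (euclidean_space, euclidean_space) real_vector
begin

lift_definition zero_L2 :: "('a, 'b) L2" is "\<lambda>x. 0"
  by (simp add: square_integrable_zero)

lift_definition plus_L2 :: "('a, 'b) L2 \<Rightarrow> ('a, 'b) L2 \<Rightarrow> ('a, 'b) L2" is "\<lambda>f g x. f x + g x"
  by (auto simp: square_integrable_add elim: eventually_elim2)

lift_definition uminus_L2 :: "('a, 'b) L2 \<Rightarrow> ('a, 'b) L2" is "\<lambda>f x. - f x"
  by (auto simp: square_integrable_minus)

lift_definition minus_L2 :: "('a, 'b) L2 \<Rightarrow> ('a, 'b) L2 \<Rightarrow> ('a, 'b) L2" is "\<lambda>f g x. f x - g x"
  by (auto simp: square_integrable_diff elim: eventually_elim2)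

lift_definition scaleR_L2 :: "real \<Rightarrow> ('a, 'b) L2 \<Rightarrow> ('a, 'b) L2" is "\<lambda>c f x. c *\<^sub>R f x"
  by (auto simp: square_integrable_scaleR elim: eventually_mono)

instance
proof
  fix f g h :: "('a, 'b) L2" and r s :: real
  show "f + g + h = f + (g + h)" "f + g = g + f" "0 + f = f" "- f + f = 0" "f - g = f + - g"
    by (transfer; auto simp: square_integrable_zero square_integrable_add square_integrable_minus
        square_integrable_diff algebra_simps)+
  show "r *\<^sub>R (f + g) = r *\<^sub>R f + r *\<^sub>R g" "(r + s) *\<^sub>R f = r *\<^sub>R f + s *\<^sub>R f"
    "r *\<^sub>R s *\<^sub>R f = (r * s) *\<^sub>R f" "1 *\<^sub>R f = f"
    by (transfer; auto simp: square_integrable_add square_integrable_scaleR algebra_simps)+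
qed

end

instantiation L2 :: (euclidean_space, euclidean_space) real_inner
begin

lift_definition inner_L2 :: "('a, 'b) L2 \<Rightarrow> ('a, 'b) L2 \<Rightarrow> real" is
  "\<lambda>f g. integral\<^sup>L lebesgue (\<lambda>x. f x \<bullet> g x)"
proof -
  fix f f' g g' :: "'a \<Rightarrow> 'b"
  assume f: "square_integrable f \<and> square_integrable f' \<and> (AE x in lebesgue. f x = f' x)"
    and g: "square_integrable g \<and> square_integrable g' \<and> (AE x in lebesgue. g x = g' x)"
  then have "AE x in lebesgue. f x \<bullet> g x = f' x \<bullet> g' x"
    by (auto elim: eventually_elim2)
  with f g show "integral\<^sup>L lebesgue (\<lambda>x. f x \<bullet> g x) = integral\<^sup>L lebesgue (\<lambda>x. f' x \<bullet> g' x)"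
    by (intro integral_cong_AE borel_measurable_inner) (auto simp: square_integrable_def)
qed

definition norm_L2 :: "('a, 'b) L2 \<Rightarrow> real" where
  "norm_L2 f = sqrt (f \<bullet> f)"

definition sgn_L2 :: "('a, 'b) L2 \<Rightarrow> ('a, 'b) L2" where
  "sgn_L2 f = f /\<^sub>R norm f"

definition dist_L2 :: "('a, 'b) L2 \<Rightarrow> ('a, 'b) L2 \<Rightarrow> real" where
  "dist_L2 f g = norm (f - g)"

definition uniformity_L2 :: "(('a, 'b) L2 \<times> ('a, 'b) L2) filter" where
  "uniformity_L2 = (INF e\<in>{0 <..}. principal {(x, y). dist x y < e})"

definition open_L2 :: "('a, 'b) L2 set \<Rightarrow> bool" where
  "open_L2 U = (\<forall>x\<in>U. \<forall>\<^sub>F (x', y) in uniformity. x' = x \<longrightarrow> y \<in> U)"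

instance
proof
  fix f g h :: "('a, 'b) L2" and r s :: real
  show "sgn f = f /\<^sub>R norm f" by (rule sgn_L2_def)
  show "dist f g = norm (f - g)" by (rule dist_L2_def)
  show "(uniformity :: (('a, 'b) L2 \<times> _) filter) = (INF e\<in>{0 <..}. principal {(x, y). dist x y < e})"
    by (rule uniformity_L2_def)
  show "open U = (\<forall>x\<in>U. \<forall>\<^sub>F (x', y) in uniformity. x' = x \<longrightarrow> y \<in> U)" for U :: "('a, 'b) L2 set"
    by (rule open_L2_def)
  show "f \<bullet> g = g \<bullet> f"
    by transfer (simp add: inner_commute)
  show "(f + g) \<bullet> h = f \<bullet> h + g \<bullet> h"
    by transfer (simp add: inner_add_left integrable_inner_square_integrable)
  show "(r *\<^sub>R f) \<bullet> g = r * (f \<bullet> g)"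
    by transfer simp
  show "0 \<le> f \<bullet> f"
    by transfer simp
  show "f \<bullet> f = 0 \<longleftrightarrow> f = 0"
  proof transfer
    fix f :: "'a \<Rightarrow> 'b"
    assume f: "square_integrable f \<and> square_integrable f \<and> (AE x in lebesgue. f x = f x)"
    then have "integral\<^sup>L lebesgue (\<lambda>x. f x \<bullet> f x) = 0 \<longleftrightarrow> (AE x in lebesgue. f x \<bullet> f x = 0)"
      by (intro integral_nonneg_eq_0_iff_AE integrable_inner_square_integrable) auto
    then show "integral\<^sup>L lebesgue (\<lambda>x. f x \<bullet> f x) = 0 \<longleftrightarrow>
        square_integrable f \<and> square_integrable (\<lambda>x::'a. 0::'b) \<and> (AE x in lebesgue. f x = 0)"
      using f by (simp add: square_integrable_zero)
  qed
  show "norm f = sqrt (f \<bullet> f)" by (rule norm_L2_def)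
qed

end

text \<open>
  \<open>rep_L2 f\<close> is an arbitrary representative of the class \<open>f\<close>; below it only occurs under
  integrals and almost-everywhere quantifiers.
\<close>

section \<open>Weak derivatives\<close>

definition partial_deriv :: "'n \<Rightarrow> (real ^ 'n::finite \<Rightarrow> complex) \<Rightarrow> real ^ 'n \<Rightarrow> complex" where
  "partial_deriv j \<phi> x = frechet_derivative \<phi> (at x) (axis j 1)"

primrec C_diff :: "nat \<Rightarrow> (real ^ 'n::finite \<Rightarrow> complex) \<Rightarrow> bool" where
  "C_diff 0 \<phi> \<longleftrightarrow> continuous_on UNIV \<phi>"
| "C_diff (Suc k) \<phi> \<longleftrightarrow>
     (\<forall>x. \<phi> differentiable (at x)) \<and> (\<forall>j. C_diff k (partial_deriv j \<phi>))"

definition test_functions :: "(real ^ 'n::finite \<Rightarrow> complex) set" where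
  "test_functions = {\<phi>. (\<forall>k. C_diff k \<phi>) \<and> compact (closure {x. \<phi> x \<noteq> 0})}"

text \<open>
  The following three notions are meant for locally integrable arguments; they express
  \<open>\<nabla>u = g\<close>, \<open>div V = d\<close> and \<open>curl V = 0\<close> in the sense of distributions.
\<close>

definition weak_gradient ::
    "(real ^ 'n::finite \<Rightarrow> complex) \<Rightarrow> (real ^ 'n \<Rightarrow> complex ^ 'n) \<Rightarrow> bool" where
  "weak_gradient u g \<longleftrightarrow>
     (\<forall>\<phi>\<in>test_functions. \<forall>j.
        integral\<^sup>L lebesgue (\<lambda>x. u x * partial_deriv j \<phi> x)
        = - integral\<^sup>L lebesgue (\<lambda>x. g x $ j * \<phi> x))"

definition weak_divergence ::
    "(real ^ 'n::finite \<Rightarrow> complex ^ 'n) \<Rightarrow> (real ^ 'n \<Rightarrow> complex) \<Rightarrow> bool" where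
  "weak_divergence V d \<longleftrightarrow>
     (\<forall>\<phi>\<in>test_functions.
        integral\<^sup>L lebesgue (\<lambda>x. \<Sum>j\<in>UNIV. V x $ j * partial_deriv j \<phi> x)
        = - integral\<^sup>L lebesgue (\<lambda>x. d x * \<phi> x))"

definition weak_curl_free :: "(real ^ 'n::finite \<Rightarrow> complex ^ 'n) \<Rightarrow> bool" where
  "weak_curl_free V \<longleftrightarrow>
     (\<forall>\<phi>\<in>test_functions. \<forall>i j.
        integral\<^sup>L lebesgue (\<lambda>x. V x $ i * partial_deriv j \<phi> x)
        = integral\<^sup>L lebesgue (\<lambda>x. V x $ j * partial_deriv i \<phi> x))"

section \<open>Coefficients\<close>

text \<open>
  With \<open>n = CARD('n)\<close>, vectors in \<open>\<complex>\<^sup>n\<^sup>+\<^sup>1\<close> are indexed by \<open>'n option\<close>: \<open>None\<close> is the normal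
  index \<open>0\<close> and \<open>Some j\<close>, for \<open>j :: 'n\<close>, are the tangential indices \<open>1, \<dots>, n\<close>.
\<close>

type_synonym 'n cvec = "complex ^ ('n option)"

type_synonym 'n coeff = "real ^ 'n \<Rightarrow> complex ^ ('n option) ^ ('n option)"

definition normal_part :: "('n::finite) cvec \<Rightarrow> complex" where
  "normal_part v = v $ None"

definition tangential_part :: "('n::finite) cvec \<Rightarrow> complex ^ 'n" where
  "tangential_part v = (\<chi> j. v $ Some j)"

definition ess_bounded :: "('n::finite) coeff \<Rightarrow> bool" where
  "ess_bounded A \<longleftrightarrow>
     A \<in> borel_measurable lebesgue \<and> (\<exists>C. AE x in lebesgue. norm (A x) \<le> C)"

definition hermitian_inner :: "complex ^ 'm::finite \<Rightarrow> complex ^ 'm \<Rightarrow> complex" where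
  "hermitian_inner v w = (\<Sum>i\<in>UNIV. v $ i * cnj (w $ i))"

definition accretive :: "('n::finite) coeff \<Rightarrow> bool" where
  "accretive A \<longleftrightarrow>
     (\<exists>\<kappa>>0. AE x in lebesgue. \<forall>v. Re (hermitian_inner (A x *v v) v) \<ge> \<kappa> * (norm v)\<^sup>2)"

definition adjoint_coeff :: "('n::finite) coeff \<Rightarrow> 'n coeff" where
  "adjoint_coeff A = (\<lambda>x. \<chi> i j. cnj (A x $ j $ i))"

section \<open>The operator \<open>T\<^sub>A\<close> and quadratic estimates\<close>

definition H1_hat :: "(real ^ 'n::finite, 'n cvec) L2 set" where
  "H1_hat = {f. weak_curl_free (\<lambda>x. tangential_part (rep_L2 f x))}"

text \<open>
  The unbounded operator \<open>T\<^sub>A\<close> as a graph. The weak derivatives \<open>g = \<nabla>f\<^sub>0\<close> and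
  \<open>d = div (A f)\<^sub>\<parallel>\<close> are unique in \<open>L\<^sub>2\<close>, so this is single-valued with domain
  \<open>D(T\<^sub>A)\<close> whenever \<open>A\<close> is bounded and accretive.
\<close>

definition T_op :: "('n::finite) coeff \<Rightarrow>
    ((real ^ 'n, 'n cvec) L2 \<times> (real ^ 'n, 'n cvec) L2) set" where
  "T_op A = {(f, h). f \<in> H1_hat \<and>
     (\<exists>(g :: (real ^ 'n, complex ^ 'n) L2) (d :: (real ^ 'n, complex) L2).
        weak_gradient (\<lambda>x. normal_part (rep_L2 f x)) (rep_L2 g) \<and>
        weak_divergence (\<lambda>x. tangential_part (A x *v rep_L2 f x)) (rep_L2 d) \<and>
        (AE x in lebesgue.
           normal_part (rep_L2 h x) =
             inverse (A x $ None $ None) *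
               ((\<Sum>j\<in>UNIV. A x $ None $ Some j * rep_L2 g x $ j) + rep_L2 d x) \<and>
           tangential_part (rep_L2 h x) = - rep_L2 g x))}"

text \<open>
  \<open>Q_op A t f = t T\<^sub>A (1 + t\<^sup>2 T\<^sub>A\<^sup>2)\<^sup>-\<^sup>1 f\<close>. The description is proper for bounded accretive \<open>A\<close>
  and \<open>f \<in> H1_hat\<close>, because \<open>T\<^sub>A\<close> is then bisectorial.
\<close>

definition Q_op :: "('n::finite) coeff \<Rightarrow> real \<Rightarrow>
    (real ^ 'n, 'n cvec) L2 \<Rightarrow> (real ^ 'n, 'n cvec) L2" where
  "Q_op A t f = (THE w. \<exists>u v z. (u, v) \<in> T_op A \<and> (v, z) \<in> T_op A \<and>
     u + t\<^sup>2 *\<^sub>R z = f \<and> w = t *\<^sub>R v)"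

definition quadratic_estimates :: "('n::finite) coeff \<Rightarrow> bool" where
  "quadratic_estimates A \<longleftrightarrow>
     (\<exists>c>0. \<exists>C>0. \<forall>f\<in>H1_hat.
        ennreal (c * (norm f)\<^sup>2) \<le> (\<integral>\<^sup>+t\<in>{0<..}. ennreal ((norm (Q_op A t f))\<^sup>2 / t) \<partial>lborel) \<and>
        (\<integral>\<^sup>+t\<in>{0<..}. ennreal ((norm (Q_op A t f))\<^sup>2 / t) \<partial>lborel) \<le> ennreal (C * (norm f)\<^sup>2))"

section \<open>Boundary value problems\<close>

text \<open>
  \<open>F\<close> is only relevant on \<open>{0<..}\<close>; \<open>f\<close> is its boundary trace.
\<close>

definition solves_with_trace :: "('n::finite) coeff \<Rightarrow>
    (real \<Rightarrow> (real ^ 'n, 'n cvec) L2) \<Rightarrow> (real ^ 'n, 'n cvec) L2 \<Rightarrow> bool" where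
  "solves_with_trace A F f \<longleftrightarrow>
     F C1_differentiable_on {0<..} \<and>
     (\<forall>t>0.
        weak_divergence (\<lambda>x. tangential_part (A x *v rep_L2 (F t) x))
          (\<lambda>x. - normal_part (A x *v rep_L2 (vector_derivative F (at t)) x)) \<and>
        weak_gradient (\<lambda>x. normal_part (rep_L2 (F t) x))
          (\<lambda>x. tangential_part (rep_L2 (vector_derivative F (at t)) x)) \<and>
        weak_curl_free (\<lambda>x. tangential_part (rep_L2 (F t) x))) \<and>
     (F \<longlongrightarrow> 0) at_top \<and> (F \<longlongrightarrow> f) (at_right 0)"

definition Reg_solution :: "('n::finite) coeff \<Rightarrow> (real ^ 'n \<Rightarrow> complex) \<Rightarrow>
    (real \<Rightarrow> (real ^ 'n, 'n cvec) L2) \<Rightarrow> bool" where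
  "Reg_solution A \<psi> F \<longleftrightarrow>
     (\<exists>f. solves_with_trace A F f \<and> weak_gradient \<psi> (\<lambda>x. tangential_part (rep_L2 f x)))"

definition Neu_solution :: "('n::finite) coeff \<Rightarrow> (real ^ 'n, complex) L2 \<Rightarrow>
    (real \<Rightarrow> (real ^ 'n, 'n cvec) L2) \<Rightarrow> bool" where
  "Neu_solution A \<phi> F \<longleftrightarrow>
     (\<exists>f. solves_with_trace A F f \<and> (AE x in lebesgue. normal_part (rep_L2 f x) = rep_L2 \<phi> x))"

definition uniquely_solvable :: "((real \<Rightarrow> 'a) \<Rightarrow> bool) \<Rightarrow> bool" where
  "uniquely_solvable S \<longleftrightarrow>
     (\<exists>F. S F) \<and> (\<forall>F G. S F \<longrightarrow> S G \<longrightarrow> (\<forall>t>0. F t = G t))"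

definition Reg_datum :: "(real ^ 'n::finite \<Rightarrow> complex) \<Rightarrow> bool" where
  "Reg_datum \<psi> \<longleftrightarrow>
     (\<forall>K. compact K \<longrightarrow> \<psi> absolutely_integrable_on K) \<and>
     (\<exists>g :: (real ^ 'n, complex ^ 'n) L2. weak_gradient \<psi> (rep_L2 g))"

definition Reg_well_posed :: "('n::finite) coeff \<Rightarrow> bool" where
  "Reg_well_posed A \<longleftrightarrow> (\<forall>\<psi>. Reg_datum \<psi> \<longrightarrow> uniquely_solvable (Reg_solution A \<psi>))"

definition Neu_perp_well_posed :: "('n::finite) coeff \<Rightarrow> bool" where
  "Neu_perp_well_posed A \<longleftrightarrow> (\<forall>\<phi>. uniquely_solvable (Neu_solution A \<phi>))"

end

theory Submission
  imports Defs "HOL-Probability.Sinc_Integral" "HOL-Computational_Algebra.Polynomial"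
begin

text \<open>
  In the coordinates \<open>((A f)\<^sub>0, f\<^sub>\<parallel>)\<close> the equation becomes \<open>F' = - D B F\<close> with \<open>D\<close> self-adjoint and
  \<open>B\<close> coercive, and the equation for \<open>A\<^sup>*\<close>, after a sign change of the tangential part, becomes the one for
  \<open>- D B\<^sup>*\<close>. Quadratic estimates give \<open>exp (-t|DB|)\<close> and bounded spectral projections, so every datum is the
  sum of a trace for \<open>D B\<close> and one for \<open>- D B\<close>, and integrating \<open>d/ds (B F(s), G(t-s)) = 0\<close> shows that \<open>B\<^sup>*\<close> maps
  the traces of \<open>- D B\<^sup>*\<close> onto the orthogonal complement of the traces \<open>X\<close> of \<open>D B\<close>. Regularity means that the second
  coordinate is bijective on \<open>X\<close>, the Neumann problem that the first one is bijective on the complement of \<open>X\<close>;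
  these are equivalent for any closed subspace of a product of Hilbert spaces.
\<close>

text \<open>\<open>D B\<close> is in general neither self-adjoint nor normal, so no spectral theorem
  supplies its exponential; it is assembled from resolvents, in real form. For a real number
  \<lambda> in place of \<open>T = D B\<close>, \<open>P r\<close> and \<open>Q r\<close> are
  1/(1+r^2 \<lambda>^2) and r\<lambda>/(1+r^2 \<lambda>^2). With s = 1/r, \<open>U\<^sub>1\<close>
  and \<open>V\<^sub>1\<close> become the integrals over s > 0 of sin(ts)
  \<lambda>^2/(s(s^2+\<lambda>^2)) and cos(ts) \<lambda>/(s^2+\<lambda>^2), that is, pi/2 times 1 -
  exp(-t|\<lambda>|) and sgn(\<lambda>) exp(-t|\<lambda>|). Their integrands are dominated only for
  vectors in domains and ranges of \<open>T\<close>; bounds by the norm of the vector alone come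
  from the quadratic estimates. Two obstacles remain. The estimates are given for A only, while the
  splitting is also needed for the adjoint; they are therefore first turned into bounds for the
  integral of |<Q_r f, g>| dr/r, which are symmetric enough to dualize. And a regularity datum is a
  potential that need not be square integrable, so each curl-free field must be shown to have a
  locally integrable potential.\<close>

abbreviation pd where "pd == partial_deriv"
abbreviation TF where "TF == test_functions"
abbreviation lmeas where "lmeas == borel_measurable lebesgue"
abbreviation lint (binder "LIN " 10) where "lint f == integral\<^sup>L lebesgue f"
abbreviation ael (binder "AEL " 10) where "ael P == eventually P (ae_filter lebesgue)"
abbreviation hint :: "(real => ennreal) => ennreal" (binder "HI " 10) where "hint f == nn_integral (restrict_space lborel {0<..}) f"
type_synonym 'n scal = "(real ^ 'n, complex) L2"
type_synonym 'n vect = "(real ^ 'n, complex ^ 'n) L2"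
type_synonym 'n full = "(real ^ 'n, 'n cvec) L2"
type_synonym 'n cfun = "real ^ 'n => complex"
notation scaleR (infixr "*:" 75)
notation tendsto (infixr "--->" 55)
notation LIMSEQ ("((_)/ ----> (_))" [60, 60] 60)

section \<open>Hilbert spaces\<close>

text \<open>The parallelogram law makes a distance-minimising sequence Cauchy, and completeness
  supplies the minimiser; minimality along the lines through it gives orthogonality.\<close>

lemma closed_subspace_proj:
 fixes S :: "'h::{real_inner,banach} set"
 assumes S: "subspace S" "closed S"
 obtains y where "y \<in> S" "!!z. z \<in> S ==> inner (x - y) z = 0"
proof -
 define d where "d = infdist x S"
 have ne: "S ~= {}" using S(1) by (auto simp: subspace_def)
 have dle: "d <= dist x y" if "y \<in> S" for y
  unfolding d_def using that by (rule infdist_le)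
 have d0: "0 <= d" unfolding d_def by (rule infdist_nonneg)
 have "\<exists>y\<in>S. dist x y < d + inverse (real (Suc n))" for n
 proof (rule ccontr)
  assume "\<not> ?thesis"
  then have "d + inverse (real (Suc n)) <= dist x y" if "y \<in> S" for y
  using that by (meson not_less)
  then have "d + inverse (real (Suc n)) <= (INF y\<in>S. dist x y)"
  by (intro cINF_greatest ne)
  then show False using ne by (simp add: d_def infdist_def)
 qed
 then obtain y where y: "!!n. y n \<in> S" "!!n. dist x (y n) < d + inverse (real (Suc n))"
  by metis
 have par: "(norm (y n - y m))^2 <= 2 * (dist x (y n))^2 + 2 * (dist x (y m))^2 - 4 * d^2" for n m
 proof -
  let ?z = "(1/2) *: (y n + y m)"
  have "?z \<in> S" using y(1) S(1) by (intro subspace_scale subspace_add) auto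
  then have "d^2 <= (norm (x - ?z))^2" using dle[of ?z] d0 by (simp add: dist_norm power_mono)
  moreover have "(norm (y n - y m))^2 = 2 * (norm (x - y n))^2 + 2 * (norm (x - y m))^2 - 4 * (norm (x - ?z))^2"
  unfolding power2_norm_eq_inner
  by (simp add: inner_diff_left inner_diff_right inner_add_left inner_add_right inner_commute algebra_simps)
  ultimately show ?thesis by (simp add: dist_norm)
 qed
 have conv: "(%n. dist x (y n)) ----> d"
 proof (rule tendsto_sandwich[of "%_. d" _ _ "%n. d + inverse (real (Suc n))"])
  show "(%n. d + inverse (real (Suc n))) ----> d"
  using tendsto_add[OF tendsto_const LIMSEQ_inverse_real_of_nat, of d] by simp
  show "\<forall>\<^sub>F n in sequentially. dist x (y n) <= d + inverse (real (Suc n))"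
  by (rule always_eventually) (use y(2) less_imp_le in blast)
 qed (use dle y(1) in auto)
 have "Cauchy y"
 proof (rule metric_CauchyI)
  fix e :: real assume e: "0 < e"
  have "(%n. (dist x (y n))^2) ----> d\<^sup>2" by (intro tendsto_intros conv)
  then have "\<forall>\<^sub>F n in sequentially. (dist x (y n))\<^sup>2 < d^2 + e^2 / 8"
  by (rule order_tendstoD(2)) (use e in simp)
  then obtain N where N: "!!n. n >= N ==> (dist x (y n))\<^sup>2 < d^2 + e^2 / 8"
  unfolding eventually_sequentially by blast
  have "dist (y m) (y n) < e" if "m >= N" "n >= N" for m n
  proof -
  have "(norm (y m - y n))^2 < e^2"
  using par[of m n] N[OF that(1)] N[OF that(2)] e zero_less_power[OF e, of 2] by linarith
  then show ?thesis using e power_less_imp_less_base[of "norm (y m - y n)" 2 e] by (simp add: dist_norm)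
  qed
  then show "\<exists>M. \<forall>m\<ge>M. \<forall>n\<ge>M. dist (y m) (y n) < e" by blast
 qed
 then obtain l where l: "y ----> l" using Cauchy_convergent convergent_def by blast
 have lS: "l \<in> S" using closed_sequentially[OF S(2)] y(1) l by blast
 have dl: "dist x l = d"
  by (rule LIMSEQ_unique[OF tendsto_dist[OF tendsto_const l] conv])
 have "inner (x - l) z = 0" if z: "z \<in> S" for z
 proof (rule ccontr)
  assume nz: "inner (x - l) z ~= 0"
  then have z0: "0 < inner z z" by (metis inner_zero_right inner_gt_zero_iff)
  \<comment> \<open>The value at which the distance from \<open>x\<close> is least along the line
    through \<open>l\<close> in direction \<open>z\<close>; a nonzero inner product would make it
    smaller than \<open>d\<close>.\<close>
  define t where "t = inner (x - l) z / inner z z"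
  have "l + t *: z \<in> S" using lS z S(1) by (intro subspace_add subspace_scale) auto
  then have "d^2 <= (norm (x - (l + t *: z)))^2" using dle[of "l + t *: z"] d0 by (simp add: dist_norm power_mono)
  also have "\<dots> = (norm (x - l))^2 - 2 * t * inner (x - l) z + t^2 * inner z z"
  unfolding power2_norm_eq_inner
  by (simp add: inner_diff_left inner_diff_right inner_add_left inner_add_right inner_commute algebra_simps power2_eq_square)
  also have "\<dots> = d^2 - (inner (x - l) z)\<^sup>2 / inner z z"
  using dl z0 by (simp add: t_def dist_norm power2_eq_square field_simps)
  finally have "(inner (x - l) z)^2 / inner z z <= 0" by simp
  moreover have "0 < (inner (x - l) z)^2 / inner z z" using nz z0 by simp
  ultimately show False by simp
 qed
 then show thesis using that lS by blast
qed

text \<open>The route to the surjectivity claims below: a range is closed by a lower norm bound, and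
  a vector orthogonal to it is shown to vanish.\<close>

lemma closed_subspace_eq_UNIV:
 fixes S :: "'h::{real_inner,banach} set"
 assumes "subspace S" "closed S" "!!x. (!!z. z \<in> S ==> inner x z = 0) ==> x = 0"
 shows "S = UNIV"
proof -
 have "x \<in> S" for x
 proof -
  obtain y where "y \<in> S" "!!z. z \<in> S ==> inner (x - y) z = 0"
  using closed_subspace_proj[OF assms(1,2), of x] by blast
  then show ?thesis using assms(3)[of "x - y"] by simp
 qed
 then show ?thesis by blast
qed

lemma subspace_closure:
 fixes S :: "'h::real_normed_vector set"
 assumes S: "subspace S"
 shows "subspace (closure S)"
 unfolding subspace_def
proof safe
 show "0 \<in> closure S" using S closure_subset subspace_0 by blast
next
 fix x y assume "x \<in> closure S" "y \<in> closure S"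
 then obtain a b where "!!n. a n \<in> S" "a ----> x" "!!n. b n \<in> S" "b ----> y"
  by (auto simp: closure_sequential)
 then show "x + y \<in> closure S" unfolding closure_sequential
  by (intro exI[of _ "%n. a n + b n"]) (simp add: S subspace_add tendsto_add)
next
 fix c :: real and x assume "x \<in> closure S"
 then obtain a where "!!n. a n \<in> S" "a ----> x"
  by (auto simp: closure_sequential)
 then show "c *: x \<in> closure S" unfolding closure_sequential
  by (intro exI[of _ "%n. c *: a n"]) (simp add: S subspace_scale tendsto_scaleR)
qed

lemma dense_subspaceI:
 fixes S :: "'h::{real_inner,banach} set"
 assumes "subspace S" "!!x. (!!z. z \<in> S ==> inner x z = 0) ==> x = 0"
 shows "closure S = UNIV"
proof (rule closed_subspace_eq_UNIV)
 show "subspace (closure S)" using assms(1) by (rule subspace_closure)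
 show "x = 0" if "!!z. z \<in> closure S ==> inner x z = 0" for x
  using assms(2) that closure_subset by blast
qed simp

lemma riesz_rep:
 fixes ph :: "'h::{real_inner,banach} => real"
 assumes "bounded_linear ph"
 obtains y where "!!x. ph x = inner y x"
proof (cases "\<forall>x. ph x = 0")
 case True
 then show ?thesis using that[of 0] by simp
next
 case False
 interpret bounded_linear ph by fact
 let ?S = "{x. ph x = 0}"
 obtain x0 where x0: "ph x0 ~= 0" using False by blast
 have "subspace ?S" by (auto simp: subspace_def add scaleR)
 moreover have "closed ?S"
  by (intro closed_Collect_eq continuous_intros) (rule continuous_on[OF continuous_on_id])
 ultimately obtain y where y: "y \<in> ?S" "!!z. z \<in> ?S ==> inner (x0 - y) z = 0"
  using closed_subspace_proj[of ?S x0] by blast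
 define u where "u = x0 - y"
 have pu: "ph u ~= 0" using x0 y(1) by (simp add: u_def diff)
 then have u0: "inner u u ~= 0" by auto
 have "ph x = inner ((ph u / inner u u) *: u) x" for x
 proof -
  have "x - (ph x / ph u) *: u \<in> ?S" using pu by (simp add: diff scaleR)
  from y(2)[OF this] have "inner u x = ph x / ph u * inner u u"
  by (simp add: u_def[symmetric] inner_diff_right)
  then show ?thesis using u0 pu by simp
 qed
 then show ?thesis using that by blast
qed

lemma inner_ext: "(!!z. inner x z = inner y z) ==> x = (y :: 'h::real_inner)"
 by (metis inner_diff_left inner_eq_zero_iff right_minus_eq)

lemma norm_le_of_inner:
 fixes x :: "'h::real_inner"
 assumes "!!z. \<bar>inner x z\<bar> <= C * norm z" "0 <= C"
 shows "norm x <= C"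
proof (cases "x = 0")
 case False
 have "norm x * norm x <= C * norm x" using assms(1)[of x] by (simp add: norm_eq_sqrt_inner)
 then show ?thesis using False by simp
qed (use assms(2) in simp)

text \<open>Lax-Milgram. Cauchy-Schwarz turns coercivity into a lower norm bound, hence injectivity
  and a closed range; a vector orthogonal to the range is orthogonal to its own image and so
  vanishes.\<close>

lemma coercive_bij:
 fixes B :: "'h::{real_inner,banach} => 'h"
 assumes B: "bounded_linear B" and ka: "0 < ka" "!!x. ka * (norm x)^2 <= inner (B x) x"
 shows "bij B" "!!x. ka * norm x <= norm (B x)"
proof -
 interpret bounded_linear B by fact
 show low: "ka * norm x <= norm (B x)" for x
 proof (cases "x = 0")
  case False
  have "ka * norm x * norm x <= norm (B x) * norm x"
  using ka(2)[of x] norm_cauchy_schwarz[of "B x" x] by (simp add: power2_eq_square)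
  then show ?thesis using False by simp
 qed simp
 have "inj B"
 proof (rule injI)
  fix x y assume "B x = B y"
  then have "ka * norm (x - y) <= 0" using low[of "x - y"] by (simp add: diff)
  then show "x = y" using ka(1) by (simp add: mult_le_0_iff)
 qed
 moreover have "range B = UNIV"
 proof (rule closed_subspace_eq_UNIV)
  show "subspace (range B)"
  using linear_subspace_image[OF linear_axioms subspace_UNIV] .
  show "closed (range B)"
  using complete_isometric_image[OF ka(1) subspace_UNIV B _ complete_UNIV] low complete_imp_closed
  by (simp add: mult.commute)
  show "x = 0" if "!!z. z \<in> range B ==> inner x z = 0" for x
  proof -
  have "ka * (norm x)^2 <= 0" using ka(2)[of x] that[of "B x"] by (simp add: inner_commute)
  then show ?thesis using ka(1) by (simp add: mult_le_0_iff)
  qed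
 qed
 ultimately show "bij B" by (simp add: bij_def)
qed

lemma coercive_inv_bl:
 fixes B :: "'h::{real_inner,banach} => 'h"
 assumes B: "bounded_linear B" and ka: "0 < ka" "!!x. ka * (norm x)^2 <= inner (B x) x"
 shows "bounded_linear (inv B)"
proof -
 interpret bounded_linear B by fact
 note bij = coercive_bij(1)[OF B ka] and low = coercive_bij(2)[OF B ka]
 have BB: "B (inv B x) = x" for x using bij by (simp add: bij_is_surj surj_f_inv_f)
 have inj: "B x = B y ==> x = y" for x y using bij by (metis bij_inv_eq_iff)
 show ?thesis
 proof (rule bounded_linear_intro[where K="1/ka"])
  show "inv B (x + y) = inv B x + inv B y" for x y by (rule inj) (simp add: add BB)
  show "inv B (r *: x) = r *: inv B x" for r x by (rule inj) (simp add: scaleR BB)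
  show "norm (inv B x) <= norm x * (1/ka)" for x
  using low[of "inv B x"] ka(1) by (simp add: BB field_simps)
 qed
qed

lemma adj_exists:
 fixes L :: "'h::{real_inner,banach} => 'k::real_inner"
 assumes "bounded_linear L"
 obtains L' where "bounded_linear L'" "!!x y. inner (L x) y = inner x (L' y)"
proof -
 interpret bounded_linear L by fact
 have "\<exists>z. \<forall>x. inner (L x) y = inner x z" for y
 proof -
  have "bounded_linear (%x. inner (L x) y)"
  by (rule bounded_linear_compose[OF bounded_linear_inner_left assms])
  then show ?thesis by (metis riesz_rep inner_commute)
 qed
 then obtain L' where L': "!!x y. inner (L x) y = inner x (L' y)" by metis
 have L'': "inner (L' y) x = inner y (L x)" for x y by (simp add: L' inner_commute[of _ "L x"] inner_commute[of "L' y"])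
 obtain K where K: "0 < K" "!!x. norm (L x) <= norm x * K" using pos_bounded by blast
 have "bounded_linear L'"
 proof (rule bounded_linear_intro[where K=K])
  show "L' (x + y) = L' x + L' y" for x y
  by (rule inner_ext) (simp add: L'' inner_add_left)
  show "L' (r *: x) = r *: L' x" for r x
  by (rule inner_ext) (simp add: L'')
  show "norm (L' x) <= norm x * K" for x
  proof (rule norm_le_of_inner)
  fix z
  have "\<bar>inner (L' x) z\<bar> <= norm x * norm (L z)" unfolding L'' by (rule Cauchy_Schwarz_ineq2)
  also have "\<dots> <= norm x * (norm z * K)" by (intro mult_left_mono K) simp
  finally show "\<bar>inner (L' x) z\<bar> <= norm x * K * norm z" by (simp add: mult_ac)
  qed (use K in simp)
 qed
 then show thesis using that L' by blast
qed

text \<open>Uniform boundedness by Baire category: the closed sets \<open>E n\<close> exhaust the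
  space, so one of them contains a ball.\<close>

lemma pw_bdd_imp_bdd:
 fixes b :: "'i => 'h::{real_inner,banach}"
 assumes pb: "!!h. \<exists>K. \<forall>i\<in>I. \<bar>inner h (b i)\<bar> <= K"
 shows "\<exists>K. \<forall>i\<in>I. norm (b i) <= K"
proof -
 define E where "E n = {h. \<forall>i\<in>I. \<bar>inner h (b i)\<bar> <= real n}" for n
 have clE: "closed (E n)" for n
 proof -
  have "E n = (\<Inter>i\<in>I. {h. \<bar>inner h (b i)\<bar> <= real n})" unfolding E_def by auto
  moreover have "closed {h. \<bar>inner h (b i)\<bar> <= real n}" for i
  by (intro closed_Collect_le continuous_intros)
  ultimately show ?thesis by auto
 qed
 have "\<exists>n. interior (E n) ~= {}"
 proof (rule ccontr)
  assume "\<not> ?thesis"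
  then have e: "interior (E n) = {}" for n by blast
  have "(euclidean interior_of \<Union> (range E)) = {}"
  proof (rule Met_TC.metric_Baire_category_alt[unfolded mtopology_is_euclidean])
  show "Met_TC.mcomplete (TYPE('h))" by (simp add: mcomplete_iff_complete complete_UNIV)
  show "countable (range E)" by simp
  show "closedin euclidean T \<and> euclidean interior_of T = {}" if "T \<in> range E" for T
  using that clE e by auto
  qed
  moreover have "\<Union> (range E) = UNIV"
  proof -
  have "h \<in> \<Union> (range E)" for h
  proof -
  obtain K where K: "\<forall>i\<in>I. \<bar>inner h (b i)\<bar> <= K" using pb by blast
  obtain n where "K <= real n" using real_arch_simple by blast
  then have "h \<in> E n" using K by (force simp: E_def)
  then show ?thesis by blast
  qed
  then show ?thesis by blast
  qed
  ultimately show False by simp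
 qed
 then obtain n h0 where "h0 \<in> interior (E n)" by blast
 then obtain e where e: "0 < e" "cball h0 e \<subseteq> E n" using mem_interior_cball by blast
 have "norm (b i) <= 2 * real n / e" if i: "i \<in> I" for i
 proof (cases "b i = 0")
  case False
  \<comment> \<open>The step of length \<open>e\<close> from the centre in the direction of
    \<open>b i\<close> reads off \<open>norm (b i)\<close>, and both end points lie in
    \<open>E n\<close>.\<close>
  define z where "z = h0 + (e / norm (b i)) *: b i"
  have "z \<in> cball h0 e" using e(1) False by (simp add: z_def dist_norm)
  then have 1: "\<bar>inner z (b i)\<bar> <= real n" using e(2) i by (auto simp: E_def)
  have 2: "\<bar>inner h0 (b i)\<bar> <= real n" using e i by (force simp: E_def)
  have "inner z (b i) - inner h0 (b i) = e * norm (b i)"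
  using False by (simp add: z_def inner_add_left power2_norm_eq_inner[symmetric] power2_eq_square)
  then have "e * norm (b i) <= 2 * real n" using 1 2 by linarith
  then show ?thesis using e(1) by (simp add: field_simps)
 qed (use e in simp)
 then show ?thesis by blast
qed

text \<open>
 With \<open>X\<close> the graph of a bounded \<open>S : K \<rightarrow> H\<close>, its orthogonal complement is the
 graph of \<open>-S\<^sup>*\<close>; the uniform boundedness principle replaces the closed graph theorem.
\<close>

lemma snd_bij_imp_orth_fst_bij:
 fixes X :: "('h::{real_inner,banach} \<times> 'k::{real_inner,banach}) set"
 assumes X: "subspace X" "closed X" and bij: "!!k. \<exists>!x. x \<in> X \<and> snd x = k"
  and Y: "Y = {y. \<forall>x\<in>X. inner x y = 0}"
 shows "\<exists>!y. y \<in> Y \<and> fst y = h"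
proof -
 have XY: "x \<in> X" if "!!y. y \<in> Y ==> inner x y = 0" for x
 proof -
  obtain p where p: "p \<in> X" "!!z. z \<in> X ==> inner (x - p) z = 0"
  using closed_subspace_proj[OF X] by blast
  then have "x - p \<in> Y" by (auto simp: Y inner_commute)
  then have "inner x (x - p) = 0" "inner (x - p) p = 0" using that p by auto
  then have "inner (x - p) (x - p) = 0" by (simp add: inner_diff_right inner_commute)
  then show ?thesis using p(1) by simp
 qed
 have X0: "x = 0" if "x \<in> X" "snd x = 0" for x
  using bij[of 0] that X(1) by (metis subspace_0 snd_zero)
 have "\<exists>h. (h, k) \<in> X" for k using bij[of k] by (metis prod.collapse)
 then obtain S where S: "!!k. (S k, k) \<in> X" by metis
 have sY: "subspace Y" unfolding Y by (auto simp: subspace_def inner_add_right)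
 have cY: "closed Y"
 proof -
  have "Y = (\<Inter>x\<in>X. {y. inner x y = 0})" unfolding Y by auto
  moreover have "closed {y. inner x y = 0}" for x by (intro closed_Collect_eq continuous_intros)
  ultimately show ?thesis by auto
 qed
 define I where "I = {y \<in> Y. norm (fst y) <= 1}"
 have "\<exists>K. \<forall>y\<in>I. norm (snd y) <= K"
 proof (rule pw_bdd_imp_bdd)
  fix k
  have "\<bar>inner k (snd y)\<bar> <= norm (S k)" if "y \<in> I" for y
  proof -
  have "inner (S k, k) y = 0" using that S by (auto simp: I_def Y)
  then have "inner k (snd y) = - inner (S k) (fst y)" by (simp add: inner_prod_def)
  then have "\<bar>inner k (snd y)\<bar> <= norm (S k) * norm (fst y)" using Cauchy_Schwarz_ineq2[of "S k" "fst y"] by simp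
  also have "\<dots> <= norm (S k) * 1" using that by (intro mult_left_mono) (auto simp: I_def)
  finally show ?thesis by simp
  qed
  then show "\<exists>K. \<forall>i\<in>I. \<bar>inner k (snd i)\<bar> <= K" by blast
 qed
 then obtain K where K: "!!y. y \<in> I ==> norm (snd y) <= K" by blast
 have "0 \<in> I" using sY by (simp add: I_def subspace_0)
 from K[OF this] have K0: "0 <= K" by simp
 have bd: "norm (snd y) <= K * norm (fst y)" if y: "y \<in> Y" for y
 proof (cases "fst y = 0")
  case True
  \<comment> \<open>Every multiple of such a \<open>y\<close> lies in \<open>I\<close>, so the bound
    on \<open>I\<close> forces \<open>snd y = 0\<close>.\<close>
  have "norm (snd y) * c <= K" if "0 < c" for c
  using K[of "c *: y"] y sY True that by (simp add: I_def subspace_scale mult.commute)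
  from this[of "(K + 1) / norm (snd y)"] have "norm (snd y) <= 0"
  using K0 by (cases "norm (snd y) = 0") auto
  then show ?thesis using True by simp
 next
  case False
  have "norm (snd ((1 / norm (fst y)) *: y)) <= K"
  by (rule K) (use y sY False in \<open>simp add: I_def subspace_scale\<close>)
  then show ?thesis using False by (simp add: field_simps)
 qed
 have lowY: "norm y <= (1 + K) * norm (fst y)" if "y \<in> Y" for y
  using bd[OF that] norm_Pair_le[of "fst y" "snd y"] by (simp add: algebra_simps)
 have "fst ` Y = UNIV"
 proof (rule closed_subspace_eq_UNIV)
  show "subspace (fst ` Y)" by (rule linear_subspace_image[OF linear_fst sY])
  have "complete (fst ` Y)"
  using lowY K0 cY
  by (intro complete_isometric_image[of "1/(1+K)"] sY bounded_linear_fst)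
  (auto simp: field_simps complete_eq_closed)
  then show "closed (fst ` Y)" by (rule complete_imp_closed)
  fix a assume a: "!!z. z \<in> fst ` Y ==> inner a z = 0"
  \<comment> \<open>A vector orthogonal to all first coordinates of \<open>Y\<close> yields an
    element of the double orthogonal complement \<open>X\<close> with zero second coordinate;
    injectivity of \<open>snd\<close> on \<open>X\<close> removes it.\<close>
  have "(a, 0) \<in> X" by (rule XY) (auto simp: inner_prod_def a)
  then show "a = 0" using X0[of "(a, 0)"] by (simp add: zero_prod_def)
 qed
 then obtain y where y: "y \<in> Y" "fst y = h" by (metis UNIV_I imageE)
 show ?thesis
 proof (rule ex1I[of _ y])
  fix y' assume y': "y' \<in> Y \<and> fst y' = h"
  then have "y' - y \<in> Y" using y sY by (simp add: subspace_diff)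
  from lowY[OF this] y y' show "y' = y" by simp
 qed (use y in simp)
qed

text \<open>The preceding result with the two factors exchanged; \<open>prod.swap\<close> is its own
  adjoint and therefore respects orthogonal complements.\<close>

lemma fst_bij_imp_orth_snd_bij:
 fixes Y :: "('h::{real_inner,banach} \<times> 'k::{real_inner,banach}) set"
 assumes Y: "subspace Y" "closed Y" and bij: "!!h. \<exists>!y. y \<in> Y \<and> fst y = h"
  and X: "X = {x. \<forall>y\<in>Y. inner x y = 0}"
 shows "\<exists>!x. x \<in> X \<and> snd x = k"
proof -
 have bl: "bounded_linear (prod.swap :: 'h \<times> 'k => 'k \<times> 'h)" "bounded_linear (prod.swap :: 'k \<times> 'h => 'h \<times> 'k)"
  by (simp_all add: prod.swap_def[abs_def] bounded_linear_Pair bounded_linear_fst bounded_linear_snd)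
 have inn: "inner (prod.swap x) y = inner x (prod.swap y)" for x :: "'h \<times> 'k" and y
  by (cases x, cases y) (simp add: inner_prod_def add.commute)
 have Yv: "prod.swap ` Y = prod.swap -` Y"
  by (force simp: image_iff)
 have "\<exists>!x. x \<in> prod.swap ` X \<and> fst x = k"
 proof (rule snd_bij_imp_orth_fst_bij)
  show "subspace (prod.swap ` Y)" by (rule linear_subspace_image[OF bounded_linear.linear[OF bl(1)] Y(1)])
  show "closed (prod.swap ` Y)" unfolding Yv
  by (intro closed_vimage Y(2)) (rule bounded_linear.continuous_on[OF bl(2) continuous_on_id])
  show "\<exists>!x. x \<in> prod.swap ` Y \<and> snd x = h" for h
  using bij[of h] by (auto simp: image_iff)
  show "prod.swap ` X = {y. \<forall>x\<in>prod.swap ` Y. inner x y = 0}"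
  unfolding X by (auto simp: inn image_iff inner_commute)
 qed
 then obtain x where x: "x \<in> prod.swap ` X" "fst x = k" "!!y. y \<in> prod.swap ` X ==> fst y = k ==> y = x" by blast
 show ?thesis
 proof (rule ex1I[of _ "prod.swap x"])
  show "prod.swap x \<in> X \<and> snd (prod.swap x) = k" using x(1,2) by auto
  fix z assume "z \<in> X \<and> snd z = k"
  then show "z = prod.swap x" using x(3)[of "prod.swap z"] by (metis fst_swap image_eqI swap_swap)
 qed
qed

section \<open>Integrals on the half line\<close>

abbreviation halfline :: "real measure" where
 "halfline \<equiv> restrict_space lborel {0<..}"

lemma space_half [simp]: "space halfline = {0<..}"
 by (simp add: space_restrict_space)

lemma meas_half_cont:
 fixes f :: "real => 'b::topological_space"
 shows "continuous_on {0<..} f ==> f \<in> borel_measurable halfline"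
 using borel_measurable_continuous_on_restrict[of "{0<..}" f]
 by (simp add: measurable_cong_sets[OF sets_restrict_space_cong[OF sets_lborel] refl])

lemma intble_half_iff: "integrable halfline f \<longleftrightarrow> set_integrable lborel {0<..} f"
 for f :: "real => real"
 by (simp add: integrable_restrict_space set_integrable_def)

lemma int_half_eq: "integral\<^sup>L halfline f = (LINT r:{0<..}|lborel. f r)"
 for f :: "real => real"
 by (simp add: integral_restrict_space set_lebesgue_integral_def)

lemma intble_half_bound:
 fixes f :: "real => real"
 assumes "continuous_on {0<..} f" "integrable halfline k" "!!r. 0 < r ==> \<bar>f r\<bar> <= k r"
 shows "integrable halfline f"
 by (rule Bochner_Integration.integrable_bound[OF assms(2) meas_half_cont[OF assms(1)]])
  (use assms(3) in \<open>auto intro!: AE_I2 order_trans[OF _ abs_ge_self]\<close>)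

text \<open>The common majorant of the kernels below. They are bounded near zero and decay like
  1/r^2 at infinity, and \<open>le_min_inv_square\<close> merges two such bounds into one multiple
  of it.\<close>

lemma intble_half_min_inv_square:
 "integrable halfline (%r. min 1 (1 / r^2))"
proof -
 have 1: "set_integrable lborel {0<..1} (%r::real. min 1 (1 / r^2))"
 proof (rule set_integrable_bound)
  show "set_integrable lborel {0<..1} (%_::real. 1::real)" by (simp add: set_integrable_def)
 qed (auto simp: set_borel_measurable_def intro!: AE_I2)
 have "set_integrable lborel {1<..} (%r::real. 1 / r^2)"
 proof -
  have "set_integrable lborel (einterval (ereal 1) \<infinity>) (%r. 1 / r^2)"
  proof (rule interval_integral_FTC_nonneg(1)[where F="%r. - 1 / r" and A="-1" and B=0])
  show "DERIV (%r. - 1 / r) x :> 1 / x^2" if "ereal 1 < ereal x" for x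
  using that by (auto intro!: derivative_eq_intros simp: power2_eq_square)
  show "isCont (%r. 1 / r^2) x" if "ereal 1 < ereal x" for x :: real
  using that by (intro continuous_intros) auto
  show "(((%r. - 1 / r) \<circ> real_of_ereal) ---> - 1) (at_right (ereal 1))"
  unfolding ereal_tendsto_simps
  by (intro tendsto_eq_intros | simp)+
  show "(((%r. - 1 / r) \<circ> real_of_ereal) ---> 0) (at_left \<infinity>)"
  unfolding ereal_tendsto_simps
  by (rule tendsto_divide_0[OF tendsto_const filterlim_at_top_imp_at_infinity[OF filterlim_ident]])
  qed auto
  moreover have "einterval (ereal 1) \<infinity> = {1<..}" by (auto simp: einterval_iff)
  ultimately show ?thesis by simp
 qed
 then have 2: "set_integrable lborel {1<..} (%r::real. min 1 (1 / r^2))"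
  by (rule set_integrable_bound) (auto intro!: AE_I2 simp: set_borel_measurable_def)
 have "{0<..} = {0<..1} \<union> {1::real<..}" by auto
 then show ?thesis unfolding intble_half_iff using set_integrable_Un[OF 1 2] by simp
qed

lemma le_min_inv_square:
 fixes x :: real
 assumes "x <= a" "x <= b / r^2" "0 <= a" "0 <= b" "0 < r"
 shows "x <= (a + b) * min 1 (1 / r^2)"
proof -
 have "b / r^2 <= (a + b) * (1 / r^2)" using assms by (simp add: divide_right_mono)
 then show ?thesis using assms by (simp add: min_def)
qed

section \<open>Weak integrals with values in a Hilbert space\<close>

definition wintble :: "'a measure => ('a => 'h::real_inner) => bool" where
 "wintble M v \<longleftrightarrow> (\<forall>g. (%x. inner (v x) g) \<in> borel_measurable M) \<and>
  (\<exists>k. integrable M k \<and> (\<forall>x\<in>space M. norm (v x) <= k x))"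

text \<open>The vector representing the functional that integrates the scalar pairings; Riesz
  provides it under \<open>wintble\<close>. Weak measurability and an integrable norm bound suffice,
  so the Hilbert space may be nonseparable.\<close>

definition wint :: "'a measure => ('a => 'h::real_inner) => 'h" where
 "wint M v = (SOME y. \<forall>g. inner y g = (\<integral>x. inner (v x) g \<partial>M))"

lemma wintbleI:
 assumes "!!g. (%x. inner (v x) g) \<in> borel_measurable M" "integrable M k"
  "!!x. x \<in> space M ==> norm (v x) <= k x"
 shows "wintble M v"
 using assms unfolding wintble_def by blast

lemma wintble_inner:
 assumes "wintble M v"
 shows "integrable M (%x. inner (v x) g)"
proof -
 obtain k where k: "integrable M k" "!!x. x \<in> space M ==> norm (v x) <= k x"
  using assms by (auto simp: wintble_def)
 show ?thesis
 proof (rule Bochner_Integration.integrable_bound)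
  show "integrable M (%x. k x * norm g)" using k(1) by simp
  show "AE x in M. norm (inner (v x) g) <= norm (k x * norm g)"
  proof (rule AE_I2)
  fix x assume "x \<in> space M"
  then have "norm (v x) * norm g <= k x * norm g" using k(2) by (intro mult_right_mono) auto
  then show "norm (inner (v x) g) <= norm (k x * norm g)"
  using Cauchy_Schwarz_ineq2[of "v x" g] by simp
  qed
 qed (use assms in \<open>auto simp: wintble_def\<close>)
qed

lemma wint_inner:
 fixes v :: "'a => 'h::{real_inner,banach}"
 assumes v: "wintble M v"
 shows "inner (wint M v) g = (\<integral>x. inner (v x) g \<partial>M)"
proof -
 obtain k where k: "integrable M k" "!!x. x \<in> space M ==> norm (v x) <= k x"
  using assms by (auto simp: wintble_def)
 note int = wintble_inner[OF v]
 have "bounded_linear (%g. \<integral>x. inner (v x) g \<partial>M)"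
 proof (rule bounded_linear_intro[where K="integral\<^sup>L M k"])
  show "(\<integral>x. inner (v x) (g + h) \<partial>M) = (\<integral>x. inner (v x) g \<partial>M) + (\<integral>x. inner (v x) h \<partial>M)" for g h
  by (simp add: inner_add_right int)
  show "norm (\<integral>x. inner (v x) g \<partial>M) <= norm g * integral\<^sup>L M k" for g
  proof -
  have "norm (\<integral>x. inner (v x) g \<partial>M) <= (\<integral>x. norm (inner (v x) g) \<partial>M)"
  by (rule integral_norm_bound)
  also have "\<dots> <= (\<integral>x. norm g * k x \<partial>M)"
  proof (rule integral_mono)
  fix x assume "x \<in> space M"
  then have "norm g * norm (v x) <= norm g * k x" using k(2) by (intro mult_left_mono) auto
  then show "norm (inner (v x) g) <= norm g * k x"
  using Cauchy_Schwarz_ineq2[of "v x" g] by (simp add: mult.commute)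
  qed (use int k in auto)
  finally show ?thesis by simp
  qed
 qed simp
 then obtain y where "!!g. (\<integral>x. inner (v x) g \<partial>M) = inner y g"
  using riesz_rep by blast
 then have "\<exists>y. \<forall>g. inner y g = (\<integral>x. inner (v x) g \<partial>M)" by metis
 then show ?thesis unfolding wint_def by (rule someI2_ex) blast
qed

lemma wint_eqI:
 fixes v :: "'a => 'h::{real_inner,banach}"
 assumes "wintble M v" "!!g. (\<integral>x. inner (v x) g \<partial>M) = inner y g"
 shows "wint M v = y"
 by (rule inner_ext) (simp add: wint_inner assms)

lemma norm_wint_le:
 fixes v :: "'a => 'h::{real_inner,banach}"
 assumes v: "wintble M v" and k: "integrable M k" "!!x. x \<in> space M ==> norm (v x) <= k x"
 shows "norm (wint M v) <= integral\<^sup>L M k"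
proof (rule norm_le_of_inner)
 fix g
 have "\<bar>\<integral>x. inner (v x) g \<partial>M\<bar> <= (\<integral>x. \<bar>inner (v x) g\<bar> \<partial>M)"
  by (rule integral_abs_bound)
 also have "\<dots> <= (\<integral>x. norm g * k x \<partial>M)"
 proof (rule integral_mono)
  fix x assume "x \<in> space M"
  then have "norm g * norm (v x) <= norm g * k x" using k(2) by (intro mult_left_mono) auto
  then show "\<bar>inner (v x) g\<bar> <= norm g * k x"
  using Cauchy_Schwarz_ineq2[of "v x" g] by (simp add: mult.commute)
 qed (use wintble_inner[OF v] k in auto)
 finally show "\<bar>inner (wint M v) g\<bar> <= integral\<^sup>L M k * norm g"
  by (simp add: wint_inner[OF v] mult.commute)
next
 show "0 <= integral\<^sup>L M k"
  by (rule Bochner_Integration.integral_nonneg_AE) (auto intro!: AE_I2 order_trans[OF norm_ge_zero k(2)])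
qed

text \<open>The adjoint of \<open>L\<close> moves it to the other side of each scalar
  integrand.\<close>

lemma wintble_bl:
 fixes L :: "'h::{real_inner,banach} => 'k::{real_inner,banach}"
 assumes v: "wintble M v" and L: "bounded_linear L"
 shows "wintble M (%x. L (v x))"
  and "wint M (%x. L (v x)) = L (wint M v)"
proof -
 obtain k where k: "integrable M k" "!!x. x \<in> space M ==> norm (v x) <= k x"
  using assms by (auto simp: wintble_def)
 obtain K where K: "0 < K" "!!x. norm (L x) <= norm x * K"
  using bounded_linear.pos_bounded[OF L] by blast
 obtain L' where L': "!!x y. inner (L x) y = inner x (L' y)" using adj_exists[OF L] by blast
 show 1: "wintble M (%x. L (v x))"
 proof (rule wintbleI[where k="%x. k x * K"])
  show "norm (L (v x)) <= k x * K" if "x \<in> space M" for x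
  using K(2)[of "v x"] mult_right_mono[OF k(2)[OF that], of K] K(1) by linarith
  show "(%x. inner (L (v x)) g) \<in> borel_measurable M" for g
  unfolding L' using v by (simp add: wintble_def)
 qed (use k in simp)
 show "wint M (%x. L (v x)) = L (wint M v)"
  by (rule wint_eqI[OF 1]) (simp add: L' wint_inner[OF v])
qed

lemma wintble_add:
 fixes v :: "'a => 'h::{real_inner,banach}"
 assumes v: "wintble M v" and w: "wintble M w"
 shows "wintble M (%x. v x + w x)"
  and "wint M (%x. v x + w x) = wint M v + wint M w"
proof -
 obtain k where k: "integrable M k" "!!x. x \<in> space M ==> norm (v x) <= k x"
  using v by (auto simp: wintble_def)
 obtain l where l: "integrable M l" "!!x. x \<in> space M ==> norm (w x) <= l x"
  using w by (auto simp: wintble_def)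
 show 1: "wintble M (%x. v x + w x)"
 proof (rule wintbleI[where k="%x. k x + l x"])
  show "norm (v x + w x) <= k x + l x" if "x \<in> space M" for x
  by (rule norm_triangle_mono[OF k(2)[OF that] l(2)[OF that]])
  show "(%x. inner (v x + w x) g) \<in> borel_measurable M" for g
  unfolding inner_add_left using v w by (intro borel_measurable_add) (auto simp: wintble_def)
 qed (use k l in simp)
 show "wint M (%x. v x + w x) = wint M v + wint M w"
  by (rule wint_eqI[OF 1])
  (simp add: inner_add_left wintble_inner[OF v] wintble_inner[OF w]
  wint_inner[OF v] wint_inner[OF w])
qed

lemmas wintble_scaleR = wintble_bl[OF _ bounded_linear_scaleR_right]

lemma wintble_diff:
 fixes v :: "'a => 'h::{real_inner,banach}"
 assumes v: "wintble M v" and w: "wintble M w"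
 shows "wintble M (%x. v x - w x)"
  and "wint M (%x. v x - w x) = wint M v - wint M w"
 using wintble_add[OF v wintble_scaleR(1)[OF w, of "-1"]]
  wintble_scaleR(2)[OF w, of "-1"] by simp_all

lemma wintble_half:
 fixes v :: "real => 'h::{real_inner,banach}"
 assumes "continuous_on {0<..} v" "integrable halfline k" "!!r. 0 < r ==> norm (v r) <= k r"
 shows "wintble halfline v"
 by (rule wintbleI[OF meas_half_cont assms(2)])
  (use assms in \<open>auto intro!: continuous_intros\<close>)

lemma wint_tendsto_zero:
 fixes v :: "nat => real => 'h::{real_inner,banach}"
 assumes c: "!!n. continuous_on {0<..} (v n)" and k: "integrable halfline k"
  and b: "!!n r. 0 < r ==> norm (v n r) <= k r"
  and l: "!!r. 0 < r ==> (%n. v n r) ----> 0"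
 shows "(%n. wint halfline (v n)) ----> 0"
proof -
 have [measurable]: "(%r. norm (v n r)) \<in> borel_measurable halfline" for n
  by (intro meas_half_cont continuous_intros c)
 have kk: "0 <= k r" if "0 < r" for r using order_trans[OF norm_ge_zero b[OF that]] .
 have "(%n. \<integral>r. norm (v n r) \<partial>halfline) ----> (\<integral>r. 0 \<partial>halfline)"
 proof (rule integral_dominated_convergence[OF _ _ k])
  show "AE r in halfline. (%n. norm (v n r)) ----> 0"
  using l by (auto intro!: AE_I2 tendsto_norm_zero)
  show "AE r in halfline. norm (norm (v n r)) <= k r" for n using b by (auto intro!: AE_I2)
 qed auto
 then have *: "(%n. \<integral>r. norm (v n r) \<partial>halfline) ----> 0" by simp
 have int: "integrable halfline (%r. norm (v n r))" for n
  by (rule Bochner_Integration.integrable_bound[OF k])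
  (use b kk in \<open>auto intro!: AE_I2\<close>)
 have "norm (wint halfline (v n)) <= (\<integral>r. norm (v n r) \<partial>halfline)" for n
  by (rule norm_wint_le[OF wintble_half[OF c k b] int]) auto
 then show ?thesis
  by (intro tendsto_norm_zero_cancel[OF tendsto_sandwich[OF _ _ tendsto_const *]] always_eventually allI norm_ge_zero)
qed

text \<open>Differentiation under the integral. By the mean value inequality the difference
  quotients are bounded by \<open>k\<close>, so their distance to \<open>v' t0\<close> is dominated
  by \<open>2 * k\<close> and tends to zero pointwise.\<close>

lemma hvd_wint:
 fixes v :: "real => real => 'h::{real_inner,banach}"
 assumes e: "0 < e"
  and c: "!!t. \<bar>t - t0\<bar> < e ==> continuous_on {0<..} (v t)" "continuous_on {0<..} (v' t0)"
  and int: "!!t. \<bar>t - t0\<bar> < e ==> wintble halfline (v t)"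
  and d: "!!t r. \<bar>t - t0\<bar> < e ==> 0 < r ==> ((%t. v t r) has_vector_derivative v' t r) (at t)"
  and k: "integrable halfline k" "!!t r. \<bar>t - t0\<bar> < e ==> 0 < r ==> norm (v' t r) <= k r"
 shows "((%t. wint halfline (v t)) has_vector_derivative wint halfline (v' t0)) (at t0)"
proof -
 let ?W = "%t. wint halfline (v t)"
 have int': "wintble halfline (v' t0)"
  by (rule wintble_half[OF c(2) k(1)]) (use k(2) e in auto)
 have lim: "((%y. norm ((?W y - ?W t0) - (y - t0) *: wint halfline (v' t0)) / norm (y - t0)) ---> 0) (at t0)"
  unfolding tendsto_at_iff_sequentially comp_def
 proof (intro allI impI)
  fix X :: "nat => real" assume X: "\<forall>i. X i \<in> UNIV - {t0}" "X ----> t0"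
  \<comment> \<open>An initial segment is dropped so that all remaining points stay within
    \<open>e\<close> of \<open>t0\<close>; \<open>LIMSEQ_offset\<close> restores it at the
    end.\<close>
  from X(2) e obtain N where N: "!!n. n >= N ==> \<bar>X n - t0\<bar> < e"
  by (metis LIMSEQ_D real_norm_def)
  define q where "q n r = (1 / (X (n + N) - t0)) *: (v (X (n + N)) r - v t0 r) - v' t0 r" for n r
  have XN: "\<bar>X (n + N) - t0\<bar> < e" "X (n + N) ~= t0" for n using N X(1) by auto
  have mv: "norm (v s r - v t0 r) <= k r * \<bar>s - t0\<bar>" if "\<bar>s - t0\<bar> < e" "0 < r" for s r
  proof -
  have seg: "\<bar>x - t0\<bar> < e" if "x \<in> closed_segment t0 s" for x
  using that \<open>\<bar>s - t0\<bar> < e\<close> by (auto simp: closed_segment_eq_real_ivl split: if_splits)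
  have "norm (v s r - v t0 r) <= k r * norm (s - t0)"
  proof (rule differentiable_bound[of "closed_segment t0 s" "%t. v t r" "%t y. y *: v' t r"])
  fix x assume x: "x \<in> closed_segment t0 s"
  show "((%t. v t r) has_derivative (%y. y *: v' x r)) (at x within closed_segment t0 s)"
  using has_derivative_at_withinI[OF d[OF seg[OF x] \<open>0 < r\<close>, unfolded has_vector_derivative_def]] .
  show "onorm (%y. y *: v' x r) <= k r"
  by (rule onorm_le) (use k(2)[OF seg[OF x] \<open>0 < r\<close>] in \<open>simp add: mult.commute mult_left_mono\<close>)
  qed auto
  then show ?thesis by simp
  qed
  have "(%n. wint halfline (q n)) ----> 0"
  proof (rule wint_tendsto_zero)
  show "continuous_on {0<..} (q n)" for n
  unfolding q_def by (intro continuous_intros c XN) (use e in simp)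
  show "integrable halfline (%r. 2 * k r)" using k(1) by simp
  show "norm (q n r) <= 2 * k r" if "0 < r" for n r
  proof -
  have "norm ((1 / (X (n + N) - t0)) *: (v (X (n + N)) r - v t0 r)) <= k r"
  using mv[OF XN(1) that, of n] XN(2)[of n] unfolding norm_scaleR by (simp add: field_simps)
  moreover have "norm (v' t0 r) <= k r" using k(2)[of t0 r] e that by simp
  ultimately show ?thesis unfolding q_def using norm_triangle_ineq4 order_trans by (smt (verit, best))
  qed
  show "(%n. q n r) ----> 0" if r: "0 < r" for r
  proof -
  have "((%y. norm ((v y r - v t0 r) - (y - t0) *: v' t0 r) / norm (y - t0)) ---> 0) (at t0)"
  using d[of t0 r] e r by (simp add: has_vector_derivative_def has_derivative_iff_norm)
  moreover have "filterlim (%n. X (n + N)) (at t0) sequentially"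
  unfolding filterlim_at using LIMSEQ_ignore_initial_segment[OF X(2), of N] XN(2) by simp
  ultimately have "(%n. norm ((v (X (n + N)) r - v t0 r) - (X (n + N) - t0) *: v' t0 r) / norm (X (n + N) - t0)) ----> 0"
  by (rule filterlim_compose)
  moreover have "norm ((v (X (n + N)) r - v t0 r) - (X (n + N) - t0) *: v' t0 r) / norm (X (n + N) - t0) = norm (q n r)" for n
  proof -
  have "q n r = (1 / (X (n + N) - t0)) *: ((v (X (n + N)) r - v t0 r) - (X (n + N) - t0) *: v' t0 r)"
  using XN(2)[of n] by (simp add: q_def scaleR_diff_right)
  then show ?thesis by (simp only: norm_scaleR) simp
  qed
  ultimately show ?thesis by (simp add: tendsto_norm_zero_iff)
  qed
  qed
  moreover have "norm (wint halfline (q n))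
  = norm ((?W (X (n + N)) - ?W t0) - (X (n + N) - t0) *: wint halfline (v' t0)) / norm (X (n + N) - t0)" for n
  proof -
  have "wintble halfline (%r. v (X (n + N)) r - v t0 r)"
  by (intro wintble_diff int XN) (use e in simp)
  then have "wint halfline (q n) = (1 / (X (n + N) - t0)) *: (?W (X (n + N)) - ?W t0) - wint halfline (v' t0)"
  unfolding q_def using int[OF XN(1)] int[of t0] e
  by (simp add: wintble_diff wintble_scaleR int')
  also have "\<dots> = (1 / (X (n + N) - t0)) *: ((?W (X (n + N)) - ?W t0) - (X (n + N) - t0) *: wint halfline (v' t0))"
  using XN(2)[of n] by (simp add: scaleR_diff_right)
  finally show ?thesis by (simp only: norm_scaleR) simp
  qed
  ultimately have "(%n. norm ((?W (X (n + N)) - ?W t0) - (X (n + N) - t0) *: wint halfline (v' t0)) / norm (X (n + N) - t0)) ----> 0"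
  by (simp only: tendsto_norm_zero_iff[symmetric, where f="%n. wint halfline (q n)"])
  then show "(%n. norm ((?W (X n) - ?W t0) - (X n - t0) *: wint halfline (v' t0)) / norm (X n - t0)) ----> 0"
  by (rule LIMSEQ_offset)
 qed
 show ?thesis unfolding has_vector_derivative_def has_derivative_iff_norm
  using lim by (simp add: bounded_linear_scaleR_left)
qed

lemma half_int_by_parts:
 fixes al be :: "real => real"
 assumes d: "!!r. 0 < r ==> (al has_real_derivative al' r) (at r)" "!!r. 0 < r ==> (be has_real_derivative be' r) (at r)"
  and c: "!!r. 0 < r ==> isCont al' r" "!!r. 0 < r ==> isCont be' r"
  and i: "integrable halfline (%r. al' r * be r)" "integrable halfline (%r. al r * be' r)"
  and l: "((%r. al r * be r) ---> 0) (at_right 0)" "((%r. al r * be r) ---> 0) at_top"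
 shows "(\<integral>r. al' r * be r \<partial>halfline) = - (\<integral>r. al r * be' r \<partial>halfline)"
proof -
 have ei: "einterval (ereal 0) \<infinity> = {0<..}" by (auto simp: einterval_iff)
 have "(LBINT r=ereal 0..\<infinity>. al' r * be r + al r * be' r) = 0 - 0"
 proof (rule interval_integral_FTC_integrable[where F="%r. al r * be r"])
  show "((%r. al r * be r) has_vector_derivative al' x * be x + al x * be' x) (at x)" if "ereal 0 < ereal x" for x
  using DERIV_mult[OF d(1) d(2), of x] that
  by (simp add: has_real_derivative_iff_has_vector_derivative[symmetric] mult.commute add.commute)
  show "isCont (%r. al' r * be r + al r * be' r) x" if "ereal 0 < ereal x" for x
  using that by (intro continuous_intros c DERIV_isCont[OF d(1)] DERIV_isCont[OF d(2)]) auto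
  show "set_integrable lborel (einterval (ereal 0) \<infinity>) (%r. al' r * be r + al r * be' r)"
  unfolding ei intble_half_iff[symmetric] using i by simp
 qed (use l in \<open>auto simp: ereal_tendsto_simps\<close>)
 then have "(\<integral>r. al' r * be r + al r * be' r \<partial>halfline) = 0"
  by (simp add: interval_integral_to_infinity_eq int_half_eq)
 then show ?thesis using i by simp
qed

text \<open>Strong convergence passes from a dense set to the whole space by a uniform bound.
  Additivity and the bound are asked for only eventually, since resolvents are controlled only for
  positive parameters.\<close>

lemma tendsto_zero_dense:
 fixes L :: "'t => 'h::real_normed_vector => 'k::real_normed_vector"
 assumes cl: "closure S = UNIV"
  and bl: "\<forall>\<^sub>F t in F. (\<forall>x y. L t (x - y) = L t x - L t y) \<and> (\<forall>x. norm (L t x) <= K * norm x)"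
  and S: "!!x. x \<in> S ==> ((%t. L t x) ---> 0) F"
 shows "((%t. L t x) ---> 0) F"
proof (rule tendstoI)
 fix e :: real assume e: "0 < e"
 define K' where "K' = max K 0 + 1"
 have K': "0 < K'" "K <= K'" by (auto simp: K'_def)
 have "x \<in> closure S" using cl by simp
 then obtain y where y: "y \<in> S" "dist y x < e / (2 * K')"
  unfolding closure_approachable using e K' by (metis divide_pos_pos mult_pos_pos zero_less_numeral)
 have "\<forall>\<^sub>F t in F. dist (L t y) 0 < e / 2" using S[OF y(1)] e by (intro tendstoD) auto
 then show "\<forall>\<^sub>F t in F. dist (L t x) 0 < e"
  using bl
 proof eventually_elim
  case (elim t)
  have "norm (L t (x - y)) <= K * norm (x - y)" using elim by blast
  also have "\<dots> <= K' * norm (x - y)" using K' by (intro mult_right_mono) auto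
  also have "\<dots> < e / 2" using y(2) K' by (simp add: dist_norm norm_minus_commute field_simps)
  finally have "norm (L t x - L t y) < e / 2" using elim by simp
  then show ?case using elim norm_triangle_sub[of "L t x" "L t y"] by (simp add: dist_norm)
 qed
qed

section \<open>Resolvents of \<open>DB\<close>\<close>

text \<open>
 \<open>D\<close> is the graph of a self-adjoint operator and \<open>B\<close> is bounded and coercive. For
 \<open>T = DB\<close> the pair \<open>P t f = (1 + t^2T\<^sup>2)\<^sup>-\<^sup>1 f\<close>, \<open>Q t f = tT(1 + t^2T\<^sup>2)\<^sup>-\<^sup>1 f\<close> is the real form of the
 resolvents \<open>(1 \<plusminus> itT)\<^sup>-\<^sup>1\<close>: it is the solution \<open>(u, w)\<close> of \<open>w = tTu\<close>, \<open>u + tTw = f\<close>.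
\<close>

locale coercive_sa =
 fixes D :: "('h::{real_inner,banach} \<times> 'h) set" and B :: "'h => 'h" and ka :: real
 assumes D_iff: "!!a b. (a, b) \<in> D \<longleftrightarrow> (\<forall>x y. (x, y) \<in> D --> inner y a = inner x b)"
  and D_single: "!!b. (0, b) \<in> D ==> b = 0"
  and B_bl: "bounded_linear B"
  and ka: "0 < ka" "!!x. ka * (norm x)^2 <= inner (B x) x"
begin

lemma D_sym: "(x, y) \<in> D ==> (a, b) \<in> D ==> inner y a = inner x b"
 using D_iff by blast

lemma D_subspace: "subspace D"
 unfolding subspace_def
proof safe
 show "0 \<in> D" unfolding zero_prod_def by (subst D_iff) simp
 show "(a, b) + (c, d) \<in> D" if "(a, b) \<in> D" "(c, d) \<in> D" for a b c d
  unfolding plus_prod_def by (simp, subst D_iff) (simp add: inner_add_right D_sym[OF _ that(1)] D_sym[OF _ that(2)])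
 show "c *: (a, b) \<in> D" if "(a, b) \<in> D" for c a b
  by (simp, subst D_iff) (simp add: D_sym[OF _ that])
qed

lemma D_add: "(a, b) \<in> D ==> (c, d) \<in> D ==> (a + c, b + d) \<in> D"
 using subspace_add[OF D_subspace, of "(a, b)" "(c, d)"] by simp

lemma D_diff: "(a, b) \<in> D ==> (c, d) \<in> D ==> (a - c, b - d) \<in> D"
 using subspace_diff[OF D_subspace, of "(a, b)" "(c, d)"] by simp

lemma D_scale: "(a, b) \<in> D ==> (c *: a, c *: b) \<in> D"
 using subspace_scale[OF D_subspace, of "(a, b)" c] by simp

lemma D_zero: "(0, 0) \<in> D"
 using subspace_0[OF D_subspace] by (simp add: zero_prod_def)

lemma D_unique: "(a, b) \<in> D ==> (a, c) \<in> D ==> b = c"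
 using D_diff[of a b a c] D_single by fastforce

lemma D_closed: "closed D"
proof -
 have *: "D = (\<Inter>p\<in>D. {q. inner (snd p) (fst q) = inner (fst p) (snd q)})"
 proof (intro set_eqI iffI)
  fix q assume "q \<in> D"
  then show "q \<in> (\<Inter>p\<in>D. {q. inner (snd p) (fst q) = inner (fst p) (snd q)})"
  using D_sym[of _ _ "fst q" "snd q"] by auto
 next
  fix q assume "q \<in> (\<Inter>p\<in>D. {q. inner (snd p) (fst q) = inner (fst p) (snd q)})"
  then show "q \<in> D" using D_iff[of "fst q" "snd q"] by force
 qed
 have "closed {q. inner (snd p) (fst q) = inner (fst p) (snd q)}" for p :: "'h \<times> 'h"
  by (intro closed_Collect_eq continuous_intros)
 then have "closed (\<Inter>p\<in>D. {q. inner (snd p) (fst q) = inner (fst p) (snd q)})" by (intro closed_INT ballI)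
 then show ?thesis by (subst *)
qed

interpretation B: bounded_linear B by (rule B_bl)

lemmas B_simps = B.add B.diff B.scaleR B.zero B.neg

lemma B_inv: "bij B" "bounded_linear (inv B)" "B (inv B x) = x" "inv B (B x) = x"
 using coercive_bij(1)[OF B_bl ka] coercive_inv_bl[OF B_bl ka]
 by (auto simp: bij_is_surj surj_f_inv_f bij_is_inj)

definition K\<^sub>B :: real where "K\<^sub>B = (SOME K. 0 < K \<and> (\<forall>x. norm (B x) <= K * norm x))"

lemma K\<^sub>B: "0 < K\<^sub>B" "norm (B x) <= K\<^sub>B * norm x"
proof -
 have "\<exists>K. 0 < K \<and> (\<forall>x. norm (B x) <= K * norm x)"
  using B.pos_bounded by (metis mult.commute)
 then have "0 < K\<^sub>B \<and> (\<forall>x. norm (B x) <= K\<^sub>B * norm x)" unfolding K\<^sub>B_def by (rule someI_ex)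
 then show "0 < K\<^sub>B" "norm (B x) <= K\<^sub>B * norm x" by auto
qed

text \<open>Norm bound over coercivity constant of \<open>B\<close>; it bounds \<open>P t\<close>
  and \<open>Q t\<close> uniformly in \<open>t\<close>.\<close>

definition K :: real where "K = K\<^sub>B / ka"

lemma K_pos: "0 < K" using K\<^sub>B ka by (simp add: K_def)

definition T :: "('h \<times> 'h) set" where "T = {(x, y). (B x, y) \<in> D}"

text \<open>Symmetry of \<open>D\<close> between its two given pairs cancels the cross terms, and
  only the coercive diagonal terms remain.\<close>

lemma resolvent_identity:
 assumes "(t *: B u, w - g) \<in> D" "(t *: B w, f - u) \<in> D" "t ~= 0"
 shows "inner (B u) u + inner (B w) w = inner (B u) f + inner (B w) g"
proof -
 have "inner (w - g) (t *: B w) = inner (t *: B u) (f - u)" by (rule D_sym[OF assms(1,2)])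
 then have "inner (w - g) (B w) = inner (B u) (f - u)" using assms(3) by simp
 then show ?thesis by (simp add: inner_diff_left inner_diff_right inner_commute)
qed

lemma resolvent_estimate:
 assumes "(t *: B u, w - g) \<in> D" "(t *: B w, f - u) \<in> D" "t ~= 0"
 shows "(norm u)^2 + (norm w)^2 <= K * (norm u * norm f + norm w * norm g)"
proof -
 have "ka * ((norm u)^2 + (norm w)^2) <= inner (B u) f + inner (B w) g"
  using resolvent_identity[OF assms] ka(2)[of u] ka(2)[of w] by (simp add: algebra_simps)
 also have "\<dots> <= norm (B u) * norm f + norm (B w) * norm g"
  by (intro add_mono norm_cauchy_schwarz)
 also have "\<dots> <= (K\<^sub>B * norm u) * norm f + (K\<^sub>B * norm w) * norm g"
  by (intro add_mono mult_right_mono K\<^sub>B) auto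
 finally show ?thesis using ka(1) by (simp add: K_def field_simps)
qed

text \<open>The block system for \<open>(u, w)\<close> has closed range by
  \<open>resolvent_estimate\<close>. A datum orthogonal to the range solves the adjoint system, and
  symmetry of \<open>D\<close> together with coercivity of \<open>B\<close> kills it.\<close>

lemma resolvent_exists:
 assumes t: "t ~= 0"
 obtains u w where "(t *: B u, w) \<in> D" "(t *: B w, f - u) \<in> D"
proof -
 \<comment> \<open>A second datum, the \<open>g\<close> of \<open>resolvent_estimate\<close>, makes
   the system square on the product space, so that its range can be compared with everything; it is
   set to zero at the end.\<close>
 define G where "G = {p :: ('h \<times> 'h) \<times> 'h \<times> 'h. (t *: B (fst (fst p)), snd (fst p) - snd (snd p)) \<in> D
  \<and> (t *: B (snd (fst p)), fst (snd p) - fst (fst p)) \<in> D}"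
 define L1 where "L1 = (%p :: ('h \<times> 'h) \<times> 'h \<times> 'h. (t *: B (fst (fst p)), snd (fst p) - snd (snd p)))"
 define L2 where "L2 = (%p :: ('h \<times> 'h) \<times> 'h \<times> 'h. (t *: B (snd (fst p)), fst (snd p) - fst (fst p)))"
 have GL: "G = L1 -` D \<inter> L2 -` D" by (auto simp: G_def L1_def L2_def)
 have bl: "bounded_linear L1" "bounded_linear L2" unfolding L1_def L2_def
  by (intro bounded_linear_Pair bounded_linear_sub bounded_linear_const_scaleR bounded_linear_compose[OF B_bl]
  bounded_linear_fst_comp bounded_linear_snd_comp bounded_linear_fst bounded_linear_snd)+
 have sG: "subspace G" unfolding GL
  by (intro subspace_inter linear_subspace_vimage bounded_linear.linear bl D_subspace)
 have cG: "closed G" unfolding GL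
  by (intro closed_Int closed_vimage D_closed bounded_linear.continuous_on[OF bl(1)] bounded_linear.continuous_on[OF bl(2)] continuous_on_id)
 have low: "norm p <= (1 + 2 * K) * norm (snd p)" if p: "p \<in> G" for p
 proof -
  let ?u = "fst (fst p)" and ?w = "snd (fst p)" and ?f = "fst (snd p)" and ?g = "snd (snd p)"
  have "(norm ?u)^2 + (norm ?w)^2 <= K * (norm ?u * norm ?f + norm ?w * norm ?g)"
  using p t by (intro resolvent_estimate) (auto simp: G_def)
  also have "\<dots> <= K * (norm (fst p) * norm (snd p) + norm (fst p) * norm (snd p))"
  using K_pos norm_fst_le[of "fst (fst p)" "snd (fst p)"] norm_snd_le[of "snd (fst p)" "fst (fst p)"]
  norm_fst_le[of "fst (snd p)" "snd (snd p)"] norm_snd_le[of "snd (snd p)" "fst (snd p)"]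
  by (intro mult_left_mono add_mono mult_mono) auto
  also have "(norm ?u)^2 + (norm ?w)^2 = norm (fst p) * norm (fst p)"
  by (simp add: norm_prod_def power2_eq_square[symmetric])
  finally have "norm (fst p) * norm (fst p) <= norm (fst p) * (2 * K * norm (snd p))"
  by (simp add: algebra_simps)
  then have "norm (fst p) <= 2 * K * norm (snd p)"
  using K_pos by (cases "norm (fst p) = 0") auto
  then show ?thesis using norm_Pair_le[of "fst p" "snd p"] by (simp add: algebra_simps)
 qed
 have "snd ` G = UNIV"
 proof (rule closed_subspace_eq_UNIV)
  show "subspace (snd ` G)" by (rule linear_subspace_image[OF linear_snd sG])
  have "complete (snd ` G)"
  using low K_pos cG
  by (intro complete_isometric_image[of "1/(1 + 2 * K)"] sG bounded_linear_snd)
  (auto simp: field_simps complete_eq_closed)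
  then show "closed (snd ` G)" by (rule complete_imp_closed)
  fix x assume x: "!!z. z \<in> snd ` G ==> inner x z = 0"
  obtain a b where ab: "x = (a, b)" by (cases x)
  obtain B' where B': "!!x y. inner (inv B x) y = inner x (B' y)"
  using adj_exists[OF B_inv(2)] by blast
  have invB_scale: "inv B (c *: x) = c *: inv B x" for c x
  using linear_cmul[OF bounded_linear.linear[OF B_inv(2)]] .
  \<comment> \<open>Orthogonality is tested on data whose solution has one zero component,
    \<open>u = 0\<close> here and \<open>w = 0\<close> next. Each choice puts a pair into the
    adjoint graph of \<open>D\<close>, which is \<open>D\<close>.\<close>
  have 1: "(a, - (1/t) *: B' b) \<in> D"
  proof (subst D_iff, safe)
  fix p q assume "(p, q) \<in> D"
  then have "((0, inv B ((1/t) *: p)), (q, inv B ((1/t) *: p))) \<in> G"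
  using t by (simp add: G_def B_inv B_simps D_zero)
  then have "(q, inv B ((1/t) *: p)) \<in> snd ` G" by force
  from x[OF this] have "inner a q + (1/t) * inner (inv B p) b = 0"
  by (simp add: ab inner_commute invB_scale)
  then show "inner q a = inner p (- (1 / t) *: B' b)" by (simp add: inner_commute[of a] B')
  qed
  have 2: "(b, (1/t) *: B' a) \<in> D"
  proof (subst D_iff, safe)
  fix p q assume pq: "(p, q) \<in> D"
  then have "((inv B ((1/t) *: p), 0), (inv B ((1/t) *: p), - q)) \<in> G"
  using t by (simp add: G_def B_inv B_simps D_zero)
  then have "(inv B ((1/t) *: p), - q) \<in> snd ` G" by force
  from x[OF this] have "(1/t) * inner (inv B p) a - inner b q = 0"
  by (simp add: ab inner_commute invB_scale)
  then show "inner q b = inner p ((1 / t) *: B' a)" by (simp add: inner_commute[of b] B')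
  qed
  have "inner (- (1/t) *: B' b) b = inner a ((1/t) *: B' a)" by (rule D_sym[OF 1 2])
  then have "inner (B' b) b + inner a (B' a) = 0"
  using t by (simp add: divide_simps)
  then have "inner (inv B b) (B (inv B b)) + inner (inv B a) (B (inv B a)) = 0"
  by (simp add: B_inv B' inner_commute[of _ "B' b"])
  moreover have "ka * (norm (inv B c))^2 <= inner (inv B c) (B (inv B c))" for c
  using ka(2)[of "inv B c"] by (simp add: inner_commute)
  ultimately have "ka * ((norm (inv B a))^2 + (norm (inv B b))^2) <= 0"
  by (smt (verit, best) distrib_left)
  then have "(norm (inv B a))^2 + (norm (inv B b))^2 <= 0" using ka(1) by (simp add: mult_le_0_iff)
  then have "inv B a = 0" "inv B b = 0"
  using sum_power2_le_zero_iff[of "norm (inv B a)" "norm (inv B b)"] by auto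
  then have "a = 0" "b = 0" using B_inv(3)[of a] B_inv(3)[of b] by (simp_all add: B_simps)
  then show "x = 0" by (simp add: ab zero_prod_def)
 qed
 then obtain p where "p \<in> G" "snd p = (f, 0)" by (metis UNIV_I imageE)
 then show thesis using that[of "fst (fst p)" "snd (fst p)"] by (simp add: G_def)
qed

section \<open>Algebra of the resolvent pair\<close>

definition PQ :: "real => 'h => 'h \<times> 'h" where
 "PQ t f = (SOME p. (t *: B (fst p), snd p) \<in> D \<and> (t *: B (snd p), f - fst p) \<in> D)"

definition P :: "real => 'h => 'h" where "P t f = fst (PQ t f)"
definition Q :: "real => 'h => 'h" where "Q t f = snd (PQ t f)"

lemma PQ_D:
 assumes "0 < t"
 shows "(t *: B (P t f), Q t f) \<in> D" "(t *: B (Q t f), f - P t f) \<in> D"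
proof -
 have "\<exists>p. (t *: B (fst p), snd p) \<in> D \<and> (t *: B (snd p), f - fst p) \<in> D"
  using resolvent_exists[of t f] assms by (metis fst_conv snd_conv less_irrefl)
 from someI_ex[OF this]
 show "(t *: B (P t f), Q t f) \<in> D" "(t *: B (Q t f), f - P t f) \<in> D"
  unfolding P_def Q_def PQ_def by auto
qed

lemma PQ_norm_sq:
 assumes "0 < t" "(t *: B u, w) \<in> D" "(t *: B w, f - u) \<in> D"
 shows "norm u <= K * norm f" "norm w <= K * norm f"
proof -
 have e: "(norm u)^2 + (norm w)^2 <= K * (norm u * norm f)"
  using resolvent_estimate[of t u w 0 f] assms by simp
 have "norm u * norm u <= norm u * (K * norm f)"
  using e zero_le_square[of "norm w"] unfolding power2_eq_square by (simp only: mult_ac)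
 then show u: "norm u <= K * norm f"
  using K_pos by (cases "norm u = 0") auto
 have "(norm w)^2 <= K * (norm u * norm f)"
  using e zero_le_power2[of "norm u"] by linarith
 then have "(norm w)^2 <= (K * norm f) * norm u" by (simp only: mult_ac)
 also have "\<dots> <= (K * norm f) * (K * norm f)" using u K_pos by (intro mult_left_mono) auto
 finally have "(norm w)^2 <= (K * norm f)^2" by (simp add: power2_eq_square)
 then show "norm w <= K * norm f" using K_pos by (rule_tac power2_le_imp_le) auto
qed

lemma PQ_unique:
 assumes "0 < t" "(t *: B u, w) \<in> D" "(t *: B w, f - u) \<in> D"
 shows "P t f = u" "Q t f = w"
proof -
 have "(t *: B (u - P t f), w - Q t f) \<in> D" "(t *: B (w - Q t f), 0 - (u - P t f)) \<in> D"
  using D_diff[OF assms(2) PQ_D(1)[OF assms(1), of f]] D_diff[OF assms(3) PQ_D(2)[OF assms(1), of f]]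
  by (simp_all add: B_simps scaleR_diff_right)
 from PQ_norm_sq[OF assms(1) this] show "P t f = u" "Q t f = w" by auto
qed

lemma P_norm: "0 < t ==> norm (P t f) <= K * norm f"
 and Q_norm: "0 < t ==> norm (Q t f) <= K * norm f"
 by (rule PQ_norm_sq(1)[OF _ PQ_D] PQ_norm_sq(2)[OF _ PQ_D]; assumption)+

lemma PQ_add:
 assumes "0 < t"
 shows "P t (f + g) = P t f + P t g" "Q t (f + g) = Q t f + Q t g"
proof -
 have 1: "(t *: B (P t f + P t g), Q t f + Q t g) \<in> D"
  using D_add[OF PQ_D(1) PQ_D(1), OF assms assms, of f g] by (simp add: B_simps scaleR_add_right)
 have 2: "(t *: B (Q t f + Q t g), (f + g) - (P t f + P t g)) \<in> D"
  using D_add[OF PQ_D(2) PQ_D(2), OF assms assms, of f g] by (simp add: B_simps scaleR_add_right algebra_simps)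
 show "P t (f + g) = P t f + P t g" "Q t (f + g) = Q t f + Q t g"
  using PQ_unique[OF assms 1 2] by auto
qed

lemma PQ_scale:
 assumes "0 < t"
 shows "P t (c *: f) = c *: P t f" "Q t (c *: f) = c *: Q t f"
proof -
 have 1: "(t *: B (c *: P t f), c *: Q t f) \<in> D"
  using D_scale[OF PQ_D(1), OF assms, of c f] by (simp add: B_simps mult.commute)
 have 2: "(t *: B (c *: Q t f), c *: f - c *: P t f) \<in> D"
  using D_scale[OF PQ_D(2), OF assms, of c f] by (simp add: B_simps mult.commute scaleR_diff_right)
 show "P t (c *: f) = c *: P t f" "Q t (c *: f) = c *: Q t f"
  using PQ_unique[OF assms 1 2] by auto
qed

lemma P_bl: "0 < t ==> bounded_linear (P t)"
 by (rule bounded_linear_intro[where K=K]) (simp_all add: P_norm PQ_add PQ_scale mult.commute[of _ K])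

lemma Q_bl: "0 < t ==> bounded_linear (Q t)"
 by (rule bounded_linear_intro[where K=K]) (simp_all add: Q_norm PQ_add PQ_scale mult.commute[of _ K])

lemma PQ_diff: "0 < t ==> P t (f - g) = P t f - P t g" "0 < t ==> Q t (f - g) = Q t f - Q t g"
 by (simp_all add: linear_diff bounded_linear.linear P_bl Q_bl)

lemma T_iff: "(x, y) \<in> T \<longleftrightarrow> (B x, y) \<in> D" by (simp add: T_def)

lemma T_zero: "(0, 0) \<in> T" by (simp add: T_iff B_simps D_zero)
lemma T_add: "(a, b) \<in> T ==> (c, d) \<in> T ==> (a + c, b + d) \<in> T" by (simp add: T_iff B_simps D_add)
lemma T_diff: "(a, b) \<in> T ==> (c, d) \<in> T ==> (a - c, b - d) \<in> T" by (simp add: T_iff B_simps D_diff)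
lemma T_scale: "(a, b) \<in> T ==> (c *: a, c *: b) \<in> T" by (simp add: T_iff B_simps D_scale)
lemma T_closed:
 assumes "!!n. (x n, y n) \<in> T" "x ----> a" "y ----> b"
 shows "(a, b) \<in> T"
proof -
 have "(%n. (B (x n), y n)) ----> (B a, b)"
  by (intro tendsto_Pair B.tendsto assms)
 then show ?thesis using closed_sequentially[OF D_closed, of "%n. (B (x n), y n)"] assms(1) by (simp add: T_iff)
qed

text \<open>A closed operator passes under the integral. Since \<open>D\<close> is its own adjoint
  graph, membership is tested by scalar pairings, and these commute with integration.\<close>

lemma T_wint:
 assumes v: "wintble M v" "wintble M w" and T: "!!x. x \<in> space M ==> (v x, w x) \<in> T"
 shows "(wint M v, wint M w) \<in> T"
 unfolding T_iff
proof (subst D_iff, safe)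
 fix p q assume pq: "(p, q) \<in> D"
 have "inner q (B (wint M v)) = (\<integral>x. inner (B (v x)) q \<partial>M)"
  using wintble_bl[OF v(1) B_bl] by (metis inner_commute wint_inner)
 also have "\<dots> = (\<integral>x. inner (w x) p \<partial>M)"
  by (rule Bochner_Integration.integral_cong) (use D_sym[OF pq] T in \<open>auto simp: T_iff inner_commute[of _ p] inner_commute[of _ q]\<close>)
 also have "\<dots> = inner p (wint M w)" by (metis inner_commute wint_inner v(2))
 finally show "inner q (B (wint M v)) = inner p (wint M w)" .
qed

lemma T_P: "0 < t ==> (P t f, (1/t) *: Q t f) \<in> T"
 using D_scale[OF PQ_D(1), of t "1/t" f] by (simp add: T_iff)

lemma T_Q: "0 < t ==> (Q t f, (1/t) *: (f - P t f)) \<in> T"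
 using D_scale[OF PQ_D(2), of t "1/t" f] by (simp add: T_iff)

lemma PQ_uniqueT:
 assumes "0 < t" "(u, (1/t) *: w) \<in> T" "(w, (1/t) *: (f - u)) \<in> T"
 shows "P t f = u" "Q t f = w"
 using PQ_unique[OF assms(1), of u w f] T_scale[OF assms(2), of t] T_scale[OF assms(3), of t] assms(1)
 by (simp_all add: T_iff B_simps)

text \<open>The vectors \<open>x - t *: Q t y\<close> and \<open>t *: P t y\<close> satisfy the
  system defining \<open>P t x\<close> and \<open>Q t x\<close>, and that system has only one
  solution.\<close>

lemma PQ_T:
 assumes "0 < t" "(x, y) \<in> T"
 shows "Q t x = t *: P t y" "x - P t x = t *: Q t y" "(P t x, P t y) \<in> T" "(Q t x, Q t y) \<in> T"
proof -
 have "(x - t *: Q t y, y - (y - P t y)) \<in> T"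
  using T_diff[OF assms(2) T_scale[OF T_Q[OF assms(1)], of t y]] assms(1) by simp
 then have 1: "(x - t *: Q t y, (1/t) *: (t *: P t y)) \<in> T" using assms(1) by simp
 have 2: "(t *: P t y, (1/t) *: (x - (x - t *: Q t y))) \<in> T"
  using T_scale[OF T_P[OF assms(1)], of t y] assms(1) by simp
 note u = PQ_uniqueT[OF assms(1) 1 2]
 show a: "Q t x = t *: P t y" "x - P t x = t *: Q t y" using u by auto
 show "(P t x, P t y) \<in> T" using T_P[OF assms(1), of x] assms(1) by (simp add: a)
 show "(Q t x, Q t y) \<in> T" using T_Q[OF assms(1), of x] assms(1) by (simp add: a)
qed

text \<open>A bounded operator that preserves the graph of \<open>T\<close> maps the system for
  \<open>f\<close> to the system for \<open>S f\<close>; uniqueness gives the commutation. All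
  mutual commutations of \<open>P\<close> and \<open>Q\<close> follow from this.\<close>

lemma PQ_commute:
 assumes S: "bounded_linear S" "!!x y. (x, y) \<in> T ==> (S x, S y) \<in> T" and t: "0 < t"
 shows "P t (S f) = S (P t f)" "Q t (S f) = S (Q t f)"
proof -
 interpret S: bounded_linear S by fact
 have 1: "(S (P t f), (1/t) *: S (Q t f)) \<in> T" using S(2)[OF T_P[OF t]] by (simp add: S.scaleR)
 have 2: "(S (Q t f), (1/t) *: (S f - S (P t f))) \<in> T"
  using S(2)[OF T_Q[OF t]] by (simp add: S.scaleR S.diff)
 show "P t (S f) = S (P t f)" "Q t (S f) = S (Q t f)" using PQ_uniqueT[OF t 1 2] by auto
qed

lemma PP: "0 < t ==> 0 < s ==> P t (P s f) = P s (P t f)"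
 and QP: "0 < t ==> 0 < s ==> Q t (P s f) = P s (Q t f)"
 and QQ: "0 < t ==> 0 < s ==> Q t (Q s f) = Q s (Q t f)"
 by (rule PQ_commute(1)[OF P_bl PQ_T(3)] PQ_commute(2)[OF P_bl PQ_T(3)] PQ_commute(2)[OF Q_bl PQ_T(4)]; assumption)+

lemma QQ_eq: "0 < t ==> 0 < s ==> Q t (Q s f) = (t/s) *: (P t f - P t (P s f))"
 using PQ_T(1)[OF _ T_Q, of t s f] by (simp add: PQ_scale PQ_diff)

lemma QP_eq: "0 < t ==> 0 < s ==> Q t (P s f) = (t/s) *: Q s (P t f)"
 using PQ_T(1)[OF _ T_P, of t s f] by (simp add: PQ_scale QP)

lemma QQ_same: "0 < t ==> Q t (Q t f) = P t f - P t (P t f)"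
 by (simp add: QQ_eq)

lemma PQ_bound1: "0 < t ==> norm (f - P t f) <= (1 + K) * norm f"
 using norm_triangle_ineq4[of f "P t f"] P_norm[of t f] by (simp add: algebra_simps)

definition K\<^sub>2 :: real where "K\<^sub>2 = K * (1 + K)"

lemma K\<^sub>2_pos: "0 < K\<^sub>2" using K_pos by (simp add: K\<^sub>2_def)

lemma QQ_norm1:
 assumes "0 < t" "0 < s"
 shows "norm (Q t (Q s f)) <= K\<^sub>2 * (t/s) * norm f"
proof -
 have "norm (P t (f - P s f)) <= K * ((1 + K) * norm f)"
  using P_norm[OF assms(1), of "f - P s f"] PQ_bound1[OF assms(2), of f] K_pos
  by (meson mult_left_mono order_trans less_imp_le)
 moreover have "norm (Q t (Q s f)) = (t/s) * norm (P t (f - P s f))"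
  using assms by (simp add: QQ_eq PQ_diff)
 moreover from calculation have "(t/s) * norm (P t (f - P s f)) <= (t/s) * (K\<^sub>2 * norm f)"
  using assms by (intro mult_left_mono) (auto simp: K\<^sub>2_def mult.assoc)
 ultimately show ?thesis by (simp add: mult_ac)
qed

text \<open>Almost orthogonality: \<open>Q t\<close> after \<open>Q s\<close> equals t/s times a
  uniformly bounded operator, and commuting the two gives s/t as well. The decay for separated
  scales drives \<open>weak_square_bound\<close>.\<close>

lemma QQ_norm:
 assumes "0 < t" "0 < s"
 shows "norm (Q t (Q s f)) <= K\<^sub>2 * min (t/s) (s/t) * norm f"
 using QQ_norm1[OF assms, of f] QQ_norm1[OF assms(2,1), of f] QQ[OF assms, of f] by (simp add: min_def)

text \<open>In terms of symbols, the numerator (t^2 - s^2)\<lambda>^2 is (t/s - s/t) times the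
  product of t\<lambda> and s\<lambda>. The coefficient contains the factor s - t, which makes the
  family differentiable.\<close>

lemma P_diff:
 assumes "0 < t" "0 < s"
 shows "P s f - P t f = (t/s - s/t) *: Q t (Q s f)"
proof -
 have 1: "P t f - P t (P s f) = (s/t) *: Q t (Q s f)" using assms by (simp add: QQ_eq)
 have "Q t (Q s f) = (s/t) *: (P s f - P t (P s f))"
  using QQ_eq[OF assms(2,1), of f] QQ[OF assms, of f] PP[OF assms, of f] by simp
 then have 2: "P s f - P t (P s f) = (t/s) *: Q t (Q s f)" using assms by simp
 have "P s f - P t f = (P s f - P t (P s f)) - (P t f - P t (P s f))" by simp
 then show ?thesis unfolding 1 2 by (simp add: scaleR_diff_left)
qed

text \<open>Arranged as s - t times an expression that converges as s tends to t, the form that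
  \<open>hvd_factor\<close> turns into a derivative.\<close>

lemma Q_diff:
 assumes "0 < t" "0 < s"
 shows "Q s f - Q t f = (s - t) *: ((1/s) *: Q s (P t f) - (1/t) *: (Q s f - Q s (P t f)))"
proof -
 have "Q t (f - P s f) = (s/t) *: (Q s f - Q s (P t f))"
 proof -
  have "f - P s f = s *: ((1/s) *: (f - P s f))" using assms by simp
  then have "Q t (f - P s f) = s *: Q t ((1/s) *: (f - P s f))" using assms by (metis PQ_scale(2))
  also have "t *: Q t ((1/s) *: (f - P s f)) = Q s f - P t (Q s f)"
  using PQ_T(2)[OF assms(1) T_Q[OF assms(2)], of f] by simp
  then have "Q t ((1/s) *: (f - P s f)) = (1/t) *: (Q s f - Q s (P t f))"
  using assms by (simp add: QP eq_vector_fraction_iff)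
  finally show ?thesis by simp
 qed
 moreover have "Q t (P s f) = (t/s) *: Q s (P t f)" using assms by (rule QP_eq)
 ultimately have "Q t f = (t/s) *: Q s (P t f) + (s/t) *: (Q s f - Q s (P t f))"
  using PQ_diff(2)[OF assms(1), of f "P s f"] by (simp add: algebra_simps)
 then have "Q s f - Q t f = (1 - s/t) *: Q s f + (s/t - t/s) *: Q s (P t f)"
  by (simp add: algebra_simps)
 also have "1 - s/t = - ((s - t) * (1/t))" using assms by (simp add: field_simps)
 also have "s/t - t/s = (s - t) * (1/s + 1/t)" using assms by (simp add: field_simps)
 finally show ?thesis by (simp add: algebra_simps)
qed

end

section \<open>Differentiability of the resolvents in the parameter\<close>

lemma hvd_factor:
 fixes f :: "real => 'a::real_normed_vector"
 assumes "\<forall>\<^sub>F s in at t. f s - f t = (s - t) *: ph s" "(ph ---> l) (at t)"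
 shows "(f has_vector_derivative l) (at t)"
 unfolding has_vector_derivative_def has_derivative_iff_norm
proof (intro conjI)
 have "((%s. norm (ph s - l)) ---> 0) (at t)"
  using assms(2) by (simp add: tendsto_norm_zero_iff LIM_zero_iff)
 moreover have "\<forall>\<^sub>F s in at t. norm (ph s - l) = norm (f s - f t - (s - t) *: l) / norm (s - t)"
  using assms(1) eventually_neq_at_within[of t t UNIV]
 proof eventually_elim
  case (elim s)
  have "f s - f t - (s - t) *: l = (s - t) *: (ph s - l)" using elim by (simp add: scaleR_diff_right)
  then show ?case using elim by simp
 qed
 ultimately show "((%s. norm (f s - f t - (s - t) *: l) / norm (s - t)) ---> 0) (at t)"
  by (rule Lim_transform_eventually)
qed (rule bounded_linear_scaleR_left)

context coercive_sa begin

text \<open>Continuity and derivatives are established in operator norm, so that composites such as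
  \<open>Q t (P t f)\<close> and resolvents applied to moving vectors can be treated by bilinear
  rules.\<close>

definition bP :: "real => 'h \<Rightarrow>\<^sub>L 'h" where "bP t = Blinfun (P t)"
definition bQ :: "real => 'h \<Rightarrow>\<^sub>L 'h" where "bQ t = Blinfun (Q t)"

lemma bPQ: "0 < t ==> blinfun_apply (bP t) f = P t f" "0 < t ==> blinfun_apply (bQ t) f = Q t f"
 by (simp_all add: bP_def bQ_def bounded_linear_Blinfun_apply P_bl Q_bl)

lemma bPQ_norm: "0 < t ==> norm (bP t) <= K" "0 < t ==> norm (bQ t) <= K"
 using K_pos by (auto intro!: norm_blinfun_bound simp: bPQ P_norm Q_norm)

lemma bQ_diff:
 assumes "0 < t" "0 < s"
 shows "bQ s - bQ t = (s - t) *: ((1/s) *: (bQ s o\<^sub>L bP t) - (1/t) *: (bQ s - (bQ s o\<^sub>L bP t)))"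
 by (rule blinfun_eqI) (use assms in \<open>simp add: blinfun.bilinear_simps bPQ Q_diff\<close>)

lemma bP_diff:
 assumes "0 < t" "0 < s"
 shows "bP s - bP t = (s - t) *: (- (1/s + 1/t) *: (bQ t o\<^sub>L bQ s))"
proof (rule blinfun_eqI)
 fix f
 have "t/s - s/t = (s - t) * (- (1/s + 1/t))" using assms by (simp add: field_simps)
 then show "blinfun_apply (bP s - bP t) f = blinfun_apply ((s - t) *: (- (1/s + 1/t) *: (bQ t o\<^sub>L bQ s))) f"
  using assms by (simp only: blinfun.bilinear_simps blinfun_apply_blinfun_compose bPQ P_diff scaleR_scaleR)
qed

lemma eventually_pos_at: "0 < t ==> \<forall>\<^sub>F s in at t. 0 < (s::real)"
 by (rule order_tendstoD(1)[OF tendsto_ident_at])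

lemma bQ_cont: "0 < t ==> isCont bQ t"
proof -
 assume t: "0 < t"
 have "\<forall>\<^sub>F s in at t. norm (bQ s - bQ t) <= \<bar>s - t\<bar> * ((1/s) * (K * K) + (1/t) * (K + K * K))"
  using eventually_pos_at[OF t]
 proof eventually_elim
  case (elim s)
  have c: "norm (bQ s o\<^sub>L bP t) <= K * K"
  using norm_blinfun_compose[of "bQ s" "bP t"] mult_mono[OF bPQ_norm(2)[OF elim] bPQ_norm(1)[OF t]] K_pos by simp
  have "norm ((1/s) *: (bQ s o\<^sub>L bP t) - (1/t) *: (bQ s - (bQ s o\<^sub>L bP t)))
  <= norm ((1/s) *: (bQ s o\<^sub>L bP t)) + norm ((1/t) *: (bQ s - (bQ s o\<^sub>L bP t)))"
  by (rule norm_triangle_ineq4)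
  also have "\<dots> <= (1/s) * (K * K) + (1/t) * (K + K * K)"
  unfolding norm_scaleR
  by (intro add_mono mult_mono' c order_trans[OF norm_triangle_ineq4 add_mono[OF bPQ_norm(2)[OF elim] c]])
  (use t elim in auto)
  finally show ?case unfolding bQ_diff[OF t elim] norm_scaleR by (intro mult_left_mono) auto
 qed
 moreover have "((%s. \<bar>s - t\<bar> * ((1/s) * (K * K) + (1/t) * (K + K * K))) ---> \<bar>t - t\<bar> * ((1/t) * (K * K) + (1/t) * (K + K * K))) (at t)"
  using t by (intro tendsto_intros) auto
 then have "((%s. \<bar>s - t\<bar> * ((1/s) * (K * K) + (1/t) * (K + K * K))) ---> 0) (at t)" by simp
 ultimately have "((%s. bQ s - bQ t) ---> 0) (at t)" by (rule Lim_null_comparison)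
 then show ?thesis unfolding isCont_def by (simp add: LIM_zero_iff)
qed

lemmas bcompose_tendsto = bounded_bilinear.tendsto[OF bounded_bilinear_blinfun_compose]

lemma bP_deriv:
 assumes t: "0 < t"
 shows "(bP has_vector_derivative (- (2/t) *: (bQ t o\<^sub>L bQ t))) (at t)"
proof (rule hvd_factor)
 show "\<forall>\<^sub>F s in at t. bP s - bP t = (s - t) *: (- (1/s + 1/t) *: (bQ t o\<^sub>L bQ s))"
  using eventually_pos_at[OF t] by eventually_elim (rule bP_diff[OF t])
 have "((%s. - (1/s + 1/t) *: (bQ t o\<^sub>L bQ s)) ---> - (1/t + 1/t) *: (bQ t o\<^sub>L bQ t)) (at t)"
  using t bQ_cont[OF t] by (intro tendsto_intros bcompose_tendsto) (auto simp: isCont_def)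
 then show "((%s. - (1/s + 1/t) *: (bQ t o\<^sub>L bQ s)) ---> - (2/t) *: (bQ t o\<^sub>L bQ t)) (at t)"
  by simp
qed

lemma bP_cont: "0 < t ==> isCont bP t"
 using bP_deriv has_vector_derivative_continuous by blast

lemma bQ_deriv:
 assumes t: "0 < t"
 shows "(bQ has_vector_derivative ((1/t) *: (2 *: (bQ t o\<^sub>L bP t) - bQ t))) (at t)"
proof (rule hvd_factor)
 show "\<forall>\<^sub>F s in at t. bQ s - bQ t = (s - t) *: ((1/s) *: (bQ s o\<^sub>L bP t) - (1/t) *: (bQ s - (bQ s o\<^sub>L bP t)))"
  using eventually_pos_at[OF t] by eventually_elim (rule bQ_diff[OF t])
 have "((%s. (1/s) *: (bQ s o\<^sub>L bP t) - (1/t) *: (bQ s - (bQ s o\<^sub>L bP t))) --->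
  (1/t) *: (bQ t o\<^sub>L bP t) - (1/t) *: (bQ t - (bQ t o\<^sub>L bP t))) (at t)"
  using t bQ_cont[OF t] by (intro tendsto_intros bcompose_tendsto) (auto simp: isCont_def)
 then show "((%s. (1/s) *: (bQ s o\<^sub>L bP t) - (1/t) *: (bQ s - (bQ s o\<^sub>L bP t))) --->
  (1/t) *: (2 *: (bQ t o\<^sub>L bP t) - bQ t)) (at t)"
  by (simp add: algebra_simps scaleR_2)
qed

lemma vector_der_transform_pos:
 fixes f :: "real => 'b::real_normed_vector"
 assumes "0 < t" "(f has_vector_derivative d) (at t)" "!!s. 0 < s ==> f s = g s"
 shows "(g has_vector_derivative d) (at t)"
 by (rule has_vector_derivative_transform_within_open[OF assms(2), of "{0<..}"]) (use assms in auto)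

lemma P_deriv:
 assumes t: "0 < t"
 shows "((%t. P t f) has_vector_derivative (- (2/t) *: Q t (Q t f))) (at t)"
proof -
 have "((%s. blinfun_apply (bP s) f) has_vector_derivative (- (2/t) *: Q t (Q t f))) (at t)"
  using bounded_linear.has_vector_derivative[OF blinfun.bounded_linear_left bP_deriv[OF t], of f]
  by (simp add: blinfun.bilinear_simps bPQ t)
 then show ?thesis by (rule vector_der_transform_pos[OF t]) (simp add: bPQ)
qed

lemma Q_deriv:
 assumes t: "0 < t"
 shows "((%t. Q t f) has_vector_derivative ((1/t) *: (2 *: Q t (P t f) - Q t f))) (at t)"
proof -
 have "((%s. blinfun_apply (bQ s) f) has_vector_derivative ((1/t) *: (2 *: Q t (P t f) - Q t f))) (at t)"
  using bounded_linear.has_vector_derivative[OF blinfun.bounded_linear_left bQ_deriv[OF t], of f]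
  by (simp add: blinfun.bilinear_simps bPQ t)
 then show ?thesis by (rule vector_der_transform_pos[OF t]) (simp add: bPQ)
qed

lemma QPP_eq: "0 < t ==> Q t (P t (P t f)) = Q t (P t f) - Q t (Q t (Q t f))"
 by (simp add: QQ_same PQ_diff)

text \<open>With x = Q P f and z = Q Q Q f this is the equation t x' = x - 4 z, the input of
  \<open>energy_interval\<close>.\<close>

lemma QP_deriv:
 assumes t: "0 < t"
 shows "((%t. Q t (P t f)) has_vector_derivative ((1/t) *: (Q t (P t f) - 4 *: Q t (Q t (Q t f))))) (at t)"
proof -
 have "((%t. bQ t o\<^sub>L bP t) has_vector_derivative
  (bQ t o\<^sub>L (- (2/t) *: (bQ t o\<^sub>L bQ t))) + (((1/t) *: (2 *: (bQ t o\<^sub>L bP t) - bQ t)) o\<^sub>L bP t)) (at t)"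
  by (rule bounded_bilinear.has_vector_derivative[OF bounded_bilinear_blinfun_compose bQ_deriv[OF t] bP_deriv[OF t]])
 from bounded_linear.has_vector_derivative[OF blinfun.bounded_linear_left this, of f]
 have "((%s. blinfun_apply (bQ s o\<^sub>L bP s) f) has_vector_derivative
  - ((2/t) *: Q t (Q t (Q t f))) + (1/t) *: (2 *: Q t (P t (P t f)) - Q t (P t f))) (at t)"
  by (simp add: blinfun.bilinear_simps bPQ t PQ_scale)
 then have "((%t. Q t (P t f)) has_vector_derivative
  - ((2/t) *: Q t (Q t (Q t f))) + (1/t) *: (2 *: Q t (P t (P t f)) - Q t (P t f))) (at t)"
  by (rule vector_der_transform_pos[OF t]) (simp add: bPQ)
 moreover have "- ((2/t) *: Q t (Q t (Q t f))) + (1/t) *: (2 *: Q t (P t (P t f)) - Q t (P t f))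
  = (1/t) *: (Q t (P t f) - 4 *: Q t (Q t (Q t f)))"
 proof -
  have "- ((2/t) *: c) + (1/t) *: (2 *: (b - c) - b) = (1/t) *: (b - 4 *: c)" for b c :: 'h
  by (simp add: algebra_simps scaleR_2 flip: scaleR_add_left)
  then show ?thesis by (simp only: QPP_eq[OF t])
 qed
 ultimately show ?thesis by simp
qed

lemma bPQ_cont_on: "continuous_on {0<..} bP" "continuous_on {0<..} bQ"
 by (auto intro!: continuous_at_imp_continuous_on bP_cont bQ_cont)

lemma P_cont: "continuous_on {0<..} g ==> continuous_on {0<..} (%t. P t (g t))"
 using continuous_on_cong[of "{0<..}" "{0<..}" "%t. blinfun_apply (bP t) (g t)" "%t. P t (g t)"]
 by (simp add: bPQ blinfun.continuous_on bPQ_cont_on)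

lemma Q_cont: "continuous_on {0<..} g ==> continuous_on {0<..} (%t. Q t (g t))"
 using continuous_on_cong[of "{0<..}" "{0<..}" "%t. blinfun_apply (bQ t) (g t)" "%t. Q t (g t)"]
 by (simp add: bPQ blinfun.continuous_on bPQ_cont_on)

section \<open>Limits of the resolvents at zero and infinity\<close>

lemma T_dom_dense: "closure {x. \<exists>y. (x, y) \<in> T} = UNIV"
proof (rule dense_subspaceI)
 show "subspace {x. \<exists>y. (x, y) \<in> T}"
  unfolding subspace_def using T_zero T_add T_scale by blast
 fix b assume b: "!!z. z \<in> {x. \<exists>y. (x, y) \<in> T} ==> inner b z = 0"
 obtain B' where B': "!!x y. inner (inv B x) y = inner x (B' y)"
  using adj_exists[OF B_inv(2)] by blast
 \<comment> \<open>The domain of \<open>T\<close> is the image under \<open>inv B\<close> of the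
   domain of \<open>D\<close>. Orthogonality to it places this pair in the adjoint graph, hence in
   \<open>D\<close>, which is single-valued at 0.\<close>
 have "(0, B' b) \<in> D"
 proof (subst D_iff, safe)
  fix p q assume "(p, q) \<in> D"
  then have "inv B p \<in> {x. \<exists>y. (x, y) \<in> T}" by (auto simp: T_iff B_inv)
  from b[OF this] show "inner q 0 = inner p (B' b)" by (simp add: B'[symmetric] inner_commute)
 qed
 then have "B' b = 0" by (rule D_single)
 then have "inner b b = 0" using B'[of "B b" b] by (simp add: B_inv)
 then show "b = 0" by simp
qed

text \<open>On the domain of \<open>T\<close> the difference \<open>x - P t x\<close> is
  \<open>t\<close> times \<open>Q t\<close> of the image of \<open>x\<close>, hence of order
  \<open>t\<close>; density and the uniform bound do the rest.\<close>

lemma P_at_0: "((%t. P t f) ---> f) (at_right 0)"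
proof -
 have "((%t. f - P t f) ---> 0) (at_right 0)"
 proof (rule tendsto_zero_dense[OF T_dom_dense, where L="%t f. f - P t f" and K="1 + K"])
  show "\<forall>\<^sub>F t in at_right 0. (\<forall>x y. x - y - P t (x - y) = x - P t x - (y - P t y)) \<and> (\<forall>x. norm (x - P t x) <= (1 + K) * norm x)"
  using eventually_at_right_less[of 0] by eventually_elim (auto simp: PQ_diff PQ_bound1)
  fix x assume "x \<in> {x. \<exists>y. (x, y) \<in> T}"
  then obtain y where xy: "(x, y) \<in> T" by blast
  have "\<forall>\<^sub>F t in at_right 0. norm (x - P t x) <= t * (K * norm y)"
  using eventually_at_right_less[of 0] by eventually_elim (simp add: PQ_T(2)[OF _ xy] Q_norm mult_left_mono)
  moreover have "((%t. t * (K * norm y)) ---> 0) (at_right 0)" by (intro tendsto_eq_intros | simp)+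
  ultimately show "((%t. x - P t x) ---> 0) (at_right 0)" by (rule Lim_null_comparison)
 qed
 from tendsto_diff[OF tendsto_const[of f] this] show ?thesis by simp
qed

lemma Q_at_0: "((%t. Q t f) ---> 0) (at_right 0)"
proof (rule tendsto_zero_dense[OF T_dom_dense, where L=Q and K=K])
 show "\<forall>\<^sub>F t in at_right 0. (\<forall>x y. Q t (x - y) = Q t x - Q t y) \<and> (\<forall>x. norm (Q t x) <= K * norm x)"
  using eventually_at_right_less[of 0] by eventually_elim (auto simp: PQ_diff Q_norm)
 fix x assume "x \<in> {x. \<exists>y. (x, y) \<in> T}"
 then obtain y where xy: "(x, y) \<in> T" by blast
 have "\<forall>\<^sub>F t in at_right 0. norm (Q t x) <= t * (K * norm y)"
  using eventually_at_right_less[of 0] by eventually_elim (simp add: PQ_T(1)[OF _ xy] P_norm mult_left_mono)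
 moreover have "((%t. t * (K * norm y)) ---> 0) (at_right 0)" by (intro tendsto_eq_intros | simp)+
 ultimately show "((%t. Q t x) ---> 0) (at_right 0)" by (rule Lim_null_comparison)
qed

end

locale coercive_sa_inj = coercive_sa +
 assumes D_inj: "!!a. (a, 0) \<in> D ==> a = 0"
begin

text \<open>A vector orthogonal to the range of a self-adjoint operator lies in its kernel, which is
  trivial by \<open>D_inj\<close>.\<close>

lemma T_range_dense: "closure {y. \<exists>x. (x, y) \<in> T} = UNIV"
proof (rule dense_subspaceI)
 show "subspace {y. \<exists>x. (x, y) \<in> T}"
  unfolding subspace_def using T_zero T_add T_scale by blast
 fix b assume b: "!!z. z \<in> {y. \<exists>x. (x, y) \<in> T} ==> inner b z = 0"
 have "(b, 0) \<in> D"
 proof (subst D_iff, safe)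
  fix p q assume "(p, q) \<in> D"
  then have "(inv B p, q) \<in> T" by (simp add: T_iff B_inv)
  then show "inner q b = inner p 0" using b[of q] by (auto simp: inner_commute)
 qed
 then show "b = 0" by (rule D_inj)
qed

lemma Q_at_top: "((%t. Q t f) ---> 0) at_top"
 and P_at_top: "((%t. P t f) ---> 0) at_top"
proof -
 have lim: "((%t. (1/t) * c) ---> 0) at_top" for c :: real
  by (rule tendsto_mult_left_zero) (rule tendsto_divide_0[OF tendsto_const filterlim_at_top_imp_at_infinity[OF filterlim_ident]])
 show "((%t. Q t f) ---> 0) at_top"
 proof (rule tendsto_zero_dense[OF T_range_dense, where L=Q and K=K])
  show "\<forall>\<^sub>F t in at_top. (\<forall>x y. Q t (x - y) = Q t x - Q t y) \<and> (\<forall>x. norm (Q t x) <= K * norm x)"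
  using eventually_gt_at_top[of 0] by eventually_elim (auto simp: PQ_diff Q_norm)
  fix y assume "y \<in> {y. \<exists>x. (x, y) \<in> T}"
  then obtain x where xy: "(x, y) \<in> T" by blast
  have "\<forall>\<^sub>F t in at_top. norm (Q t y) <= (1/t) * ((1 + K) * norm x)"
  using eventually_gt_at_top[of 0]
  proof eventually_elim
  case (elim t)
  have "Q t y = (1/t) *: (x - P t x)" using PQ_T(2)[OF elim xy] elim by simp
  then show ?case using PQ_bound1[OF elim, of x] elim by (simp add: divide_right_mono)
  qed
  then show "((%t. Q t y) ---> 0) at_top" using lim by (rule Lim_null_comparison)
 qed
 show "((%t. P t f) ---> 0) at_top"
 proof (rule tendsto_zero_dense[OF T_range_dense, where L=P and K=K])
  show "\<forall>\<^sub>F t in at_top. (\<forall>x y. P t (x - y) = P t x - P t y) \<and> (\<forall>x. norm (P t x) <= K * norm x)"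
  using eventually_gt_at_top[of 0] by eventually_elim (auto simp: PQ_diff P_norm)
  fix y assume "y \<in> {y. \<exists>x. (x, y) \<in> T}"
  then obtain x where xy: "(x, y) \<in> T" by blast
  have "\<forall>\<^sub>F t in at_top. norm (P t y) <= (1/t) * (K * norm x)"
  using eventually_gt_at_top[of 0]
  proof eventually_elim
  case (elim t)
  have "P t y = (1/t) *: Q t x" using PQ_T(1)[OF elim xy] elim by simp
  then show ?case using Q_norm[OF elim, of x] elim by (simp add: divide_right_mono)
  qed
  then show "((%t. P t y) ---> 0) at_top" using lim by (rule Lim_null_comparison)
 qed
qed

end

section \<open>Square function estimates\<close>

text \<open>The squared norm of \<open>x\<close> has derivative (2 sg/t) <x, x - 4z>, and 2 <x, x -
  4z> is at least |x|^2 - 16 |z|^2 because |x - 4z|^2 is nonnegative. Integration leaves the two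
  boundary values, whose sign depends on \<open>sg\<close> and is therefore discarded.\<close>

lemma energy_interval:
 fixes x z :: "real => 'h::real_inner"
 assumes ab: "0 < a" "a <= b" and sg: "\<bar>sg\<bar> = 1"
  and d: "!!t. 0 < t ==> (x has_vector_derivative (sg/t) *: (x t - 4 *: z t)) (at t)"
  and z: "continuous_on {0<..} z"
 shows "integral {a..b} (%t. (norm (x t))^2 / t)
  <= 16 * integral {a..b} (%t. (norm (z t))^2 / t) + (norm (x a))^2 + (norm (x b))^2"
proof -
 have sub: "{a..b} \<subseteq> {0<..}" using ab by auto
 have cx: "continuous_on {a..b} x"
  using ab by (auto intro!: continuous_at_imp_continuous_on has_vector_derivative_continuous[OF d])
 have cz: "continuous_on {a..b} z" by (rule continuous_on_subset[OF z sub])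
 have i1: "(%t. (norm (x t))^2 / t) integrable_on {a..b}" "(%t. (norm (z t))^2 / t) integrable_on {a..b}"
  using ab by (auto intro!: integrable_continuous_interval continuous_intros cx cz)
 have "((%t. sg * (2 * (sg/t) * inner (x t) (x t - 4 *: z t))) has_integral (sg * ((norm (x b))^2 - (norm (x a))\<^sup>2))) {a..b}"
 proof (rule has_integral_mult_right, rule fundamental_theorem_of_calculus[OF ab(2)])
  fix t assume "t \<in> {a..b}"
  then have t: "0 < t" using ab by auto
  have "((%t. inner (x t) (x t)) has_vector_derivative
  inner (x t) ((sg/t) *: (x t - 4 *: z t)) + inner ((sg/t) *: (x t - 4 *: z t)) (x t)) (at t within {a..b})"
  by (rule bounded_bilinear.has_vector_derivative[OF bounded_bilinear_inner
  has_vector_derivative_at_within[OF d[OF t]] has_vector_derivative_at_within[OF d[OF t]]])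
  then show "((%t. (norm (x t))^2) has_vector_derivative 2 * (sg/t) * inner (x t) (x t - 4 *: z t)) (at t within {a..b})"
  by (simp add: power2_norm_eq_inner inner_commute mult.assoc)
 qed
 then have "integral {a..b} (%t. (norm (x t))^2 / t - 16 * ((norm (z t))^2 / t)) <= sg * ((norm (x b))^2 - (norm (x a))\<^sup>2)"
 proof (rule has_integral_le[OF integrable_integral, rotated])
  show "(%t. (norm (x t))^2 / t - 16 * ((norm (z t))^2 / t)) integrable_on {a..b}"
  by (intro integrable_diff integrable_on_mult_right i1)
  fix t assume "t \<in> {a..b}"
  then have t: "0 < t" using ab by auto
  have ss: "sg * sg = 1" using sg by (metis abs_mult_self_eq mult_1)
  have "0 <= (norm (x t - 4 *: z t))^2" by simp
  then have "(norm (x t))^2 - 16 * (norm (z t))^2 <= 2 * inner (x t) (x t - 4 *: z t)"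
  unfolding power2_norm_eq_inner by (simp add: inner_diff_left inner_diff_right inner_commute)
  then have "((norm (x t))^2 - 16 * (norm (z t))^2) / t <= 2 * inner (x t) (x t - 4 *: z t) / t"
  using t by (intro divide_right_mono) auto
  moreover have "sg * (2 * (sg/t) * inner (x t) (x t - 4 *: z t)) = (sg * sg) * (2 * inner (x t) (x t - 4 *: z t) / t)"
  by simp
  ultimately have "((norm (x t))^2 - 16 * (norm (z t))^2) / t <= sg * (2 * (sg/t) * inner (x t) (x t - 4 *: z t))"
  unfolding ss by linarith
  then show "(norm (x t))^2 / t - 16 * ((norm (z t))^2 / t) <= sg * (2 * (sg/t) * inner (x t) (x t - 4 *: z t))"
  by (simp only: diff_divide_distrib times_divide_eq_right)
 qed
 also have "sg * ((norm (x b))^2 - (norm (x a))\<^sup>2) <= \<bar>sg\<bar> * \<bar>(norm (x b))\<^sup>2 - (norm (x a))\<^sup>2\<bar>"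
  by (simp add: abs_mult[symmetric])
 also have "\<dots> <= (norm (x a))^2 + (norm (x b))^2"
  unfolding sg by (auto simp: abs_le_iff)
 finally show ?thesis
  unfolding integral_diff[OF i1(1) integrable_on_mult_right[OF i1(2)]] integral_mult_right by linarith
qed

lemma meas_half_borel: "f \<in> borel_measurable borel ==> f \<in> borel_measurable halfline"
 by (rule measurable_restrict_space1) simp

lemma nn_int_half_Icc:
 fixes g :: "real => real"
 assumes g: "continuous_on {0<..} g" "!!t. 0 < t ==> 0 <= g t" and ab: "0 < a"
 shows "(HI t. ennreal (g t) * indicator {a..b} t) = ennreal (integral {a..b} g)"
proof -
 have sub: "{a..b} \<subseteq> {0<..}" using ab by auto
 have si: "set_integrable lborel {a..b} g"
  by (intro borel_integrable_atLeastAtMost' continuous_on_subset[OF g(1) sub])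
 have "(HI t. ennreal (g t) * indicator {a..b} t)
  = (\<integral>\<^sup>+t. ennreal (indicator {a..b} t *: g t) \<partial>lborel)"
  using sub by (subst nn_integral_restrict_space) (auto intro!: nn_integral_cong simp: indicator_def)
 also have "\<dots> = ennreal (\<integral>t. indicator {a..b} t *: g t \<partial>lborel)"
  using si g(2) sub by (intro nn_integral_eq_integral) (auto simp: set_integrable_def intro!: AE_I2 split: split_indicator)
 also have "(\<integral>t. indicator {a..b} t *: g t \<partial>lborel) = integral {a..b} g"
  using set_borel_integral_eq_integral(2)[OF si] by (simp add: set_lebesgue_integral_def)
 finally show ?thesis .
qed

lemma nn_int_half_ge:
 fixes g :: "real => real"
 assumes g: "continuous_on {0<..} g" "!!t. 0 < t ==> 0 <= g t" and ab: "0 < a"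
 shows "ennreal (integral {a..b} g) <= (HI t. ennreal (g t))"
 by (subst nn_int_half_Icc[OF assms, symmetric]) (auto intro!: nn_integral_mono split: split_indicator)

text \<open>Monotone exhaustion of the half line by compact intervals; \<open>e\<close> absorbs
  boundary terms that disappear in the limit.\<close>

lemma nn_int_half_le:
 fixes g :: "real => real"
 assumes g: "continuous_on {0<..} g" "!!t. 0 < t ==> 0 <= g t"
  and le: "!!n. ennreal (integral {1 / real (Suc n)..real (Suc n)} g) <= C + e n" and e: "e ----> 0"
 shows "(HI t. ennreal (g t)) <= C"
proof -
 define f where "f n t = ennreal (g t) * indicator {1 / real (Suc n)..real (Suc n)} t" for n t
 have [measurable]: "g \<in> borel_measurable halfline" by (rule meas_half_cont[OF g(1)])
 have [measurable]: "(%t. indicator {1 / real (Suc n)..real (Suc n)} t :: ennreal) \<in> borel_measurable halfline" for n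
  by (rule meas_half_borel) simp
 have mono: "{1 / real (Suc m)..real (Suc m)} \<subseteq> {1 / real (Suc n)..real (Suc n)}" if "m <= n" for m n
  using that by (auto simp: frac_le order_trans[of "1 / (1 + real n)" "1 / (1 + real m)"])
 have inc: "incseq f"
  unfolding incseq_def le_fun_def f_def using mono by (fastforce split: split_indicator)
 have "(HI t. (SUP n. f n t)) = (SUP n. HI t. f n t)"
  by (rule nn_integral_monotone_convergence_SUP[OF inc]) (unfold f_def[abs_def], measurable)
 moreover have "(HI t. (SUP n. f n t)) = (HI t. ennreal (g t))"
 proof (rule nn_integral_cong)
  fix t assume "t \<in> space halfline"
  then have t: "0 < t" by simp
  obtain n where n: "max t (1/t) <= real n" using real_arch_simple by blast
  have "t \<in> {1 / real (Suc n)..real (Suc n)}"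
  using n t by (auto simp: field_simps)
  then have "f n t = ennreal (g t)" by (simp add: f_def)
  then have "ennreal (g t) <= (SUP n. f n t)" by (metis SUP_upper UNIV_I)
  moreover have "(SUP n. f n t) <= ennreal (g t)"
  by (rule SUP_least) (auto simp: f_def split: split_indicator)
  ultimately show "(SUP n. f n t) = ennreal (g t)" by (rule antisym[rotated])
 qed
 moreover have "(SUP n. HI t. f n t) <= C"
 proof -
  have "incseq (%n. HI t. f n t)"
  using inc by (auto simp: incseq_def le_fun_def intro!: nn_integral_mono)
  then have 1: "(%n. HI t. f n t) ----> (SUP n. HI t. f n t)"
  by (rule LIMSEQ_SUP)
  have 2: "(%n. C + e n) ----> C + 0" by (intro tendsto_add e tendsto_const)
  have "(HI t. f n t) <= C + e n" for n
  unfolding f_def by (subst nn_int_half_Icc[OF g]) (use le[of n] in auto)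
  then have "(SUP n. HI t. f n t) <= C + 0" by (intro LIMSEQ_le[OF 1 2]) blast
  then show ?thesis by simp
 qed
 ultimately show ?thesis by simp
qed

lemma half_scale:
 fixes f :: "real => real"
 assumes "0 < s"
 shows "integral\<^sup>L halfline (%r. f (r/s)) = s * integral\<^sup>L halfline f"
  "integrable halfline f ==> integrable halfline (%r. f (r/s))"
proof -
 have i: "indicator {0<..} (s * x) = (indicator {0<..} x :: real)" for x :: real
  using assms by (simp add: indicator_def zero_less_mult_iff)
 have "(\<integral>r. indicator {0<..} r *: f (r/s) \<partial>lborel) = s * (\<integral>r. indicator {0<..} r *: f r \<partial>lborel)"
  using assms by (subst lborel_integral_real_affine[where c=s and t=0]) (auto simp: i)
 then show "integral\<^sup>L halfline (%r. f (r/s)) = s * integral\<^sup>L halfline f"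
  by (simp add: int_half_eq set_lebesgue_integral_def)
 assume "integrable halfline f"
 then have "integrable lborel (%x. indicator {0<..} x *: f x)" by (simp add: intble_half_iff set_integrable_def)
 then have "integrable lborel (%r. indicator {0<..} (0 + (1/s) * r) *: f (0 + (1/s) * r))"
  by (rule lborel_integrable_real_affine) (use assms in simp)
 moreover have "(%r. indicator {0<..} (0 + (1/s) * r) *: f (0 + (1/s) * r)) = (%r. indicator {0<..} r *: f (r/s))"
  using assms by (simp add: fun_eq_iff indicator_def zero_less_divide_iff)
 ultimately show "integrable halfline (%r. f (r/s))" by (simp only: intble_half_iff set_integrable_def)
qed

locale quadratic_sa = coercive_sa +
 assumes quad: "\<exists>c>0. \<exists>C>0. \<forall>f.
  ennreal (c * (norm f)^2) <= (HI t. ennreal ((norm (Q t f))^2 / t)) \<and>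
  (HI t. ennreal ((norm (Q t f))^2 / t)) <= ennreal (C * (norm f)^2)"

text \<open>On the kernel of \<open>T\<close> every \<open>Q t x\<close> vanishes, so the lower
  quadratic estimate forces \<open>x = 0\<close>.\<close>

sublocale quadratic_sa \<subseteq> coercive_sa_inj
proof
 fix a assume a: "(a, 0) \<in> D"
 define x where "x = inv B a"
 have x: "(x, 0) \<in> T" using a by (simp add: x_def T_iff B_inv)
 have Qx: "Q t x = 0" if "0 < t" for t
  using PQ_T(1)[OF that x] bounded_linear.linear[OF P_bl[OF that]] by (simp add: linear_0)
 obtain c where c: "0 < c" "ennreal (c * (norm x)^2) <= (HI t. ennreal ((norm (Q t x))^2 / t))"
  using quad by blast
 have "(HI t. ennreal ((norm (Q t x))^2 / t)) = (HI t. 0)"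
  by (rule nn_integral_cong) (simp add: Qx)
 then have "c * (norm x)^2 <= 0" using c(2) by (simp add: ennreal_eq_0_iff)
 then have "x = 0" using c(1) by (simp add: mult_le_0_iff)
 then show "a = 0" using B_inv(3)[of a] linear_0[OF bounded_linear.linear[OF B_bl]] by (simp add: x_def)
qed

context quadratic_sa begin

lemma Q_sq_cont:
 "continuous_on {0<..} (%t. (norm (Q t f))^2 / t)"
 "continuous_on {0<..} (%t. (norm (Q t (Q t (Q t f))))^2 / t)"
 by (auto intro!: continuous_intros Q_cont)

text \<open>\<open>Q t f\<close> is the sum of x = Q P f and y = Q (1 - P) f. Both satisfy Euler
  type equations with the same right-hand side z = Q Q Q f and opposite signs, so the energy
  inequality controls both by z. The two extra factors of \<open>Q\<close> allow one to be spent on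
  almost orthogonality later.\<close>

lemma Q_cube_lower:
 "(HI t. ennreal ((norm (Q t f))^2 / t))
  <= 64 * (HI t. ennreal ((norm (Q t (Q t (Q t f))))^2 / t))" (is "_ <= 64 * ?I3")
proof -
 define x where "x t = Q t (P t f)" for t
 define y where "y t = Q t f - Q t (P t f)" for t
 define z where "z t = Q t (Q t (Q t f))" for t
 define e where "e t = (norm (x t))^2 + (norm (y t))^2" for t
 have cz: "continuous_on {0<..} z" unfolding z_def by (intro Q_cont continuous_on_const)
 have cx: "continuous_on {0<..} x" unfolding x_def by (intro Q_cont P_cont continuous_on_const)
 have cy: "continuous_on {0<..} y" unfolding y_def by (intro continuous_intros Q_cont P_cont continuous_on_const)
 have dx: "(x has_vector_derivative (1/t) *: (x t - 4 *: z t)) (at t)" if "0 < t" for t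
  using QP_deriv[OF that, of f] by (simp only: x_def[abs_def] z_def)
 have dy: "(y has_vector_derivative (-1/t) *: (y t - 4 *: z t)) (at t)" if "0 < t" for t
 proof -
  have "(y has_vector_derivative ((1/t) *: (2 *: x t - Q t f) - (1/t) *: (x t - 4 *: z t))) (at t)"
  using has_vector_derivative_diff[OF Q_deriv[OF that, of f] QP_deriv[OF that, of f]]
  by (simp only: x_def z_def y_def[abs_def])
  moreover have "(1/t) *: (2 *: x t - Q t f) - (1/t) *: (x t - 4 *: z t) = (-1/t) *: (y t - 4 *: z t)"
  unfolding y_def x_def[symmetric] by (simp add: algebra_simps scaleR_2)
  ultimately show ?thesis by simp
 qed
 \<comment> \<open>The constant 64 is 2 * 16 + 2 * 16: the square of a sum costs a factor 2, and
   each summand costs 16 by \<open>energy_interval\<close>.\<close>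
 have fin: "integral {a..b} (%t. (norm (Q t f))^2 / t) <= 64 * integral {a..b} (%t. (norm (z t))^2 / t) + 2 * (e a + e b)"
  if ab: "0 < a" "a <= b" for a b
 proof -
  have sub: "{a..b} \<subseteq> {0<..}" using ab by auto
  have ix: "(%t. (norm (x t))^2 / t) integrable_on {a..b}" "(%t. (norm (y t))^2 / t) integrable_on {a..b}"
  using ab by (auto intro!: integrable_continuous_interval continuous_intros continuous_on_subset[OF cx sub] continuous_on_subset[OF cy sub])
  have iq: "(%t. (norm (Q t f))^2 / t) integrable_on {a..b}"
  by (intro integrable_continuous_interval continuous_on_subset[OF Q_sq_cont(1) sub])
  have "integral {a..b} (%t. (norm (Q t f))^2 / t)
  <= integral {a..b} (%t. 2 * ((norm (x t))^2 / t) + 2 * ((norm (y t))^2 / t))"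
  proof (rule integral_le[OF iq])
  show "(%t. 2 * ((norm (x t))^2 / t) + 2 * ((norm (y t))^2 / t)) integrable_on {a..b}"
  by (intro integrable_add integrable_on_mult_right ix)
  fix t assume "t \<in> {a..b}"
  then have t: "0 < t" using ab by auto
  have "Q t f = x t + y t" by (simp add: x_def y_def)
  then have "(norm (Q t f))^2 <= (norm (x t) + norm (y t))^2" by (simp add: norm_triangle_ineq power_mono)
  also have "\<dots> <= 2 * (norm (x t))^2 + 2 * (norm (y t))^2"
  using sum_squares_bound[of "norm (x t)" "norm (y t)"] by (simp add: power2_sum)
  finally have "(norm (Q t f))^2 / t <= (2 * (norm (x t))^2 + 2 * (norm (y t))^2) / t"
  using t by (intro divide_right_mono) auto
  then show "(norm (Q t f))^2 / t <= 2 * ((norm (x t))^2 / t) + 2 * ((norm (y t))^2 / t)"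
  by (simp add: add_divide_distrib)
  qed
  also have "\<dots> = 2 * integral {a..b} (%t. (norm (x t))^2 / t) + 2 * integral {a..b} (%t. (norm (y t))^2 / t)"
  by (simp only: integral_add integrable_on_mult_right ix integral_mult_right)
  finally show ?thesis
  using energy_interval[of a b 1 x z] energy_interval[of a b "-1" y z] dx dy cz ab by (simp add: e_def)
 qed
 \<comment> \<open>The boundary values are images of \<open>Q t f\<close> under bounded operators,
   so they vanish at both ends of the half line together with it.\<close>
 have small: "((%t. e t) ---> 0) F" if F: "((%t. Q t f) ---> 0) F" "\<forall>\<^sub>F t in F. 0 < t" for F
 proof -
  have "\<forall>\<^sub>F t in F. norm (e t) <= (K^2 + (1 + K)^2) * (norm (Q t f))^2"
  using F(2)
  proof eventually_elim
  case (elim t)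
  have "norm (x t) <= K * norm (Q t f)" unfolding x_def using QP[OF elim elim, of f] P_norm[OF elim, of "Q t f"] by simp
  moreover have "norm (y t) <= (1 + K) * norm (Q t f)" unfolding y_def
  using QP[OF elim elim, of f] PQ_bound1[OF elim, of "Q t f"] by simp
  ultimately have "(norm (x t))^2 <= (K * norm (Q t f))^2" "(norm (y t))^2 <= ((1 + K) * norm (Q t f))^2"
  by (simp_all add: power_mono)
  then have "e t <= (K^2 + (1 + K)^2) * (norm (Q t f))^2"
  unfolding e_def distrib_right power_mult_distrib[symmetric] by (rule add_mono)
  moreover have "0 <= e t" by (simp add: e_def)
  ultimately show ?case by simp
  qed
  moreover have "((%t. (K^2 + (1 + K)^2) * (norm (Q t f))^2) ---> (K^2 + (1 + K)^2) * 0^2) F"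
  by (intro tendsto_intros tendsto_norm_zero F)
  then have "((%t. (K^2 + (1 + K)^2) * (norm (Q t f))^2) ---> 0) F" by simp
  ultimately show ?thesis by (rule Lim_null_comparison)
 qed
 have top: "filterlim (%n. real (Suc n)) at_top sequentially"
  by (rule filterlim_compose[OF filterlim_real_sequentially filterlim_Suc])
 have bot: "filterlim (%n. 1 / real (Suc n)) (at_right 0) sequentially"
  unfolding filterlim_at using LIMSEQ_inverse_real_of_nat by (simp add: inverse_eq_divide)
 have e0: "(%n. 2 * (e (1 / real (Suc n)) + e (real (Suc n)))) ----> 2 * (0 + 0)"
  by (intro tendsto_intros filterlim_compose[OF small[OF Q_at_0 eventually_at_right_less] bot]
  filterlim_compose[OF small[OF Q_at_top eventually_gt_at_top] top])
 show ?thesis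
 proof (rule nn_int_half_le[OF Q_sq_cont(1)])
  show "(%n. ennreal (2 * (e (1 / real (Suc n)) + e (real (Suc n))))) ----> 0"
  using tendsto_ennrealI[OF e0] by simp
  show "ennreal (integral {1 / real (Suc n)..real (Suc n)} (%t. (norm (Q t f))^2 / t))
  <= 64 * ?I3 + ennreal (2 * (e (1 / real (Suc n)) + e (real (Suc n))))" for n
  proof -
  let ?a = "1 / real (Suc n)" and ?b = "real (Suc n)"
  have ab: "0 < ?a" "?a <= ?b" by (auto simp: field_simps)
  have zi: "0 <= integral {?a..?b} (%t. (norm (z t))^2 / t)"
  proof (rule integral_nonneg)
  show "(%t. (norm (z t))^2 / t) integrable_on {?a..?b}" unfolding z_def
  by (intro integrable_continuous_interval continuous_on_subset[OF Q_sq_cont(2)])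
  (use ab(1) in \<open>simp only: subset_iff greaterThan_iff atLeastAtMost_iff\<close>, meson less_le_trans)
  fix x assume "x \<in> {?a..?b}"
  then have "0 < x" using ab(1) unfolding atLeastAtMost_iff by linarith
  then show "0 <= (norm (z x))^2 / x" by simp
  qed
  have "ennreal (integral {?a..?b} (%t. (norm (Q t f))^2 / t))
  <= ennreal (64 * integral {?a..?b} (%t. (norm (z t))^2 / t) + 2 * (e ?a + e ?b))"
  by (rule ennreal_leI[OF fin[OF ab]])
  also have "\<dots> = 64 * ennreal (integral {?a..?b} (%t. (norm (z t))^2 / t)) + ennreal (2 * (e ?a + e ?b))"
  using zi by (subst ennreal_plus) (auto simp: e_def ennreal_mult)
  also have "\<dots> <= 64 * ?I3 + ennreal (2 * (e ?a + e ?b))"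
  unfolding z_def by (intro add_mono mult_left_mono nn_int_half_ge Q_sq_cont order_refl) (use ab in auto)
  finally show ?thesis .
  qed
 qed auto
qed

section \<open>Weak bounds from quadratic estimates\<close>

definition I\<^sub>0 :: real where "I\<^sub>0 = integral\<^sup>L halfline (%r. min 1 (1 / r^2))"

text \<open>The measure dr/r is invariant under scaling, so the Schur integral of the almost
  orthogonality kernel does not depend on \<open>s\<close>.\<close>

lemma min_kernel:
 assumes "0 < s"
 shows "integrable halfline (%r. min (s/r) (r/s) / r)" "integral\<^sup>L halfline (%r. min (s/r) (r/s) / r) = I\<^sub>0"
proof -
 have eq: "min (s/r) (r/s) / r = (1/s) * min 1 (1 / (r/s)^2)" if "0 < r" for r
 proof (cases "r <= s")
  case True
  then have "(r/s)^2 <= 1" using that assms by (simp add: power_le_one)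
  then have "1 <= 1 / (r/s)^2" using that assms by (simp add: field_simps)
  moreover have "r/s <= s/r" using that assms True by (simp add: field_simps power2_eq_square[symmetric] power_mono)
  ultimately show ?thesis using that assms by (simp add: min_def)
 next
  case False
  then have "1 < (r/s)^2" using that assms by simp
  then have "1 / (r/s)^2 < 1" using that assms by (simp add: field_simps)
  moreover have "s/r < r/s" using that assms False by (simp add: field_simps power2_eq_square[symmetric] power_strict_mono)
  ultimately show ?thesis using that assms by (simp add: min_def field_simps power2_eq_square)
 qed
 note sc = half_scale[OF assms, of "%r. min 1 (1 / r^2)"]
 have "integrable halfline (%r. (1/s) * min 1 (1 / (r/s)^2))"
  using sc(2)[OF intble_half_min_inv_square] by (rule integrable_mult_right)
 then show "integrable halfline (%r. min (s/r) (r/s) / r)"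
  by (subst Bochner_Integration.integrable_cong[OF refl, of _ _ "%r. (1/s) * min 1 (1 / (r/s)^2)"]) (use eq in auto)
 have "integral\<^sup>L halfline (%r. min (s/r) (r/s) / r) = integral\<^sup>L halfline (%r. (1/s) * min 1 (1 / (r/s)^2))"
  by (rule Bochner_Integration.integral_cong) (use eq in auto)
 also have "\<dots> = I\<^sub>0" unfolding integral_mult_right_zero sc(1) I\<^sub>0_def using assms by simp
 finally show "integral\<^sup>L halfline (%r. min (s/r) (r/s) / r) = I\<^sub>0" .
qed

lemma I\<^sub>0_nonneg: "0 <= I\<^sub>0"
 unfolding I\<^sub>0_def by (rule Bochner_Integration.integral_nonneg_AE) (auto intro!: AE_I2)

text \<open>With suitable signs the integral over [a, b] becomes <w, g>, where w integrates the
  family applied to f. The lower estimate in its cubic form bounds |w| through Q Q Q w, almost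
  orthogonality reduces this to \<open>Q s f\<close>, and the upper estimate returns |f|. The
  constant is independent of a and b.\<close>

lemma weak_square_bound:
 assumes bl: "!!r. 0 < r ==> bounded_linear (Ps r)"
  and cont: "!!f. continuous_on {0<..} (%r. Ps r f)"
  and comm: "!!s r f. 0 < s ==> 0 < r ==> Q s (Ps r f) = Ps r (Q s f)"
  and nb: "!!r f. 0 < r ==> norm (Ps r f) <= K\<^sub>1 * norm f" "0 <= K\<^sub>1"
  and off: "!!s r f. 0 < s ==> 0 < r ==> norm (Q s (Ps r f)) <= K\<^sub>3 * min (s/r) (r/s) * norm f" "0 <= K\<^sub>3"
 shows "\<exists>C\<ge>0. \<forall>f g. (HI r. ennreal (\<bar>inner (Ps r f) g\<bar> / r)) <= ennreal (C * norm f * norm g)"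
proof -
 obtain c C where cC: "0 < c" "0 < C"
  "!!f. ennreal (c * (norm f)^2) <= (HI t. ennreal ((norm (Q t f))^2 / t))"
  "!!f. (HI t. ennreal ((norm (Q t f))^2 / t)) <= ennreal (C * (norm f)^2)"
  using quad by blast
 define L where "L = K\<^sub>3 * I\<^sub>0 * K"
 have L0: "0 <= L" using off(2) I\<^sub>0_nonneg K_pos by (simp add: L_def)
 define C' where "C' = sqrt (64 * L^2 * C / c)"
 have C'0: "0 <= C'" by (simp add: C'_def cC less_imp_le)
 have main: "integral {a..b} (%r. \<bar>inner (Ps r f) g\<bar> / r) <= C' * norm f * norm g" if a: "0 < a" for a b f g
 proof -
  \<comment> \<open>The sign makes the pairing with \<open>g\<close> nonnegative, and the cut-off to
    [a, b] makes the weak integral exist.\<close>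
  define m where "m r = indicator {a..b} r * (if 0 <= inner (Ps r f) g then 1 else -1) / (r::real)" for r
  define v where "v r = m r *: Ps r f" for r
  have [measurable]: "(%r. inner (Ps r f) h) \<in> borel_measurable halfline" for h
  by (intro meas_half_cont continuous_intros cont)
  have [measurable]: "(%r. indicator {a..b} r :: real) \<in> borel_measurable halfline" "(%r. r) \<in> borel_measurable halfline"
  by (rule meas_half_borel, simp)+
  have [measurable]: "m \<in> borel_measurable halfline" unfolding m_def by measurable
  have mle: "\<bar>m r\<bar> <= 1 / r" "\<bar>m r\<bar> <= indicator {a..b} r / a" if "0 < r" for r
  using that a by (auto simp: m_def abs_mult frac_le split: split_indicator)
  have ind: "integrable halfline (%r. indicator {a..b} r :: real)"
  proof -
  have "{0<..} \<inter> {a..b} = {a..b}" using a by auto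
  then have "integrable lborel (indicator ({0<..} \<inter> {a..b}) :: real => real)"
  by (simp add: integrable_indicator_iff emeasure_lborel_Icc_eq)
  then show ?thesis
  by (simp add: intble_half_iff set_integrable_def flip: indicator_inter_arith)
  qed
  have wv: "wintble halfline v"
  proof (rule wintbleI)
  show "(%r. inner (v r) h) \<in> borel_measurable halfline" for h by (simp add: v_def)
  show "integrable halfline (%r. indicator {a..b} r * (1 / a * (K\<^sub>1 * norm f)))"
  by (rule integrable_mult_left[OF ind])
  fix r assume "r \<in> space halfline"
  then have r: "0 < r" by simp
  have "\<bar>m r\<bar> * norm (Ps r f) <= (indicator {a..b} r / a) * (K\<^sub>1 * norm f)"
  by (intro mult_mono mle nb r) (use a in auto)
  then show "norm (v r) <= indicator {a..b} r * (1 / a * (K\<^sub>1 * norm f))" by (simp add: v_def)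
  qed
  define w where "w = wint halfline v"
  have wg: "inner w g = integral {a..b} (%r. \<bar>inner (Ps r f) g\<bar> / r)"
  proof -
  have sub: "{a..b} \<subseteq> {0<..}" using a by auto
  have "inner w g = (\<integral>r. inner (v r) g \<partial>halfline)" unfolding w_def by (rule wint_inner[OF wv])
  also have "\<dots> = (LINT r:{a..b}|lborel. \<bar>inner (Ps r f) g\<bar> / r)"
  unfolding int_half_eq set_lebesgue_integral_def
  using sub by (intro Bochner_Integration.integral_cong) (auto simp: v_def m_def split: split_indicator)
  also have "\<dots> = integral {a..b} (%r. \<bar>inner (Ps r f) g\<bar> / r)"
  using a by (intro set_borel_integral_eq_integral borel_integrable_atLeastAtMost')
  (auto intro!: continuous_intros continuous_on_subset[OF cont sub])
  finally show ?thesis .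
  qed
  have cube: "norm (Q s (Q s (Q s w))) <= L * norm (Q s f)" if s: "0 < s" for s
  proof -
  have bl3: "bounded_linear (%x. Q s (Q s (Q s x)))"
  by (intro bounded_linear_compose[OF Q_bl[OF s]] Q_bl[OF s])
  have "norm (Q s (Q s (Q s w))) = norm (wint halfline (%r. Q s (Q s (Q s (v r)))))"
  unfolding w_def wintble_bl(2)[OF wv bl3] ..
  also have "\<dots> <= integral\<^sup>L halfline (%r. (K\<^sub>3 * norm (Q s (Q s f))) * (min (s/r) (r/s) / r))"
  proof (rule norm_wint_le[OF wintble_bl(1)[OF wv bl3]])
  show "integrable halfline (%r. (K\<^sub>3 * norm (Q s (Q s f))) * (min (s/r) (r/s) / r))"
  by (rule integrable_mult_right[OF min_kernel(1)[OF s]])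
  fix r assume "r \<in> space halfline"
  then have r: "0 < r" by simp
  \<comment> \<open>One factor stays next to \<open>Ps r\<close> and produces decay; the other two
    commute through to \<open>f\<close>, where one is kept for the quadratic estimate and one is
    merely bounded.\<close>
  have "Q s (Q s (Q s (v r))) = m r *: Q s (Ps r (Q s (Q s f)))"
  using s r by (simp add: v_def PQ_scale comm)
  then have "norm (Q s (Q s (Q s (v r)))) = \<bar>m r\<bar> * norm (Q s (Ps r (Q s (Q s f))))" by simp
  also have "\<dots> <= (1/r) * (K\<^sub>3 * min (s/r) (r/s) * norm (Q s (Q s f)))"
  by (intro mult_mono mle off s r) (use r in auto)
  finally show "norm (Q s (Q s (Q s (v r)))) <= (K\<^sub>3 * norm (Q s (Q s f))) * (min (s/r) (r/s) / r)"
  by (simp add: mult_ac)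
  qed
  also have "\<dots> = K\<^sub>3 * I\<^sub>0 * norm (Q s (Q s f))" unfolding integral_mult_right_zero min_kernel(2)[OF s] by (simp add: mult_ac)
  also have "\<dots> <= K\<^sub>3 * I\<^sub>0 * (K * norm (Q s f))"
  by (intro mult_left_mono Q_norm s) (use off(2) I\<^sub>0_nonneg in auto)
  finally show ?thesis by (simp add: L_def mult_ac)
  qed
  have "ennreal (c * (norm w)^2) <= 64 * (HI t. ennreal ((norm (Q t (Q t (Q t w))))^2 / t))"
  using cC(3)[of w] Q_cube_lower[of w] by (rule order_trans)
  also have "\<dots> <= 64 * (HI t. ennreal (L^2) * ennreal ((norm (Q t f))^2 / t))"
  proof (intro mult_left_mono nn_integral_mono)
  fix t assume "t \<in> space halfline"
  then have t: "0 < t" by simp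
  have "(norm (Q t (Q t (Q t w))))^2 <= (L * norm (Q t f))^2" by (intro power_mono cube t) simp
  then have "(norm (Q t (Q t (Q t w))))^2 / t <= L^2 * ((norm (Q t f))^2 / t)"
  using t by (simp add: power_mult_distrib divide_right_mono)
  then show "ennreal ((norm (Q t (Q t (Q t w))))^2 / t) <= ennreal (L^2) * ennreal ((norm (Q t f))^2 / t)"
  using t by (subst ennreal_mult[symmetric]) (auto intro: ennreal_leI)
  qed simp
  also have "\<dots> = 64 * (ennreal (L^2) * (HI t. ennreal ((norm (Q t f))^2 / t)))"
  by (subst nn_integral_cmult) (auto intro!: meas_half_cont Q_sq_cont measurable_compose[OF _ measurable_ennreal])
  also have "\<dots> <= 64 * (ennreal (L^2) * ennreal (C * (norm f)^2))"
  by (intro mult_left_mono cC) auto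
  also have "\<dots> = ennreal (64 * (L^2 * (C * (norm f)^2)))"
  using cC by (simp add: ennreal_mult)
  finally have "c * (norm w)^2 <= 64 * (L^2 * (C * (norm f)^2))"
  using cC by (subst (asm) ennreal_le_iff) auto
  then have "(norm w)^2 <= (64 * L^2 * C / c) * (norm f)^2" using cC(1) by (simp add: field_simps)
  also have "\<dots> = (C' * norm f)^2" using cC by (simp add: C'_def power_mult_distrib)
  finally have "norm w <= C' * norm f" using C'0 by (rule_tac power2_le_imp_le) auto
  then have "norm w * norm g <= C' * norm f * norm g" by (intro mult_right_mono) auto
  then show ?thesis unfolding wg[symmetric] using norm_cauchy_schwarz[of w g] by linarith
 qed
 show ?thesis
 proof (intro exI[of _ C'] conjI allI C'0)
  fix f g
  show "(HI r. ennreal (\<bar>inner (Ps r f) g\<bar> / r)) <= ennreal (C' * norm f * norm g)"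
  proof (rule nn_int_half_le[where e="%_. 0"])
  show "continuous_on {0<..} (%r. \<bar>inner (Ps r f) g\<bar> / r)"
  by (auto intro!: continuous_intros cont)
  show "ennreal (integral {1 / real (Suc n)..real (Suc n)} (%r. \<bar>inner (Ps r f) g\<bar> / r)) <= ennreal (C' * norm f * norm g) + 0" for n
  using main[of "1 / real (Suc n)" "real (Suc n)" f g] by (simp add: ennreal_leI)
  qed auto
 qed
qed

lemma weak_Q_bound:
 "\<exists>C\<ge>0. \<forall>f g. (HI r. ennreal (\<bar>inner (Q r f) g\<bar> / r)) <= ennreal (C * norm f * norm g)"
 by (rule weak_square_bound[where K\<^sub>1=K and K\<^sub>3=K\<^sub>2])
  (assumption | rule Q_bl Q_cont continuous_on_const QQ Q_norm QQ_norm less_imp_le[OF K_pos] less_imp_le[OF K\<^sub>2_pos])+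

lemma weak_QP_bound:
 "\<exists>C\<ge>0. \<forall>f g. (HI r. ennreal (\<bar>inner (Q r (P r f)) g\<bar> / r)) <= ennreal (C * norm f * norm g)"
proof (rule weak_square_bound[where K\<^sub>1="K * K" and K\<^sub>3="K\<^sub>2 * K"])
 show "bounded_linear (%f. Q r (P r f))" if "0 < r" for r
  by (rule bounded_linear_compose[OF Q_bl[OF that] P_bl[OF that]])
 show "continuous_on {0<..} (%r. Q r (P r f))" for f by (intro Q_cont P_cont continuous_on_const)
 show "Q s (Q r (P r f)) = Q r (P r (Q s f))" if "0 < s" "0 < r" for s r f
  by (simp add: QQ[OF that] QP[OF that])
 show "norm (Q r (P r f)) <= K * K * norm f" if "0 < r" for r f
  using order_trans[OF Q_norm[OF that] mult_left_mono[OF P_norm[OF that, of f]]] K_pos by (simp add: mult.assoc)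
 show "norm (Q s (Q r (P r f))) <= K\<^sub>2 * K * min (s/r) (r/s) * norm f" if "0 < s" "0 < r" for s r f
 proof -
  have "norm (Q s (Q r (P r f))) <= K\<^sub>2 * min (s/r) (r/s) * norm (P r f)" by (rule QQ_norm[OF that])
  also have "\<dots> <= K\<^sub>2 * min (s/r) (r/s) * (K * norm f)"
  using that by (intro mult_left_mono P_norm mult_nonneg_nonneg less_imp_le[OF K\<^sub>2_pos]) auto
  finally show ?thesis by (simp add: mult_ac)
 qed
qed (use K_pos K\<^sub>2_pos in simp_all)

lemma weak_QQ_bound:
 "\<exists>C\<ge>0. \<forall>f g. (HI r. ennreal (\<bar>inner (Q r (Q r f)) g\<bar> / r)) <= ennreal (C * norm f * norm g)"
proof (rule weak_square_bound[where K\<^sub>1="K * K" and K\<^sub>3="K\<^sub>2 * K"])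
 show "bounded_linear (%f. Q r (Q r f))" if "0 < r" for r
  by (rule bounded_linear_compose[OF Q_bl[OF that] Q_bl[OF that]])
 show "continuous_on {0<..} (%r. Q r (Q r f))" for f by (intro Q_cont continuous_on_const)
 show "Q s (Q r (Q r f)) = Q r (Q r (Q s f))" if "0 < s" "0 < r" for s r f
  by (simp add: QQ[OF that])
 show "norm (Q r (Q r f)) <= K * K * norm f" if "0 < r" for r f
  using order_trans[OF Q_norm[OF that] mult_left_mono[OF Q_norm[OF that, of f]]] K_pos by (simp add: mult.assoc)
 show "norm (Q s (Q r (Q r f))) <= K\<^sub>2 * K * min (s/r) (r/s) * norm f" if "0 < s" "0 < r" for s r f
 proof -
  have "norm (Q s (Q r (Q r f))) <= K\<^sub>2 * min (s/r) (r/s) * norm (Q r f)" by (rule QQ_norm[OF that])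
  also have "\<dots> <= K\<^sub>2 * min (s/r) (r/s) * (K * norm f)"
  using that by (intro mult_left_mono Q_norm mult_nonneg_nonneg less_imp_le[OF K\<^sub>2_pos]) auto
  finally show ?thesis by (simp add: mult_ac)
 qed
qed (use K_pos K\<^sub>2_pos in simp_all)

end

text \<open>Exactly what the splitting needs. Unlike the square function estimates, these bounds
  treat \<open>f\<close> and \<open>g\<close> alike and hence pass to the adjoint operator.\<close>

locale weak_square_sa = coercive_sa_inj D B ka
 for D :: "('h::{real_inner,banach} \<times> 'h) set" and B ka +
 assumes weak_Q: "\<exists>C\<ge>0. \<forall>f g. (HI r. ennreal (\<bar>inner (Q r f) g\<bar> / r)) <= ennreal (C * norm f * norm g)"
  and weak_QP: "\<exists>C\<ge>0. \<forall>f g. (HI r. ennreal (\<bar>inner (Q r (P r f)) g\<bar> / r)) <= ennreal (C * norm f * norm g)"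
  and weak_QQ: "\<exists>C\<ge>0. \<forall>f g. (HI r. ennreal (\<bar>inner (Q r (Q r f)) g\<bar> / r)) <= ennreal (C * norm f * norm g)"

sublocale quadratic_sa \<subseteq> weak_square_sa
 by unfold_locales (rule weak_Q_bound weak_QP_bound weak_QQ_bound)+

locale dual_pair = one: coercive_sa D B ka + two: coercive_sa D B' ka'
 for D :: "('h::{real_inner,banach} \<times> 'h) set" and B ka B' ka' +
 assumes adj: "!!x y. inner (B x) y = inner x (B' y)"
begin

text \<open>For the bilinear form <B f, g> the operators \<open>D B\<close> and \<open>D B'\<close>
  are adjoint to each other, and so are their resolvents.\<close>

lemma Q_dual:
 assumes t: "0 < t"
 shows "inner (B (one.Q t f)) g = inner (B f) (two.Q t g)"
proof -
 let ?u = "one.P t f" and ?w = "one.Q t f" and ?u' = "two.P t g" and ?w' = "two.Q t g"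
 have 1: "inner ?w (t *: B' ?u') = inner (t *: B ?u) ?w'"
  by (rule one.D_sym[OF one.PQ_D(1)[OF t] two.PQ_D(1)[OF t]])
 have 2: "inner (f - ?u) (t *: B' ?w') = inner (t *: B ?w) (g - ?u')"
  by (rule one.D_sym[OF one.PQ_D(2)[OF t] two.PQ_D(2)[OF t]])
 from 1 have 1: "inner (B ?w) ?u' = inner (B ?u) ?w'" using t by (simp add: adj)
 from 2 have 2: "inner (B (f - ?u)) ?w' = inner (B ?w) (g - ?u')" using t by (simp add: adj)
 have "inner (B ?w) g = inner (B ?w) (g - ?u') + inner (B ?w) ?u'" by (simp add: inner_diff_right)
 also have "\<dots> = inner (B f) ?w'" unfolding 1 2[symmetric]
  by (simp add: bounded_linear.linear[OF one.B_bl, THEN linear_diff] inner_diff_left)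
 finally show ?thesis .
qed

lemma P_dual:
 assumes t: "0 < t"
 shows "inner (B (one.P t f)) g = inner (B f) (two.P t g)"
proof -
 let ?u = "one.P t f" and ?w = "one.Q t f" and ?u' = "two.P t g" and ?w' = "two.Q t g"
 have "inner ?w (t *: B' ?w') = inner (t *: B ?u) (g - ?u')"
  by (rule one.D_sym[OF one.PQ_D(1)[OF t] two.PQ_D(2)[OF t]])
 then have 1: "inner (B ?w) ?w' = inner (B ?u) (g - ?u')" using t by (simp add: adj)
 have "inner (f - ?u) (t *: B' ?u') = inner (t *: B ?w) ?w'"
  by (rule one.D_sym[OF one.PQ_D(2)[OF t] two.PQ_D(1)[OF t]])
 then have 2: "inner (B (f - ?u)) ?u' = inner (B ?w) ?w'" using t by (simp add: adj)
 show ?thesis using 1 2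
  by (simp add: bounded_linear.linear[OF one.B_bl, THEN linear_diff] inner_diff_left inner_diff_right)
qed

text \<open>Apply the bound to \<open>inv B g\<close> and \<open>B' f\<close>: the form <B f, g>
  turns into the inner product at the cost of the norms of \<open>inv B\<close> and
  \<open>B'\<close>.\<close>

lemma weak_bound_dual:
 assumes M: "\<exists>C\<ge>0. \<forall>f g. (HI r. ennreal (\<bar>inner (Ps r f) g\<bar> / r)) <= ennreal (C * norm f * norm g)"
  and dual: "!!r f g. 0 < r ==> inner (B (Ps r f)) g = inner (B f) (Ps' r g)"
 shows "\<exists>C\<ge>0. \<forall>f g. (HI r. ennreal (\<bar>inner (Ps' r f) g\<bar> / r)) <= ennreal (C * norm f * norm g)"
proof -
 obtain C where C: "0 <= C" "!!f g. (HI r. ennreal (\<bar>inner (Ps r f) g\<bar> / r)) <= ennreal (C * norm f * norm g)"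
  using M by blast
 have kap: "norm (inv B g) <= norm g / ka" for g
  using coercive_bij(2)[OF one.B_bl one.ka, of "inv B g"] one.ka(1) by (simp add: one.B_inv field_simps)
 have nn: "0 <= C * two.K\<^sub>B / ka" using C(1) two.K\<^sub>B(1) one.ka(1) by simp
 show ?thesis
 proof (intro exI[of _ "C * two.K\<^sub>B / ka"] conjI allI nn)
  fix f g
  have "(HI r. ennreal (\<bar>inner (Ps' r f) g\<bar> / r))
  = (HI r. ennreal (\<bar>inner (Ps r (inv B g)) (B' f)\<bar> / r))"
  proof (rule nn_integral_cong)
  fix r assume "r \<in> space halfline"
  then have "inner (Ps' r f) g = inner (Ps r (inv B g)) (B' f)"
  using dual[of r "inv B g" f] by (simp add: one.B_inv adj inner_commute[of _ g])
  then show "ennreal (\<bar>inner (Ps' r f) g\<bar> / r) = ennreal (\<bar>inner (Ps r (inv B g)) (B' f)\<bar> / r)" by simp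
  qed
  also have "\<dots> <= ennreal (C * norm (inv B g) * norm (B' f))" by (rule C(2))
  also have "\<dots> <= ennreal (C * (norm g / ka) * (two.K\<^sub>B * norm f))"
  by (intro ennreal_leI mult_mono kap two.K\<^sub>B mult_nonneg_nonneg) (use C(1) one.ka(1) in auto)
  finally show "(HI r. ennreal (\<bar>inner (Ps' r f) g\<bar> / r)) <= ennreal (C * two.K\<^sub>B / ka * norm f * norm g)"
  by (simp add: mult_ac)
 qed
qed

lemma weak_square_dual:
 assumes "weak_square_sa D B ka"
 shows "weak_square_sa D B' ka'"
proof -
 interpret w: weak_square_sa D B ka by fact
 show ?thesis
 proof
  show "a = 0" if "(a, 0) \<in> D" for a using w.D_inj that .
  show "\<exists>C\<ge>0. \<forall>f g. (HI r. ennreal (\<bar>inner (two.Q r f) g\<bar> / r)) <= ennreal (C * norm f * norm g)"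
  by (rule weak_bound_dual[OF w.weak_Q Q_dual])
  show "\<exists>C\<ge>0. \<forall>f g. (HI r. ennreal (\<bar>inner (two.Q r (two.P r f)) g\<bar> / r)) <= ennreal (C * norm f * norm g)"
  by (rule weak_bound_dual[OF w.weak_QP]) (simp add: Q_dual P_dual two.QP)
  show "\<exists>C\<ge>0. \<forall>f g. (HI r. ennreal (\<bar>inner (two.Q r (two.Q r f)) g\<bar> / r)) <= ennreal (C * norm f * norm g)"
  by (rule weak_bound_dual[OF w.weak_QQ]) (simp add: Q_dual)
 qed
qed

end

section \<open>Splitting into traces of solutions\<close>

text \<open>The graph form of F' = - D B F; it includes the requirement that \<open>B (F t)\<close>
  lies in the domain of \<open>D\<close>.\<close>

definition trsol ::
  "('h::{real_inner,banach} \<times> 'h) set => ('h => 'h) => (real => 'h) => 'h => bool" where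
 "trsol D B F f \<longleftrightarrow> F C1_differentiable_on {0<..} \<and>
  (\<forall>t>0. (B (F t), - vector_derivative F (at t)) \<in> D) \<and>
  (F ---> 0) at_top \<and> (F ---> f) (at_right 0)"

definition neg_graph :: "('a::ab_group_add \<times> 'a) set => ('a \<times> 'a) set" where
 "neg_graph D = {(x, y). (x, - y) \<in> D}"

lemma inv_square_bound_cos: "\<bar>1 - cos x\<bar> <= x^2 / 2" for x :: real
proof -
 have "1 - cos x = 2 * (sin (x/2))^2" using cos_double_sin[of "x/2"] by simp
 also have "\<dots> <= 2 * (x/2)^2"
  using abs_sin_x_le_abs_x[of "x/2"] unfolding abs_le_square_iff by (rule mult_left_mono) simp
 finally show ?thesis by (simp add: power2_eq_square)
qed

text \<open>With s = 1/r this is the integral of (1 - cos s)/s^2 over s > 0. The normalisation uses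
  its positivity and its scaling behaviour \<open>int_cos\<close> rather than its numerical
  value.\<close>

definition c\<^sub>0 :: real where "c\<^sub>0 = integral\<^sup>L halfline (%r. 1 - cos (1/r))"

lemma intble_cos: "integrable halfline (%r. 1 - cos (t/r))"
proof (rule intble_half_bound)
 show "continuous_on {0<..} (%r. 1 - cos (t/r))" by (intro continuous_intros) auto
 show "integrable halfline (%r. (2 + t^2/2) * min 1 (1 / r^2))"
  by (intro integrable_mult_right intble_half_min_inv_square)
 show "\<bar>1 - cos (t/r)\<bar> <= (2 + t^2/2) * min 1 (1 / r^2)" if "0 < r" for r
 proof (rule le_min_inv_square)
  show "\<bar>1 - cos (t/r)\<bar> <= 2" using cos_ge_minus_one[of "t/r"] cos_le_one[of "t/r"] by linarith
  show "\<bar>1 - cos (t/r)\<bar> <= t^2 / 2 / r^2"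
  using inv_square_bound_cos[of "t/r"] by (simp add: power_divide mult.commute)
 qed (use that in auto)
qed

lemma int_cos: "0 < t ==> integral\<^sup>L halfline (%r. 1 - cos (t/r)) = c\<^sub>0 * t"
 using half_scale(1)[of t "%r. 1 - cos (1/r)"] by (simp add: c\<^sub>0_def)

lemma int_cos': "integral\<^sup>L halfline (%r. 1 - cos (t/r)) = c\<^sub>0 * \<bar>t\<bar>"
proof (cases "t = 0")
 case False
 have "(%r. 1 - cos (t/r)) = (%r. 1 - cos (\<bar>t\<bar>/r))"
  by (auto simp: fun_eq_iff abs_if)
 then show ?thesis using int_cos[of "\<bar>t\<bar>"] False by simp
qed simp

lemma c\<^sub>0_pos: "0 < c\<^sub>0"
proof -
 have ind: "integrable halfline (%r. indicator {1/3..1/2} r :: real)"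
 proof -
  have "{0<..} \<inter> {1/3..1/2} = {1/3..1/2::real}" by auto
  then have "integrable lborel (indicator ({0<..} \<inter> {1/3..1/2}) :: real => real)"
  by (simp add: integrable_indicator_iff emeasure_lborel_Icc_eq)
  then show ?thesis
  by (simp add: intble_half_iff set_integrable_def flip: indicator_inter_arith)
 qed
 have "(\<integral>r. indicator {1/3..1/2} r \<partial>halfline) <= c\<^sub>0" unfolding c\<^sub>0_def
 proof (rule integral_mono[OF ind intble_cos])
  fix r :: real assume "r \<in> space halfline"
  show "indicator {1/3..1/2} r <= 1 - cos (1/r)"
  proof (cases "r \<in> {1/3..1/2}")
  case True
  \<comment> \<open>Between 2 and 3 the argument lies in [pi/2, pi], where the cosine is at most
    0.\<close>
  then have "2 <= 1/r" "1/r <= 3" by (auto simp: field_simps)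
  then have "cos (1/r) <= cos (pi/2)"
  using pi_gt3 pi_half_less_two by (intro cos_monotone_0_pi_le) auto
  then show ?thesis using True by simp
  qed simp
 qed
 moreover have "(\<integral>r. indicator {1/3..1/2} r \<partial>halfline) = (1/6 :: real)"
 proof -
  have "(%r. indicator {0<..} r *: indicator {1/3..1/2} r) = (indicator {1/3..1/2} :: real => real)"
  by (auto simp: fun_eq_iff indicator_def)
  then show ?thesis
  by (simp only: int_half_eq set_lebesgue_integral_def) simp
 qed
 ultimately show ?thesis by simp
qed

context weak_square_sa begin

text \<open>
 \<open>U t\<close> and \<open>V t\<close> represent \<open>exp (-t|T|)\<close> and \<open>sgn(T) exp (-t|T|)\<close>; the Dirichlet type integral \<open>c\<^sub>0\<close>
 equals \<open>\<pi>/2\<close>.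
\<close>

definition U\<^sub>1 :: "'h => real => 'h" where
 "U\<^sub>1 f t = wint halfline (%r. (sin (t/r) / r) *: (f - P r f))"

definition U :: "'h => real => 'h" where "U f t = f - (1/c\<^sub>0) *: U\<^sub>1 f t"

definition V\<^sub>1 :: "'h => real => 'h" where
 "V\<^sub>1 f t = wint halfline (%r. (cos (t/r) / r) *: Q r f)"

definition V :: "'h => real => 'h" where "V f t = (1/c\<^sub>0) *: V\<^sub>1 f t"

definition tame :: "'h => bool" where
 "tame f \<longleftrightarrow> (\<exists>h f1 f2. (h, f) \<in> T \<and> (f, f1) \<in> T \<and> (f1, f2) \<in> T)"

lemma cont_trig:
 "continuous_on {0<..} (%r::real. sin (t/r) / r)" "continuous_on {0<..} (%r::real. cos (t/r) / r)"
 "continuous_on {0<..} (%r::real. cos (t/r) / r^2)" "continuous_on {0<..} (%r::real. 1 - cos (t/r))"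
 by (intro continuous_intros; auto)+

lemma sin_le: "0 < r ==> \<bar>sin (t/r)\<bar> <= \<bar>t\<bar> / r" for r t :: real
 using abs_sin_x_le_abs_x[of "t/r"] by simp

lemma norm_scaled: "norm (a *: x) <= b * c" if "\<bar>a\<bar> <= b" "norm x <= c" for x :: 'h
 using mult_mono[OF that(1,2)] that(1) by (simp add: order_trans[OF abs_ge_zero])

text \<open>Near zero \<open>f - P r f\<close> is \<open>r\<close> times a bounded vector because
  \<open>f\<close> is in the domain; at infinity sin(t/r) contributes another factor 1/r.\<close>

lemma U\<^sub>1_integrable:
 assumes "(f, f1) \<in> T"
 shows "wintble halfline (%r. (sin (t/r) / r) *: (f - P r f))"
proof (rule wintble_half)
 show "continuous_on {0<..} (%r. (sin (t/r) / r) *: (f - P r f))"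
  by (intro continuous_intros cont_trig P_cont)
 show "integrable halfline (%r. (K * norm f1 + \<bar>t\<bar> * ((1 + K) * norm f)) * min 1 (1 / r^2))"
  by (intro integrable_mult_right intble_half_min_inv_square)
 fix r :: real assume r: "0 < r"
 show "norm ((sin (t/r) / r) *: (f - P r f)) <= (K * norm f1 + \<bar>t\<bar> * ((1 + K) * norm f)) * min 1 (1 / r^2)"
 proof (rule le_min_inv_square[OF _ _ _ _ r])
  have "norm ((sin (t/r) / r) *: (f - P r f)) = \<bar>sin (t/r)\<bar> * norm (Q r f1)"
  using r by (simp add: PQ_T(2)[OF r assms] abs_mult)
  also have "\<dots> <= 1 * (K * norm f1)" by (intro mult_mono Q_norm r) auto
  finally show "norm ((sin (t/r) / r) *: (f - P r f)) <= K * norm f1" by simp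
  have "norm ((sin (t/r) / r) *: (f - P r f)) <= (\<bar>t\<bar> / r / r) * ((1 + K) * norm f)"
  by (rule norm_scaled) (use divide_right_mono[OF sin_le[OF r, of t], of r] r in \<open>simp_all add: PQ_bound1\<close>)
  then show "norm ((sin (t/r) / r) *: (f - P r f)) <= \<bar>t\<bar> * ((1 + K) * norm f) / r^2"
  by (simp add: power2_eq_square)
 qed (use K_pos in auto)
qed

text \<open>The cosine does not decay at infinity, so the missing factor 1/r comes from
  \<open>f\<close> being in the range of \<open>T\<close>; near zero the domain is used.\<close>

lemma V\<^sub>1_integrable:
 assumes "(h, f) \<in> T" "(f, f1) \<in> T"
 shows "wintble halfline (%r. (cos (t/r) / r) *: Q r f)"
proof (rule wintble_half)
 show "continuous_on {0<..} (%r. (cos (t/r) / r) *: Q r f)"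
  by (intro continuous_intros cont_trig Q_cont)
 show "integrable halfline (%r. (K * norm f1 + (1 + K) * norm h) * min 1 (1 / r^2))"
  by (intro integrable_mult_right intble_half_min_inv_square)
 fix r :: real assume r: "0 < r"
 show "norm ((cos (t/r) / r) *: Q r f) <= (K * norm f1 + (1 + K) * norm h) * min 1 (1 / r^2)"
 proof (rule le_min_inv_square[OF _ _ _ _ r])
  have "norm ((cos (t/r) / r) *: Q r f) = \<bar>cos (t/r)\<bar> * norm (P r f1)"
  using r by (simp add: PQ_T(1)[OF r assms(2)] abs_mult)
  also have "\<dots> <= 1 * (K * norm f1)" by (intro mult_mono P_norm r) auto
  finally show "norm ((cos (t/r) / r) *: Q r f) <= K * norm f1" by simp
  have "Q r f = (1/r) *: (h - P r h)" using r by (simp add: PQ_T(2)[OF r assms(1)])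
  then have "norm ((cos (t/r) / r) *: Q r f) = \<bar>cos (t/r)\<bar> * norm (h - P r h) / r^2"
  using r by (simp add: abs_mult power2_eq_square)
  also have "\<dots> <= (1 * ((1 + K) * norm h)) / r^2"
  by (intro divide_right_mono mult_mono PQ_bound1 r) (use r in auto)
  finally show "norm ((cos (t/r) / r) *: Q r f) <= (1 + K) * norm h / r^2" by simp
 qed (use K_pos in auto)
qed

lemma U_diff:
 assumes "(f, f1) \<in> T" "(g, g1) \<in> T"
 shows "U (f - g) t = U f t - U g t"
proof -
 have "U\<^sub>1 (f - g) t = U\<^sub>1 f t - U\<^sub>1 g t"
  unfolding U\<^sub>1_def wintble_diff(2)[OF U\<^sub>1_integrable[OF assms(1)] U\<^sub>1_integrable[OF assms(2)], symmetric]
  by (rule wint_eqI[OF U\<^sub>1_integrable[OF T_diff[OF assms]]])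
  (subst wint_inner[OF wintble_diff(1)[OF U\<^sub>1_integrable[OF assms(1)] U\<^sub>1_integrable[OF assms(2)]]],
  rule Bochner_Integration.integral_cong, auto simp: PQ_diff algebra_simps)
 then show ?thesis by (simp add: U_def scaleR_diff_right)
qed

lemma V_diff:
 assumes "(h, f) \<in> T" "(f, f1) \<in> T" "(k, g) \<in> T" "(g, g1) \<in> T"
 shows "V (f - g) t = V f t - V g t"
proof -
 have "V\<^sub>1 (f - g) t = V\<^sub>1 f t - V\<^sub>1 g t"
  unfolding V\<^sub>1_def wintble_diff(2)[OF V\<^sub>1_integrable[OF assms(1,2)] V\<^sub>1_integrable[OF assms(3,4)], symmetric]
  by (rule wint_eqI[OF V\<^sub>1_integrable[OF T_diff[OF assms(1,3)] T_diff[OF assms(2,4)]]])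
  (subst wint_inner[OF wintble_diff(1)[OF V\<^sub>1_integrable[OF assms(1,2)] V\<^sub>1_integrable[OF assms(3,4)]]],
  rule Bochner_Integration.integral_cong, auto simp: PQ_diff algebra_simps)
 then show ?thesis by (simp add: V_def scaleR_diff_right)
qed

lemma cos_deriv_bound:
 assumes r: "0 < r" and f: "(f, f1) \<in> T" "(f1, f2) \<in> T"
 shows "norm ((cos (t/r) / r^2) *: (f - P r f)) <= (K * norm f2 + (1 + K) * norm f) * min 1 (1 / r^2)"
proof (rule le_min_inv_square[OF _ _ _ _ r])
 have "f - P r f = r^2 *: P r f2"
  using r by (simp add: PQ_T(2)[OF r f(1)] PQ_T(1)[OF r f(2)] power2_eq_square)
 then have "norm ((cos (t/r) / r^2) *: (f - P r f)) = \<bar>cos (t/r)\<bar> * norm (P r f2)"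
  using r by (simp add: abs_mult)
 also have "\<dots> <= 1 * (K * norm f2)" by (intro mult_mono P_norm r) auto
 finally show "norm ((cos (t/r) / r^2) *: (f - P r f)) <= K * norm f2" by simp
 have "norm ((cos (t/r) / r^2) *: (f - P r f)) <= (1 / r^2) * ((1 + K) * norm f)"
  by (rule norm_scaled) (use r in \<open>auto simp: divide_right_mono PQ_bound1\<close>)
 then show "norm ((cos (t/r) / r^2) *: (f - P r f)) <= (1 + K) * norm f / r^2" by simp
qed (use K_pos in auto)

lemma V\<^sub>1_T:
 assumes "(f, f1) \<in> T" "0 < r"
 shows "(cos (t/r) / r) *: Q r f1 = (cos (t/r) / r^2) *: (f - P r f)"
 using assms by (simp add: PQ_T(2)[OF assms(2,1)] power2_eq_square)

lemma V\<^sub>1_f1: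
 assumes "(f, f1) \<in> T"
 shows "V\<^sub>1 f1 t = wint halfline (%r. (cos (t/r) / r^2) *: (f - P r f))"
 unfolding V\<^sub>1_def wint_def
 by (rule arg_cong[where f=Eps], rule ext, rule iff_allI,
  rule arg_cong2[where f="(=)", OF refl], rule Bochner_Integration.integral_cong)
  (auto simp: V\<^sub>1_T[OF assms])

lemma V_T: "(h, f) \<in> T ==> (f, f1) \<in> T ==> (f1, f2) \<in> T ==> (V f t, V f1 t) \<in> T"
 unfolding V_def V\<^sub>1_def
 by (intro T_scale T_wint V\<^sub>1_integrable) (auto intro: T_scale PQ_T(4))

lemma U_T: "(f, f1) \<in> T ==> (f1, f2) \<in> T ==> (U f t, U f1 t) \<in> T"
 unfolding U_def U\<^sub>1_def
 by (intro T_diff T_scale T_wint U\<^sub>1_integrable) (auto intro!: T_scale T_diff PQ_T(3))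

text \<open>Formally, d/dt exp(-t|T|) = - sgn(T) exp(-t|T|) T.\<close>

lemma U_deriv:
 assumes f: "(h, f) \<in> T" "(f, f1) \<in> T" "(f1, f2) \<in> T"
 shows "(U f has_vector_derivative - V f1 t) (at t)"
proof -
 have "((%t. U\<^sub>1 f t) has_vector_derivative V\<^sub>1 f1 t) (at t)"
  unfolding U\<^sub>1_def V\<^sub>1_f1[OF f(2)]
 proof (rule hvd_wint[where e=1 and k="%r. (K * norm f2 + (1 + K) * norm f) * min 1 (1 / r^2)"])
  show "((%t. (sin (t/r) / r) *: (f - P r f)) has_vector_derivative (cos (s/r) / r^2) *: (f - P r f)) (at s)" if "0 < r" for r s
  proof (rule has_vector_derivative_scaleR[THEN has_vector_derivative_eq_rhs])
  show "((%t. sin (t/r) / r) has_field_derivative cos (s/r) / r^2) (at s)"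
  using that by (auto intro!: derivative_eq_intros simp: power2_eq_square)
  qed (auto intro!: has_vector_derivative_const)
  show "norm ((cos (s/r) / r^2) *: (f - P r f)) <= (K * norm f2 + (1 + K) * norm f) * min 1 (1 / r^2)" if "0 < r" for s r
  by (rule cos_deriv_bound[OF that f(2,3)])
 qed (auto intro!: U\<^sub>1_integrable[OF f(2)] continuous_intros cont_trig P_cont intble_half_min_inv_square)
 from bounded_linear.has_vector_derivative[OF bounded_linear_scaleR_right this, of "1/c\<^sub>0"]
 have "((%t. (1/c\<^sub>0) *: U\<^sub>1 f t) has_vector_derivative V f1 t) (at t)" by (simp add: V_def)
 from has_vector_derivative_diff[OF has_vector_derivative_const this]
 show ?thesis by (simp add: U_def[abs_def])
qed

definition V\<^sub>2 :: "'h => real => 'h" where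
 "V\<^sub>2 f1 t = wint halfline (%r. (1 - cos (t/r)) *: (f1 - P r f1))"

lemma V\<^sub>2_integrable: "wintble halfline (%r. (1 - cos (t/r)) *: (f - P r f))"
proof (rule wintble_half)
 show "continuous_on {0<..} (%r. (1 - cos (t/r)) *: (f - P r f))"
  by (intro continuous_intros cont_trig P_cont)
 show "integrable halfline (%r. (1 - cos (t/r)) * ((1 + K) * norm f))"
  by (intro integrable_mult_left intble_cos)
 fix r :: real assume r: "0 < r"
 show "norm ((1 - cos (t/r)) *: (f - P r f)) <= (1 - cos (t/r)) * ((1 + K) * norm f)"
  by (rule norm_scaled) (use PQ_bound1[OF r] in auto)
qed

text \<open>Formal differentiation of \<open>V\<^sub>1\<close> produces sin(t/r)/r times
  \<open>P r f1\<close>, which is not absolutely integrable near zero, since \<open>P r f1\<close>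
  tends to \<open>f1\<close> there. Splitting \<open>P r\<close> as 1 - (1 - P r) isolates this
  part; it integrates explicitly to \<open>c\<^sub>0 * \<bar>t\<bar>\<close> times
  \<open>f1\<close>, and the remainder \<open>V\<^sub>2\<close> can be differentiated under the
  integral.\<close>

lemma V_eq:
 assumes f: "(h, f) \<in> T" "(f, f1) \<in> T"
 shows "V f t = V f 0 - \<bar>t\<bar> *: f1 + (1/c\<^sub>0) *: V\<^sub>2 f1 t"
proof (rule inner_ext)
 fix g
 note i1 = V\<^sub>1_integrable[OF f, of t] and i0 = V\<^sub>1_integrable[OF f, of 0]
 have "inner (V\<^sub>1 f t) g - inner (V\<^sub>1 f 0) g = (\<integral>r. inner ((cos (t/r) / r) *: Q r f) g - inner ((cos (0/r) / r) *: Q r f) g \<partial>halfline)"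
  unfolding V\<^sub>1_def wint_inner[OF i1] wint_inner[OF i0]
  by (rule Bochner_Integration.integral_diff[symmetric]) (rule wintble_inner[OF i1] wintble_inner[OF i0])+
 also have "\<dots> = (\<integral>r. inner ((1 - cos (t/r)) *: (f1 - P r f1)) g - (1 - cos (t/r)) * inner f1 g \<partial>halfline)"
 proof (rule Bochner_Integration.integral_cong[OF refl])
  fix r assume "r \<in> space halfline"
  then have r: "0 < r" by simp
  show "inner ((cos (t/r) / r) *: Q r f) g - inner ((cos (0/r) / r) *: Q r f) g
  = inner ((1 - cos (t/r)) *: (f1 - P r f1)) g - (1 - cos (t/r)) * inner f1 g"
  using r by (simp add: PQ_T(1)[OF r f(2)] inner_diff_left algebra_simps)
 qed
 also have "\<dots> = inner (V\<^sub>2 f1 t) g - c\<^sub>0 * \<bar>t\<bar> * inner f1 g"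
  unfolding V\<^sub>2_def wint_inner[OF V\<^sub>2_integrable]
  using wintble_inner[OF V\<^sub>2_integrable, of t f1 g] intble_cos[of t]
  by (subst Bochner_Integration.integral_diff) (auto simp: int_cos')
 finally have "inner (V\<^sub>1 f t) g = inner (V\<^sub>1 f 0) g + (inner (V\<^sub>2 f1 t) g - c\<^sub>0 * \<bar>t\<bar> * inner f1 g)" by simp
 then show "inner (V f t) g = inner (V f 0 - \<bar>t\<bar> *: f1 + (1/c\<^sub>0) *: V\<^sub>2 f1 t) g"
  using c\<^sub>0_pos by (simp add: V_def inner_add_left inner_diff_left field_simps)
qed

lemma V\<^sub>2_deriv:
 assumes f: "(f1, f2) \<in> T"
 shows "((%t. V\<^sub>2 f1 t) has_vector_derivative U\<^sub>1 f1 t) (at t)"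
 unfolding U\<^sub>1_def V\<^sub>2_def
proof (rule hvd_wint[where e=1 and k="%r. (K * norm f2 + (\<bar>t\<bar> + 1) * ((1 + K) * norm f1)) * min 1 (1 / r^2)"])
 show "((%t. (1 - cos (t/r)) *: (f1 - P r f1)) has_vector_derivative (sin (s/r) / r) *: (f1 - P r f1)) (at s)" if "0 < r" for r s
 proof (rule has_vector_derivative_scaleR[THEN has_vector_derivative_eq_rhs])
  show "((%t. 1 - cos (t/r)) has_field_derivative sin (s/r) / r) (at s)"
  using that by (auto intro!: derivative_eq_intros simp: power2_eq_square)
 qed (auto intro!: has_vector_derivative_const)
 fix s r :: real assume s: "\<bar>s - t\<bar> < 1" and r: "0 < r"
 show "norm ((sin (s/r) / r) *: (f1 - P r f1)) <= (K * norm f2 + (\<bar>t\<bar> + 1) * ((1 + K) * norm f1)) * min 1 (1 / r^2)"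
 proof (rule le_min_inv_square[OF _ _ _ _ r])
  have "norm ((sin (s/r) / r) *: (f1 - P r f1)) = \<bar>sin (s/r)\<bar> * norm (Q r f2)"
  using r by (simp add: PQ_T(2)[OF r f] abs_mult)
  also have "\<dots> <= 1 * (K * norm f2)" by (intro mult_mono Q_norm r) auto
  finally show "norm ((sin (s/r) / r) *: (f1 - P r f1)) <= K * norm f2" by simp
  have "\<bar>sin (s/r)\<bar> <= (\<bar>t\<bar> + 1) / r"
  using sin_le[OF r, of s] divide_right_mono[of "\<bar>s\<bar>" "\<bar>t\<bar> + 1" r] s r by linarith
  from divide_right_mono[OF this, of r] have "\<bar>sin (s/r) / r\<bar> <= (\<bar>t\<bar> + 1) / r / r" using r by simp
  then have "norm ((sin (s/r) / r) *: (f1 - P r f1)) <= ((\<bar>t\<bar> + 1) / r / r) * ((1 + K) * norm f1)"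
  by (rule norm_scaled) (rule PQ_bound1[OF r])
  then show "norm ((sin (s/r) / r) *: (f1 - P r f1)) <= (\<bar>t\<bar> + 1) * ((1 + K) * norm f1) / r^2"
  by (simp add: power2_eq_square)
 qed (use K_pos in auto)
qed (auto intro!: V\<^sub>2_integrable continuous_intros cont_trig P_cont intble_half_min_inv_square)

lemma V_deriv:
 assumes f: "(h, f) \<in> T" "(f, f1) \<in> T" "(f1, f2) \<in> T" and t: "0 < t"
 shows "(V f has_vector_derivative - U f1 t) (at t)"
proof -
 have "((%t. V f 0 - t *: f1 + (1/c\<^sub>0) *: V\<^sub>2 f1 t) has_vector_derivative 0 - 1 *: f1 + (1/c\<^sub>0) *: U\<^sub>1 f1 t) (at t)"
  by (intro has_vector_derivative_add has_vector_derivative_diff has_vector_derivative_const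
  bounded_linear.has_vector_derivative[OF bounded_linear_scaleR_left has_vector_derivative_id]
  bounded_linear.has_vector_derivative[OF bounded_linear_scaleR_right V\<^sub>2_deriv[OF f(3)]])
 then have "(V f has_vector_derivative 0 - 1 *: f1 + (1/c\<^sub>0) *: U\<^sub>1 f1 t) (at t)"
 proof (rule vector_der_transform_pos[OF t])
  show "V f 0 - s *: f1 + (1/c\<^sub>0) *: V\<^sub>2 f1 s = V f s" if "0 < s" for s
  unfolding V_eq[OF f(1,2), of s] using that by simp
 qed
 then show ?thesis by (simp add: U_def)
qed

lemma V_at_0:
 assumes f: "(h, f) \<in> T" "(f, f1) \<in> T" "(f1, f2) \<in> T"
 shows "(V f ---> V f 0) (at_right 0)"
proof -
 have "isCont (%t. V\<^sub>2 f1 t) 0" by (rule has_vector_derivative_continuous[OF V\<^sub>2_deriv[OF f(3)]])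
 then have "isCont (%t. V f 0 - \<bar>t\<bar> *: f1 + (1/c\<^sub>0) *: V\<^sub>2 f1 t) 0" by (intro continuous_intros)
 moreover have "(%t. V f 0 - \<bar>t\<bar> *: f1 + (1/c\<^sub>0) *: V\<^sub>2 f1 t) = V f"
  by (rule ext) (rule V_eq[OF f(1,2), symmetric])
 ultimately have "isCont (V f) 0" by simp
 then show ?thesis by (auto simp: isCont_def intro: tendsto_within_subset)
qed

lemma U_at_0:
 assumes f: "(h, f) \<in> T" "(f, f1) \<in> T" "(f1, f2) \<in> T"
 shows "(U f ---> f) (at_right 0)"
proof -
 have "U\<^sub>1 f 0 = 0" unfolding U\<^sub>1_def
  by (rule wint_eqI) (use U\<^sub>1_integrable[OF f(2), of 0] in auto)
 then have "U f 0 = f" by (simp add: U_def)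
 moreover have "isCont (U f) 0" by (rule has_vector_derivative_continuous[OF U_deriv[OF f]])
 ultimately show ?thesis by (auto simp: isCont_def intro: tendsto_within_subset)
qed

subsection \<open>Uniform bounds\<close>

text \<open>A weak bound is absolute integrability with respect to dr/r, so it tolerates any bounded
  continuous multiplier. This is how oscillating kernels are estimated uniformly in
  \<open>t\<close>.\<close>

lemma weighted_bound:
 assumes C: "(HI r. ennreal (\<bar>b r\<bar> / r)) <= ennreal C" "0 <= C"
  and b: "continuous_on {0<..} b" and m: "continuous_on {0<..} m" "!!r. 0 < r ==> \<bar>m r\<bar> <= M"
 shows "integrable halfline (%r. m r * (b r / r))" "\<bar>\<integral>r. m r * (b r / r) \<partial>halfline\<bar> <= M * C"
proof -
 have M0: "0 <= M" using m(2)[of 1] by simp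
 have mb: "(%r. b r / r) \<in> borel_measurable halfline" "(%r. m r * (b r / r)) \<in> borel_measurable halfline"
  by (intro meas_half_cont continuous_intros b m; auto)+
 have ib: "integrable halfline (%r. b r / r)"
 proof (rule integrableI_bounded[OF mb(1)])
  have "(HI r. ennreal (norm (b r / r))) = (HI r. ennreal (\<bar>b r\<bar> / r))"
  by (rule nn_integral_cong) (simp add: abs_div)
  also have "\<dots> <= ennreal C" by (rule C)
  finally show "(HI r. ennreal (norm (b r / r))) < \<infinity>" by (simp add: le_less_trans)
 qed
 have le: "\<bar>m r * (b r / r)\<bar> <= M * \<bar>b r / r\<bar>" if "0 < r" for r
  unfolding abs_mult using m(2)[OF that] by (intro mult_right_mono) auto
 show i: "integrable halfline (%r. m r * (b r / r))"
  by (rule Bochner_Integration.integrable_bound[OF integrable_mult_right[OF integrable_abs[OF ib], of M] mb(2)], rule AE_I2)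
  (simp only: real_norm_def space_half greaterThan_iff, meson le order_trans abs_ge_self)
 have "\<bar>\<integral>r. m r * (b r / r) \<partial>halfline\<bar> <= (\<integral>r. M * \<bar>b r / r\<bar> \<partial>halfline)"
  by (rule order_trans[OF integral_abs_bound integral_mono[OF integrable_abs[OF i] integrable_mult_right[OF integrable_abs[OF ib]]]])
  (simp only: space_half greaterThan_iff le)
 also have "\<dots> = M * (\<integral>r. \<bar>b r / r\<bar> \<partial>halfline)" by (rule integral_mult_right_zero)
 also have "\<dots> <= M * C"
 proof (rule mult_left_mono[OF _ M0])
  have "ennreal (\<integral>r. \<bar>b r / r\<bar> \<partial>halfline) = (HI r. ennreal (\<bar>b r / r\<bar>))"
  by (rule nn_integral_eq_integral[OF integrable_abs[OF ib], symmetric]) simp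
  also have "\<dots> = (HI r. ennreal (\<bar>b r\<bar> / r))"
  by (rule nn_integral_cong) (simp add: abs_div)
  also have "\<dots> <= ennreal C" by (rule C)
  finally show "(\<integral>r. \<bar>b r / r\<bar> \<partial>halfline) <= C" using C(2) by (simp add: ennreal_le_iff)
 qed
 finally show "\<bar>\<integral>r. m r * (b r / r) \<partial>halfline\<bar> <= M * C" .
qed

definition K\<^sub>M :: real where
 "K\<^sub>M = (SOME C. 0 <= C \<and> (\<forall>f g.
  (HI r. ennreal (\<bar>inner (Q r f) g\<bar> / r)) <= ennreal (C * norm f * norm g) \<and>
  (HI r. ennreal (\<bar>inner (Q r (P r f)) g\<bar> / r)) <= ennreal (C * norm f * norm g) \<and>
  (HI r. ennreal (\<bar>inner (Q r (Q r f)) g\<bar> / r)) <= ennreal (C * norm f * norm g)))"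

lemma K\<^sub>M:
 "0 <= K\<^sub>M"
 "(HI r. ennreal (\<bar>inner (Q r f) g\<bar> / r)) <= ennreal (K\<^sub>M * norm f * norm g)"
 "(HI r. ennreal (\<bar>inner (Q r (P r f)) g\<bar> / r)) <= ennreal (K\<^sub>M * norm f * norm g)"
 "(HI r. ennreal (\<bar>inner (Q r (Q r f)) g\<bar> / r)) <= ennreal (K\<^sub>M * norm f * norm g)"
proof -
 obtain C1 where C1: "0 <= C1"
  "!!f g. (HI r. ennreal (\<bar>inner (Q r f) g\<bar> / r)) <= ennreal (C1 * norm f * norm g)"
  using weak_Q by blast
 obtain C2 where C2: "0 <= C2"
  "!!f g. (HI r. ennreal (\<bar>inner (Q r (P r f)) g\<bar> / r)) <= ennreal (C2 * norm f * norm g)"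
  using weak_QP by blast
 obtain C3 where C3: "0 <= C3"
  "!!f g. (HI r. ennreal (\<bar>inner (Q r (Q r f)) g\<bar> / r)) <= ennreal (C3 * norm f * norm g)"
  using weak_QQ by blast
 note C = C1(1) C2(1) C3(1) C1(2) C2(2) C3(2)
 have le: "ennreal (D' * norm f * norm g) <= ennreal ((C1 + C2 + C3) * norm f * norm g)"
  if "D' <= C1 + C2 + C3" for D' and f g :: 'h
  using that by (intro ennreal_leI mult_right_mono) auto
 have "\<exists>C. 0 <= C \<and> (\<forall>f g.
  (HI r. ennreal (\<bar>inner (Q r f) g\<bar> / r)) <= ennreal (C * norm f * norm g) \<and>
  (HI r. ennreal (\<bar>inner (Q r (P r f)) g\<bar> / r)) <= ennreal (C * norm f * norm g) \<and>
  (HI r. ennreal (\<bar>inner (Q r (Q r f)) g\<bar> / r)) <= ennreal (C * norm f * norm g))"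
  by (intro exI[of _ "C1 + C2 + C3"] conjI allI order_trans[OF C(4) le] order_trans[OF C(5) le] order_trans[OF C(6) le])
  (use C in auto)
 from someI_ex[OF this]
 show "0 <= K\<^sub>M"
  "(HI r. ennreal (\<bar>inner (Q r f) g\<bar> / r)) <= ennreal (K\<^sub>M * norm f * norm g)"
  "(HI r. ennreal (\<bar>inner (Q r (P r f)) g\<bar> / r)) <= ennreal (K\<^sub>M * norm f * norm g)"
  "(HI r. ennreal (\<bar>inner (Q r (Q r f)) g\<bar> / r)) <= ennreal (K\<^sub>M * norm f * norm g)"
  unfolding K\<^sub>M_def by blast+
qed

lemma K\<^sub>M_nonneg: "0 <= K\<^sub>M * norm (f :: 'h) * norm (g :: 'h)"
 by (intro mult_nonneg_nonneg K\<^sub>M(1) norm_ge_zero)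

lemma inner_QQ_deriv:
 assumes "0 < r"
 shows "((%r. inner (f - P r f) g) has_real_derivative (2 / r) * inner (Q r (Q r f)) g) (at r)"
 using bounded_linear.has_vector_derivative[OF bounded_linear_inner_left[of g]
  has_vector_derivative_diff[OF has_vector_derivative_const[of f] P_deriv[OF assms, of f]]]
 by (simp add: has_real_derivative_iff_has_vector_derivative)

lemma cont_inner_P: "continuous_on {0<..} (%r. inner (f - P r f) g)"
 and cont_inner_Q: "continuous_on {0<..} (%r. inner (Q r f) g)"
 and cont_inner_QP: "continuous_on {0<..} (%r. inner (Q r (P r f)) g)"
 and cont_inner_QQ: "continuous_on {0<..} (%r. inner (Q r (Q r f)) g)"
 by (intro continuous_intros P_cont Q_cont; simp)+

lemma isCont_of_cont_pos: "continuous_on {0<..} f ==> 0 < (r::real) ==> isCont f r"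
 by (simp add: continuous_on_eq_continuous_at)

lemma inner_one_minus_P_at_0: "((%r. inner (f - P r f) g) ---> 0) (at_right 0)"
 using tendsto_inner[OF tendsto_diff[OF tendsto_const[of f] P_at_0[of f]] tendsto_const[of g]] by simp

lemma bdd_mult_tendsto_zero:
 fixes a b :: "'t => real"
 assumes "(b ---> 0) F" "\<forall>\<^sub>F r in F. \<bar>a r\<bar> <= M"
 shows "((%r. a r * b r) ---> 0) F" "((%r. b r * a r) ---> 0) F"
proof -
 have "((%r. M * \<bar>b r\<bar>) ---> M * \<bar>0\<bar>) F" by (intro tendsto_intros assms)
 then have l: "((%r. M * \<bar>b r\<bar>) ---> 0) F" by simp
 have "\<forall>\<^sub>F r in F. norm (a r * b r) <= M * \<bar>b r\<bar>"
  using assms(2) by eventually_elim (simp add: abs_mult mult_right_mono)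
 then show "((%r. a r * b r) ---> 0) F" using l by (rule Lim_null_comparison)
 then show "((%r. b r * a r) ---> 0) F" by (simp add: mult.commute)
qed

lemma inner_bdd: "\<forall>\<^sub>F r in at_top. \<bar>inner (f - P r f) g\<bar> <= (1 + K) * norm f * norm g"
 using eventually_gt_at_top[of 0]
proof eventually_elim
 case (elim r)
 have "\<bar>inner (f - P r f) g\<bar> <= norm (f - P r f) * norm g" by (rule Cauchy_Schwarz_ineq2)
 also have "\<dots> <= (1 + K) * norm f * norm g" by (intro mult_right_mono PQ_bound1 elim) auto
 finally show ?case .
qed

lemma div_at_top: "((%r. t / r) ---> 0) at_top" for t :: real
 by (rule tendsto_divide_0[OF tendsto_const filterlim_at_top_imp_at_infinity[OF filterlim_ident]])

lemma V_norm:
 assumes f: "(h, f) \<in> T" "(f, f1) \<in> T"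
 shows "norm (V f t) <= K\<^sub>M / c\<^sub>0 * norm f"
proof (rule norm_le_of_inner)
 fix g
 have "inner (V\<^sub>1 f t) g = (\<integral>r. cos (t/r) * (inner (Q r f) g / r) \<partial>halfline)"
  unfolding V\<^sub>1_def wint_inner[OF V\<^sub>1_integrable[OF f]] by simp
 also have "\<bar>\<dots>\<bar> <= 1 * (K\<^sub>M * norm f * norm g)"
 proof (rule weighted_bound(2)[OF K\<^sub>M(2) K\<^sub>M_nonneg cont_inner_Q])
  show "continuous_on {0<..} (%r. cos (t/r))" by (intro continuous_intros) auto
 qed simp
 finally show "\<bar>inner (V f t) g\<bar> <= K\<^sub>M / c\<^sub>0 * norm f * norm g"
  using c\<^sub>0_pos by (simp add: V_def divide_right_mono mult.commute)
qed (use K\<^sub>M(1) c\<^sub>0_pos in auto)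

text \<open>The kernel sin(t/r)/r is the r-derivative of -Si(t/r), and the sine integral is bounded.
  Integration by parts moves the derivative onto 1 - P, producing (2/r) Q Q, for which a weak bound
  is available.\<close>

lemma U\<^sub>1_norm:
 assumes f: "(f, f1) \<in> T" and B: "!!x. \<bar>Si x\<bar> <= S"
 shows "norm (U\<^sub>1 f t) <= 2 * S * K\<^sub>M * norm f"
proof (rule norm_le_of_inner)
 fix g
 have sinc: "((%r. - Si (t/r)) has_real_derivative sin (t/r) / r) (at r)" if r: "0 < r" for r
 proof -
  have "((%r. Si (t/r)) has_real_derivative sinc (t/r) * (- t / r^2)) (at r)"
  by (rule DERIV_chain2[OF DERIV_Si]) (use r in \<open>auto intro!: derivative_eq_intros simp: power2_eq_square\<close>)
  moreover have "sinc (t/r) * (- t / r^2) = - (sin (t/r) / r)"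
  using r by (cases "t = 0") (auto simp: power2_eq_square field_simps)
  ultimately show ?thesis using DERIV_minus by fastforce
 qed
 have cSi: "continuous_on {0<..} (%r. Si (t/r))"
 proof (rule continuous_on_compose2[where t=UNIV and f="%r. t/r"])
  show "continuous_on UNIV Si" by (simp add: continuous_at_imp_continuous_on isCont_Si)
  show "continuous_on {0<..} (%r. t/r)" by (intro continuous_intros) auto
 qed simp
 have eq: "- Si (t/r) * (2 / r * inner (Q r (Q r f)) g) = - Si (t/r) * 2 * (inner (Q r (Q r f)) g / r)" for r by simp
 have cm: "continuous_on {0<..} (%r. - Si (t/r) * 2)" by (intro continuous_intros cSi)
 have bm: "\<bar>- Si (t/r) * 2\<bar> <= 2 * S" for r using B[of "t/r"] by simp
 note w1 = weighted_bound(1)[OF K\<^sub>M(4)[of f g] K\<^sub>M_nonneg cont_inner_QQ cm bm]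
  and w2 = weighted_bound(2)[OF K\<^sub>M(4)[of f g] K\<^sub>M_nonneg cont_inner_QQ cm bm]
 have "inner (U\<^sub>1 f t) g = (\<integral>r. (sin (t/r) / r) * inner (f - P r f) g \<partial>halfline)"
  unfolding U\<^sub>1_def wint_inner[OF U\<^sub>1_integrable[OF f]] by simp
 also have "\<dots> = - (\<integral>r. - Si (t/r) * (2 / r * inner (Q r (Q r f)) g) \<partial>halfline)"
 proof (rule half_int_by_parts[OF sinc inner_QQ_deriv])
  show "isCont (%r. sin (t/r) / r) r" if "0 < r" for r using that by (intro continuous_intros) auto
  show "isCont (%r. 2 / r * inner (Q r (Q r f)) g) r" if "0 < r" for r
  by (rule isCont_of_cont_pos[OF _ that]) (auto intro!: continuous_intros cont_inner_QQ)
  show "integrable halfline (%r. (sin (t/r) / r) * inner (f - P r f) g)"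
  using wintble_inner[OF U\<^sub>1_integrable[OF f], of t g] by simp
  show "integrable halfline (%r. - Si (t/r) * (2 / r * inner (Q r (Q r f)) g))" unfolding eq by (rule w1)
  show "((%r. - Si (t/r) * inner (f - P r f) g) ---> 0) (at_right 0)"
  by (rule bdd_mult_tendsto_zero(1)[OF inner_one_minus_P_at_0, where M=S]) (simp add: B)
  have "((%r. - Si (t/r)) ---> - Si 0) at_top"
  by (intro tendsto_minus isCont_tendsto_compose[OF isCont_Si div_at_top])
  moreover have "Si 0 = 0" using Si_neg[of 0] by simp
  ultimately show "((%r. - Si (t/r) * inner (f - P r f) g) ---> 0) at_top"
  by (intro bdd_mult_tendsto_zero(2)[OF _ inner_bdd]) simp
 qed auto
 finally show "\<bar>inner (U\<^sub>1 f t) g\<bar> <= 2 * S * K\<^sub>M * norm f * norm g"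
  using w2 unfolding eq by (simp add: mult.assoc)
qed (use K\<^sub>M(1) order_trans[OF abs_ge_zero B] in auto)

lemma U_norm: "\<exists>C\<ge>0. \<forall>f f1 t. (f, f1) \<in> T --> norm (U f t) <= C * norm f"
proof -
 obtain S where S: "!!x. \<bar>Si x\<bar> <= S" using bounded_Si by blast
 have S0: "0 <= S" using order_trans[OF abs_ge_zero S] .
 show ?thesis
 proof (intro exI[of _ "1 + 2 * S * K\<^sub>M / c\<^sub>0"] conjI allI impI)
  show "0 <= 1 + 2 * S * K\<^sub>M / c\<^sub>0" using S0 K\<^sub>M(1) c\<^sub>0_pos by simp
  fix f f1 t assume f: "(f, f1) \<in> T"
  have "norm (U f t) <= norm f + norm ((1/c\<^sub>0) *: U\<^sub>1 f t)" unfolding U_def by (rule norm_triangle_ineq4)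
  also have "norm ((1/c\<^sub>0) *: U\<^sub>1 f t) <= (1/c\<^sub>0) * (2 * S * K\<^sub>M * norm f)"
  using U\<^sub>1_norm[OF f S, of t] c\<^sub>0_pos by (simp add: divide_right_mono)
  finally show "norm (U f t) <= (1 + 2 * S * K\<^sub>M / c\<^sub>0) * norm f" by (simp add: distrib_right)
 qed
qed

text \<open>The kernel cos(t/r)/r^2 is the r-derivative of -sin(t/r)/t. Integration by parts
  therefore gains 1/t, and the derivative of 1 - P falls under the weak bound for Q Q.\<close>

lemma V_deriv_norm:
 assumes f: "(h, f) \<in> T" "(f, f1) \<in> T" "(f1, f2) \<in> T" and t: "0 < t"
 shows "norm (V f1 t) <= (2 * K\<^sub>M / c\<^sub>0) / t * norm f"
proof (rule norm_le_of_inner)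
 fix g
 have eq: "- sin (t/r) / t * (2 / r * inner (Q r (Q r f)) g) = - sin (t/r) / t * 2 * (inner (Q r (Q r f)) g / r)" for r by simp
 have cm: "continuous_on {0<..} (%r. - sin (t/r) / t * 2)" using t by (intro continuous_intros) auto
 have bm: "\<bar>- sin (t/r) / t * 2\<bar> <= 2 / t" for r
  using abs_sin_le_one[of "t/r"] t by (simp add: abs_mult divide_right_mono)
 note w1 = weighted_bound(1)[OF K\<^sub>M(4)[of f g] K\<^sub>M_nonneg cont_inner_QQ cm bm]
  and w2 = weighted_bound(2)[OF K\<^sub>M(4)[of f g] K\<^sub>M_nonneg cont_inner_QQ cm bm]
 have "wintble halfline (%r. (cos (t/r) / r^2) *: (f - P r f))"
  by (rule wintble_half[OF _ _ cos_deriv_bound[OF _ f(2,3)]])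
  (auto intro!: continuous_intros cont_trig P_cont intble_half_min_inv_square)
 note wi = this
 have "inner (V\<^sub>1 f1 t) g = (\<integral>r. (cos (t/r) / r^2) * inner (f - P r f) g \<partial>halfline)"
  unfolding V\<^sub>1_f1[OF f(2)] wint_inner[OF wi] by simp
 also have "\<dots> = - (\<integral>r. - sin (t/r) / t * (2 / r * inner (Q r (Q r f)) g) \<partial>halfline)"
 proof (rule half_int_by_parts[OF _ inner_QQ_deriv])
  show "((%r. - sin (t/r) / t) has_real_derivative cos (t/r) / r^2) (at r)" if "0 < r" for r
  using that t by (auto intro!: derivative_eq_intros simp: power2_eq_square)
  show "isCont (%r. cos (t/r) / r^2) r" if "0 < r" for r using that by (intro continuous_intros) auto
  show "isCont (%r. 2 / r * inner (Q r (Q r f)) g) r" if "0 < r" for r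
  by (rule isCont_of_cont_pos[OF _ that]) (auto intro!: continuous_intros cont_inner_QQ)
  show "integrable halfline (%r. (cos (t/r) / r^2) * inner (f - P r f) g)"
  using wintble_inner[OF wi, of g] by simp
  show "integrable halfline (%r. - sin (t/r) / t * (2 / r * inner (Q r (Q r f)) g))" unfolding eq by (rule w1)
  show "((%r. - sin (t/r) / t * inner (f - P r f) g) ---> 0) (at_right 0)"
  by (rule bdd_mult_tendsto_zero(1)[OF inner_one_minus_P_at_0, where M="1/t"])
  (use t in \<open>auto simp: divide_right_mono\<close>)
  have "((%r. - sin (t/r) / t) ---> - sin 0 / t) at_top"
  by (intro tendsto_intros div_at_top) (use t in auto)
  then show "((%r. - sin (t/r) / t * inner (f - P r f) g) ---> 0) at_top"
  by (intro bdd_mult_tendsto_zero(2)[OF _ inner_bdd]) simp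
 qed auto
 finally have "\<bar>inner (V\<^sub>1 f1 t) g\<bar> <= 2 / t * (K\<^sub>M * norm f * norm g)" using w2 unfolding eq by simp
 then show "\<bar>inner (V f1 t) g\<bar> <= (2 * K\<^sub>M / c\<^sub>0) / t * norm f * norm g"
  using c\<^sub>0_pos by (simp add: V_def field_simps)
qed (use K\<^sub>M(1) c\<^sub>0_pos t in auto)

lemma Q_over_r_deriv:
 assumes r: "0 < r"
 shows "((%r. inner (Q r f /\<^sub>R r) g) has_real_derivative (2 / r^2) * (inner (Q r (P r f)) g - inner (Q r f) g)) (at r)"
proof -
 have 1: "((%r. inner (Q r f) g) has_real_derivative (1/r) * (2 * inner (Q r (P r f)) g - inner (Q r f) g)) (at r)"
  using bounded_linear.has_vector_derivative[OF bounded_linear_inner_left[of g] Q_deriv[OF r, of f]]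
  by (simp add: has_real_derivative_iff_has_vector_derivative inner_diff_left)
 have "((%r. inner (Q r f) g / r) has_real_derivative
  ((1/r) * (2 * inner (Q r (P r f)) g - inner (Q r f) g) * r - inner (Q r f) g * 1) / (r * r)) (at r)"
  by (rule DERIV_divide[OF 1 DERIV_ident]) (use r in simp)
 moreover have "((1/r) * (2 * inner (Q r (P r f)) g - inner (Q r f) g) * r - inner (Q r f) g * 1) / (r * r)
  = (2 / r^2) * (inner (Q r (P r f)) g - inner (Q r f) g)"
  using r by (simp add: power2_eq_square field_simps)
 ultimately show ?thesis by (simp add: divide_inverse mult.commute)
qed

text \<open>The sine integral as antiderivative would give no factor 1/t. Instead sin(t/r)/r is
  completed by (cos(t/r) - 1)/t to the derivative of a function of size r/t. The added term
  contributes \<open>V\<^sub>2\<close> divided by t, which \<open>V_eq\<close> evaluates.\<close>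

lemma U_deriv_norm:
 assumes f: "(h, f) \<in> T" "(f, f1) \<in> T" "(f1, f2) \<in> T" and t: "0 < t"
 shows "norm (U f1 t) <= (10 * K\<^sub>M / c\<^sub>0) / t * norm f"
proof (rule norm_le_of_inner)
 fix g
 \<comment> \<open>Its factor r cancels one power in the derivative of \<open>P r f1\<close>,
   leaving dr/r against a multiplier bounded by 4/t. The two weak bounds give 8/t, and the values of
   \<open>V f\<close> at t and 0 add 2/t, hence the constant 10.\<close>
 let ?al = "%r. (r / t) * (cos (t/r) - 1)"
 let ?al' = "%r. (cos (t/r) - 1) / t + sin (t/r) / r"
 let ?be = "%r. inner (f1 - P r f1) g"
 let ?be' = "%r. - ((2 / r^2) * (inner (Q r (P r f)) g - inner (Q r f) g))"
 let ?m = "%r. (1 - cos (t/r)) * (2 / t)"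
 have Pf1: "P r f1 = Q r f /\<^sub>R r" if "0 < r" for r using PQ_T(1)[OF that f(2)] that by simp
 have dbe: "(?be has_real_derivative ?be' r) (at r)" if r: "0 < r" for r
 proof -
  have "((%r. inner f1 g - inner (Q r f /\<^sub>R r) g) has_real_derivative 0 - ((2 / r^2) * (inner (Q r (P r f)) g - inner (Q r f) g))) (at r)"
  by (intro DERIV_diff Q_over_r_deriv r DERIV_const)
  then show ?thesis
  unfolding has_real_derivative_iff_has_vector_derivative
  by (simp, elim vector_der_transform_pos[OF r]) (simp add: inner_diff_left Pf1)
 qed
 have M2: "\<bar>?m r\<bar> <= 4 / t" for r
 proof -
  have "\<bar>1 - cos (t/r)\<bar> <= 2" using cos_le_one[of "t/r"] cos_ge_minus_one[of "t/r"] by linarith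
  then have "\<bar>1 - cos (t/r)\<bar> * (2/t) <= 2 * (2/t)" using t by (intro mult_right_mono) auto
  then show ?thesis using t by (simp add: abs_mult)
 qed
 have cm: "continuous_on {0<..} ?m" by (intro continuous_intros) auto
 note wP = weighted_bound[OF K\<^sub>M(3)[of f g] K\<^sub>M_nonneg cont_inner_QP cm M2]
  and wQ = weighted_bound[OF K\<^sub>M(2)[of f g] K\<^sub>M_nonneg cont_inner_Q cm M2]
 have eq: "?al r * ?be' r = ?m r * (inner (Q r (P r f)) g / r) - ?m r * (inner (Q r f) g / r)" if "0 < r" for r
  using that t by (simp add: field_simps power2_eq_square)
 have iV2: "integrable halfline (%r. (1 - cos (t/r)) * ?be r)" and vV2: "inner (V\<^sub>2 f1 t) g = (\<integral>r. (1 - cos (t/r)) * ?be r \<partial>halfline)"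
  using wintble_inner[OF V\<^sub>2_integrable, of t f1 g] wint_inner[OF V\<^sub>2_integrable, of t f1 g]
  by (simp_all add: V\<^sub>2_def)
 have iU1: "integrable halfline (%r. sin (t/r) / r * ?be r)" and vU1: "inner (U\<^sub>1 f1 t) g = (\<integral>r. sin (t/r) / r * ?be r \<partial>halfline)"
  using wintble_inner[OF U\<^sub>1_integrable[OF f(3)], of t g] wint_inner[OF U\<^sub>1_integrable[OF f(3)], of t g]
  by (simp_all add: U\<^sub>1_def)
 have split: "?al' r * ?be r = sin (t/r) / r * ?be r - (1/t) * ((1 - cos (t/r)) * ?be r)" for r
  by (simp add: algebra_simps diff_divide_distrib)
 have "inner (U\<^sub>1 f1 t) g - (1/t) * inner (V\<^sub>2 f1 t) g = (\<integral>r. ?al' r * ?be r \<partial>halfline)"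
  unfolding split vV2 vU1 using iV2 iU1 by simp
 also have "\<dots> = - (\<integral>r. ?al r * ?be' r \<partial>halfline)"
 proof (rule half_int_by_parts[OF _ dbe])
  show "(?al has_real_derivative ?al' r) (at r)" if "0 < r" for r
  using that t by (auto intro!: derivative_eq_intros simp: field_simps power2_eq_square)
  show "isCont ?al' r" if "0 < r" for r using that t by (intro continuous_intros) auto
  show "isCont ?be' r" if "0 < r" for r
  by (rule isCont_of_cont_pos[OF _ that]) (auto intro!: continuous_intros cont_inner_QP cont_inner_Q)
  show "integrable halfline (%r. ?al' r * ?be r)" unfolding split using iV2 iU1 by simp
  show "integrable halfline (%r. ?al r * ?be' r)"
  by (subst Bochner_Integration.integrable_cong[OF refl eq]) (use wP(1) wQ(1) in auto)
  have "((%r. (r/t) * 2) ---> (0/t) * 2) (at_right 0)" by (intro tendsto_intros) (use t in auto)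
  then have l0: "((%r. (r/t) * 2) ---> 0) (at_right 0)" by simp
  have "\<forall>\<^sub>F r in at_right 0. norm (?al r) <= (r/t) * 2"
  using eventually_at_right_less[of 0]
  proof eventually_elim
  case (elim r)
  have "\<bar>cos (t/r) - 1\<bar> <= 2" using cos_le_one[of "t/r"] cos_ge_minus_one[of "t/r"] by linarith
  then show ?case unfolding norm_mult using elim t by (intro mult_mono) auto
  qed
  then have a0: "(?al ---> 0) (at_right 0)" using l0 by (rule Lim_null_comparison)
  show "((%r. ?al r * ?be r) ---> 0) (at_right 0)"
  proof (rule bdd_mult_tendsto_zero(2)[OF a0])
  show "\<forall>\<^sub>F r in at_right 0. \<bar>?be r\<bar> <= (1 + K) * norm f1 * norm g"
  using eventually_at_right_less[of 0]
  proof eventually_elim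
  case (elim r)
  have "\<bar>?be r\<bar> <= norm (f1 - P r f1) * norm g" by (rule Cauchy_Schwarz_ineq2)
  also have "\<dots> <= (1 + K) * norm f1 * norm g" by (intro mult_right_mono PQ_bound1 elim) auto
  finally show ?case .
  qed
  qed
  have "\<forall>\<^sub>F r in at_top. norm (?al r) <= (t/2) / r"
  using eventually_gt_at_top[of 0]
  proof eventually_elim
  case (elim r)
  have "\<bar>?al r\<bar> = (r/t) * \<bar>1 - cos (t/r)\<bar>" using elim t by (simp add: abs_mult)
  also have "\<dots> <= (r/t) * ((t/r)^2/2)" using inv_square_bound_cos[of "t/r"] elim t by (intro mult_left_mono) auto
  also have "\<dots> = (t/2) / r" using elim t by (simp add: power2_eq_square)
  finally show ?case by simp
  qed
  then have "(?al ---> 0) at_top" using div_at_top[of "t/2"] by (rule Lim_null_comparison)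
  then show "((%r. ?al r * ?be r) ---> 0) at_top"
  by (rule bdd_mult_tendsto_zero(2)[OF _ inner_bdd])
 qed auto
 also have "(\<integral>r. ?al r * ?be' r \<partial>halfline) = (\<integral>r. ?m r * (inner (Q r (P r f)) g / r) \<partial>halfline) - (\<integral>r. ?m r * (inner (Q r f) g / r) \<partial>halfline)"
 proof -
  have "(\<integral>r. ?al r * ?be' r \<partial>halfline) = (\<integral>r. ?m r * (inner (Q r (P r f)) g / r) - ?m r * (inner (Q r f) g / r) \<partial>halfline)"
  by (rule Bochner_Integration.integral_cong[OF refl]) (simp only: eq space_half greaterThan_iff)
  also have "\<dots> = (\<integral>r. ?m r * (inner (Q r (P r f)) g / r) \<partial>halfline) - (\<integral>r. ?m r * (inner (Q r f) g / r) \<partial>halfline)"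
  by (rule Bochner_Integration.integral_diff[OF wP(1) wQ(1)])
  finally show ?thesis .
 qed
 finally have "\<bar>inner (U\<^sub>1 f1 t) g - (1/t) * inner (V\<^sub>2 f1 t) g\<bar> <= 8 / t * (K\<^sub>M * norm f * norm g)"
  using wP(2) wQ(2) by simp
 then have 1: "\<bar>(1/c\<^sub>0) * (inner (U\<^sub>1 f1 t) g - (1/t) * inner (V\<^sub>2 f1 t) g)\<bar> <= 8 / t * (K\<^sub>M / c\<^sub>0 * norm f * norm g)"
  using c\<^sub>0_pos by (simp add: abs_mult field_simps)
 \<comment> \<open>The term \<open>t *: f1\<close>, divided by t, cancels the \<open>f1\<close> in
   the definition of \<open>U f1\<close>; only differences of \<open>V f\<close> remain, and these
   are bounded by |f|.\<close>
 have 2: "(1/c\<^sub>0) *: V\<^sub>2 f1 t = V f t - V f 0 + t *: f1" using V_eq[OF f(1,2), of t] t by simp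
 have "inner (U f1 t) g = inner f1 g - ((1/c\<^sub>0) * (inner (U\<^sub>1 f1 t) g - (1/t) * inner (V\<^sub>2 f1 t) g)) - (1/t) * inner ((1/c\<^sub>0) *: V\<^sub>2 f1 t) g"
  by (simp add: U_def inner_diff_left algebra_simps)
 also have "\<dots> = - ((1/c\<^sub>0) * (inner (U\<^sub>1 f1 t) g - (1/t) * inner (V\<^sub>2 f1 t) g)) - (1/t) * (inner (V f t) g - inner (V f 0) g)"
  unfolding 2 using t by (simp add: inner_add_left inner_diff_left field_simps)
 finally have 3: "inner (U f1 t) g = - ((1/c\<^sub>0) * (inner (U\<^sub>1 f1 t) g - (1/t) * inner (V\<^sub>2 f1 t) g)) - (1/t) * (inner (V f t) g - inner (V f 0) g)" .
 have v: "\<bar>inner (V f s) g\<bar> <= K\<^sub>M / c\<^sub>0 * norm f * norm g" for s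
  by (rule order_trans[OF Cauchy_Schwarz_ineq2 mult_right_mono[OF V_norm[OF f(1,2)]]]) simp
 have "\<bar>inner (V f t) g - inner (V f 0) g\<bar> <= 2 * (K\<^sub>M / c\<^sub>0 * norm f * norm g)"
  using v[of t] v[of 0] by linarith
 then have "(1/t) * \<bar>inner (V f t) g - inner (V f 0) g\<bar> <= (1/t) * (2 * (K\<^sub>M / c\<^sub>0 * norm f * norm g))"
  using t by (intro mult_left_mono) auto
 then have 4: "\<bar>(1/t) * (inner (V f t) g - inner (V f 0) g)\<bar> <= 2 / t * (K\<^sub>M / c\<^sub>0 * norm f * norm g)"
  using t by (simp add: abs_mult)
 have "\<bar>inner (U f1 t) g\<bar> <= 8 / t * (K\<^sub>M / c\<^sub>0 * norm f * norm g) + 2 / t * (K\<^sub>M / c\<^sub>0 * norm f * norm g)"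
  unfolding 3 by (rule order_trans[OF abs_triangle_ineq4]) (intro add_mono, simp_all only: abs_minus_cancel 1 4)
 then show "\<bar>inner (U f1 t) g\<bar> <= (10 * K\<^sub>M / c\<^sub>0) / t * norm f * norm g"
  by (simp add: field_simps)
qed (use K\<^sub>M(1) c\<^sub>0_pos t in auto)

end

section \<open>Solutions for general data by approximation\<close>

lemma tendsto_uniform_approx:
 fixes F :: "real => 'h::real_normed_vector"
 assumes pos: "\<forall>\<^sub>F t in A. 0 < t"
  and le: "!!n t. 0 < t ==> norm (F t - W n t) <= e n" and e: "e ----> 0"
  and W: "!!n. (W n ---> l n) A" and l: "l ----> L"
 shows "(F ---> L) A"
proof (rule tendstoI)
 fix ep :: real assume ep: "0 < ep"
 have "\<forall>\<^sub>F n in sequentially. e n < ep/3" by (rule order_tendstoD(2)[OF e]) (use ep in simp)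
 moreover have "\<forall>\<^sub>F n in sequentially. dist (l n) L < ep/3" by (rule tendstoD[OF l]) (use ep in simp)
 ultimately have "\<forall>\<^sub>F n in sequentially. e n < ep/3 \<and> dist (l n) L < ep/3" by (rule eventually_conj)
 then obtain n where n: "e n < ep/3" "dist (l n) L < ep/3"
  unfolding eventually_sequentially by blast
 have "\<forall>\<^sub>F t in A. dist (W n t) (l n) < ep/3" by (rule tendstoD[OF W]) (use ep in simp)
 with pos show "\<forall>\<^sub>F t in A. dist (F t) L < ep"
 proof eventually_elim
  case (elim t)
  have "dist (F t) (W n t) <= e n" using le[OF elim(1)] by (simp add: dist_norm)
  then show ?case using elim n dist_triangle[of "F t" L "W n t"] dist_triangle[of "W n t" L "l n"] by linarith
 qed
qed

context weak_square_sa begin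

text \<open>The chain is as long as the limit argument requires: the preimage \<open>h\<close> and
  its own preimage give decay of the semigroup at infinity, and the images beyond \<open>f1\<close>
  give continuity of the derivative.\<close>

definition nice :: "'h => 'h => 'h => bool" where
 "nice h f f1 \<longleftrightarrow> (\<exists>k f2 f3. (k, h) \<in> T \<and> (h, f) \<in> T \<and> (f, f1) \<in> T \<and> (f1, f2) \<in> T \<and> (f2, f3) \<in> T)"

text \<open>For \<open>sg\<close> equal to 1 or -1 this stands for exp(-t|T|) composed with the
  spectral projection of \<open>T\<close> to the positive or negative half line.\<close>

definition W :: "real => 'h => real => 'h" where
 "W sg f t = (1/2) *: (U f t + sg *: V f t)"

lemma W_diff:
 assumes "(h, f) \<in> T" "(f, f1) \<in> T" "(k, g) \<in> T" "(g, g1) \<in> T"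
 shows "W sg (f - g) t = W sg f t - W sg g t"
 unfolding W_def U_diff[OF assms(2,4)] V_diff[OF assms] by (simp add: algebra_simps)

lemma W_deriv:
 assumes f: "(h, f) \<in> T" "(f, f1) \<in> T" "(f1, f2) \<in> T" and t: "0 < t" and sg: "sg * sg = 1"
 shows "(W sg f has_vector_derivative - sg *: W sg f1 t) (at t)"
proof -
 have "((%t. (1/2) *: (U f t + sg *: V f t)) has_vector_derivative (1/2) *: (- V f1 t + sg *: (- U f1 t))) (at t)"
  by (intro bounded_linear.has_vector_derivative[OF bounded_linear_scaleR_right] has_vector_derivative_add
  U_deriv[OF f] V_deriv[OF f t])
 moreover have "(1/2) *: (- V f1 t + sg *: (- U f1 t)) = - sg *: W sg f1 t"
  using sg by (simp add: W_def scaleR_add_right scaleR_diff_right)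
 ultimately show ?thesis by (simp add: W_def[abs_def])
qed

lemma W_T:
 assumes f: "(h, f) \<in> T" "(f, f1) \<in> T" "(f1, f2) \<in> T"
 shows "(W sg f t, W sg f1 t) \<in> T"
 unfolding W_def by (intro T_scale T_add U_T[OF f(2,3)] V_T[OF f])

lemma W_bounds:
 "\<exists>C\<ge>0. \<forall>sg h f f1 f2 t. \<bar>sg\<bar> = 1 --> (h, f) \<in> T --> (f, f1) \<in> T --> (f1, f2) \<in> T --> 0 < t -->
  norm (W sg f t) <= C * norm f \<and> norm (W sg f1 t) <= C / t * norm f"
proof -
 obtain C where C: "0 <= C" "!!f f1 t. (f, f1) \<in> T ==> norm (U f t) <= C * norm f" using U_norm by blast
 define L where "L = K\<^sub>M / c\<^sub>0"
 have L0: "0 <= L" using K\<^sub>M(1) c\<^sub>0_pos by (simp add: L_def)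
 have half: "norm ((1/2) *: (u + sg *: v)) <= norm u + norm v" if "\<bar>sg\<bar> = 1" for sg and u v :: 'h
 proof -
  have 1: "norm ((1/2) *: (u + sg *: v)) = norm (u + sg *: v) / 2" by simp
  have 2: "norm (u + sg *: v) <= norm u + norm v"
  using norm_triangle_ineq[of u "sg *: v"] that by simp
  show ?thesis unfolding 1 using 2 norm_ge_zero[of u] norm_ge_zero[of v] by linarith
 qed
 show ?thesis
 proof (intro exI[of _ "C + 12 * L"] conjI allI impI)
  show "0 <= C + 12 * L" using C L0 by simp
  fix sg :: real and h f f1 f2 t
  assume sg: "\<bar>sg\<bar> = 1" and f: "(h, f) \<in> T" "(f, f1) \<in> T" "(f1, f2) \<in> T" and t: "0 < (t::real)"
  have "norm (W sg f t) <= norm (U f t) + norm (V f t)" unfolding W_def by (rule half[OF sg])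
  also have "\<dots> <= C * norm f + L * norm f" unfolding L_def by (intro add_mono C(2)[OF f(2)] V_norm[OF f(1,2)])
  also have "\<dots> <= (C + 12 * L) * norm f"
  using L0 by (simp add: distrib_right mult_right_mono)
  finally show "norm (W sg f t) <= (C + 12 * L) * norm f" .
  have "norm (W sg f1 t) <= norm (U f1 t) + norm (V f1 t)" unfolding W_def by (rule half[OF sg])
  also have "\<dots> <= (10 * K\<^sub>M / c\<^sub>0) / t * norm f + (2 * K\<^sub>M / c\<^sub>0) / t * norm f"
  by (intro add_mono U_deriv_norm[OF f t] V_deriv_norm[OF f t])
  also have "\<dots> = (12 * L) / t * norm f" by (simp add: L_def field_simps)
  also have "\<dots> <= (C + 12 * L) / t * norm f"
  using C(1) t by (intro mult_right_mono divide_right_mono) auto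
  finally show "norm (W sg f1 t) <= (C + 12 * L) / t * norm f" .
 qed
qed

text \<open>Applying 1 - P_R twice puts a vector into the range of T squared, and P_ep three times
  puts it into the domain of T cubed. Both change the vector little when R is large and ep is
  small.\<close>

lemma nice_dense:
 obtains f h f1 where "!!n. nice (h n) (f n) (f1 n)" "f ----> g"
proof -
 have ex: "\<exists>h f f1. nice h f f1 \<and> dist f g < e" if e: "0 < e" for e
 proof -
  have "((%R. (2 + K) * norm (P R g)) ---> (2 + K) * 0) at_top"
  by (intro tendsto_intros tendsto_norm_zero P_at_top)
  then have "\<forall>\<^sub>F R in at_top. (2 + K) * norm (P R g) < e/2"
  by (rule order_tendstoD(2)) (use e in simp)
  then have "\<forall>\<^sub>F R in at_top. (2 + K) * norm (P R g) < e/2 \<and> 0 < R"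
  using eventually_gt_at_top[of 0] by (rule eventually_conj)
  then obtain R where R: "(2 + K) * norm (P R g) < e/2" "0 < R"
  by (auto simp: eventually_at_top_linorder)
  define g1 where "g1 = g - P R g"
  define g2 where "g2 = g1 - P R g1"
  have "norm (g2 - g) <= norm (P R g) + norm (P R g1)"
  using norm_triangle_ineq4[of "- P R g" "P R g1"] by (simp add: g2_def g1_def algebra_simps)
  also have "P R g1 = P R g - P R (P R g)" by (simp add: g1_def PQ_diff R)
  also have "norm (P R g - P R (P R g)) <= (1 + K) * norm (P R g)" by (rule PQ_bound1[OF R(2)])
  finally have a: "norm (g2 - g) < e/2" using R(1) by (simp add: algebra_simps)
  define S where "S = (%ep x. P ep (P ep (P ep x)))"
  have "\<forall>\<^sub>F ep in at_right 0. norm (S ep g2 - g2) <= (K * K + K + 1) * norm (P ep g2 - g2)"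
  using eventually_at_right_less[of 0]
  proof eventually_elim
  case (elim ep)
  have "S ep g2 - g2 = P ep (P ep (P ep g2 - g2)) + P ep (P ep g2 - g2) + (P ep g2 - g2)"
  by (simp add: S_def PQ_diff elim)
  then have "norm (S ep g2 - g2) <= norm (P ep (P ep (P ep g2 - g2))) + norm (P ep (P ep g2 - g2)) + norm (P ep g2 - g2)"
  by (metis norm_triangle_ineq norm_triangle_mono order_refl)
  also have "\<dots> <= K * (K * norm (P ep g2 - g2)) + K * norm (P ep g2 - g2) + norm (P ep g2 - g2)"
  using K_pos by (intro add_mono order_refl P_norm elim order_trans[OF P_norm[OF elim] mult_left_mono[OF P_norm[OF elim]]]) auto
  finally show ?case by (simp add: algebra_simps)
  qed
  moreover have "((%ep. (K * K + K + 1) * norm (P ep g2 - g2)) ---> (K * K + K + 1) * norm (g2 - g2)) (at_right 0)"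
  by (intro tendsto_intros P_at_0)
  then have "\<forall>\<^sub>F ep in at_right 0. (K * K + K + 1) * norm (P ep g2 - g2) < e/2"
  by (rule order_tendstoD(2)) (use e in simp)
  ultimately have "\<forall>\<^sub>F ep in at_right 0. norm (S ep g2 - g2) < e/2 \<and> 0 < ep"
  using eventually_at_right_less[of 0] by eventually_elim auto
  then obtain ep where ep: "norm (S ep g2 - g2) < e/2" "0 < ep"
  using eventually_happens' trivial_limit_at_right_real by blast
  define i where "i = 1 / ep"
  have ST: "(x, y) \<in> T ==> (S ep x, S ep y) \<in> T" for x y
  unfolding S_def by (intro PQ_T(3) ep)
  have t1: "(R *: Q R x, x - P R x) \<in> T" for x
  using T_scale[OF T_Q[OF R(2)], of R x] R(2) by simp
  have t2: "(R *: Q R (R *: Q R g), R *: Q R g1) \<in> T"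
  using T_scale[OF PQ_T(4)[OF R(2) t1[of g]], of R] by (simp add: g1_def)
  have t3: "(R *: Q R g1, g2) \<in> T" unfolding g2_def by (rule t1)
  have p: "(P ep x, i *: Q ep x) \<in> T" for x unfolding i_def by (rule T_P[OF ep(2)])
  have "nice (S ep (R *: Q R g1)) (S ep g2) (P ep (P ep (i *: Q ep g2)))"
  unfolding nice_def
  proof (intro exI conjI)
  show "(S ep (R *: Q R (R *: Q R g)), S ep (R *: Q R g1)) \<in> T" by (rule ST[OF t2])
  show "(S ep (R *: Q R g1), S ep g2) \<in> T" by (rule ST[OF t3])
  show "(S ep g2, P ep (P ep (i *: Q ep g2))) \<in> T" unfolding S_def by (intro PQ_T(3) ep p)
  show "(P ep (P ep (i *: Q ep g2)), P ep (i *: Q ep (i *: Q ep g2))) \<in> T" by (intro PQ_T(3) ep p)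
  show "(P ep (i *: Q ep (i *: Q ep g2)), i *: Q ep (i *: Q ep (i *: Q ep g2))) \<in> T" by (rule p)
  qed
  moreover have "dist (S ep g2) g < e"
  using ep(1) a norm_triangle_ineq[of "S ep g2 - g2" "g2 - g"] by (simp add: dist_norm)
  ultimately show ?thesis by blast
 qed
 have "\<exists>h f f1. nice h f f1 \<and> dist f g < 1 / real (Suc n)" for n by (rule ex) simp
 then obtain h f f1 where *: "!!n. nice (h n) (f n) (f1 n)" "!!n. dist (f n) g < 1 / real (Suc n)" by metis
 have "(%n. dist (f n) g) ----> 0"
 proof (rule tendsto_sandwich[OF _ _ tendsto_const])
  show "\<forall>\<^sub>F n in sequentially. dist (f n) g <= 1 / real (Suc n)"
  by (intro always_eventually allI less_imp_le *)
  show "(%n. 1 / real (Suc n)) ----> 0" using LIMSEQ_inverse_real_of_nat by (simp add: inverse_eq_divide)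
 qed simp
 then have "f ----> g" using tendsto_dist_iff by blast
 then show thesis using that * by blast
qed

text \<open>\<open>W_bounds\<close> is uniform along the sequence: the functions converge uniformly
  on the half line and their derivatives uniformly away from zero. So the limit is C^1, and
  closedness of \<open>T\<close> preserves the equation.\<close>

lemma limit_sol:
 assumes nice: "!!n. nice (h n) (f n) (f1 n)" and lim: "f ----> g" and sg: "sg = 1 \<or> sg = -1"
 obtains F l where "F C1_differentiable_on {0<..}" "!!t. 0 < t ==> (F t, - sg *: vector_derivative F (at t)) \<in> T"
  "(F ---> 0) at_top" "(F ---> l) (at_right 0)" "(%n. (1/2) *: (f n + sg *: V (f n) 0)) ----> l"
proof -
 have s1: "\<bar>sg\<bar> = 1" "sg * sg = 1" using sg by auto
 obtain C where C: "0 <= C"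
  "!!h f f1 f2 t. (h, f) \<in> T ==> (f, f1) \<in> T ==> (f1, f2) \<in> T ==> 0 < t ==>
  norm (W sg f t) <= C * norm f \<and> norm (W sg f1 t) <= C / t * norm f"
  using W_bounds s1(1) by blast
 obtain k f2 f3 where ch: "!!n. (k n, h n) \<in> T" "!!n. (h n, f n) \<in> T" "!!n. (f n, f1 n) \<in> T"
  "!!n. (f1 n, f2 n) \<in> T" "!!n. (f2 n, f3 n) \<in> T"
  using nice unfolding nice_def by metis
 have Wd: "norm (W sg (f n) t - W sg (f m) t) <= C * norm (f n - f m)"
  "norm (W sg (f1 n) t - W sg (f1 m) t) <= C / t * norm (f n - f m)" if t: "0 < t" for n m t
  using C(2)[OF T_diff[OF ch(2) ch(2)] T_diff[OF ch(3) ch(3)] T_diff[OF ch(4) ch(4)] t, of n m]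
  unfolding W_diff[OF ch(2,3) ch(2,3)] W_diff[OF ch(3,4) ch(3,4)] by auto
 have cau: "\<exists>M. \<forall>m\<ge>M. \<forall>n\<ge>M. norm (f m - f n) < e" if "0 < e" for e
  using LIMSEQ_imp_Cauchy[OF lim] that unfolding Cauchy_iff by blast
 have cauchy: "convergent w" if w: "!!n m. norm (w n - w m) <= c * norm (f n - f m)" for w :: "nat => 'h" and c
 proof -
  have "Cauchy w"
  proof (rule CauchyI)
  fix e :: real assume e: "0 < e"
  have c1: "0 < \<bar>c\<bar> + 1" by simp
  obtain M where M: "!!m n. m >= M ==> n >= M ==> norm (f m - f n) < e / (\<bar>c\<bar> + 1)"
  using cau[OF divide_pos_pos[OF e c1]] by blast
  have "norm (w m - w n) < e" if "m >= M" "n >= M" for m n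
  proof -
  have "norm (w m - w n) <= (\<bar>c\<bar> + 1) * norm (f m - f n)"
  by (rule order_trans[OF w]) (intro mult_right_mono, auto)
  also have "\<dots> < e" using M[OF that] c1 by (simp add: field_simps)
  finally show ?thesis .
  qed
  then show "\<exists>M. \<forall>m\<ge>M. \<forall>n\<ge>M. norm (w m - w n) < e" by blast
  qed
  then show ?thesis by (rule Cauchy_convergent)
 qed
 define F where "F t = lim (%n. W sg (f n) t)" for t
 define G where "G t = lim (%n. W sg (f1 n) t)" for t
 have Fl: "(%n. W sg (f n) t) ----> F t" if "0 < t" for t
  unfolding F_def convergent_LIMSEQ_iff[symmetric] by (rule cauchy[OF Wd(1)[OF that]])
 have Gl: "(%n. W sg (f1 n) t) ----> G t" if "0 < t" for t
  unfolding G_def convergent_LIMSEQ_iff[symmetric] by (rule cauchy[OF Wd(2)[OF that]])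
 define e where "e n = norm (g - f n)" for n
 have e0: "e ----> 0" unfolding e_def
  using tendsto_norm_zero[OF LIM_zero[OF lim]] by (simp add: norm_minus_commute)
 have Fe: "norm (F t - W sg (f n) t) <= C * e n" if t: "0 < t" for n t unfolding e_def
  by (rule LIMSEQ_le[OF tendsto_norm[OF tendsto_diff[OF Fl[OF t] tendsto_const]]
  tendsto_mult[OF tendsto_const tendsto_norm[OF tendsto_diff[OF lim tendsto_const]]]])
  (use Wd(1)[OF t] in blast)
 have Ge: "norm (G t - W sg (f1 n) t) <= C / t * e n" if t: "0 < t" for n t unfolding e_def
  by (rule LIMSEQ_le[OF tendsto_norm[OF tendsto_diff[OF Gl[OF t] tendsto_const]]
  tendsto_mult[OF tendsto_const tendsto_norm[OF tendsto_diff[OF lim tendsto_const]]]])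
  (use Wd(2)[OF t] in blast)
 have Gu: "\<forall>\<^sub>F n in sequentially. \<forall>t\<in>{a<..}. norm (W sg (f1 n) t - G t) <= ep" if a: "0 < a" and ep: "0 < ep" for a ep
 proof -
  have "(%n. C / a * e n) ----> C / a * 0" by (intro tendsto_intros e0)
  then have "\<forall>\<^sub>F n in sequentially. C / a * e n < ep" by (rule order_tendstoD(2)) (use ep in simp)
  then show ?thesis
  proof eventually_elim
  case (elim n)
  show ?case
  proof
  fix t assume "t \<in> {a<..}"
  then have t: "a < t" "0 < t" using a by auto
  have "norm (G t - W sg (f1 n) t) <= C / t * e n" by (rule Ge[OF t(2)])
  also have "\<dots> <= C / a * e n"
  using t a C(1) by (intro mult_right_mono divide_left_mono) (auto simp: e_def)
  finally show "norm (W sg (f1 n) t - G t) <= ep" using elim by (simp add: norm_minus_commute)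
  qed
  qed
 qed
 have Fd: "(F has_vector_derivative - sg *: G t) (at t)" if t: "0 < t" for t
 proof -
  let ?S = "{t/2<..}"
  have "\<exists>g. \<forall>x\<in>?S. (%n. W sg (f n) x) ----> g x \<and> (g has_derivative (%h. h *: (- sg *: G x))) (at x within ?S)"
  proof (rule has_derivative_sequence[where f'="%n x h. h *: (- sg *: W sg (f1 n) x)"])
  show "convex ?S" by simp
  show "(W sg (f n) has_derivative (%h. h *: (- sg *: W sg (f1 n) x))) (at x within ?S)" if "x \<in> ?S" for n x
  using has_vector_derivative_at_within[OF W_deriv[OF ch(2,3,4) _ s1(2)], of x n ?S] that t
  by (simp add: has_vector_derivative_def)
  show "\<forall>\<^sub>F n in sequentially. \<forall>x\<in>?S. \<forall>h. norm (h *: (- sg *: W sg (f1 n) x) - h *: (- sg *: G x)) <= ep * norm h"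
  if ep: "0 < ep" for ep
  using Gu[of "t/2" ep] t ep
  proof (rule_tac eventually_mono)
  fix n assume n: "\<forall>x\<in>?S. norm (W sg (f1 n) x - G x) <= ep"
  show "\<forall>x\<in>?S. \<forall>h. norm (h *: (- sg *: W sg (f1 n) x) - h *: (- sg *: G x)) <= ep * norm h"
  proof (intro ballI allI)
  fix x h assume x: "x \<in> ?S"
  have "h *: (- sg *: W sg (f1 n) x) - h *: (- sg *: G x) = (- h * sg) *: (W sg (f1 n) x - G x)"
  by (simp add: scaleR_diff_right)
  then have "norm (h *: (- sg *: W sg (f1 n) x) - h *: (- sg *: G x)) = \<bar>h\<bar> * norm (W sg (f1 n) x - G x)"
  using s1(1) by (simp add: abs_mult)
  also have "\<dots> <= \<bar>h\<bar> * ep" using n x by (intro mult_left_mono) auto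
  finally show "norm (h *: (- sg *: W sg (f1 n) x) - h *: (- sg *: G x)) <= ep * norm h" by (simp add: mult.commute)
  qed
  qed simp
  show "t \<in> ?S" using t by simp
  show "(%n. W sg (f n) t) ----> F t" by (rule Fl[OF t])
  qed
  then obtain g' where g': "!!x. x \<in> ?S ==> (%n. W sg (f n) x) ----> g' x"
  "!!x. x \<in> ?S ==> (g' has_derivative (%h. h *: (- sg *: G x))) (at x within ?S)" by blast
  have eq: "g' x = F x" if "x \<in> ?S" for x
  using LIMSEQ_unique[OF g'(1)[OF that] Fl] that t by simp
  have "(g' has_vector_derivative (- sg *: G t)) (at t within ?S)"
  using g'(2)[of t] t by (simp add: has_vector_derivative_def)
  then have "(g' has_vector_derivative (- sg *: G t)) (at t)"
  using t by (subst (asm) at_within_open) auto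
  then show ?thesis
  by (rule has_vector_derivative_transform_within_open[of _ _ _ ?S]) (use t eq in auto)
 qed
 have Gc: "continuous_on {0<..} G"
 proof (intro continuous_at_imp_continuous_on ballI)
  fix t :: real assume "t \<in> {0<..}"
  then have t: "0 < t" by simp
  have "continuous_on {t/2<..} G"
  proof (rule uniform_limit_theorem)
  show "\<forall>\<^sub>F n in sequentially. continuous_on {t/2<..} (W sg (f1 n))"
  using t by (auto intro!: always_eventually continuous_at_imp_continuous_on
  has_vector_derivative_continuous[OF W_deriv[OF ch(3,4,5) _ s1(2)]])
  show "uniform_limit {t/2<..} (%n. W sg (f1 n)) G sequentially"
  proof (rule uniform_limitI)
  fix ep :: real assume ep: "0 < ep"
  have "\<forall>\<^sub>F n in sequentially. \<forall>x\<in>{t/2<..}. norm (W sg (f1 n) x - G x) <= ep/2"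
  by (rule Gu) (use t ep in auto)
  then show "\<forall>\<^sub>F n in sequentially. \<forall>x\<in>{t/2<..}. dist (W sg (f1 n) x) (G x) < ep"
  proof eventually_elim
  case (elim n)
  show ?case
  proof
  fix x assume "x \<in> {t/2<..}"
  with elim have "norm (W sg (f1 n) x - G x) <= ep/2" by blast
  then show "dist (W sg (f1 n) x) (G x) < ep" using ep unfolding dist_norm by linarith
  qed
  qed
  qed
  qed simp
  then show "isCont G t" using t by (simp add: continuous_on_eq_continuous_at)
 qed
 have vd: "vector_derivative F (at t) = - sg *: G t" if "0 < t" for t
  by (rule vector_derivative_at[OF Fd[OF that]])
 have e0': "(%n. C * e n) ----> 0" using tendsto_mult_right_zero[OF e0] .
 have Vd: "norm (V (f n) 0 - V (f m) 0) <= K\<^sub>M / c\<^sub>0 * norm (f n - f m)" for n m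
  using V_norm[OF T_diff[OF ch(2) ch(2)] T_diff[OF ch(3) ch(3)], of n m 0] V_diff[OF ch(2,3) ch(2,3), of n m 0] by simp
 from cauchy[OF Vd] obtain v where v: "(%n. V (f n) 0) ----> v" by (auto simp: convergent_def)
 have l: "(%n. (1/2) *: (f n + sg *: V (f n) 0)) ----> (1/2) *: (g + sg *: v)"
  by (intro tendsto_intros lim v)
 show thesis
 proof (rule that[of F "(1/2) *: (g + sg *: v)"])
  show "F C1_differentiable_on {0<..}" unfolding C1_differentiable_on_def
  by (intro exI[of _ "%t. - sg *: G t"] conjI ballI continuous_intros Gc) (use Fd in auto)
  show "(F t, - sg *: vector_derivative F (at t)) \<in> T" if "0 < t" for t
  proof -
  have "(F t, G t) \<in> T" by (rule T_closed[OF W_T[OF ch(2,3,4)] Fl[OF that] Gl[OF that]])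
  then show ?thesis using s1(2) by (simp add: vd[OF that])
  qed
  show "(F ---> 0) at_top"
  proof (rule tendsto_uniform_approx[where l="%_. 0", OF eventually_gt_at_top Fe e0' _ tendsto_const])
  fix n
  \<comment> \<open>\<open>f n\<close> is the image of \<open>h n\<close> under \<open>T\<close>, so
    the derivative bound applied to \<open>h n\<close> gives decay of order 1/t.\<close>
  have "\<forall>\<^sub>F t in at_top. norm (W sg (f n) t) <= (C * norm (h n)) / t"
  using eventually_gt_at_top[of 0] by eventually_elim (use C(2)[OF ch(1,2,3)] in auto)
  then show "(W sg (f n) ---> 0) at_top" using div_at_top by (rule Lim_null_comparison)
  qed simp
  show "(F ---> (1/2) *: (g + sg *: v)) (at_right 0)"
  proof (rule tendsto_uniform_approx[OF eventually_at_right_less Fe e0' _ l])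
  show "(W sg (f n) ---> (1/2) *: (f n + sg *: V (f n) 0)) (at_right 0)" for n
  unfolding W_def by (intro tendsto_intros U_at_0[OF ch(2,3,4)] V_at_0[OF ch(2,3,4)])
  qed
 qed (rule l)
qed

text \<open>The two spectral halves are taken along the same approximating sequence; the terms with
  \<open>V\<close> cancel in their sum, and \<open>f\<close> remains.\<close>

theorem splitting:
 "\<exists>F fp G fm. trsol D B F fp \<and> trsol (neg_graph D) B G fm \<and> f = fp + fm"
proof -
 obtain h fn f1 where nice: "!!n. nice (h n) (fn n) (f1 n)" and lim: "fn ----> f"
  using nice_dense by blast
 obtain F fp where F: "F C1_differentiable_on {0<..}" "!!t. 0 < t ==> (F t, - 1 *: vector_derivative F (at t)) \<in> T"
  "(F ---> 0) at_top" "(F ---> fp) (at_right 0)" "(%n. (1/2) *: (fn n + 1 *: V (fn n) 0)) ----> fp"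
  using limit_sol[OF nice lim, of 1] by blast
 obtain G fm where G: "G C1_differentiable_on {0<..}" "!!t. 0 < t ==> (G t, - (- 1) *: vector_derivative G (at t)) \<in> T"
  "(G ---> 0) at_top" "(G ---> fm) (at_right 0)" "(%n. (1/2) *: (fn n + (- 1) *: V (fn n) 0)) ----> fm"
  using limit_sol[OF nice lim, of "-1"] by blast
 have "(%n. (1/2) *: (fn n + 1 *: V (fn n) 0) + (1/2) *: (fn n + (- 1) *: V (fn n) 0)) ----> fp + fm"
  by (rule tendsto_add[OF F(5) G(5)])
 moreover have "(1/2) *: (x + 1 *: y) + (1/2) *: (x + (- 1) *: y) = x" for x y :: 'h
 proof -
  have "(1/2) *: (x + 1 *: y) + (1/2) *: (x + (- 1) *: y) = (1/2) *: (x + x)"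
  by (simp only: scaleR_add_right scaleR_minus_left scaleR_one scaleR_minus_right) simp
  then show ?thesis by (simp only: scaleR_half_double)
 qed
 ultimately have "fn ----> fp + fm" by simp
 then have "f = fp + fm" using lim LIMSEQ_unique by blast
 moreover have "trsol D B F fp" unfolding trsol_def
  using F by (auto simp: T_iff)
 moreover have "trsol (neg_graph D) B G fm" unfolding trsol_def
  using G by (auto simp: T_iff neg_graph_def)
 ultimately show ?thesis by blast
qed

end

section \<open>Pairing of solutions of adjoint equations\<close>

lemma neg_graph_neg_graph [simp]: "neg_graph (neg_graph D) = D"
 by (auto simp: neg_graph_def)

lemma (in coercive_sa) coercive_sa_neg_graph: "coercive_sa (neg_graph D) B ka"
proof (rule coercive_sa.intro)
 fix a b
 show "((a, b) \<in> neg_graph D) = (\<forall>x y. (x, y) \<in> neg_graph D --> inner y a = inner x b)"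
 proof
  assume "(a, b) \<in> neg_graph D"
  then have ab: "(a, - b) \<in> D" by (simp add: neg_graph_def)
  show "\<forall>x y. (x, y) \<in> neg_graph D --> inner y a = inner x b"
  using D_sym[OF _ ab] by (fastforce simp: neg_graph_def)
 next
  assume r: "\<forall>x y. (x, y) \<in> neg_graph D --> inner y a = inner x b"
  have "(a, - b) \<in> D"
  proof (subst D_iff, safe)
  fix x y assume "(x, y) \<in> D"
  then have "(x, - y) \<in> neg_graph D" by (simp add: neg_graph_def)
  with r have "inner (- y) a = inner x b" by blast
  then show "inner y a = inner x (- b)" by simp
  qed
  then show "(a, b) \<in> neg_graph D" by (simp add: neg_graph_def)
 qed
next
 show "b = 0" if "(0, b) \<in> neg_graph D" for b using that D_single[of "- b"] by (simp add: neg_graph_def)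
qed (rule B_bl ka)+

lemma trsol_derivD:
 assumes "trsol D B F f" "0 < t"
 shows "(F has_vector_derivative vector_derivative F (at t)) (at t)" "(B (F t), - vector_derivative F (at t)) \<in> D"
  "isCont F t"
proof -
 show 1: "(F has_vector_derivative vector_derivative F (at t)) (at t)"
 proof -
  obtain F' where "!!x. 0 < x ==> (F has_vector_derivative F' x) (at x)"
  using assms(1) by (auto simp: trsol_def C1_differentiable_on_def)
  from this[OF assms(2)] show ?thesis by (simp add: vector_derivative_at)
 qed
 then show "isCont F t" by (rule has_vector_derivative_continuous)
 show "(B (F t), - vector_derivative F (at t)) \<in> D" using assms by (simp add: trsol_def)
qed

lemma hvd_shift:
 assumes "(F has_vector_derivative d) (at (s + t))"
 shows "((%t. F (s + t)) has_vector_derivative d) (at (t::real))"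
proof -
 have "((%t. s + t) has_vector_derivative 1) (at t)"
  by (auto intro!: derivative_eq_intros simp: has_real_derivative_iff_has_vector_derivative[symmetric])
 from vector_diff_chain_at[OF this assms] show ?thesis by (simp add: comp_def)
qed

lemma trsol_shift:
 assumes F: "trsol D B F f" and s: "0 < s"
 shows "trsol D B (%t. F (s + t)) (F s)"
 unfolding trsol_def
proof (intro conjI allI impI)
 obtain F' where F': "!!t. 0 < t ==> (F has_vector_derivative F' t) (at t)" "continuous_on {0<..} F'"
  using F by (auto simp: trsol_def C1_differentiable_on_def)
 have d: "((%t. F (s + t)) has_vector_derivative F' (s + t)) (at t)" if "0 < t" for t
  by (rule hvd_shift[OF F'(1)]) (use that s in simp)
 show "(%t. F (s + t)) C1_differentiable_on {0<..}"
  unfolding C1_differentiable_on_def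
  using d s by (intro exI[of _ "%t. F' (s + t)"] conjI ballI continuous_on_compose2[OF F'(2)] continuous_intros) auto
 show "(B (F (s + t)), - vector_derivative (%t. F (s + t)) (at t)) \<in> D" if "0 < t" for t
  using trsol_derivD(2)[OF F, of "s + t"] that s
  by (simp add: vector_derivative_at[OF d[OF that]] vector_derivative_at[OF F'(1)])
 have "filterlim (%t. s + t) at_top at_top" by (rule filterlim_tendsto_add_at_top[OF tendsto_const filterlim_ident])
 then show "((%t. F (s + t)) ---> 0) at_top"
  using F unfolding trsol_def by (metis filterlim_compose)
 have "isCont F (s + 0)" using trsol_derivD(3)[OF F s] by simp
 then have "isCont (%t. F (s + t)) 0" by (rule isCont_o2[rotated]) (intro continuous_intros)
 then show "((%t. F (s + t)) ---> F s) (at_right 0)"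
  by (auto simp: isCont_def intro: tendsto_within_subset)
qed

context dual_pair begin

text \<open>The pairing <B F(t), G(t)> is constant, because F' = - D B F and G' = D B' G make its
  derivative cancel by symmetry of \<open>D\<close>. It tends to 0 at infinity and to the claimed
  inner product at zero.\<close>

lemma trace_orth:
 assumes F: "trsol D B F f" and G: "trsol (neg_graph D) B' G g"
 shows "inner (B f) g = 0"
proof -
 let ?ph = "%t. inner (B (F t)) (G t)"
 have d: "(?ph has_vector_derivative 0) (at t)" if t: "0 < t" for t
 proof -
  let ?F' = "vector_derivative F (at t)" and ?G' = "vector_derivative G (at t)"
  have "(?ph has_vector_derivative inner (B (F t)) ?G' + inner (B ?F') (G t)) (at t)"
  by (intro bounded_bilinear.has_vector_derivative[OF bounded_bilinear_inner]
  bounded_linear.has_vector_derivative[OF one.B_bl] trsol_derivD(1)[OF F t] trsol_derivD(1)[OF G t])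
  moreover have "(B' (G t), ?G') \<in> D" using trsol_derivD(2)[OF G t] by (simp add: neg_graph_def)
  from one.D_sym[OF trsol_derivD(2)[OF F t] this]
  have "inner (B ?F') (G t) = - inner (B (F t)) ?G'" by (simp add: adj)
  ultimately show ?thesis by simp
 qed
 have "\<exists>c. \<forall>t\<in>{0<..}. ?ph t = c"
 proof (rule has_vector_derivative_zero_constant)
  show "(?ph has_vector_derivative 0) (at t within {0<..})" if "t \<in> {0<..}" for t
  by (rule has_vector_derivative_at_within[OF d]) (use that in auto)
 qed auto
 then obtain c where c: "!!t. 0 < t ==> ?ph t = c" by auto
 have lim: "(?ph ---> inner (B a) b) A" if "(F ---> a) A" "(G ---> b) A" for a b A
  using that by (intro tendsto_inner bounded_linear.tendsto[OF one.B_bl])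
 have "(?ph ---> inner (B 0) 0) at_top" using F G by (intro lim) (auto simp: trsol_def)
 moreover have "(?ph ---> c) at_top"
  by (rule tendsto_eventually) (use eventually_gt_at_top[of 0] in eventually_elim, simp add: c)
 ultimately have "c = 0" using tendsto_unique[OF trivial_limit_at_top_linorder, of ?ph] by force
 have "(?ph ---> inner (B f) g) (at_right 0)" using F G by (intro lim) (auto simp: trsol_def)
 moreover have "(?ph ---> c) (at_right 0)"
  by (rule tendsto_eventually) (use eventually_at_right_less[of 0] in eventually_elim, simp add: c)
 ultimately show ?thesis using tendsto_unique[OF trivial_limit_at_right_real, of ?ph] \<open>c = 0\<close> by force
qed

text \<open>Running the second solution backwards in time from \<open>s\<close> uses the zero trace of \<open>F\<close>.\<close>

lemma zero_trace_orth:
 assumes F: "trsol D B F 0" and G: "trsol D B' G g" and s: "0 < s"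
 shows "inner (B (F s)) g = 0"
proof -
 let ?ph = "%t. inner (B (F t)) (G (s - t))"
 have d: "(?ph has_vector_derivative 0) (at t)" if t: "0 < t" "t < s" for t
 proof -
  let ?F' = "vector_derivative F (at t)" and ?G' = "vector_derivative G (at (s - t))"
  have st: "0 < s - t" using t by simp
  have "((%t. G (s - t)) has_vector_derivative - ?G') (at t)"
  proof -
  have "((%t. s - t) has_vector_derivative -1) (at t)"
  by (auto intro!: derivative_eq_intros simp: has_real_derivative_iff_has_vector_derivative[symmetric])
  from vector_diff_chain_at[OF this trsol_derivD(1)[OF G st]] show ?thesis by (simp add: comp_def)
  qed
  then have "(?ph has_vector_derivative inner (B (F t)) (- ?G') + inner (B ?F') (G (s - t))) (at t)"
  by (intro bounded_bilinear.has_vector_derivative[OF bounded_bilinear_inner]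
  bounded_linear.has_vector_derivative[OF one.B_bl] trsol_derivD(1)[OF F t(1)])
  moreover from one.D_sym[OF trsol_derivD(2)[OF F t(1)] trsol_derivD(2)[OF G st]]
  have "inner (B ?F') (G (s - t)) = inner (B (F t)) ?G'" by (simp add: adj)
  ultimately show ?thesis by simp
 qed
 have "\<exists>c. \<forall>t\<in>{0<..<s}. ?ph t = c"
 proof (rule has_vector_derivative_zero_constant)
  show "(?ph has_vector_derivative 0) (at t within {0<..<s})" if "t \<in> {0<..<s}" for t
  by (rule has_vector_derivative_at_within[OF d]) (use that in auto)
 qed auto
 then obtain c where c: "!!t. 0 < t ==> t < s ==> ?ph t = c" by auto
 have lim: "(?ph ---> inner (B a) b) A" if "(F ---> a) A" "((%t. G (s - t)) ---> b) A" for a b A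
  using that by (intro tendsto_inner bounded_linear.tendsto[OF one.B_bl])
 have "isCont G (s - 0)" using trsol_derivD(3)[OF G s] by simp
 then have "isCont (%t. G (s - t)) 0" by (rule isCont_o2[rotated]) (intro continuous_intros)
 then have "((%t. G (s - t)) ---> G s) (at_right 0)"
  by (auto simp: isCont_def intro: tendsto_within_subset)
 then have "(?ph ---> inner (B 0) (G s)) (at_right 0)" using F by (intro lim) (auto simp: trsol_def)
 then have 1: "(?ph ---> 0) (at_right 0)" using linear_0[OF bounded_linear.linear[OF one.B_bl]] by simp
 have 2: "(?ph ---> c) (at_right 0)"
  by (rule tendsto_eventually)
  (use eventually_at_right_less[of 0] eventually_at_right_field[of "%t. t < s" 0] s in \<open>auto elim!: eventually_elim2 simp: c\<close>)
 from 1 2 have "c = 0" by (rule tendsto_unique[OF trivial_limit_at_right_real, rotated])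
 have "filterlim (%t. s - t) (at_right 0) (at_left s)"
  unfolding filterlim_at
  by (auto intro!: tendsto_eq_intros simp: eventually_at_filter)
 then have "((%t. G (s - t)) ---> g) (at_left s)"
  using G unfolding trsol_def by (metis filterlim_compose)
 moreover have "(F ---> F s) (at_left s)"
  using trsol_derivD(3)[OF F s] by (auto simp: isCont_def intro: tendsto_within_subset)
 ultimately have 3: "(?ph ---> inner (B (F s)) g) (at_left s)" by (intro lim)
 have 4: "(?ph ---> c) (at_left s)"
  by (rule tendsto_eventually) (use eventually_at_left_real[OF s] in eventually_elim, simp add: c)
 from 3 4 show ?thesis unfolding \<open>c = 0\<close> by (rule tendsto_unique[OF trivial_limit_at_left_real])
qed

end

section \<open>Trace spaces and their annihilators\<close>

locale split_pair = dual_pair D B ka B' ka'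
 for D :: "('h::{real_inner,banach} \<times> 'h) set" and B ka B' ka' +
 assumes split: "!!f. \<exists>F fp G fm. trsol D B F fp \<and> trsol (neg_graph D) B G fm \<and> f = fp + fm"
  and split': "!!f. \<exists>F fp G fm. trsol D B' F fp \<and> trsol (neg_graph D) B' G fm \<and> f = fp + fm"
begin

text \<open>Replacing \<open>D\<close> by its negative while exchanging \<open>B\<close> and
  \<open>B'\<close> preserves all hypotheses, so each statement on \<open>traces\<close> has a
  mirror image on \<open>traces'\<close>.\<close>

lemma split_pair_neg: "split_pair (neg_graph D) B' ka' B ka"
proof -
 interpret n1: coercive_sa "neg_graph D" B' ka' by (rule two.coercive_sa_neg_graph)
 interpret n2: coercive_sa "neg_graph D" B ka by (rule one.coercive_sa_neg_graph)
 show ?thesis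
 proof
  show "inner (B' x) y = inner x (B y)" for x y by (metis adj inner_commute)
  show "\<exists>F fp G fm. trsol (neg_graph D) B' F fp \<and> trsol (neg_graph (neg_graph D)) B' G fm \<and> f = fp + fm" for f
  using split'[of f] by (metis neg_graph_neg_graph add.commute)
  show "\<exists>F fp G fm. trsol (neg_graph D) B F fp \<and> trsol (neg_graph (neg_graph D)) B G fm \<and> f = fp + fm" for f
  using split[of f] by (metis neg_graph_neg_graph add.commute)
 qed
qed

lemma dual_pair_neg: "dual_pair (neg_graph D) B ka B' ka'"
proof -
 interpret n1: coercive_sa "neg_graph D" B' ka' by (rule two.coercive_sa_neg_graph)
 interpret n2: coercive_sa "neg_graph D" B ka by (rule one.coercive_sa_neg_graph)
 show ?thesis by unfold_locales (rule adj)
qed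

lemma trace_orth':
 "trsol (neg_graph D) B F f ==> trsol D B' G g ==> inner (B f) g = 0"
 using dual_pair.trace_orth[OF dual_pair_neg] by simp

definition traces :: "'h set" where "traces = {f. \<exists>F. trsol D B F f}"

definition traces' :: "'h set" where "traces' = {g. \<exists>G. trsol (neg_graph D) B' G g}"

lemma B_zero_iff: "B x = 0 \<longleftrightarrow> x = 0"
 by (metis one.B_inv(4) linear_0[OF bounded_linear.linear[OF one.B_bl]])

text \<open>For the converse split \<open>f = fp + fm\<close> and an arbitrary
  \<open>g = gp + gm\<close>. The vector \<open>B fm\<close> is orthogonal to \<open>gm\<close> by
  hypothesis and \<open>trace_orth\<close>, and to \<open>gp\<close> by \<open>trace_orth'\<close>;
  hence \<open>fm = 0\<close>.\<close>

lemma traces_iff: "f \<in> traces \<longleftrightarrow> (\<forall>g\<in>traces'. inner (B f) g = 0)"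
proof
 show "\<forall>g\<in>traces'. inner (B f) g = 0" if "f \<in> traces"
  using that trace_orth by (auto simp: traces_def traces'_def)
next
 assume orth: "\<forall>g\<in>traces'. inner (B f) g = 0"
 obtain F fp G fm where f: "trsol D B F fp" "trsol (neg_graph D) B G fm" "f = fp + fm"
  using split by blast
 have "inner (B fm) g = 0" for g
 proof -
  obtain G1 gp G2 gm where g: "trsol D B' G1 gp" "trsol (neg_graph D) B' G2 gm" "g = gp + gm"
  using split' by blast
  have "inner (B f) gm = 0" using orth g(2) by (auto simp: traces'_def)
  moreover have "inner (B fp) gm = 0" by (rule trace_orth[OF f(1) g(2)])
  ultimately have "inner (B fm) gm = 0"
  by (simp add: f(3) linear_add[OF bounded_linear.linear[OF one.B_bl]] inner_add_left)
  moreover have "inner (B fm) gp = 0" by (rule trace_orth'[OF f(2) g(1)])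
  ultimately show ?thesis by (simp add: g(3) inner_add_right)
 qed
 then have "B fm = 0" by (metis inner_eq_zero_iff)
 then have "f = fp" using f(3) by (simp add: B_zero_iff)
 then show "f \<in> traces" using f(1) by (auto simp: traces_def)
qed

text \<open>\<open>B (F s)\<close> is orthogonal to both parts of every vector: to traces of
  \<open>D B'\<close> by the pairing with reversed time, and to traces of \<open>- D B'\<close>
  because \<open>F s\<close> is itself the trace of the shifted solution.\<close>

lemma trsol_zero:
 assumes F: "trsol D B F 0" and s: "0 < s"
 shows "F s = 0"
proof -
 have "inner (B (F s)) g = 0" for g
 proof -
  obtain G1 gp G2 gm where g: "trsol D B' G1 gp" "trsol (neg_graph D) B' G2 gm" "g = gp + gm"
  using split' by blast
  show ?thesis using zero_trace_orth[OF F g(1) s] trace_orth[OF trsol_shift[OF F s] g(2)]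
  by (simp add: g(3) inner_add_right)
 qed
 then have "B (F s) = 0" by (metis inner_eq_zero_iff)
 then show ?thesis by (simp add: B_zero_iff)
qed

lemma trsol_diff:
 assumes F: "trsol D B F f" and G: "trsol D B G g"
 shows "trsol D B (%t. F t - G t) (f - g)"
proof -
 have d: "((%t. F t - G t) has_vector_derivative vector_derivative F (at t) - vector_derivative G (at t)) (at t)" if "0 < t" for t
  by (intro has_vector_derivative_diff trsol_derivD(1)[OF F that] trsol_derivD(1)[OF G that])
 show ?thesis unfolding trsol_def
 proof (intro conjI allI impI)
  show "(%t. F t - G t) C1_differentiable_on {0<..}"
  using F G by (intro C1_differentiable_on_diff) (auto simp: trsol_def)
  show "(B (F t - G t), - vector_derivative (%t. F t - G t) (at t)) \<in> D" if "0 < t" for t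
  using one.D_diff[OF trsol_derivD(2)[OF F that] trsol_derivD(2)[OF G that]]
  by (simp add: vector_derivative_at[OF d[OF that]] linear_diff[OF bounded_linear.linear[OF one.B_bl]])
  show "((%t. F t - G t) ---> 0) at_top" "((%t. F t - G t) ---> f - g) (at_right 0)"
  using F G tendsto_diff[of F 0 at_top G 0] by (auto simp: trsol_def intro!: tendsto_diff)
 qed
qed

lemma trsol_unique:
 assumes "trsol D B F f" "trsol D B G f" "0 < t"
 shows "F t = G t"
 using trsol_zero[OF _ assms(3), of "%t. F t - G t"] trsol_diff[OF assms(1,2)] by simp

lemma traces'_iff: "g \<in> traces' \<longleftrightarrow> (\<forall>f\<in>traces. inner (B f) g = 0)"
 and trsol_unique':
  "trsol (neg_graph D) B' F g ==> trsol (neg_graph D) B' G g ==> 0 < t ==> F t = G t"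
proof -
 interpret n: split_pair "neg_graph D" B' ka' B ka by (rule split_pair_neg)
 show "g \<in> traces' \<longleftrightarrow> (\<forall>f\<in>traces. inner (B f) g = 0)"
  using n.traces_iff[of g] unfolding n.traces_def n.traces'_def traces_def traces'_def neg_graph_neg_graph
  by (simp add: adj inner_commute[of "B' g"])
 show "trsol (neg_graph D) B' F g ==> trsol (neg_graph D) B' G g ==> 0 < t ==> F t = G t"
  by (rule n.trsol_unique)
qed

lemma traces_subspace: "subspace traces" and traces_closed: "closed traces"
proof -
 have eq: "traces = (\<Inter>g\<in>traces'. {f. inner f (B' g) = 0})"
  using traces_iff by (auto simp: adj)
 have "subspace {f. inner f (B' g) = 0}" for g by (auto simp: subspace_def inner_add_left)
 then show "subspace traces" unfolding eq by (auto simp: subspace_def)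
 have "closed {f. inner f (B' g) = 0}" for g by (intro closed_Collect_eq continuous_intros)
 then show "closed traces" unfolding eq by auto
qed

lemma B'_traces': "B' ` traces' = {z. \<forall>f\<in>traces. inner f z = 0}"
proof (intro set_eqI iffI)
 show "z \<in> {z. \<forall>f\<in>traces. inner f z = 0}" if "z \<in> B' ` traces'" for z
  using that traces'_iff by (auto simp: adj)
 fix z assume z: "z \<in> {z. \<forall>f\<in>traces. inner f z = 0}"
 have "inv B' z \<in> traces'" unfolding traces'_iff using z by (auto simp: adj two.B_inv)
 then show "z \<in> B' ` traces'" by (metis image_eqI two.B_inv(3))
qed

end

lemma dual_pair_split_pair:
 assumes "dual_pair D B ka B' ka'" "weak_square_sa D B ka"
 shows "split_pair D B ka B' ka'"
proof -
 interpret dual_pair D B ka B' ka' by fact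
 interpret w: weak_square_sa D B ka by fact
 interpret w': weak_square_sa D B' ka' by (rule weak_square_dual) fact
 show ?thesis by unfold_locales (rule w.splitting w'.splitting)+
qed

text \<open>
 With \<open>X\<close> the space of traces of \<open>D B\<close>, the map \<open>g \<mapsto> B' g\<close> takes the traces of \<open>-D B'\<close> onto \<open>X\<^sup>\<bottom>\<close>.
\<close>

theorem split_pair_duality:
 fixes D :: "(('a::{real_inner,banach} \<times> 'b::{real_inner,banach}) \<times> 'a \<times> 'b) set"
 assumes "split_pair D B ka B' ka'"
 shows "(\<forall>k. \<exists>!f. (\<exists>F. trsol D B F f) \<and> snd f = k) \<longleftrightarrow>
  (\<forall>h. \<exists>!g. (\<exists>G. trsol (neg_graph D) B' G g) \<and> fst (B' g) = h)"
proof -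
 interpret split_pair D B ka B' ka' by fact
 let ?Y = "B' ` traces'"
 have Y: "?Y = {y. \<forall>x\<in>traces. inner x y = 0}" by (rule B'_traces')
 have sY: "subspace ?Y" unfolding Y by (auto simp: subspace_def inner_add_right)
 have cY: "closed ?Y"
 proof -
  have "?Y = (\<Inter>x\<in>traces. {y. inner x y = 0})" unfolding Y by auto
  moreover have "closed {y. inner x y = 0}" for x :: "'a \<times> 'b" by (intro closed_Collect_eq continuous_intros)
  ultimately show ?thesis by auto
 qed
 have X: "traces = {x. \<forall>y\<in>?Y. inner x y = 0}"
  using traces_iff by (auto simp: adj)
 have inj: "B' x = B' y \<longleftrightarrow> x = y" for x y by (metis two.B_inv(4))
 have "(\<forall>k. \<exists>!x. x \<in> traces \<and> snd x = k) \<longleftrightarrow> (\<forall>h. \<exists>!y. y \<in> ?Y \<and> fst y = h)"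
 proof (intro iffI allI)
  fix h assume k: "\<forall>k. \<exists>!x. x \<in> traces \<and> snd x = k"
  show "\<exists>!y. y \<in> ?Y \<and> fst y = h"
  by (rule snd_bij_imp_orth_fst_bij[OF traces_subspace traces_closed _ Y]) (rule k[rule_format])
 next
  fix k assume h: "\<forall>h. \<exists>!y. y \<in> ?Y \<and> fst y = h"
  show "\<exists>!x. x \<in> traces \<and> snd x = k"
  by (rule fst_bij_imp_orth_snd_bij[OF sY cY _ X]) (rule h[rule_format])
 qed
 moreover have "(\<exists>!y. y \<in> ?Y \<and> fst y = h) \<longleftrightarrow> (\<exists>!g. g \<in> traces' \<and> fst (B' g) = h)" for h
 proof
  assume "\<exists>!y. y \<in> ?Y \<and> fst y = h"
  then obtain y where y: "y \<in> ?Y \<and> fst y = h" "\<forall>z. z \<in> ?Y \<and> fst z = h --> z = y" by (rule ex1E)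
  then obtain g where g: "g \<in> traces'" "y = B' g" by blast
  show "\<exists>!g. g \<in> traces' \<and> fst (B' g) = h"
  proof (rule ex1I[of _ g])
  fix g' assume "g' \<in> traces' \<and> fst (B' g') = h"
  then have "B' g' = y" using y(2) by blast
  then show "g' = g" by (simp add: g(2) inj)
  qed (use g y(1) in simp)
 next
  assume "\<exists>!g. g \<in> traces' \<and> fst (B' g) = h"
  then obtain g where g: "g \<in> traces' \<and> fst (B' g) = h" "\<forall>g'. g' \<in> traces' \<and> fst (B' g') = h --> g' = g" by (rule ex1E)
  show "\<exists>!y. y \<in> ?Y \<and> fst y = h"
  proof (rule ex1I[of _ "B' g"])
  fix y assume y: "y \<in> ?Y \<and> fst y = h"
  then obtain g' where g': "g' \<in> traces'" "y = B' g'" by blast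
  then show "y = B' g" using g(2)[rule_format, of g'] y by simp
  qed (use g(1) in blast)
 qed
 ultimately show ?thesis by (simp add: traces_def traces'_def)
qed

section \<open>The Hilbert space \<open>L\<^sub>2\<close>\<close>

lemma sqi_rep [simp]: "square_integrable (rep_L2 f)"
 using Quotient3_rep_reflp[OF Quotient3_L2] by blast

lemma abs_rep_L2 [simp]: "abs_L2 (rep_L2 f) = f"
 by (rule Quotient3_abs_rep[OF Quotient3_L2])

lemma abs_L2_eq_iff:
 "square_integrable f ==> square_integrable g ==> abs_L2 f = abs_L2 g \<longleftrightarrow> (AEL x. f x = g x)"
 using Quotient3_rel[OF Quotient3_L2, of f g] by auto

lemma rep_abs_L2: "square_integrable f ==> AEL x. rep_L2 (abs_L2 f) x = f x"
 using abs_L2_eq_iff[of "rep_L2 (abs_L2 f)" f] by simp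

lemma rep_L2_meas [measurable]: "rep_L2 f \<in> lmeas"
 using sqi_rep[of f] unfolding square_integrable_def by blast

lemma L2_eqI: "(AEL x. rep_L2 f x = rep_L2 g x) ==> f = g"
 using abs_L2_eq_iff[of "rep_L2 f" "rep_L2 g"] by simp

lemma abs_L2_add: "square_integrable f ==> square_integrable g ==> abs_L2 f + abs_L2 g = abs_L2 (%x. f x + g x)"
 by (rule plus_L2.abs_eq) auto

lemma abs_L2_diff: "square_integrable f ==> square_integrable g ==> abs_L2 f - abs_L2 g = abs_L2 (%x. f x - g x)"
 by (rule minus_L2.abs_eq) auto

lemma abs_L2_scaleR: "square_integrable f ==> c *: abs_L2 f = abs_L2 (%x. c *: f x)"
 by (rule scaleR_L2.abs_eq) auto

lemma abs_L2_minus: "square_integrable f ==> - abs_L2 f = abs_L2 (%x. - f x)"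
 by (rule uminus_L2.abs_eq) auto

lemma inner_abs_L2: "square_integrable f ==> square_integrable g ==> inner (abs_L2 f) (abs_L2 g) = (LIN x. f x \<bullet> g x)"
 by (rule inner_L2.abs_eq) auto

lemma inner_L2: "inner f g = (LIN x. rep_L2 f x \<bullet> rep_L2 g x)"
 using inner_abs_L2[of "rep_L2 f" "rep_L2 g"] by simp

lemma inner_L2_abs: "square_integrable g ==> inner f (abs_L2 g) = (LIN x. rep_L2 f x \<bullet> g x)"
 using inner_abs_L2[of "rep_L2 f" g] by simp

lemma rep_L2_add: "AEL x. rep_L2 (f + g) x = rep_L2 f x + rep_L2 g x"
 using rep_abs_L2[OF square_integrable_add[of "rep_L2 f" "rep_L2 g"]] abs_L2_add[of "rep_L2 f" "rep_L2 g"] by simp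

lemma rep_L2_scaleR: "AEL x. rep_L2 (c *: f) x = c *: rep_L2 f x"
 using rep_abs_L2[OF square_integrable_scaleR[of "rep_L2 f" c]] abs_L2_scaleR[of "rep_L2 f" c] by simp

lemma rep_L2_minus: "AEL x. rep_L2 (- f) x = - rep_L2 f x"
 using rep_abs_L2[OF square_integrable_minus[of "rep_L2 f"]] abs_L2_minus[of "rep_L2 f"] by simp

lemma rep_L2_zero: "AEL x. rep_L2 0 x = 0"
 using rep_abs_L2[OF square_integrable_zero] by (simp add: zero_L2.abs_eq)

lemma norm_L2_sq: "(norm f)^2 = (LIN x. (norm (rep_L2 f x))\<^sup>2)"
 by (simp add: power2_norm_eq_inner inner_L2)

lemma norm_abs_L2_sq: "square_integrable f ==> (norm (abs_L2 f))\<^sup>2 = (LIN x. (norm (f x))\<^sup>2)"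
 by (simp add: power2_norm_eq_inner inner_abs_L2)

lemma sqi_bound:
 assumes g: "square_integrable g" and f: "f \<in> lmeas" and le: "AEL x. norm (f x) <= norm (g x)"
 shows "square_integrable f"
 unfolding square_integrable_def
proof
 show "integrable lebesgue (%x. (norm (f x))^2)"
  by (rule Bochner_Integration.integrable_bound[of _ "%x. (norm (g x))^2"])
  (use g f le in \<open>auto simp: square_integrable_def elim!: eventually_mono intro: power_mono\<close>)
qed (rule f)

lemma sum_abs_L2:
 assumes "!!k. square_integrable (d k)"
 shows "square_integrable (%x. \<Sum>k<N. d k x) \<and> (\<Sum>k<N. abs_L2 (d k)) = abs_L2 (%x. \<Sum>k<(N::nat). d k x)"
proof (induction N)
 case 0
 then show ?case by (simp add: zero_L2.abs_eq square_integrable_zero)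
next
 case (Suc N)
 then show ?case using assms[of N] by (simp add: square_integrable_add abs_L2_add)
qed

text \<open>Riesz-Fischer. Monotone convergence bounds the sum of the pointwise norms in L2; it is
  finite almost everywhere and dominates all tails of the series.\<close>

lemma L2_summable_geometric:
 fixes u :: "nat => ('a::euclidean_space, 'b::euclidean_space) L2"
 assumes u: "!!k. norm (u k) <= (1/2) ^ k"
 shows "\<exists>s. (%N. \<Sum>k<N. u k) ----> s"
proof -
 define d where "d k = rep_L2 (u k)" for k
 have [measurable]: "d k \<in> lmeas" for k by (simp add: d_def)
 have dsq: "square_integrable (d k)" for k by (simp add: d_def)
 define n where "n k x = norm (d k x)" for k x
 have nsq: "square_integrable (n k)" for k
  using dsq[of k] by (auto simp: square_integrable_def n_def[abs_def])
 have nnorm: "norm (abs_L2 (n k)) = norm (u k)" for k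
 proof -
  have "(norm (abs_L2 (n k)))^2 = (norm (u k))^2"
  unfolding norm_abs_L2_sq[OF nsq] norm_L2_sq[of "u k"] by (simp add: n_def d_def)
  then show ?thesis by simp
 qed
 define S where "S N x = (\<Sum>k<N. n k x)" for N x
 have S0: "0 <= S N x" for N x by (simp add: S_def n_def sum_nonneg)
 have Ssq: "square_integrable (S N)" for N
  using sum_abs_L2[of n N] nsq by (simp add: S_def[abs_def])
 have Sle: "(LIN x. (S N x)\<^sup>2) <= 4" for N
 proof -
  have "norm (abs_L2 (S N)) <= (\<Sum>k<N. norm (abs_L2 (n k)))"
  using sum_abs_L2[of n N] nsq norm_sum[of "%k. abs_L2 (n k)" "{..<N}"] by (simp add: S_def[abs_def])
  also have "\<dots> <= (\<Sum>k<N. (1/2) ^ k)" unfolding nnorm by (intro sum_mono u)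
  also have "\<dots> <= 2" by (simp add: sum_gp_strict)
  finally have "(norm (abs_L2 (S N)))^2 <= 2^2" by (intro power_mono) auto
  then show ?thesis unfolding norm_abs_L2_sq[OF Ssq] by simp
 qed
 define G where "G x = (SUP N. ennreal ((S N x)^2))" for x
 have [measurable]: "S N \<in> lmeas" for N using Ssq by (simp add: square_integrable_def)
 have Sinc: "S M x <= S N x" if "M <= N" for M N x
  unfolding S_def using that by (intro sum_mono2) (auto simp: n_def)
 have "(\<integral>\<^sup>+x. G x \<partial>lebesgue) = (SUP N. \<integral>\<^sup>+x. ennreal ((S N x)^2) \<partial>lebesgue)"
  unfolding G_def
  by (rule nn_integral_monotone_convergence_SUP)
  (auto simp: incseq_def le_fun_def intro!: ennreal_leI power_mono Sinc S0)
 also have "\<dots> <= ennreal 4"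
 proof (rule SUP_least)
  fix N
  have "(\<integral>\<^sup>+x. ennreal ((S N x)^2) \<partial>lebesgue) = ennreal (LIN x. (S N x)\<^sup>2)"
  using Ssq[of N] by (intro nn_integral_eq_integral) (auto simp: square_integrable_def)
  then show "(\<integral>\<^sup>+x. ennreal ((S N x)^2) \<partial>lebesgue) <= ennreal 4" using ennreal_leI[OF Sle[of N]] by simp
 qed
 finally have Gi: "(\<integral>\<^sup>+x. G x \<partial>lebesgue) <= ennreal 4" .
 have [measurable]: "G \<in> lmeas" unfolding G_def by measurable
 have Gf: "AEL x. G x ~= \<infinity>"
  by (rule nn_integral_PInf_AE) (use Gi in \<open>auto simp: top_unique\<close>)
 define g where "g x = sqrt (enn2real (G x))" for x
 have gm [measurable]: "g \<in> lmeas" unfolding g_def[abs_def] by measurable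
 have gS: "S N x <= g x" if "G x ~= \<infinity>" for N x
 proof -
  have "ennreal ((S N x)^2) <= G x" unfolding G_def by (rule SUP_upper) simp
  also have "G x = ennreal (enn2real (G x))" using that by (simp add: ennreal_enn2real_if)
  finally have "(S N x)^2 <= enn2real (G x)" by (simp add: ennreal_le_iff)
  then show ?thesis unfolding g_def by (rule real_le_rsqrt)
 qed
 have g2: "integrable lebesgue (%x. (g x)^2)"
 proof (rule integrableI_bounded)
  show "(%x. (g x)^2) \<in> lmeas" by measurable
  have "(\<integral>\<^sup>+x. ennreal (norm ((g x)^2)) \<partial>lebesgue) <= (\<integral>\<^sup>+x. G x \<partial>lebesgue)"
  by (intro nn_integral_mono) (simp add: g_def ennreal_enn2real_if)
  also have "\<dots> < \<infinity>" using Gi by (simp add: le_less_trans)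
  finally show "(\<integral>\<^sup>+x. ennreal (norm ((g x)^2)) \<partial>lebesgue) < \<infinity>" .
 qed
 have sm: "summable (%k. norm (d k x))" if "G x ~= \<infinity>" for x
 proof (rule summableI_nonneg_bounded)
  show "(\<Sum>k<N. norm (d k x)) <= g x" for N using gS[OF that, of N] by (simp add: S_def n_def)
 qed simp
 define s where "s x = (\<Sum>k. d k x)" for x
 have [measurable]: "s \<in> lmeas" unfolding s_def by measurable
 have tail: "norm (s x - (\<Sum>k<N. d k x)) <= g x" if "G x ~= \<infinity>" for N x
 proof -
  have sn: "summable (%k. d k x)" by (rule summable_norm_cancel[OF sm[OF that]])
  have "s x - (\<Sum>k<N. d k x) = (\<Sum>k. d (k + N) x)"
  unfolding s_def by (simp add: suminf_minus_initial_segment[OF sn])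
  also have "norm \<dots> <= (\<Sum>k. norm (d (k + N) x))"
  by (rule summable_norm) (rule summable_ignore_initial_segment[OF sm[OF that]])
  also have "\<dots> = (\<Sum>k. norm (d k x)) - (\<Sum>k<N. norm (d k x))"
  by (simp add: suminf_minus_initial_segment[OF sm[OF that]])
  also have "\<dots> <= (\<Sum>k. norm (d k x))" by (simp add: sum_nonneg)
  also have "\<dots> <= g x"
  by (rule suminf_le_const[OF sm[OF that]]) (use gS[OF that] in \<open>simp add: S_def n_def\<close>)
  finally show ?thesis .
 qed
 have gsq: "square_integrable g"
  unfolding square_integrable_def using g2 gm by (simp add: abs_of_nonneg g_def)
 have g0: "0 <= g x" for x by (simp add: g_def)
 have ssq: "square_integrable s"
 proof (rule sqi_bound[OF gsq])
  show "AEL x. norm (s x) <= norm (g x)"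
  using Gf by eventually_elim (use tail[of _ 0] g0 in simp)
 qed simp
 have dif: "square_integrable (%x. s x - (\<Sum>k<N. d k x))" for N
  using square_integrable_diff[OF ssq conjunct1[OF sum_abs_L2[of d N]]] dsq by simp
 have "(%N. LIN x. (norm (s x - (\<Sum>k<N. d k x)))\<^sup>2) ----> (LINT x|(lebesgue :: 'a measure). (0::real))"
 proof (rule integral_dominated_convergence[OF _ _ g2])
  show "AEL x. (%N. (norm (s x - (\<Sum>k<N. d k x)))^2) ----> 0"
  using Gf
  proof eventually_elim
  case (elim x)
  have "(%N. \<Sum>k<N. d k x) ----> s x"
  unfolding s_def by (rule summable_LIMSEQ[OF summable_norm_cancel[OF sm[OF elim]]])
  then have "(%N. (norm (s x - (\<Sum>k<N. d k x)))^2) ----> (norm (s x - s x))\<^sup>2"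
  by (intro tendsto_intros)
  then show ?case by simp
  qed
  show "AEL x. norm ((norm (s x - (\<Sum>k<N. d k x)))^2) <= (g x)^2" for N
  using Gf by eventually_elim (use tail in \<open>simp add: power_mono\<close>)
 qed auto
 then have "(%N. (norm (abs_L2 s - (\<Sum>k<N. u k)))^2) ----> 0"
 proof -
  have "abs_L2 s - (\<Sum>k<N. u k) = abs_L2 (%x. s x - (\<Sum>k<N. d k x))" for N
  proof -
  have "(\<Sum>k<N. u k) = (\<Sum>k<N. abs_L2 (d k))" by (simp add: d_def)
  also have "\<dots> = abs_L2 (%x. \<Sum>k<N. d k x)" using sum_abs_L2[of d N] dsq by simp
  finally show ?thesis using ssq sum_abs_L2[of d N] dsq by (simp add: abs_L2_diff)
  qed
  then have "(norm (abs_L2 s - (\<Sum>k<N. u k)))^2 = (LIN x. (norm (s x - (\<Sum>k<N. d k x)))\<^sup>2)" for N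
  by (simp add: norm_abs_L2_sq[OF dif])
  then show ?thesis using \<open>(%N. LIN x. (norm (s x - (\<Sum>k<N. d k x)))\<^sup>2) ----> (LINT x|(lebesgue :: 'a measure). (0::real))\<close> by simp
 qed
 from tendsto_real_sqrt[OF this] have "(%N. norm (abs_L2 s - (\<Sum>k<N. u k))) ----> 0" by simp
 then have "(%N. norm ((\<Sum>k<N. u k) - abs_L2 s)) ----> 0" by (simp add: norm_minus_commute)
 then have "(%N. \<Sum>k<N. u k) ----> abs_L2 s" by (simp add: LIM_zero_iff tendsto_norm_zero_iff)
 then show ?thesis by blast
qed

instance L2 :: (euclidean_space, euclidean_space) banach
proof
 fix X :: "nat => ('a, 'b) L2" assume X: "Cauchy X"
 have "\<exists>N. \<forall>m\<ge>N. \<forall>n\<ge>N. norm (X m - X n) < (1/2) ^ k" for k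
  using X unfolding Cauchy_iff by (meson half_gt_zero_iff zero_less_one zero_less_power)
 then obtain N where N: "!!k m n. m >= N k ==> n >= N k ==> norm (X m - X n) < (1/2) ^ k" by metis
 \<comment> \<open>The partial sums dominate each \<open>N k\<close>, and the summand
   \<open>k\<close> makes the subsequence strictly increasing.\<close>
 define r where "r k = (\<Sum>i\<le>k. N i) + k" for k
 have rN: "N k <= r k" for k unfolding r_def by (rule trans_le_add1) (rule member_le_sum, auto)
 have rmono: "strict_mono r" by (rule strict_monoI_Suc) (simp add: r_def)
 define u where "u k = X (r (Suc k)) - X (r k)" for k
 have "norm (u k) <= (1/2) ^ k" for k
  unfolding u_def using N[of k "r (Suc k)" "r k"] rN[of k] strict_monoD[OF rmono, of k "Suc k"] by simp
 then obtain s where s: "(%n. \<Sum>k<n. u k) ----> s" using L2_summable_geometric by blast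
 have "(\<Sum>k<n. u k) = X (r n) - X (r 0)" for n unfolding u_def by (rule sum_lessThan_telescope)
 then have "(%n. X (r n)) ----> s + X (r 0)"
  using tendsto_add[OF s tendsto_const[of "X (r 0)"]] by simp
 then have lim: "(%n. X (r n)) ----> s + X (r 0)" .
 have "X ----> s + X (r 0)"
 proof (rule LIMSEQ_I)
  fix e :: real assume e: "0 < e"
  obtain M where M: "!!m n. m >= M ==> n >= M ==> norm (X m - X n) < e/2"
  using X e unfolding Cauchy_iff by (metis half_gt_zero)
  obtain M' where M': "!!n. n >= M' ==> norm (X (r n) - (s + X (r 0))) < e/2"
  using LIMSEQ_D[OF lim, of "e/2"] e by auto
  have "norm (X n - (s + X (r 0))) < e" if n: "n >= M" for n
  proof -
  define k where "k = max M M'"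
  have "M <= r k" using seq_suble[OF rmono, of k] by (simp add: k_def)
  then have "norm (X n - X (r k)) < e/2" using M n by blast
  moreover have "norm (X (r k) - (s + X (r 0))) < e/2" by (rule M') (simp add: k_def)
  ultimately show ?thesis using norm_diff_triangle_less[of "X n" "X (r k)" "e/2" "s + X (r 0)" "e/2"] by simp
  qed
  then show "\<exists>no. \<forall>n\<ge>no. norm (X n - (s + X (r 0))) < e" by blast
 qed
 then show "convergent X" by (auto simp: convergent_def)
qed

subsection \<open>Pointwise operators and translations\<close>

definition L2_map :: "('a::euclidean_space => 'b::euclidean_space => 'c::euclidean_space) => ('a, 'b) L2 => ('a, 'c) L2" where
 "L2_map Ph f = abs_L2 (%x. Ph x (rep_L2 f x))"

text \<open>Linearity is demanded everywhere and the norm bound only almost everywhere, which fits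
  multiplication by an essentially bounded matrix.\<close>

definition pw_bdd :: "('a::euclidean_space => 'b::euclidean_space => 'c::euclidean_space) => bool" where
 "pw_bdd Ph \<longleftrightarrow> (\<forall>x. linear (Ph x)) \<and> (\<exists>K. AEL x. \<forall>v. norm (Ph x v) <= K * norm v) \<and>
  (\<forall>f. f \<in> lmeas --> (%x. Ph x (f x)) \<in> lmeas)"

lemma pw_bdd_sqi:
 assumes "pw_bdd Ph" "square_integrable f"
 shows "square_integrable (%x. Ph x (f x))"
proof -
 obtain K where K: "AEL x. \<forall>v. norm (Ph x v) <= K * norm v"
  using assms(1) by (auto simp: pw_bdd_def)
 show ?thesis
 proof (rule sqi_bound[OF square_integrable_scaleR[OF assms(2), of "\<bar>K\<bar>"]])
  show "(%x. Ph x (f x)) \<in> lmeas"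
  using assms by (auto simp: pw_bdd_def square_integrable_def)
  show "AEL x. norm (Ph x (f x)) <= norm (\<bar>K\<bar> *: f x)"
  using K
  proof eventually_elim
  case (elim x)
  have "norm (Ph x (f x)) <= K * norm (f x)" using elim by blast
  also have "\<dots> <= \<bar>K\<bar> * norm (f x)" by (intro mult_right_mono) auto
  finally show ?case by simp
  qed
 qed
qed

lemma rep_L2_map:
 assumes "pw_bdd Ph"
 shows "AEL x. rep_L2 (L2_map Ph f) x = Ph x (rep_L2 f x)"
 unfolding L2_map_def by (rule rep_abs_L2[OF pw_bdd_sqi[OF assms]]) simp

lemma L2_map_norm:
 assumes P: "pw_bdd Ph" and K: "AEL x. \<forall>v. norm (Ph x v) <= K * norm v" "0 <= K"
 shows "norm (L2_map Ph f) <= K * norm f"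
proof (rule power2_le_imp_le)
 have sq: "square_integrable (%x. Ph x (rep_L2 f x))" by (rule pw_bdd_sqi[OF P]) simp
 have "(norm (L2_map Ph f))^2 = (LIN x. (norm (Ph x (rep_L2 f x)))\<^sup>2)"
  unfolding L2_map_def by (rule norm_abs_L2_sq[OF sq])
 also have "\<dots> <= (LIN x. K\<^sup>2 * (norm (rep_L2 f x))^2)"
 proof (rule integral_mono_AE)
  show "AEL x. (norm (Ph x (rep_L2 f x)))\<^sup>2 <= K^2 * (norm (rep_L2 f x))^2"
  using K(1)
  proof eventually_elim
  case (elim x)
  then have "(norm (Ph x (rep_L2 f x)))^2 <= (K * norm (rep_L2 f x))^2" by (intro power_mono) auto
  then show ?case by (simp add: power_mult_distrib)
  qed
 qed (use sq sqi_rep[of f] in \<open>auto simp: square_integrable_def\<close>)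
 also have "\<dots> = (K * norm f)^2" by (simp add: norm_L2_sq power_mult_distrib)
 finally show "(norm (L2_map Ph f))^2 <= (K * norm f)^2" .
qed (use K in simp)

lemma L2_map_bl:
 assumes P: "pw_bdd Ph"
 shows "bounded_linear (L2_map Ph)"
proof -
 obtain K where K: "AEL x. \<forall>v. norm (Ph x v) <= K * norm v"
  using assms(1) by (auto simp: pw_bdd_def)
 have lin: "linear (Ph x)" for x using P by (simp add: pw_bdd_def)
 have K': "AEL x. \<forall>v. norm (Ph x v) <= \<bar>K\<bar> * norm v"
  using K by eventually_elim (metis abs_ge_self mult_right_mono norm_ge_zero order_trans)
 show ?thesis
 proof (rule bounded_linear_intro[where K="\<bar>K\<bar>"])
  show "L2_map Ph (f + g) = L2_map Ph f + L2_map Ph g" for f g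
  proof (rule L2_eqI)
  show "AEL x. rep_L2 (L2_map Ph (f + g)) x = rep_L2 (L2_map Ph f + L2_map Ph g) x"
  using rep_L2_map[OF P, of "f + g"] rep_L2_map[OF P, of f] rep_L2_map[OF P, of g]
  rep_L2_add[of f g] rep_L2_add[of "L2_map Ph f" "L2_map Ph g"]
  by eventually_elim (simp add: linear_add[OF lin])
  qed
  show "L2_map Ph (c *: f) = c *: L2_map Ph f" for c f
  proof (rule L2_eqI)
  show "AEL x. rep_L2 (L2_map Ph (c *: f)) x = rep_L2 (c *: L2_map Ph f) x"
  using rep_L2_map[OF P, of "c *: f"] rep_L2_map[OF P, of f]
  rep_L2_scaleR[of c f] rep_L2_scaleR[of c "L2_map Ph f"]
  by eventually_elim (simp add: linear_cmul[OF lin])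
  qed
  show "norm (L2_map Ph f) <= norm f * \<bar>K\<bar>" for f
  using L2_map_norm[OF P K', of f] by (simp add: mult.commute)
 qed
qed

lemma pw_bdd_const:
 fixes L :: "'b::euclidean_space => 'c::euclidean_space"
 assumes "linear L"
 shows "pw_bdd (%_::'a::euclidean_space. L)"
proof -
 have bl: "bounded_linear L" using assms by (simp add: linear_conv_bounded_linear)
 then obtain K where "\<forall>v. norm (L v) <= norm v * K" using bounded_linear.bounded by blast
 then have "\<exists>K. AE x::'a in lebesgue. \<forall>v. norm (L v) <= K * norm v"
  by (intro exI[of _ K]) (simp add: mult.commute)
 moreover have "(%x. L (f x)) \<in> lmeas" if "f \<in> lmeas" for f :: "'a => 'b"
  using measurable_compose[OF that borel_measurable_continuous_onI[OF bounded_linear.continuous_on[OF bl continuous_on_id]]] .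
 ultimately show ?thesis using assms by (simp add: pw_bdd_def)
qed

lemma transl_meas: "(%x. x + y) \<in> lebesgue \<rightarrow>\<^sub>M lebesgue"
 and distr_transl: "distr lebesgue lebesgue (%x. x + y) = lebesgue"
 for y :: "'a::euclidean_space"
proof -
 have eq: "(%x. y + (\<Sum>j\<in>Basis. (1 * (x \<bullet> j)) *: j)) = (%x. x + y)"
  by (simp add: fun_eq_iff euclidean_representation add.commute)
 show m: "(%x. x + y) \<in> lebesgue \<rightarrow>\<^sub>M lebesgue"
  using lebesgue_affine_measurable[of "%_. 1" y] unfolding eq by simp
 have "lebesgue = density (distr lebesgue lebesgue (%x. x + y)) (%x. ennreal (\<Prod>j\<in>(Basis::'a set). \<bar>1\<bar>))"
  using lebesgue_affine_euclidean[of "%_. 1" y] unfolding eq by simp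
 then show "distr lebesgue lebesgue (%x. x + y) = lebesgue" by (simp add: density_1)
qed

lemma AE_transl: "AEL x. P x ==> AEL x. P (x + y)" for y :: "'a::euclidean_space"
 using AE_distrD[OF transl_meas[of y], of P] unfolding distr_transl .

lemma meas_transl:
 "f \<in> lmeas ==> (%x. f (x + y)) \<in> lmeas" for y :: "'a::euclidean_space"
 by (rule measurable_compose[OF transl_meas])

lemma int_transl:
 fixes f :: "'a::euclidean_space => 'b::{banach,second_countable_topology}"
 assumes "f \<in> lmeas"
 shows "(LIN x. f (x + y)) = (LIN x. f x)"
 using integral_distr[OF transl_meas[of y], of f] assms by (simp add: distr_transl)

lemma intble_transl:
 fixes f :: "'a::euclidean_space => 'b::{banach,second_countable_topology}"
 assumes "integrable lebesgue f"
 shows "integrable lebesgue (%x. f (x + y))"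
 using integrable_distr[OF transl_meas[of y], of f] assms by (simp add: distr_transl)

lemma sqi_transl:
 "square_integrable f ==> square_integrable (%x. f (x + y))"
 unfolding square_integrable_def using intble_transl[of "%x. (norm (f x))^2" y] meas_transl by blast

definition L2_shift :: "'a => ('a::euclidean_space, 'b::euclidean_space) L2 => ('a, 'b) L2" where
 "L2_shift y f = abs_L2 (%x. rep_L2 f (x + y))"

lemma L2_shift_abs:
 assumes "square_integrable f"
 shows "L2_shift y (abs_L2 f) = abs_L2 (%x. f (x + y))"
 unfolding L2_shift_def abs_L2_eq_iff[OF sqi_transl[OF sqi_rep] sqi_transl[OF assms]]
 by (rule AE_transl[OF rep_abs_L2[OF assms]])

lemma rep_L2_shift: "AEL x. rep_L2 (L2_shift y f) x = rep_L2 f (x + y)"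
 unfolding L2_shift_def by (rule rep_abs_L2[OF sqi_transl]) simp

lemma L2_shift_add: "L2_shift y (f + g) = L2_shift y f + L2_shift y g"
proof (rule L2_eqI)
 show "AEL x. rep_L2 (L2_shift y (f + g)) x = rep_L2 (L2_shift y f + L2_shift y g) x"
  using rep_L2_shift[of y "f + g"] rep_L2_shift[of y f] rep_L2_shift[of y g]
  AE_transl[OF rep_L2_add[of f g], of y] rep_L2_add[of "L2_shift y f" "L2_shift y g"]
  by eventually_elim simp
qed

lemma L2_shift_scaleR: "L2_shift y (c *: f) = c *: L2_shift y f"
proof (rule L2_eqI)
 show "AEL x. rep_L2 (L2_shift y (c *: f)) x = rep_L2 (c *: L2_shift y f) x"
  using rep_L2_shift[of y "c *: f"] rep_L2_shift[of y f]
  AE_transl[OF rep_L2_scaleR[of c f], of y] rep_L2_scaleR[of c "L2_shift y f"]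
  by eventually_elim simp
qed

lemma L2_shift_inner: "inner (L2_shift y f) (L2_shift y g) = inner f g"
proof -
 have "inner (L2_shift y f) (L2_shift y g) = (LIN x. rep_L2 f (x + y) \<bullet> rep_L2 g (x + y))"
  unfolding L2_shift_def by (intro inner_abs_L2 sqi_transl) auto
 also have "\<dots> = inner f g"
  unfolding inner_L2 by (rule int_transl[of "%x. rep_L2 f x \<bullet> rep_L2 g x"]) measurable
 finally show ?thesis .
qed

lemma L2_shift_norm: "norm (L2_shift y f) = norm f"
 by (simp add: norm_eq_sqrt_inner L2_shift_inner)

lemma L2_shift_bl: "bounded_linear (L2_shift y)"
 by (rule bounded_linear_intro[where K=1]) (auto simp: L2_shift_add L2_shift_scaleR L2_shift_norm)

lemma L2_shift_diff: "L2_shift y (f - g) = L2_shift y f - L2_shift y g"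
 by (rule linear_diff[OF bounded_linear.linear[OF L2_shift_bl]])

lemma L2_shift_shift: "L2_shift y (L2_shift z f) = L2_shift (y + z) f"
proof (rule L2_eqI)
 show "AEL x. rep_L2 (L2_shift y (L2_shift z f)) x = rep_L2 (L2_shift (y + z) f) x"
  using rep_L2_shift[of y "L2_shift z f"] AE_transl[OF rep_L2_shift[of z f], of y] rep_L2_shift[of "y + z" f]
  by eventually_elim (simp add: add.assoc)
qed

lemma L2_shift_0: "L2_shift 0 f = f"
 by (simp add: L2_shift_def)

lemma L2_shift_inner_left: "inner (L2_shift y f) g = inner f (L2_shift (- y) g)"
 using L2_shift_inner[of "- y" "L2_shift y f" g] by (simp add: L2_shift_shift L2_shift_0)

section \<open>Test functions\<close>

definition smooth :: "(real ^ 'n::finite => complex) => bool" where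
 "smooth ph \<longleftrightarrow> (\<forall>k. C_diff k ph)"

lemma pd_eq: "(ph has_derivative D) (at x) ==> pd j ph x = D (axis j 1)"
 unfolding partial_deriv_def using frechet_derivative_at by metis

text \<open>A class of differentiable functions closed under partial derivatives consists of smooth
  functions. Each closure property then needs only one differentiation.\<close>

lemma smooth_coinduct:
 assumes R: "!!ph. ph \<in> R ==> (\<forall>x. ph differentiable (at x)) \<and> (\<forall>j. pd j ph \<in> R)" and ph: "ph \<in> R"
 shows "smooth ph"
proof -
 have "\<forall>ph\<in>R. C_diff k ph" for k
 proof (induction k)
  case 0
  show ?case
  using R by (auto intro!: continuous_at_imp_continuous_on differentiable_imp_continuous_within)
 next
  case (Suc k)
  then show ?case using R by simp
 qed
 then show ?thesis using ph by (simp add: smooth_def)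
qed

lemma smooth_differentiable: "smooth ph ==> ph differentiable (at x)"
 unfolding smooth_def by (metis C_diff.simps(2))

lemma smooth_pd: "smooth ph ==> smooth (pd j ph)"
 unfolding smooth_def by (metis C_diff.simps(2))

lemma smooth_der: "smooth ph ==> (ph has_derivative frechet_derivative ph (at x)) (at x)"
 using smooth_differentiable frechet_derivative_works by blast

lemma smooth_cont: "smooth ph ==> continuous_on S ph"
 by (meson continuous_at_imp_continuous_on differentiable_imp_continuous_within smooth_differentiable)

lemma pd_lin:
 assumes "smooth ph" "bounded_linear L"
 shows "pd j (%x. L (ph x)) = (%x. L (pd j ph x))"
proof
 fix x
 have "((%x. L (ph x)) has_derivative (%h. L (frechet_derivative ph (at x) h))) (at x)"
  by (rule bounded_linear.has_derivative[OF assms(2) smooth_der[OF assms(1)]])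
 then show "pd j (%x. L (ph x)) x = L (pd j ph x)"
  by (simp add: pd_eq) (simp add: partial_deriv_def)
qed

lemma smooth_lin:
 assumes "smooth ph" "bounded_linear L"
 shows "smooth (%x. L (ph x))"
proof (rule smooth_coinduct[of "{%x. L (ph x) | ph. smooth ph}"])
 fix ps assume "ps \<in> {%x. L (ph x) | ph. smooth ph}"
 then obtain ph where ph: "smooth ph" "ps = (%x. L (ph x))" by blast
 have "ps differentiable (at x)" for x
  unfolding ph(2) differentiable_def using bounded_linear.has_derivative[OF assms(2) smooth_der[OF ph(1)]] by blast
 moreover have "pd j ps \<in> {%x. L (ph x) | ph. smooth ph}" for j
  unfolding ph(2) pd_lin[OF ph(1) assms(2)] using smooth_pd[OF ph(1)] by blast
 ultimately show "(\<forall>x. ps differentiable (at x)) \<and> (\<forall>j. pd j ps \<in> {%x. L (ph x) | ph. smooth ph})" by blast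
qed (use assms in blast)

lemma has_der_shift:
 assumes "(ph has_derivative D) (at (x + y))"
 shows "((%x. ph (x + y)) has_derivative D) (at x)"
 using has_derivative_compose[OF has_derivative_add_const[OF has_derivative_ident] assms] .

lemma pd_shift:
 assumes "smooth ph"
 shows "pd j (%x. ph (x + y)) = (%x. pd j ph (x + y))"
proof
 fix x
 show "pd j (%x. ph (x + y)) x = pd j ph (x + y)"
  unfolding pd_eq[OF has_der_shift[OF smooth_der[OF assms, of "x + y"]], of j]
  by (simp add: partial_deriv_def)
qed

lemma smooth_shift:
 assumes "smooth ph"
 shows "smooth (%x. ph (x + y))"
proof (rule smooth_coinduct[of "{%x. ph (x + y) | ph. smooth ph}"])
 fix ps assume "ps \<in> {%x. ph (x + y) | ph. smooth ph}"
 then obtain ph where ph: "smooth ph" "ps = (%x. ph (x + y))" by blast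
 have "ps differentiable (at x)" for x
  unfolding ph(2) differentiable_def using has_der_shift[OF smooth_der[OF ph(1)]] by blast
 moreover have "pd j ps \<in> {%x. ph (x + y) | ph. smooth ph}" for j
  unfolding ph(2) pd_shift[OF ph(1)] using smooth_pd[OF ph(1)] by blast
 ultimately show "(\<forall>x. ps differentiable (at x)) \<and> (\<forall>j. pd j ps \<in> {%x. ph (x + y) | ph. smooth ph})" by blast
qed (use assms in blast)

lemma C_diff_add: "C_diff k ph ==> C_diff k ps ==> C_diff k (%x. ph x + ps x)"
proof (induction k arbitrary: ph ps)
 case 0
 then show ?case by (auto intro: continuous_on_add)
next
 case (Suc k)
 have d: "((%x. ph x + ps x) has_derivative (%h. frechet_derivative ph (at x) h + frechet_derivative ps (at x) h)) (at x)" for x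
  using Suc.prems by (intro has_derivative_add) (auto simp: frechet_derivative_works[symmetric])
 have "pd j (%x. ph x + ps x) = (%x. pd j ph x + pd j ps x)" for j
  using pd_eq[OF d] by (simp add: fun_eq_iff partial_deriv_def)
 moreover have "(%x. ph x + ps x) differentiable (at x)" for x
  unfolding differentiable_def using d[of x] by blast
 ultimately show ?case using Suc by simp
qed

lemma pd_mult:
 assumes "smooth ph" "smooth ps"
 shows "pd j (%x. ph x * ps x) = (%x. pd j ph x * ps x + ph x * pd j ps x)"
proof
 fix x
 show "pd j (%x. ph x * ps x) x = pd j ph x * ps x + ph x * pd j ps x"
  using pd_eq[OF has_derivative_mult[OF smooth_der[OF assms(1)] smooth_der[OF assms(2)]], of j x]
  by (simp add: partial_deriv_def)
qed

lemma smooth_mult: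
 assumes "smooth ph" "smooth ps"
 shows "smooth (%x. ph x * ps x)"
proof -
 have "C_diff k (%x. ph x * ps x)" if "smooth ph" "smooth ps" for k ph and ps :: "'a cfun"
  using that
 proof (induction k arbitrary: ph ps)
  case 0
  then show ?case by (auto intro: continuous_on_mult smooth_cont)
 next
  case (Suc k)
  have "(%x. ph x * ps x) differentiable (at x)" for x
  using Suc.prems by (intro differentiable_mult smooth_differentiable)
  moreover have "C_diff k (%x. pd j ph x * ps x + ph x * pd j ps x)" for j
  using Suc.prems by (intro C_diff_add Suc.IH smooth_pd)
  ultimately show ?case by (simp add: pd_mult[OF Suc.prems])
 qed
 then show ?thesis using assms by (simp add: smooth_def)
qed

lemma smooth_const: "smooth (%x. c)"
proof (rule smooth_coinduct[of "range (%c x. c)"])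
 fix ph :: "'a cfun" assume "ph \<in> range (%c x. c)"
 then obtain c where c: "ph = (%x. c)" by blast
 have "pd j ph = (%x. 0)" for j
  unfolding c by (rule ext) (simp add: pd_eq[OF has_derivative_const])
 then show "(\<forall>x. ph differentiable (at x)) \<and> (\<forall>j. pd j ph \<in> range (%c x. c))" by (auto simp: c)
qed blast

lemma smooth_prod: "finite I ==> (!!i. i \<in> I ==> smooth (f i)) ==> smooth (%x. \<Prod>i\<in>I. f i x)"
 by (induction I rule: finite_induct) (auto intro: smooth_const smooth_mult)

text \<open>Multiples of the \<open>h n\<close>, read in one coordinate, form a class as in
  \<open>smooth_coinduct\<close>: a partial derivative raises \<open>n\<close> and changes the
  factor, which is 0 in the other directions.\<close>

lemma smooth_one_dim:
 fixes i :: "'n::finite"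
 assumes h: "!!n x. (h n has_real_derivative h (Suc n) x) (at x)"
 shows "smooth (%x :: real ^ 'n. complex_of_real (h 0 (c * (x $ i) + d)))"
proof -
 define R where "R = {%x :: real ^ 'n. complex_of_real (a * h n (c * (x $ i) + d)) | a n. True}"
 show ?thesis
 proof (rule smooth_coinduct[of R])
  fix ps assume "ps \<in> R"
  then obtain a n where ps: "ps = (%x. complex_of_real (a * h n (c * (x $ i) + d)))" by (auto simp: R_def)
  have bl: "bounded_linear (%r. complex_of_real (a * r))"
  by (rule bounded_linear_compose[OF bounded_linear_of_real bounded_linear_mult_right])
  have in1: "((%x :: real ^ 'n. c * (x $ i) + d) has_derivative (%v. c * (v $ i))) (at x)" for x
  by (intro has_derivative_add_const has_derivative_mult_right bounded_linear_imp_has_derivative bounded_linear_vec_nth)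
  have der: "(ps has_derivative (%v. complex_of_real (a * (h (Suc n) (c * (x $ i) + d) * (c * (v $ i)))))) (at x)" for x
  unfolding ps by (rule bounded_linear.has_derivative[OF bl])
  (rule has_derivative_compose[OF in1 h[unfolded has_field_derivative_def]])
  have "pd j ps = (%x. complex_of_real ((a * c * (axis j 1 $ i)) * h (Suc n) (c * (x $ i) + d)))" for j
  using pd_eq[OF der] by (simp add: fun_eq_iff mult_ac)
  then have "pd j ps \<in> R" for j unfolding R_def by blast
  then show "(\<forall>x. ps differentiable (at x)) \<and> (\<forall>j. pd j ps \<in> R)"
  using der by (auto simp: differentiable_def)
 next
  show "(%x. complex_of_real (h 0 (c * (x $ i) + d))) \<in> R"
  unfolding R_def mem_Collect_eq by (rule exI[of _ 1], rule exI[of _ 0]) simp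
 qed
qed

subsection \<open>Bump functions\<close>

text \<open>Differentiating p(1/x) exp(-1/x) gives (1/x^2) (p - p')(1/x) exp(-1/x), whence the
  recursion.\<close>

primrec flat_poly :: "nat => real poly" where
 "flat_poly 0 = 1"
| "flat_poly (Suc n) = [:0, 0, 1:] * (flat_poly n - pderiv (flat_poly n))"

text \<open>\<open>flat n\<close> is the \<open>n\<close>-th derivative of \<open>exp (-1/x)\<close>, extended by \<open>0\<close> to \<open>x <= 0\<close>.\<close>

definition flat :: "nat => real => real" where
 "flat n x = (if 0 < x then poly (flat_poly n) (1/x) * exp (- (1/x)) else 0)"

lemma poly_exp_at_top: "((%z. poly p z * exp (- z)) ---> 0) at_top" for p :: "real poly"
proof -
 have "((%z. \<Sum>i\<le>degree p. coeff p i * (z ^ i / exp z)) ---> (\<Sum>i\<le>degree p. coeff p i * 0)) at_top"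
  by (intro tendsto_sum tendsto_mult tendsto_const tendsto_power_div_exp_0)
 moreover have "(%z. \<Sum>i\<le>degree p. coeff p i * (z ^ i / exp z)) = (%z. poly p z * exp (- z))"
  unfolding poly_altdef sum_distrib_right by (intro ext sum.cong refl) (simp add: exp_minus divide_inverse)
 ultimately show ?thesis by simp
qed

lemma flat_deriv: "(flat n has_real_derivative flat (Suc n) x) (at x)"
proof -
 consider "0 < x" | "x < 0" | "x = 0" by linarith
 then show ?thesis
 proof cases
  case 1
  have "((%x. poly (flat_poly n) (1/x) * exp (- (1/x))) has_real_derivative
  (poly (pderiv (flat_poly n)) (1/x) * (- 1 / x^2)) * exp (- (1/x)) + (exp (- (1/x)) * (1 / x^2)) * poly (flat_poly n) (1/x)) (at x)"
  using 1 by (intro DERIV_mult DERIV_chain2[OF poly_DERIV] DERIV_chain2[OF DERIV_exp])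
  (auto intro!: derivative_eq_intros simp: power2_eq_square)
  moreover have "(poly (pderiv (flat_poly n)) (1/x) * (- 1 / x^2)) * exp (- (1/x)) + (exp (- (1/x)) * (1 / x^2)) * poly (flat_poly n) (1/x) = flat (Suc n) x"
  using 1 by (simp add: flat_def field_simps power2_eq_square)
  ultimately have "((%x. poly (flat_poly n) (1/x) * exp (- (1/x))) has_real_derivative flat (Suc n) x) (at x)" by simp
  then show ?thesis
  by (rule has_field_derivative_transform_within_open[where S="{0<..}"]) (use 1 in \<open>auto simp: flat_def\<close>)
 next
  case 2
  have "((%x. 0) has_real_derivative flat (Suc n) x) (at x)" using 2 by (simp add: flat_def)
  then show ?thesis
  by (rule has_field_derivative_transform_within_open[where S="{..<0}"]) (use 2 in \<open>auto simp: flat_def\<close>)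
 next
  case 3
  have "((%y. flat n y / y) ---> 0) (at_right 0)"
  proof (rule Lim_transform_eventually)
  show "((%y. poly (pCons 0 (flat_poly n)) (inverse y) * exp (- inverse y)) ---> 0) (at_right 0)"
  by (rule filterlim_compose[OF poly_exp_at_top filterlim_inverse_at_top_right])
  show "\<forall>\<^sub>F y in at_right 0. poly (pCons 0 (flat_poly n)) (inverse y) * exp (- inverse y) = flat n y / y"
  using eventually_at_right_less[of 0] by eventually_elim (simp add: flat_def field_simps)
  qed
  moreover have "((%y. flat n y / y) ---> 0) (at_left 0)"
  by (rule tendsto_eventually) (use eventually_at_left_real[of "-1" 0] in \<open>auto elim!: eventually_mono simp: flat_def\<close>)
  ultimately have "((%y. flat n y / y) ---> 0) (at 0)" by (rule filterlim_split_at[rotated])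
  then show ?thesis unfolding 3 has_field_derivative_iff by (simp add: flat_def)
 qed
qed

lemma flat_0: "flat 0 x = (if 0 < x then exp (- (1/x)) else 0)" by (simp add: flat_def)

lemma flat_0_bounds: "0 <= flat 0 x" "flat 0 x <= 1" by (auto simp: flat_0)

lemma flat_0_limit: "(%m. flat 0 (real (Suc m) * y)) ----> (if 0 < y then 1 else 0)"
proof (cases "0 < y")
 case True
 have pos: "0 < real (Suc m) * y" for m using True by (intro mult_pos_pos) auto
 have "(%m. exp (- (inverse (real (Suc m)) * (1/y)))) ----> exp (- (0 * (1/y)))"
  by (intro tendsto_intros LIMSEQ_inverse_real_of_nat)
 moreover have "exp (- (inverse (real (Suc m)) * (1/y))) = flat 0 (real (Suc m) * y)" for m
  unfolding flat_0 if_P[OF pos] by (simp add: field_simps)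
 ultimately show ?thesis using True by simp
next
 case False
 then have "flat 0 (real (Suc m) * y) = 0" for m by (simp add: flat_0 zero_less_mult_iff)
 then show ?thesis using False by simp
qed

text \<open>Two flat factors per coordinate cut off at the two faces of the box. The parameter
  \<open>m\<close> is the steepness: as it grows, the functions tend pointwise to the indicator of
  the open box.\<close>

definition real_bump :: "real => real ^ 'n::finite => real ^ 'n => real ^ 'n => real" where
 "real_bump m a b x = (\<Prod>i\<in>UNIV. flat 0 (m * (x $ i - a $ i)) * flat 0 (m * (b $ i - x $ i)))"

lemma real_bump_bounds: "0 <= real_bump m a b x" "real_bump m a b x <= 1"
 unfolding real_bump_def
 by (auto intro!: prod_nonneg prod_le_1 mult_nonneg_nonneg mult_le_one flat_0_bounds)

lemma real_bump_supp: "real_bump m a b x ~= 0 ==> 0 < m ==> x \<in> box a b"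
proof -
 assume nz: "real_bump m a b x ~= 0" and m: "0 < m"
 have nzi: "flat 0 (m * (x $ i - a $ i)) ~= 0 \<and> flat 0 (m * (b $ i - x $ i)) ~= 0" for i
  using nz by (auto simp: real_bump_def)
 have "a $ i < x $ i \<and> x $ i < b $ i" for i
  using m nzi[of i] by (auto simp: flat_0 zero_less_mult_iff split: if_splits)
 then show "x \<in> box a b" by (simp add: mem_box_cart)
qed

lemma real_bump_limit: "(%m. real_bump (real (Suc m)) a b x) ----> indicator (box a b) x"
proof -
 have "(%m. real_bump (real (Suc m)) a b x) ---->
  (\<Prod>i\<in>UNIV. (if 0 < x $ i - a $ i then 1 else 0) * (if 0 < b $ i - x $ i then 1 else 0))"
  unfolding real_bump_def by (intro tendsto_prod tendsto_mult flat_0_limit)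
 moreover have "(\<Prod>i\<in>UNIV. (if 0 < x $ i - a $ i then 1 else 0) * (if 0 < b $ i - x $ i then 1 else 0)) = (indicator (box a b) x :: real)"
 proof (cases "x \<in> box a b")
  case True
  then show ?thesis by (simp add: mem_box_cart)
 next
  case False
  then obtain i where "\<not> (a $ i < x $ i \<and> x $ i < b $ i)" by (auto simp: mem_box_cart)
  then have "\<exists>i\<in>UNIV. (if 0 < x $ i - a $ i then 1 else 0) * (if 0 < b $ i - x $ i then 1 else (0::real)) = 0"
  by (intro bexI[of _ i]) auto
  then show ?thesis using False by (simp add: prod_zero_iff)
 qed
 ultimately show ?thesis by simp
qed

lemma test_fun_iff: "ph \<in> TF \<longleftrightarrow> smooth ph \<and> bounded {x. ph x ~= 0}"
 by (simp add: test_functions_def smooth_def compact_closure)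

lemma bump_test: "0 < m ==> (%x. complex_of_real (real_bump m a b x)) \<in> TF"
 unfolding test_fun_iff
proof
 assume m: "0 < m"
 have "smooth (%x. complex_of_real (flat 0 (m * (x $ i) + (- m * a $ i))) * complex_of_real (flat 0 ((- m) * (x $ i) + m * b $ i)))" for i
  by (intro smooth_mult smooth_one_dim flat_deriv)
 then have "smooth (%x. \<Prod>i\<in>UNIV. complex_of_real (flat 0 (m * (x $ i) + (- m * a $ i))) * complex_of_real (flat 0 ((- m) * (x $ i) + m * b $ i)))"
  by (intro smooth_prod) auto
 moreover have "complex_of_real (real_bump m a b x) = (\<Prod>i\<in>UNIV. complex_of_real (flat 0 (m * (x $ i) + (- m * a $ i))) * complex_of_real (flat 0 ((- m) * (x $ i) + m * b $ i)))" for x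
  by (simp add: real_bump_def algebra_simps)
 ultimately show "smooth (%x. complex_of_real (real_bump m a b x))" by simp
 show "bounded {x. complex_of_real (real_bump m a b x) ~= 0}"
  by (rule bounded_subset[OF bounded_box[of a b]]) (use real_bump_supp m in auto)
qed

lemma test_smooth: "ph \<in> TF ==> smooth ph" by (simp add: test_fun_iff)

lemma test_supp:
 assumes "ph \<in> TF"
 obtains R where "0 < R" "!!x. R < norm x ==> ph x = 0"
proof -
 obtain R where "0 < R" "\<forall>x\<in>{x. ph x ~= 0}. norm x <= R" using assms unfolding test_fun_iff bounded_pos by blast
 then show thesis using that[of R] by force
qed

lemma test_lin:
 assumes "ph \<in> TF" "bounded_linear L"
 shows "(%x. L (ph x)) \<in> TF"
proof -
 interpret bounded_linear L by fact
 have "bounded {x. L (ph x) ~= 0}"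
  by (rule bounded_subset[of "{x. ph x ~= 0}"]) (use assms zero in \<open>auto simp: test_fun_iff\<close>)
 then show ?thesis using assms by (simp add: test_fun_iff smooth_lin)
qed

lemma test_shift:
 assumes "ph \<in> TF"
 shows "(%x. ph (x + y)) \<in> TF"
proof -
 obtain R where R: "0 < R" "!!x. R < norm x ==> ph x = 0" using test_supp[OF assms] by blast
 have "norm x <= R + norm y" if "ph (x + y) ~= 0" for x
  using R(2)[of "x + y"] that norm_triangle_ineq4[of "x + y" y] by force
 then have "bounded {x. ph (x + y) ~= 0}" unfolding bounded_iff by blast
 then show ?thesis using assms by (simp add: test_fun_iff smooth_shift)
qed

lemma test_pd:
 assumes "ph \<in> TF"
 shows "pd j ph \<in> TF"
proof -
 obtain R where R: "0 < R" "!!x. R < norm x ==> ph x = 0" using test_supp[OF assms] by blast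
 have "pd j ph x = 0" if "R < norm x" for x
 proof -
  have "(ph has_derivative (%_. 0)) (at x)"
  proof (rule has_derivative_transform_within_open[OF has_derivative_const[of 0]])
  show "open {x :: real ^ 'a. R < norm x}" by (intro open_Collect_less continuous_intros)
  qed (use that R in auto)
  from pd_eq[OF this] show ?thesis by simp
 qed
 then have "bounded {x. pd j ph x ~= 0}" unfolding bounded_iff by (metis (mono_tags) mem_Collect_eq not_less)
 then show ?thesis using assms by (simp add: test_fun_iff smooth_pd)
qed

lemma test_cont: "ph \<in> TF ==> continuous_on S ph"
 by (simp add: test_smooth smooth_cont)

lemma intble_cont_compact:
 fixes f :: "'a::euclidean_space => 'b::{banach,second_countable_topology}"
 assumes "continuous_on UNIV f" "!!x. R < norm x ==> f x = 0"
 shows "integrable lebesgue f"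
proof -
 have "integrable lborel (%x. indicator (cball 0 R) x *: f x)"
  by (rule borel_integrable_compact) (auto intro: continuous_on_subset[OF assms(1)])
 moreover have "(%x. indicator (cball 0 R) x *: f x) = f"
  using assms(2) by (auto simp: fun_eq_iff indicator_def)
 ultimately show ?thesis using integrable_completion[of f lborel] borel_measurable_continuous_onI[OF assms(1)] by simp
qed

lemma test_sqi:
 assumes "ph \<in> TF"
 shows "square_integrable ph"
proof -
 obtain R where R: "0 < R" "!!x. R < norm x ==> ph x = 0" using test_supp[OF assms] by blast
 have "ph \<in> lmeas"
  using borel_measurable_continuous_onI[OF test_cont[OF assms]] by (intro measurable_completion) simp
 moreover have "integrable lebesgue (%x. (norm (ph x))^2)"
  by (rule intble_cont_compact[of _ R]) (use R test_cont[OF assms] in \<open>auto intro!: continuous_intros\<close>)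
 ultimately show ?thesis by (simp add: square_integrable_def)
qed

text \<open>The restriction to at most 1 keeps the supports of shifted functions inside a ball of
  radius \<open>R + 1\<close>, which is used in the norm estimates for difference quotients.\<close>

lemma test_unif_cont:
 assumes "ph \<in> TF" "0 < e"
 shows "\<exists>d>0. d <= 1 \<and> (\<forall>x y. dist x y < d --> dist (ph x) (ph y) < e)"
proof -
 obtain R where R: "0 < R" "!!x. R < norm x ==> ph x = 0" using test_supp[OF assms(1)] by blast
 have "uniformly_continuous_on (cball 0 (R + 1)) ph"
  by (rule compact_uniformly_continuous[OF test_cont[OF assms(1)]]) simp
 then obtain d where d: "0 < d" "!!x y. x \<in> cball 0 (R + 1) ==> y \<in> cball 0 (R + 1) ==> dist y x < d ==> dist (ph y) (ph x) < e"
  using assms(2) unfolding uniformly_continuous_on_def by meson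
 show ?thesis
 proof (intro exI[of _ "min d 1"] conjI allI impI)
  fix x y :: "real ^ 'a" assume xy: "dist x y < min d 1"
  show "dist (ph x) (ph y) < e"
  proof (cases "x \<in> cball 0 (R + 1) \<and> y \<in> cball 0 (R + 1)")
  case True
  then show ?thesis using d(2)[of y x] xy by simp
  next
  case False
  then have "R < norm x" "R < norm y"
  using xy norm_triangle_ineq2[of x y] norm_triangle_ineq2[of y x] by (auto simp: dist_norm norm_minus_commute)
  then show ?thesis using R(2) assms(2) by simp
  qed
 qed (use d in auto)
qed

definition tf :: "(real ^ 'n::finite => complex) => 'n scal" where
 "tf ph = abs_L2 ph"

lemma tf_shift: "ph \<in> TF ==> L2_shift y (tf ph) = tf (%x. ph (x + y))"
 unfolding tf_def by (rule L2_shift_abs[OF test_sqi])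

subsection \<open>Density of test functions\<close>

text \<open>Boxes are an intersection-stable generator of the Borel sets, so inside each box the
  integral vanishes over every Borel set, in particular over the sets where the function has one
  sign.\<close>

lemma AE_zero_of_box_ints:
 fixes f :: "real ^ 'n::finite => real"
 assumes m: "f \<in> lmeas"
  and i: "!!a b. integrable lebesgue (%x. indicator (box a b) x * f x)"
  and z: "!!a b. (LIN x. indicator (box a b) x * f x) = 0"
 shows "AEL x. f x = 0"
proof -
 \<comment> \<open>A Borel representative replaces \<open>f\<close>, because the induction over
   generated sets reaches Borel sets only, not their Lebesgue completion.\<close>
 obtain g where g [measurable]: "g \<in> borel_measurable lborel" and ae: "AE x in lborel. f x = g x"
  using completion_ex_borel_measurable_real[OF m] by blast
 have conv: "integrable lborel (%x. indicator (box a b) x * g x)" "(LINT x|lborel. indicator (box a b) x * g x) = 0" for a b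
 proof -
  have ae': "AEL x. indicator (box a b) x * f x = indicator (box a b) x * g x"
  using AE_completion[OF ae] by eventually_elim simp
  have gm: "(%x. indicator (box a b) x * g x) \<in> borel_measurable lborel" by measurable
  have gm': "(%x. indicator (box a b) x * g x) \<in> lmeas" by (rule measurable_completion[OF gm])
  have fm': "(%x. indicator (box a b) x * f x) \<in> lmeas" using i by (rule borel_measurable_integrable)
  have "integrable lebesgue (%x. indicator (box a b) x * g x)"
  using integrable_cong_AE[OF fm' gm' ae'] i by simp
  then show "integrable lborel (%x. indicator (box a b) x * g x)" by (simp add: integrable_completion[OF gm])
  have "(LIN x. indicator (box a b) x * g x) = 0"
  using integral_cong_AE[OF fm' gm' ae'] z by simp
  then show "(LINT x|lborel. indicator (box a b) x * g x) = 0" by (simp add: integral_completion[OF gm])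
 qed
 have key: "AE x in lborel. x \<in> box a b --> g x = 0" for a b
 proof -
  define h where "h x = indicator (box a b) x * g x" for x
  have hi: "integrable lborel h" unfolding h_def by (rule conv)
  have hm [measurable]: "h \<in> borel_measurable borel" using borel_measurable_integrable[OF hi] by simp
  have hE: "integrable lborel (%x. indicator E x * h x)" if "E \<in> sets borel" for E
  using integrable_mult_indicator[OF _ hi, of E] that by simp
  have "(LINT x|lborel. indicator E x * h x) = 0" if "E \<in> sets borel" for E
  proof -
  have "Int_stable (range (%(a, b). box a b :: (real ^ 'n) set))"
  by (auto simp: Int_stable_def box_Int_box)
  moreover have "range (%(a, b). box a b :: (real ^ 'n) set) \<subseteq> Pow UNIV" by simp
  moreover have "E \<in> sigma_sets UNIV (range (%(a, b). box a b :: (real ^ 'n) set))"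
  using that by (simp add: borel_eq_box)
  ultimately show ?thesis
  proof (induction rule: sigma_sets_induct_disjoint)
  case (basic A)
  then obtain c d where A: "A = box c d" by auto
  obtain e k where ek: "box c d \<inter> box a b = box e k" using box_Int_box by blast
  have "(%x. indicator A x * h x) = (%x. indicator (box e k) x * g x)"
  by (simp add: fun_eq_iff h_def A flip: ek) (simp add: indicator_def)
  then show ?case using conv(2)[of e k] by simp
  next
  case empty
  then show ?case by simp
  next
  case (compl A)
  then have A: "A \<in> sets borel" by (simp add: borel_eq_box)
  have "(%x. indicator (UNIV - A) x * h x) = (%x. h x - indicator A x * h x)"
  by (auto simp: fun_eq_iff indicator_def)
  moreover have "integral\<^sup>L lborel h = 0" unfolding h_def by (rule conv(2))
  ultimately show ?case using compl hi hE[OF A] by simp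
  next
  case (union A)
  have A: "A i \<in> sets borel" for i using union(2) by (auto simp: borel_eq_box)
  have dis: "A i \<inter> A j = {}" if "i ~= j" for i j using union(1) that by (simp add: disjoint_family_on_def)
  have "set_integrable lborel (\<Union> (range A)) h"
  using hE[of "\<Union> (range A)"] A by (auto simp: set_integrable_def)
  from lebesgue_integral_countable_add[OF _ dis this]
  have "(LINT x|lborel. indicator (\<Union> (range A)) x * h x) = (\<Sum>i. LINT x|lborel. indicator (A i) x * h x)"
  using A by (simp add: set_lebesgue_integral_def)
  then show ?case using union(3) by simp
  qed
  qed
  note hz = this
  have side: "AE x in lborel. indicator E x * h x = 0" if E: "E \<in> sets borel" and s: "!!x. x \<in> E ==> 0 <= sg * h x" and sg: "sg ~= 0" for E sg
  proof -
  have int: "integrable lborel (%x. sg * (indicator E x * h x))" using hE[OF E] by simp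
  have "0 <= sg * (indicator E x * h x)" for x using s[of x] by (auto simp: indicator_def)
  then have "(LINT x|lborel. sg * (indicator E x * h x)) = 0 \<longleftrightarrow> (AE x in lborel. sg * (indicator E x * h x) = 0)"
  by (intro integral_nonneg_eq_0_iff_AE int) auto
  then show ?thesis using hz[OF E] sg by simp
  qed
  have E: "{x. 0 <= h x} \<in> sets borel" "{x. h x <= 0} \<in> sets borel" by measurable
  have s1: "AE x in lborel. indicator {x. 0 <= h x} x * h x = 0"
  by (rule side[OF E(1), of 1]) auto
  have s2: "AE x in lborel. indicator {x. h x <= 0} x * h x = 0"
  by (rule side[OF E(2), of "-1"]) auto
  show ?thesis using s1 s2
  by eventually_elim (auto simp: indicator_def h_def split: if_splits)
 qed
 have "AE x in lborel. \<forall>n::nat. x \<in> box (\<chi> i. - real n) (\<chi> i. real n) --> g x = 0"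
  unfolding AE_all_countable using key by blast
 then have "AE x in lborel. g x = 0"
 proof eventually_elim
  case (elim x)
  obtain n :: nat where n: "norm x < real n" using reals_Archimedean2 by blast
  have "\<bar>x $ i\<bar> < real n" for i using component_le_norm_cart[of x i] n by linarith
  then have "x \<in> box (\<chi> i. - real n) (\<chi> i. real n)"
  unfolding mem_box_cart by (simp add: abs_less_iff minus_less_iff)
  then show ?case using elim by blast
 qed
 then have "AE x in lborel. f x = 0" using ae by eventually_elim simp
 then show ?thesis by (rule AE_completion)
qed

lemma AE_zero_of_bump_ints:
 fixes f :: "real ^ 'n::finite => real"
 assumes m: "f \<in> lmeas"
  and i: "!!a b. integrable lebesgue (%x. indicator (box a b) x * f x)"
  and z: "!!m a b. 0 < m ==> (LIN x. real_bump m a b x * f x) = 0"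
 shows "AEL x. f x = 0"
proof (rule AE_zero_of_box_ints[OF m i])
 fix a b :: "real ^ 'n"
 have bm: "real_bump m a b \<in> lmeas" if "0 < m" for m
 proof -
  have [measurable]: "(%x. complex_of_real (real_bump m a b x)) \<in> lmeas"
  using test_sqi[OF bump_test[OF that, of a b]] unfolding square_integrable_def by blast
  have "(%x. Re (complex_of_real (real_bump m a b x))) \<in> lmeas" by measurable
  then show ?thesis by simp
 qed
 have "(%k. LIN x. real_bump (real (Suc k)) a b x * f x) ----> (LIN x. indicator (box a b) x * f x)"
 proof (rule integral_dominated_convergence)
  show "(%x. indicator (box a b) x * f x) \<in> lmeas" using i by (rule borel_measurable_integrable)
  show "(%x. real_bump (real (Suc k)) a b x * f x) \<in> lmeas" for k
  by (intro borel_measurable_times bm m) simp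
  show "integrable lebesgue (%x. \<bar>indicator (box a b) x * f x\<bar>)" using i by simp
  show "AEL x. (%k. real_bump (real (Suc k)) a b x * f x) ----> indicator (box a b) x * f x"
  by (intro AE_I2 tendsto_mult real_bump_limit tendsto_const)
  show "AEL x. norm (real_bump (real (Suc k)) a b x * f x) <= \<bar>indicator (box a b) x * f x\<bar>" for k
  proof (rule AE_I2)
  fix x
  show "norm (real_bump (real (Suc k)) a b x * f x) <= \<bar>indicator (box a b) x * f x\<bar>"
  proof (cases "x \<in> box a b")
  case True
  have "\<bar>real_bump (real (Suc k)) a b x\<bar> * \<bar>f x\<bar> <= 1 * \<bar>f x\<bar>"
  using real_bump_bounds[of "real (Suc k)" a b x] by (intro mult_right_mono) auto
  then show ?thesis using True by (simp add: abs_mult)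
  next
  case False
  then have "real_bump (real (Suc k)) a b x = 0" using real_bump_supp[of "real (Suc k)" a b x] by auto
  then show ?thesis by simp
  qed
  qed
 qed
 moreover have "(%k. LIN x. real_bump (real (Suc k)) a b x * f x) = (%k. 0)" using z by simp
 ultimately show "(LIN x. indicator (box a b) x * f x) = 0" by (simp add: LIMSEQ_const_iff)
qed

lemma intble_indicator_box_L2:
 fixes f :: "real ^ 'n::finite => real"
 assumes "square_integrable f"
 shows "integrable lebesgue (%x. indicator (box a b) x * f x)"
proof -
 have "square_integrable (indicator (box a b) :: real ^ 'n => real)"
  unfolding square_integrable_def
 proof
  have "integrable lebesgue (indicator (box a b) :: real ^ 'n => real)"
  by (simp add: integrable_indicator_iff emeasure_lborel_box_eq)
  moreover have "(%x. (norm (indicator (box a b) x :: real))^2) = (indicator (box a b) :: real ^ 'n => real)"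
  by (auto simp: fun_eq_iff indicator_def)
  ultimately show "integrable lebesgue (%x. (norm (indicator (box a b) x :: real))^2)" by simp
  show "(indicator (box a b) :: real ^ 'n => real) \<in> lmeas"
  by (intro measurable_completion borel_measurable_indicator) simp
 qed
 from integrable_inner_square_integrable[OF this assms] show ?thesis by simp
qed

text \<open>The real inner product sees one real direction at a time, so bumps are multiplied by a
  complex constant; the constants 1 and i recover both components.\<close>

lemma test_orth_zero:
 fixes u :: "('n::finite) scal"
 assumes u: "!!ph. ph \<in> TF ==> inner u (tf ph) = 0"
 shows "u = 0"
proof -
 have gen: "AEL x. inner (rep_L2 u x) c = 0" for c
 proof (rule AE_zero_of_bump_ints)
  show "(%x. inner (rep_L2 u x) c) \<in> lmeas" by measurable
  have "square_integrable (%x. inner (rep_L2 u x) c)"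
  by (rule pw_bdd_sqi[OF pw_bdd_const])
  (auto intro: bounded_linear.linear bounded_linear_inner_left)
  then show "integrable lebesgue (%x. indicator (box a b) x * inner (rep_L2 u x) c)" for a b
  by (rule intble_indicator_box_L2)
  fix m :: real and a b :: "real ^ 'n" assume m: "0 < m"
  have t: "(%x. complex_of_real (real_bump m a b x) * c) \<in> TF"
  by (rule test_lin[OF bump_test[OF m] bounded_linear_mult_left])
  have "(LIN x. real_bump m a b x * inner (rep_L2 u x) c) = inner u (tf (%x. complex_of_real (real_bump m a b x) * c))"
  unfolding tf_def inner_L2_abs[OF test_sqi[OF t]]
  by (rule Bochner_Integration.integral_cong[OF refl]) (simp add: scaleR_conv_of_real[symmetric])
  then show "(LIN x. real_bump m a b x * inner (rep_L2 u x) c) = 0" using u[OF t] by simp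
 qed
 have "AEL x. rep_L2 u x = 0"
  using gen[of 1] gen[of \<i>] by eventually_elim (simp add: inner_complex_def complex_eq_iff)
 then show ?thesis using rep_L2_zero by (intro L2_eqI) (auto elim: eventually_elim2)
qed

lemma tf_add: "ph \<in> TF ==> ps \<in> TF ==> tf ph + tf ps = tf (%x. ph x + ps x)"
 unfolding tf_def by (intro abs_L2_add test_sqi)

lemma test_add:
 assumes "ph \<in> TF" "ps \<in> TF"
 shows "(%x. ph x + ps x) \<in> TF"
proof -
 have "bounded {x. ph x + ps x ~= 0}"
  by (rule bounded_subset[of "{x. ph x ~= 0} \<union> {x. ps x ~= 0}"]) (use assms in \<open>auto simp: test_fun_iff\<close>)
 then show ?thesis using assms by (simp add: test_fun_iff smooth_def C_diff_add)
qed

lemma tf_dense: "closure (tf ` TF) = (UNIV :: ('n::finite) scal set)"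
proof (rule dense_subspaceI)
 show "subspace (tf ` TF :: 'n scal set)"
  unfolding subspace_def
 proof safe
  have "(%x. 0) \<in> TF" by (simp add: test_fun_iff smooth_const)
  then show "0 \<in> tf ` TF" by (auto simp: tf_def zero_L2.abs_eq)
  show "tf ph + tf ps \<in> tf ` TF" if "ph \<in> TF" "ps \<in> TF" for ph ps :: "'n cfun"
  using that tf_add test_add by blast
  show "c *: tf ph \<in> tf ` TF" if "ph \<in> TF" for c and ph :: "'n cfun"
  using that abs_L2_scaleR[OF test_sqi[OF that], of c] test_lin[OF that bounded_linear_scaleR_right, of c]
  unfolding tf_def by blast
 qed
qed (use test_orth_zero in blast)

lemma tf_sequence:
 obtains ph where "!!n::nat. ph n \<in> TF" "(%n. tf (ph n)) ----> u"
proof -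
 have "u \<in> closure (tf ` TF)" using tf_dense by blast
 then obtain w where w: "!!n. w n \<in> tf ` TF" "w ----> u" unfolding closure_sequential by blast
 then have "\<exists>ph. ph \<in> TF \<and> w n = tf ph" for n by blast
 then obtain ph where "!!n. ph n \<in> TF" "!!n. w n = tf (ph n)" by metis
 then show thesis using that w(2) by (metis (no_types, lifting) LIMSEQ_iff)
qed

lemma norm_tf_le:
 fixes f :: "('n::finite) cfun"
 assumes f: "square_integrable f" and b: "!!x. norm (f x) <= e" "!!x. R < norm x ==> f x = 0" "0 <= e"
 shows "norm (abs_L2 f) <= e * sqrt (measure lebesgue (cball (0 :: real ^ 'n) R))"
proof (rule power2_le_imp_le)
 have "(norm (abs_L2 f))^2 = (LIN x. (norm (f x))\<^sup>2)" by (rule norm_abs_L2_sq[OF f])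
 also have "\<dots> <= (LIN x. e\<^sup>2 * indicator (cball (0 :: real ^ 'n) R) x)"
 proof (rule Bochner_Integration.integral_mono)
  have "integrable lebesgue (indicator (cball 0 R) :: real ^ 'n => real)"
  using lmeasurable_cball[of "0 :: real ^ 'n" R] by (simp add: fmeasurable_def integrable_indicator_iff)
  then show "integrable lebesgue (%x. e^2 * indicator (cball (0 :: real ^ 'n) R) x)" by simp
  show "(norm (f x))^2 <= e^2 * indicator (cball 0 R) x" for x
  proof (cases "norm x <= R")
  case True
  then show ?thesis using power_mono[OF b(1)[of x], of 2] by simp
  next
  case False
  then show ?thesis using b(2)[of x] by simp
  qed
 qed (use f in \<open>simp add: square_integrable_def\<close>)
 also have "\<dots> = e^2 * measure lebesgue (cball (0 :: real ^ 'n) R)" by simp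
 finally show "(norm (abs_L2 f))^2 <= (e * sqrt (measure lebesgue (cball (0 :: real ^ 'n) R)))^2"
  by (simp add: power_mult_distrib)
qed (use b in simp)

lemma test_shift_cont_0:
 assumes ph: "ph \<in> TF"
 shows "((%y. L2_shift y (tf ph) - tf ph) ---> 0) (at 0)"
proof -
 obtain R where R: "0 < R" "!!x. R < norm x ==> ph x = 0" using test_supp[OF ph] by blast
 let ?M = "sqrt (measure lebesgue (cball (0 :: real ^ 'a) (R + 1)))"
 show ?thesis
 proof (rule tendstoI)
  fix e :: real assume e: "0 < e"
  define e' where "e' = e / (?M + 1)"
  have M1: "0 < ?M + 1" by (rule add_nonneg_pos) auto
  have e': "0 < e'" using e M1 by (simp add: e'_def)
  obtain d where d: "0 < d" "d <= 1" "!!x y. dist x y < d ==> dist (ph x) (ph y) < e'"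
  using test_unif_cont[OF ph e'] by blast
  have "dist (L2_shift y (tf ph) - tf ph) 0 < e" if y: "dist y 0 < d" for y
  proof -
  have eq: "L2_shift y (tf ph) - tf ph = abs_L2 (%x. ph (x + y) - ph x)"
  unfolding tf_shift[OF ph] unfolding tf_def
  by (intro abs_L2_diff test_sqi test_shift ph)
  have "norm (L2_shift y (tf ph) - tf ph) <= e' * ?M"
  unfolding eq
  proof (rule norm_tf_le)
  show "square_integrable (%x. ph (x + y) - ph x)"
  by (intro square_integrable_diff test_sqi test_shift ph)
  show "norm (ph (x + y) - ph x) <= e'" for x
  using d(3)[of "x + y" x] y by (simp add: dist_norm less_imp_le)
  show "ph (x + y) - ph x = 0" if "R + 1 < norm x" for x
  proof -
  have "R < norm (x + y)" using that y d(2) norm_diff_ineq[of x y] by (simp add: dist_norm)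
  then show ?thesis using R that by simp
  qed
  qed (use e' in simp)
  also have "\<dots> < e' * (?M + 1)" using e' by simp
  also have "\<dots> = e" using M1 by (simp add: e'_def)
  finally show ?thesis by (simp add: dist_norm)
  qed
  then show "\<forall>\<^sub>F y in at 0. dist (L2_shift y (tf ph) - tf ph) 0 < e"
  unfolding eventually_at using d(1) by blast
 qed
qed

lemma L2_shift_cont:
 fixes f :: "('n::finite) scal"
 shows "isCont (%y. L2_shift y f) z"
proof -
 have 0: "((%y. L2_shift y f - f) ---> 0) (at 0)"
 proof (rule tendsto_zero_dense[OF tf_dense, where L="%y f. L2_shift y f - f" and K=2])
  have le: "norm (L2_shift t x - x) <= 2 * norm x" for t and x :: "'n scal"
  using norm_triangle_ineq4[of "L2_shift t x" x] by (simp add: L2_shift_norm)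
  show "\<forall>\<^sub>F t in at 0. (\<forall>x y :: 'n scal. L2_shift t (x - y) - (x - y) = L2_shift t x - x - (L2_shift t y - y)) \<and>
  (\<forall>x :: 'n scal. norm (L2_shift t x - x) <= 2 * norm x)"
  by (intro always_eventually allI conjI) (simp_all add: L2_shift_diff le)
 qed (use test_shift_cont_0 in blast)
 have "((%y. L2_shift z (L2_shift y f - f) + L2_shift z f) ---> L2_shift z 0 + L2_shift z f) (at 0)"
  by (intro tendsto_add tendsto_const bounded_linear.tendsto[OF L2_shift_bl] 0)
 moreover have "L2_shift z (L2_shift y f - f) + L2_shift z f = L2_shift (y + z) f" for y
  by (simp add: L2_shift_diff L2_shift_shift add.commute)
 moreover have "L2_shift z (0 :: 'n scal) = 0" using linear_0[OF bounded_linear.linear[OF L2_shift_bl]] .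
 ultimately have "((%y. L2_shift (y + z) f) ---> L2_shift z f) (at 0)" by simp
 then show ?thesis unfolding isCont_def using LIM_offset_zero_iff[of z "%y. L2_shift y f" "L2_shift z f"] by (simp add: add.commute)
qed

lemma inner_shift_cont:
 fixes f :: "('n::finite) scal"
 shows "continuous_on S (%y. inner u (L2_shift y f))"
 by (intro continuous_at_imp_continuous_on ballI continuous_intros L2_shift_cont)

section \<open>Differentiation along translations\<close>

lemma smooth_dir:
 assumes "smooth ph"
 shows "((%s. ph (x + s *: axis j 1)) has_vector_derivative pd j ph (x + s *: axis j 1)) (at s)"
proof -
 have "((%s. x + s *: axis j 1) has_vector_derivative axis j 1) (at s)"
  by (auto intro!: derivative_eq_intros)
 from vector_derivative_diff_chain_within[OF this, of ph, OF has_derivative_at_withinI[OF smooth_der[OF assms]]]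
 show ?thesis by (simp add: comp_def partial_deriv_def)
qed

text \<open>Uniform continuity of the partial derivative and the mean value inequality bound the
  remainder uniformly by a small multiple of |s|; a common bounded support converts this into an L2
  bound.\<close>

lemma test_shift_deriv_0:
 assumes ph: "ph \<in> TF"
 shows "((%s. L2_shift (s *: axis j 1) (tf ph)) has_vector_derivative tf (pd j ph)) (at 0)"
proof -
 let ?e = "axis j 1 :: real ^ 'a"
 let ?d = "pd j ph"
 have ph': "?d \<in> TF" by (rule test_pd[OF ph])
 obtain R1 where R1: "0 < R1" "!!x. R1 < norm x ==> ph x = 0" using test_supp[OF ph] by blast
 obtain R2 where R2: "0 < R2" "!!x. R2 < norm x ==> ?d x = 0" using test_supp[OF ph'] by blast
 define R where "R = max R1 R2"
 let ?M = "sqrt (measure lebesgue (cball (0 :: real ^ 'a) (R + 1)))"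
 have ne: "norm ?e = 1" by (simp add: norm_axis_1)
 have "((%s. norm (L2_shift (s *: ?e) (tf ph) - L2_shift (0 *: ?e) (tf ph) - (s - 0) *: tf ?d) / norm (s - 0)) ---> 0) (at 0)"
 proof (rule tendstoI)
  fix e :: real assume e: "0 < e"
  define e' where "e' = e / (?M + 1)"
  have M1: "0 < ?M + 1" by (rule add_nonneg_pos) auto
  have e': "0 < e'" using e M1 by (simp add: e'_def)
  obtain d where d: "0 < d" "d <= 1" "!!x y. dist x y < d ==> dist (?d x) (?d y) < e'"
  using test_unif_cont[OF ph' e'] by blast
  have main: "norm (L2_shift (s *: ?e) (tf ph) - tf ph - s *: tf ?d) <= (e' * \<bar>s\<bar>) * ?M" if s: "\<bar>s\<bar> < d" for s
  proof -
  have sq: "square_integrable (%x. ph (x + s *: ?e) - ph x)" "square_integrable (%x. s *: ?d x)"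
  by (intro square_integrable_diff square_integrable_scaleR test_sqi test_shift ph ph')+
  have eq: "L2_shift (s *: ?e) (tf ph) - tf ph - s *: tf ?d = abs_L2 (%x. ph (x + s *: ?e) - ph x - s *: ?d x)"
  unfolding tf_shift[OF ph] unfolding tf_def
  abs_L2_diff[OF test_sqi[OF test_shift[OF ph]] test_sqi[OF ph]]
  abs_L2_scaleR[OF test_sqi[OF ph']] abs_L2_diff[OF sq] ..
  show ?thesis unfolding eq
  proof (rule norm_tf_le)
  show "square_integrable (%x. ph (x + s *: ?e) - ph x - s *: ?d x)" by (rule square_integrable_diff[OF sq])
  show "norm (ph (x + s *: ?e) - ph x - s *: ?d x) <= e' * \<bar>s\<bar>" for x
  proof -
  have "norm ((%r. ph (x + r *: ?e) - r *: ?d x) s - (%r. ph (x + r *: ?e) - r *: ?d x) 0) <= e' * norm (s - 0)"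
  proof (rule differentiable_bound[of "closed_segment 0 s" _ "%r h. h *: (?d (x + r *: ?e) - ?d x)"])
  fix r assume r: "r \<in> closed_segment 0 s"
  then have r': "\<bar>r\<bar> < d" using s by (auto simp: closed_segment_eq_real_ivl split: if_splits)
  have "((%r. ph (x + r *: ?e) - r *: ?d x) has_vector_derivative (?d (x + r *: ?e) - 1 *: ?d x)) (at r)"
  by (intro has_vector_derivative_diff smooth_dir test_smooth ph
  bounded_linear.has_vector_derivative[OF bounded_linear_scaleR_left has_vector_derivative_id])
  then show "((%r. ph (x + r *: ?e) - r *: ?d x) has_derivative (%h. h *: (?d (x + r *: ?e) - ?d x))) (at r within closed_segment 0 s)"
  by (simp add: has_vector_derivative_def has_derivative_at_withinI)
  have "norm (?d (x + r *: ?e) - ?d x) <= e'"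
  using d(3)[of "x + r *: ?e" x] r' ne by (simp add: dist_norm less_imp_le)
  then show "onorm (%h. h *: (?d (x + r *: ?e) - ?d x)) <= e'"
  by (intro onorm_le) (simp add: mult.commute[of e'] mult_left_mono)
  qed auto
  then show ?thesis by (simp add: algebra_simps)
  qed
  show "ph (x + s *: ?e) - ph x - s *: ?d x = 0" if "R + 1 < norm x" for x
  proof -
  have "R < norm (x + s *: ?e)" using that s d(2) norm_diff_ineq[of x "s *: ?e"] ne by simp
  then show ?thesis using R1 R2 that by (simp add: R_def)
  qed
  qed (use e' in simp)
  qed
  have "norm (L2_shift (s *: ?e) (tf ph) - L2_shift (0 *: ?e) (tf ph) - (s - 0) *: tf ?d) / norm (s - 0) < e"
  if "s ~= 0" "\<bar>s\<bar> < d" for s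
  proof -
  have "norm (L2_shift (s *: ?e) (tf ph) - tf ph - s *: tf ?d) / \<bar>s\<bar> <= e' * ?M"
  using main[OF that(2)] that(1) by (simp add: field_simps)
  also have "\<dots> < e' * (?M + 1)" using e' by simp
  also have "\<dots> = e" using M1 by (simp add: e'_def)
  finally show ?thesis by (simp add: L2_shift_0)
  qed
  then show "\<forall>\<^sub>F s in at 0. dist (norm (L2_shift (s *: ?e) (tf ph) - L2_shift (0 *: ?e) (tf ph) - (s - 0) *: tf ?d) / norm (s - 0)) 0 < e"
  unfolding eventually_at using d(1) by (intro exI[of _ d]) (auto simp: dist_norm)
 qed
 then show ?thesis unfolding has_vector_derivative_def has_derivative_iff_norm
  by (simp add: bounded_linear_scaleR_left)
qed

lemma test_shift_deriv:
 assumes ph: "ph \<in> TF"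
 shows "((%s. L2_shift (s *: axis j 1) (tf ph)) has_vector_derivative L2_shift (s *: axis j 1) (tf (pd j ph))) (at s)"
proof -
 let ?e = "axis j 1 :: real ^ 'a"
 have d1: "((%r. r - s) has_vector_derivative 1) (at s)" by (auto intro!: derivative_eq_intros simp: has_real_derivative_iff_has_vector_derivative[symmetric])
 have "((%s. L2_shift (s *: ?e) (tf ph)) has_vector_derivative tf (pd j ph)) (at (s - s))"
  using test_shift_deriv_0[OF ph, of j] by simp
 from vector_diff_chain_at[OF d1 this]
 have "((%r. L2_shift ((r - s) *: ?e) (tf ph)) has_vector_derivative tf (pd j ph)) (at s)" by (simp add: comp_def)
 from bounded_linear.has_vector_derivative[OF L2_shift_bl this, of "s *: ?e"]
 show ?thesis by (simp add: L2_shift_shift algebra_simps)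
qed

text \<open>Translations are isometries, so the pairing of two functions shifted together is
  constant; its derivative at 0 is the identity sought.\<close>

lemma tf_int_by_parts:
 assumes "ph \<in> TF" "ps \<in> TF"
 shows "inner (tf (pd j ph)) (tf ps) = - inner (tf ph) (tf (pd j ps))"
proof -
 let ?S = "%s. L2_shift (s *: axis j 1)"
 have "((%s. inner (?S s (tf ph)) (?S s (tf ps))) has_vector_derivative
  inner (?S 0 (tf ph)) (tf (pd j ps)) + inner (tf (pd j ph)) (?S 0 (tf ps))) (at 0)"
  by (rule bounded_bilinear.has_vector_derivative[OF bounded_bilinear_inner test_shift_deriv_0[OF assms(1)] test_shift_deriv_0[OF assms(2)]])
 then have "((%s. inner (tf ph) (tf ps)) has_vector_derivative
  inner (tf ph) (tf (pd j ps)) + inner (tf (pd j ph)) (tf ps)) (at (0::real))"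
  by (simp add: L2_shift_inner L2_shift_0)
 from vector_derivative_unique_at[OF this has_vector_derivative_const] show ?thesis by simp
qed

text \<open>The derivative along translations of <S_s d_i ph, et> = - <S_s ph, d_i et> is computed
  in two ways. This gives the symmetry of second derivatives as an identity in L2.\<close>

lemma tf_pd_commute:
 assumes ph: "ph \<in> TF"
 shows "tf (pd i (pd j ph)) = tf (pd j (pd i ph))"
proof -
 have "inner (tf (pd i (pd j ph)) - tf (pd j (pd i ph))) (tf et) = 0"
  if et: "et \<in> TF" for et
 proof -
  let ?S = "%s. L2_shift (s *: axis j 1)"
  have "((%s. inner (?S s (tf (pd i ph))) (tf et)) has_vector_derivative
  inner (tf (pd j (pd i ph))) (tf et)) (at 0)"
  by (rule bounded_linear.has_vector_derivative[OF bounded_linear_inner_left test_shift_deriv_0[OF test_pd[OF ph]]])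
  moreover have "((%s. - inner (?S s (tf ph)) (tf (pd i et))) has_vector_derivative
  - inner (tf (pd j ph)) (tf (pd i et))) (at 0)"
  by (intro has_vector_derivative_minus bounded_linear.has_vector_derivative[OF bounded_linear_inner_left] test_shift_deriv_0[OF ph])
  moreover have "inner (?S s (tf (pd i ph))) (tf et) = - inner (?S s (tf ph)) (tf (pd i et))" for s
  using tf_int_by_parts[OF test_shift[OF ph] et, of i]
  by (simp add: tf_shift ph test_pd pd_shift test_smooth)
  ultimately have "inner (tf (pd j (pd i ph))) (tf et) = - inner (tf (pd j ph)) (tf (pd i et))"
  using vector_derivative_unique_at by simp blast
  also have "\<dots> = inner (tf (pd i (pd j ph))) (tf et)"
  using tf_int_by_parts[OF test_pd[OF ph] et, of i j] by simp
  finally show ?thesis by (simp add: inner_diff_left)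
 qed
 from test_orth_zero[OF this] show ?thesis by simp
qed

section \<open>Weak derivatives and translations\<close>

definition L2_nth :: "(real ^ 'n::finite, complex ^ 'm::finite) L2 => 'm => 'n scal" where
 "L2_nth V j = L2_map (%_ v. v $ j) V"

definition L2_axis :: "'m::finite => ('n::finite) scal => (real ^ 'n, complex ^ 'm) L2" where
 "L2_axis j u = L2_map (%_ z. axis j z) u"

lemma lin_nth: "linear (%v :: complex ^ 'm::finite. v $ j)"
 by (intro bounded_linear.linear bounded_linear_vec_nth)

lemma lin_axis: "linear (%z :: complex. axis j z :: complex ^ 'm::finite)"
 by (rule linearI) (auto simp: vec_eq_iff axis_def)

lemmas pw_nth = pw_bdd_const[OF lin_nth]
lemmas pw_axis = pw_bdd_const[OF lin_axis]

lemma rep_L2_nth: "AEL x. rep_L2 (L2_nth V j) x = rep_L2 V x $ j"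
 unfolding L2_nth_def by (rule rep_L2_map[OF pw_nth])

lemma L2_nth_bl: "bounded_linear (%V. L2_nth V j)"
 unfolding L2_nth_def using L2_map_bl[OF pw_nth] .

lemma L2_nth_eqI: "(!!j. L2_nth V j = L2_nth W j) ==> V = W"
proof (rule L2_eqI)
 assume eq: "!!j. L2_nth V j = L2_nth W j"
 have "AEL x. \<forall>j. rep_L2 V x $ j = rep_L2 W x $ j"
  unfolding AE_all_countable
 proof
  fix j
  show "AEL x. rep_L2 V x $ j = rep_L2 W x $ j"
  using rep_L2_nth[of V j] rep_L2_nth[of W j] by eventually_elim (simp add: eq)
 qed
 then show "AEL x. rep_L2 V x = rep_L2 W x" by eventually_elim (simp add: vec_eq_iff)
qed

lemma inner_L2_nth: "inner V W = (\<Sum>j\<in>UNIV. inner (L2_nth V j) (L2_nth W j))"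
proof -
 have sq: "square_integrable (%x. rep_L2 V x $ j)" for V :: "(real ^ 'a, complex ^ 'b) L2" and j
  by (rule pw_bdd_sqi[OF pw_nth]) simp
 have "inner V W = (LIN x. (\<Sum>j\<in>UNIV. inner (rep_L2 V x $ j) (rep_L2 W x $ j)))"
  unfolding inner_L2 inner_vec_def ..
 also have "\<dots> = (\<Sum>j\<in>UNIV. LIN x. inner (rep_L2 V x $ j) (rep_L2 W x $ j))"
  by (rule Bochner_Integration.integral_sum) (rule integrable_inner_square_integrable[OF sq sq])
 also have "\<dots> = (\<Sum>j\<in>UNIV. inner (L2_nth V j) (L2_nth W j))"
  unfolding L2_nth_def L2_map_def by (simp add: inner_abs_L2 sq)
 finally show ?thesis .
qed

lemma inner_L2_axis: "inner V (L2_axis j u) = inner (L2_nth V j) u"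
proof -
 have "AEL x. inner (rep_L2 V x) (rep_L2 (L2_axis j u) x) = inner (rep_L2 (L2_nth V j) x) (rep_L2 u x)"
  using rep_L2_nth[of V j] rep_L2_map[OF pw_axis, of j u] unfolding L2_axis_def
  by eventually_elim (simp add: inner_axis)
 then show ?thesis unfolding inner_L2 by (intro integral_cong_AE) auto
qed

lemma L2_nth_axis:
 fixes u :: "('n::finite) scal"
 shows "L2_nth (L2_axis j u) k = (if k = j then u else 0)"
proof (rule L2_eqI)
 have "AEL x. rep_L2 (0 :: 'n scal) x = 0" by (rule rep_L2_zero)
 then show "AEL x. rep_L2 (L2_nth (L2_axis j u) k) x = rep_L2 (if k = j then u else 0) x"
  using rep_L2_nth[of "L2_axis j u" k] rep_L2_map[OF pw_axis, of j u] unfolding L2_axis_def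
  by eventually_elim (simp add: axis_def)
qed

subsection \<open>Complex and real pairings\<close>

text \<open>Guards the distributional pairings: the integral of a function that is not integrable is
  0 by default, so identities between integrals carry information only under this condition.\<close>

definition test_intble :: "(real ^ 'n::finite => complex) => bool" where
 "test_intble f \<longleftrightarrow> (\<forall>ph\<in>TF. integrable lebesgue (%x. f x * ph x))"

text \<open>The real part of a product z w is the real inner product of z with cnj w, and its
  imaginary part is the real part of z (-i w).\<close>

lemma int_mult_eq_inner:
 fixes f g :: "('n::finite) cfun"
 assumes "integrable lebesgue (%x. f x * g x)"
 shows "(LIN x. f x * g x) =
  Complex (LIN x. inner (f x) (cnj (g x))) (LIN x. inner (f x) (cnj (- \<i> * g x)))"
proof (rule complex_eqI)
 have "Re (LIN x. f x * g x) = (LIN x. Re (f x * g x))"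
  using integral_Re[OF assms] by simp
 then show "Re (LIN x. f x * g x) = Re (Complex (LIN x. inner (f x) (cnj (g x))) (LIN x. inner (f x) (cnj (- \<i> * g x))))"
  by (simp add: inner_complex_def)
 have "Im (LIN x. f x * g x) = (LIN x. Im (f x * g x))"
  using integral_Im[OF assms] by simp
 then show "Im (LIN x. f x * g x) = Im (Complex (LIN x. inner (f x) (cnj (g x))) (LIN x. inner (f x) (cnj (- \<i> * g x))))"
  by (simp add: inner_complex_def)
qed

lemma int_inner_eq_Re:
 fixes f g :: "('n::finite) cfun"
 assumes "integrable lebesgue (%x. f x * cnj (g x))"
 shows "(LIN x. inner (f x) (g x)) = Re (LIN x. f x * cnj (g x))"
 unfolding int_mult_eq_inner[OF assms] by simp

lemma test_cnj: "ph \<in> TF ==> (%x. cnj (ph x)) \<in> TF"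
 by (rule test_lin[OF _ bounded_linear_cnj])

lemma bl_rot: "bounded_linear (%z. cnj (- \<i> * z))"
 by (rule bounded_linear_compose[OF bounded_linear_cnj bounded_linear_mult_right])

lemma test_rot: "ph \<in> TF ==> (%x. cnj (- \<i> * ph x)) \<in> TF"
 by (rule test_lin[OF _ bl_rot])

lemma pd_cnj: "ph \<in> TF ==> pd j (%x. cnj (ph x)) = (%x. cnj (pd j ph x))"
 by (rule pd_lin[OF test_smooth bounded_linear_cnj])

lemma pd_rot:
 "ph \<in> TF ==> pd j (%x. cnj (- \<i> * ph x)) = (%x. cnj (- \<i> * pd j ph x))"
 by (rule pd_lin[OF test_smooth bl_rot])

text \<open>Testing with \<open>cnj ph\<close> and \<open>cnj (- \<i> ph)\<close> turns a bilinear complex identity into a real one.\<close>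

lemma weak_gradient_iff_inner:
 assumes u: "test_intble u" and g: "!!j. test_intble (%x. g x $ j)"
 shows "weak_gradient u g \<longleftrightarrow> (\<forall>ph\<in>TF. \<forall>j.
  (LIN x. inner (u x) (pd j ph x)) = - (LIN x. inner (g x $ j) (ph x)))"
proof
 assume w: "weak_gradient u g"
 show "\<forall>ph\<in>TF. \<forall>j. (LIN x. inner (u x) (pd j ph x)) = - (LIN x. inner (g x $ j) (ph x))"
 proof (intro ballI allI)
  fix ph :: "'a cfun" and j assume ph: "ph \<in> TF"
  have "(LIN x. inner (u x) (pd j ph x)) = Re (LIN x. u x * pd j (%x. cnj (ph x)) x)"
  unfolding pd_cnj[OF ph]
  by (rule int_inner_eq_Re) (use u test_cnj[OF test_pd[OF ph]] in \<open>simp add: test_intble_def\<close>)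
  also have "\<dots> = - Re (LIN x. g x $ j * cnj (ph x))"
  using w test_cnj[OF ph] by (simp add: weak_gradient_def)
  also have "Re (LIN x. g x $ j * cnj (ph x)) = (LIN x. inner (g x $ j) (ph x))"
  by (rule int_inner_eq_Re[symmetric]) (use g test_cnj[OF ph] in \<open>simp add: test_intble_def\<close>)
  finally show "(LIN x. inner (u x) (pd j ph x)) = - (LIN x. inner (g x $ j) (ph x))" .
 qed
next
 assume w: "\<forall>ph\<in>TF. \<forall>j. (LIN x. inner (u x) (pd j ph x)) = - (LIN x. inner (g x $ j) (ph x))"
 show "weak_gradient u g" unfolding weak_gradient_def
 proof (intro ballI allI)
  fix ph :: "'a cfun" and j assume ph: "ph \<in> TF"
  have iu: "integrable lebesgue (%x. u x * pd j ph x)" and ig: "integrable lebesgue (%x. g x $ j * ph x)"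
  using u g test_pd[OF ph] ph by (auto simp: test_intble_def)
  show "(LIN x. u x * pd j ph x) = - (LIN x. g x $ j * ph x)"
  unfolding int_mult_eq_inner[OF iu] int_mult_eq_inner[OF ig]
  using w[rule_format, OF test_cnj[OF ph], of j] w[rule_format, OF test_rot[OF ph], of j]
  by (simp only: pd_cnj[OF ph] pd_rot[OF ph]) (simp add: complex_eq_iff)
 qed
qed

lemma weak_divergence_iff_inner:
 assumes V: "!!j. test_intble (%x. V x $ j)" and d: "test_intble d"
 shows "weak_divergence V d \<longleftrightarrow> (\<forall>ph\<in>TF.
  (\<Sum>j\<in>UNIV. LIN x. inner (V x $ j) (pd j ph x)) = - (LIN x. inner (d x) (ph x)))"
proof -
 have iV: "integrable lebesgue (%x. V x $ j * pd j ph x)" if "ph \<in> TF" for j ph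
  using V test_pd[OF that] by (auto simp: test_intble_def)
 have id: "integrable lebesgue (%x. d x * ph x)" if "ph \<in> TF" for ph
  using d that by (auto simp: test_intble_def)
 have sum: "(LIN x. (\<Sum>j\<in>UNIV. V x $ j * pd j ph x)) = (\<Sum>j\<in>UNIV. LIN x. V x $ j * pd j ph x)"
  if "ph \<in> TF" for ph by (rule Bochner_Integration.integral_sum) (rule iV[OF that])
 show ?thesis
 proof
  assume w: "weak_divergence V d"
  show "\<forall>ph\<in>TF. (\<Sum>j\<in>UNIV. LIN x. inner (V x $ j) (pd j ph x)) = - (LIN x. inner (d x) (ph x))"
  proof
  fix ph :: "'a cfun" assume ph: "ph \<in> TF"
  have "(\<Sum>j\<in>UNIV. LIN x. inner (V x $ j) (pd j ph x)) = (\<Sum>j\<in>UNIV. Re (LIN x. V x $ j * pd j (%x. cnj (ph x)) x))"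
  unfolding pd_cnj[OF ph]
  by (intro sum.cong refl int_inner_eq_Re) (use iV[OF test_cnj[OF ph]] in \<open>simp add: pd_cnj[OF ph]\<close>)
  also have "\<dots> = - Re (LIN x. d x * cnj (ph x))"
  using w test_cnj[OF ph] by (simp add: weak_divergence_def sum Re_sum[symmetric])
  also have "Re (LIN x. d x * cnj (ph x)) = (LIN x. inner (d x) (ph x))"
  by (rule int_inner_eq_Re[symmetric]) (rule id[OF test_cnj[OF ph]])
  finally show "(\<Sum>j\<in>UNIV. LIN x. inner (V x $ j) (pd j ph x)) = - (LIN x. inner (d x) (ph x))" .
  qed
 next
  assume w: "\<forall>ph\<in>TF. (\<Sum>j\<in>UNIV. LIN x. inner (V x $ j) (pd j ph x)) = - (LIN x. inner (d x) (ph x))"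
  show "weak_divergence V d" unfolding weak_divergence_def
  proof
  fix ph :: "'a cfun" assume ph: "ph \<in> TF"
  show "(LIN x. (\<Sum>j\<in>UNIV. V x $ j * pd j ph x)) = - (LIN x. d x * ph x)"
  unfolding sum[OF ph] int_mult_eq_inner[OF iV[OF ph]] int_mult_eq_inner[OF id[OF ph]]
  using w[rule_format, OF test_cnj[OF ph]] w[rule_format, OF test_rot[OF ph]]
  by (simp only: pd_cnj[OF ph] pd_rot[OF ph]) (simp add: complex_eq_iff Re_sum Im_sum)
  qed
 qed
qed

lemma weak_curl_free_iff_inner:
 assumes V: "!!j. test_intble (%x. V x $ j)"
 shows "weak_curl_free V \<longleftrightarrow> (\<forall>ph\<in>TF. \<forall>i j.
  (LIN x. inner (V x $ i) (pd j ph x)) = (LIN x. inner (V x $ j) (pd i ph x)))"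
proof -
 have iV: "integrable lebesgue (%x. V x $ i * pd j ph x)" if "ph \<in> TF" for i j ph
  using V test_pd[OF that] by (auto simp: test_intble_def)
 have re: "(LIN x. inner (V x $ i) (pd j ph x)) = Re (LIN x. V x $ i * pd j (%x. cnj (ph x)) x)"
  if ph: "ph \<in> TF" for i j ph
  unfolding pd_cnj[OF ph]
  by (rule int_inner_eq_Re) (use iV[OF test_cnj[OF ph]] in \<open>simp add: pd_cnj[OF ph]\<close>)
 show ?thesis
 proof
  assume w: "weak_curl_free V"
  show "\<forall>ph\<in>TF. \<forall>i j. (LIN x. inner (V x $ i) (pd j ph x)) = (LIN x. inner (V x $ j) (pd i ph x))"
  proof (intro ballI allI)
  fix ph :: "'a cfun" and i j assume ph: "ph \<in> TF"
  show "(LIN x. inner (V x $ i) (pd j ph x)) = (LIN x. inner (V x $ j) (pd i ph x))"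
  unfolding re[OF ph] using w[unfolded weak_curl_free_def, rule_format, OF test_cnj[OF ph], of i j] by (rule arg_cong)
  qed
 next
  assume w: "\<forall>ph\<in>TF. \<forall>i j. (LIN x. inner (V x $ i) (pd j ph x)) = (LIN x. inner (V x $ j) (pd i ph x))"
  show "weak_curl_free V" unfolding weak_curl_free_def
  proof (intro ballI allI)
  fix ph :: "'a cfun" and i j assume ph: "ph \<in> TF"
  show "(LIN x. V x $ i * pd j ph x) = (LIN x. V x $ j * pd i ph x)"
  unfolding int_mult_eq_inner[OF iV[OF ph]]
  using w[rule_format, OF test_cnj[OF ph], of i j] w[rule_format, OF test_rot[OF ph], of i j]
  by (simp only: pd_cnj[OF ph] pd_rot[OF ph])
  qed
 qed
qed

lemma test_intble_L2:
 assumes "square_integrable f"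
 shows "test_intble f"
 unfolding test_intble_def
proof
 fix ph :: "'a cfun" assume ph: "ph \<in> TF"
 have nf: "square_integrable (%x. norm (f x))" and nph: "square_integrable (%x. norm (ph x))"
  using assms test_sqi[OF ph] by (auto simp: square_integrable_def)
 have m: "f \<in> lmeas" "ph \<in> lmeas"
  using assms test_sqi[OF ph] by (auto simp: square_integrable_def)
 show "integrable lebesgue (%x. f x * ph x)"
  by (rule Bochner_Integration.integrable_bound[OF integrable_inner_square_integrable[OF nf nph]])
  (use m in \<open>auto simp: norm_mult\<close>)
qed

lemma int_inner_test:
 assumes f: "f \<in> lmeas" "AEL x. f x = rep_L2 u x" and ph: "ph \<in> TF"
 shows "(LIN x. inner (f x) (ph x)) = inner u (tf ph)"
proof -
 have m: "ph \<in> lmeas" using test_sqi[OF ph] by (simp add: square_integrable_def)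
 show ?thesis unfolding tf_def inner_L2_abs[OF test_sqi[OF ph]]
 proof (rule integral_cong_AE)
  show "AEL x. inner (f x) (ph x) = inner (rep_L2 u x) (ph x)" using f(2) by eventually_elim simp
 qed (use f(1) m in \<open>auto intro: borel_measurable_inner\<close>)
qed

lemma sqi_AE:
 assumes "f \<in> lmeas" "AEL x. f x = rep_L2 u x"
 shows "square_integrable f"
 by (rule sqi_bound[OF sqi_rep[of u] assms(1)]) (use assms(2) in \<open>auto elim: eventually_mono\<close>)

definition weak_deriv :: "('n::finite) scal => 'n => 'n scal => bool" where
 "weak_deriv a j b \<longleftrightarrow> (\<forall>ph\<in>TF. inner a (tf (pd j ph)) = - inner b (tf ph))"

definition L2_div :: "('n::finite) vect => 'n scal => bool" where
 "L2_div V d \<longleftrightarrow> (\<forall>ph\<in>TF. (\<Sum>j\<in>UNIV. inner (L2_nth V j) (tf (pd j ph))) = - inner d (tf ph))"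

definition L2_curl_free :: "('n::finite) vect => bool" where
 "L2_curl_free V \<longleftrightarrow> (\<forall>ph\<in>TF. \<forall>i j.
  inner (L2_nth V i) (tf (pd j ph)) = inner (L2_nth V j) (tf (pd i ph)))"

lemma nth_AE:
 assumes "f \<in> lmeas" "AEL x. f x = rep_L2 (V :: (real ^ 'n::finite, complex ^ 'm::finite) L2) x"
 shows "(%x. f x $ j) \<in> lmeas" "AEL x. f x $ j = rep_L2 (L2_nth V j) x"
proof -
 show "(%x. f x $ j) \<in> lmeas" using pw_nth[of j] assms(1) unfolding pw_bdd_def by blast
 show "AEL x. f x $ j = rep_L2 (L2_nth V j) x"
  using rep_L2_nth[of V j] assms(2) by eventually_elim simp
qed

lemma weak_gradient_L2:
 assumes f: "f \<in> lmeas" "AEL x. f x = rep_L2 a x"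
  and g: "g \<in> lmeas" "AEL x. g x = rep_L2 G x"
 shows "weak_gradient f g \<longleftrightarrow> (\<forall>j. weak_deriv a j (L2_nth G j))"
proof -
 have "test_intble f" "test_intble (%x. g x $ j)" for j
  using test_intble_L2[OF sqi_AE[OF f]] test_intble_L2[OF sqi_AE[OF nth_AE[OF g]]] by auto
 note iff = weak_gradient_iff_inner[OF this]
 show ?thesis unfolding iff weak_deriv_def
  by (simp add: int_inner_test[OF f] int_inner_test[OF nth_AE[OF g]] test_pd) blast
qed

lemma weak_divergence_L2:
 assumes f: "f \<in> lmeas" "AEL x. f x = rep_L2 V x"
  and g: "g \<in> lmeas" "AEL x. g x = rep_L2 d x"
 shows "weak_divergence f g \<longleftrightarrow> L2_div V d"
proof -
 have "test_intble (%x. f x $ j)" "test_intble g" for j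
  using test_intble_L2[OF sqi_AE[OF g]] test_intble_L2[OF sqi_AE[OF nth_AE[OF f]]] by auto
 note iff = weak_divergence_iff_inner[OF this]
 show ?thesis unfolding iff L2_div_def
  by (simp add: int_inner_test[OF g] int_inner_test[OF nth_AE[OF f]] test_pd)
qed

lemma weak_curl_free_L2:
 assumes f: "f \<in> lmeas" "AEL x. f x = rep_L2 V x"
 shows "weak_curl_free f \<longleftrightarrow> L2_curl_free V"
proof -
 have "test_intble (%x. f x $ j)" for j
  using test_intble_L2[OF sqi_AE[OF nth_AE[OF f]]] by auto
 note iff = weak_curl_free_iff_inner[OF this]
 show ?thesis unfolding iff L2_curl_free_def
  by (simp add: int_inner_test[OF nth_AE[OF f]] test_pd)
qed

subsection \<open>Weak derivatives as derivatives of translations\<close>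

lemma weak_deriv_tf: "ph \<in> TF ==> weak_deriv (tf ph) j (tf (pd j ph))"
 unfolding weak_deriv_def using tf_int_by_parts[of ph _ j] by simp

lemma weak_deriv_shift:
 assumes "weak_deriv g j G"
 shows "weak_deriv (L2_shift y g) j (L2_shift y G)"
 unfolding weak_deriv_def
proof
 fix ph :: "'a cfun" assume ph: "ph \<in> TF"
 have eq: "L2_shift (- y) (tf (pd j ph)) = tf (pd j (%x. ph (x + - y)))"
  unfolding tf_shift[OF test_pd[OF ph]] pd_shift[OF test_smooth[OF ph]] ..
 show "inner (L2_shift y g) (tf (pd j ph)) = - inner (L2_shift y G) (tf ph)"
  unfolding L2_shift_inner_left eq tf_shift[OF ph]
  by (rule assms[unfolded weak_deriv_def, rule_format, OF test_shift[OF ph]])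
qed

lemma weak_deriv_test_der:
 assumes g: "weak_deriv g j G" and ph: "ph \<in> TF"
 shows "((%s. inner (tf ph) (L2_shift (s *: axis j 1) g)) has_real_derivative inner (tf ph) (L2_shift (s *: axis j 1) G)) (at s)"
proof -
 let ?e = "axis j 1 :: real ^ 'a"
 have "((%r. L2_shift (r *: ?e) (tf ph)) has_vector_derivative L2_shift ((- s) *: ?e) (tf (pd j ph))) (at (- s))"
  by (rule test_shift_deriv[OF ph])
 from vector_diff_chain_at[of uminus "-1" s, OF _ this]
 have "((%r. L2_shift ((- r) *: ?e) (tf ph)) has_vector_derivative - L2_shift ((- s) *: ?e) (tf (pd j ph))) (at s)"
  by (simp add: comp_def has_vector_derivative_minus has_vector_derivative_id)
 from bounded_linear.has_vector_derivative[OF bounded_linear_inner_left this, of g]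
 have "((%r. inner (L2_shift (- (r *: ?e)) (tf ph)) g) has_vector_derivative - inner (L2_shift (- (s *: ?e)) (tf (pd j ph))) g) (at s)"
  by (simp add: inner_minus_left)
 moreover have "inner (L2_shift (- (r *: ?e)) u) g = inner u (L2_shift (r *: ?e) g)" for r u
  by (simp add: L2_shift_inner_left)
 moreover have "- inner (tf (pd j ph)) (L2_shift (s *: ?e) g) = inner (tf ph) (L2_shift (s *: ?e) G)"
  using weak_deriv_shift[OF g, of "s *: ?e"] ph by (simp add: weak_deriv_def inner_commute)
 ultimately show ?thesis by (simp add: has_real_derivative_iff_has_vector_derivative)
qed

text \<open>The mean value inequality is applied to pairings with test functions; by density the
  difference can then be paired with itself.\<close>

lemma weak_deriv_shift_bound:
 assumes g: "weak_deriv g j G"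
 shows "norm (L2_shift (s *: axis j 1) g - g) <= \<bar>s\<bar> * norm G"
proof -
 let ?e = "axis j 1 :: real ^ 'a"
 define x where "x = L2_shift (s *: ?e) g - g"
 have test: "inner (tf ph) x <= norm (tf ph) * (\<bar>s\<bar> * norm G)" if ph: "ph \<in> TF" for ph
 proof -
  have "norm (inner (tf ph) (L2_shift (s *: ?e) g) - inner (tf ph) (L2_shift (0 *: ?e) g)) <= (norm (tf ph) * norm G) * norm (s - 0)"
  proof (rule field_differentiable_bound[of UNIV])
  fix r :: real
  show "((%s. inner (tf ph) (L2_shift (s *: ?e) g)) has_real_derivative inner (tf ph) (L2_shift (r *: ?e) G)) (at r within UNIV)"
  using weak_deriv_test_der[OF g ph] by simp
  show "norm (inner (tf ph) (L2_shift (r *: ?e) G)) <= norm (tf ph) * norm G"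
  using Cauchy_Schwarz_ineq2[of "tf ph" "L2_shift (r *: ?e) G"] by (simp add: L2_shift_norm)
  qed auto
  then show ?thesis by (simp add: x_def inner_diff_right L2_shift_0 mult_ac)
 qed
 obtain ph where ph: "!!n::nat. ph n \<in> TF" "(%n. tf (ph n)) ----> x" using tf_sequence by blast
 have "inner x x <= norm x * (\<bar>s\<bar> * norm G)"
  by (rule LIMSEQ_le[OF tendsto_inner[OF ph(2) tendsto_const] tendsto_mult[OF tendsto_norm[OF ph(2)] tendsto_const]])
  (use test[OF ph(1)] in blast)
 then have "norm x * norm x <= norm x * (\<bar>s\<bar> * norm G)" by (simp add: power2_norm_eq_inner[symmetric] power2_eq_square)
 then have "norm x <= \<bar>s\<bar> * norm G" by (cases "x = 0") auto
 then show ?thesis by (simp add: x_def)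
qed

text \<open>Difference quotients paired with test functions converge by
  \<open>weak_deriv_test_der\<close>, and \<open>weak_deriv_shift_bound\<close> bounds the quotients
  uniformly; hence they converge weakly against every \<open>u\<close>.\<close>

lemma weak_deriv_der:
 assumes g: "weak_deriv g j G"
 shows "((%s. inner u (L2_shift (s *: axis j 1) g)) has_real_derivative inner u (L2_shift (s *: axis j 1) G)) (at s)"
proof -
 let ?e = "axis j 1 :: real ^ 'a"
 have at0: "((%s. inner u (L2_shift (s *: ?e) g)) has_real_derivative inner u G) (at 0)" for u
 proof -
  define L where "L h u = inner u (L2_shift (h *: ?e) g - g) / h - inner u G" for h u
  have "((%h. L h u) ---> 0) (at 0)"
  proof (rule tendsto_zero_dense[OF tf_dense, where L=L and K="2 * norm G"])
  have add: "L h (x - y) = L h x - L h y" for h x y by (simp add: L_def inner_diff_left diff_divide_distrib)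
  have bd: "norm (L h x) <= 2 * norm G * norm x" if "h ~= 0" for h x
  proof -
  have "\<bar>inner x (L2_shift (h *: ?e) g - g)\<bar> <= norm x * (\<bar>h\<bar> * norm G)"
  by (rule order_trans[OF Cauchy_Schwarz_ineq2]) (intro mult_left_mono weak_deriv_shift_bound[OF g] norm_ge_zero)
  then have "\<bar>inner x (L2_shift (h *: ?e) g - g) / h\<bar> <= norm x * norm G"
  using that by (simp add: abs_divide divide_le_eq mult_ac)
  moreover have "\<bar>inner x G\<bar> <= norm x * norm G" by (rule Cauchy_Schwarz_ineq2)
  ultimately have "\<bar>inner x (L2_shift (h *: ?e) g - g) / h\<bar> + \<bar>inner x G\<bar> <= norm x * norm G + norm x * norm G"
  by (rule add_mono)
  also have "\<dots> = 2 * norm G * norm x" by simp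
  finally have "\<bar>inner x (L2_shift (h *: ?e) g - g) / h\<bar> + \<bar>inner x G\<bar> <= 2 * norm G * norm x" .
  then show ?thesis unfolding L_def real_norm_def using abs_triangle_ineq4 order_trans by blast
  qed
  show "\<forall>\<^sub>F t in at 0. (\<forall>x y. L t (x - y) = L t x - L t y) \<and> (\<forall>x. norm (L t x) <= 2 * norm G * norm x)"
  using eventually_neq_at_within[of 0 0 UNIV] by eventually_elim (use add bd in blast)
  fix s :: "'a scal" assume "s \<in> tf ` TF"
  then obtain ph where ph: "ph \<in> TF" "s = tf ph" by blast
  have "((%h. (inner s (L2_shift ((0 + h) *: ?e) g) - inner s (L2_shift (0 *: ?e) g)) / h) ---> inner s (L2_shift (0 *: ?e) G)) (at 0)"
  using weak_deriv_test_der[OF g ph(1), of 0] unfolding ph(2) DERIV_def .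
  then have "((%h. (inner s (L2_shift (h *: ?e) g) - inner s g) / h) ---> inner s G) (at 0)"
  by (simp add: L2_shift_0)
  from tendsto_diff[OF this tendsto_const[of "inner s G"]]
  show "((%h. L h s) ---> 0) (at 0)" by (simp add: L_def inner_diff_right)
  qed
  from tendsto_add[OF this tendsto_const[of "inner u G"]]
  show ?thesis unfolding DERIV_def by (simp add: L_def inner_diff_right L2_shift_0)
 qed
 have "((%h. inner u (L2_shift ((h + s) *: ?e) g)) has_real_derivative inner u (L2_shift (s *: ?e) G)) (at 0)"
 proof -
  have eq: "inner u (L2_shift ((h + s) *: ?e) k) = inner (L2_shift (- (s *: ?e)) u) (L2_shift (h *: ?e) k)" for h k
  by (simp add: L2_shift_inner_left L2_shift_shift scaleR_add_left add.commute)
  from eq[of 0 G] have "inner u (L2_shift (s *: ?e) G) = inner (L2_shift (- (s *: ?e)) u) G" by (simp add: L2_shift_0)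
  then show ?thesis unfolding eq using at0 by simp
 qed
 then show ?thesis using DERIV_shift[of "%s. inner u (L2_shift (s *: ?e) g)" _ 0 s] by simp
qed

text \<open>The translation is performed along one coordinate axis after another, and each step is
  an isometry on the remaining difference.\<close>

lemma weak_gradient_shift_bound:
 fixes g :: "('n::finite) scal"
 assumes g: "!!j. weak_deriv g j (G j)"
 shows "norm (L2_shift y g - g) <= (\<Sum>j\<in>UNIV. \<bar>y $ j\<bar> * norm (G j))"
proof -
 have ind: "norm (L2_shift (\<Sum>j\<in>S. (y $ j) *: axis j 1) g - g) <= (\<Sum>j\<in>S. \<bar>y $ j\<bar> * norm (G j))" if "finite S" for S
  using that
 proof (induction S rule: finite_induct)
  case empty
  then show ?case by (simp add: L2_shift_0)
 next
  case (insert i S)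
  let ?a = "(y $ i) *: axis i 1 :: real ^ 'n" and ?b = "\<Sum>j\<in>S. (y $ j) *: axis j 1 :: real ^ 'n"
  have "L2_shift (?a + ?b) g - g = L2_shift ?a (L2_shift ?b g - g) + (L2_shift ?a g - g)"
  by (simp add: L2_shift_diff L2_shift_shift)
  also have "norm \<dots> <= norm (L2_shift ?b g - g) + \<bar>y $ i\<bar> * norm (G i)"
  by (rule order_trans[OF norm_triangle_ineq]) (intro add_mono weak_deriv_shift_bound[OF g], simp add: L2_shift_norm)
  finally show ?case using insert by simp
 qed
 have "(\<Sum>j\<in>UNIV. (y $ j) *: axis j 1) = y"
  by (simp add: vec_eq_iff axis_def if_distrib sum.delta cong: if_cong)
 with ind[of UNIV] show ?thesis by simp
qed

subsection \<open>Integration by parts\<close>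

text \<open>Translation invariance makes the integral of each difference quotient vanish, and
  dominated convergence passes to the derivative. Steps of length at most 1 keep everything in the
  ball of radius \<open>R + 1\<close>.\<close>

lemma int_dir_der:
 fixes w w' :: "real ^ 'n::finite => real"
 assumes w: "continuous_on UNIV w" "!!x. R < norm x ==> w x = 0"
  and w': "continuous_on UNIV w'" "!!x. R < norm x ==> w' x = 0"
  and d: "!!x s. ((%s. w (x + s *: axis j 1)) has_real_derivative w' (x + s *: axis j 1)) (at s)"
 shows "(LIN x. w' x) = 0"
proof -
 let ?e = "axis j 1 :: real ^ 'n"
 have ne: "norm ?e = 1" by (simp add: norm_axis_1)
 have "bounded (w' ` cball 0 R)" by (intro compact_imp_bounded compact_continuous_image continuous_on_subset[OF w'(1)]) auto
 then obtain K where K: "0 < K" "!!x. x \<in> cball 0 R ==> norm (w' x) <= K" unfolding bounded_pos by blast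
 have bound: "norm (w' x) <= K" for x using K w'(2)[of x] by (cases "norm x <= R") auto
 have lip: "\<bar>w (x + s *: ?e) - w x\<bar> <= K * \<bar>s\<bar>" for x s
 proof -
  have "norm (w (x + s *: ?e) - w (x + 0 *: ?e)) <= K * norm (s - 0)"
  by (rule field_differentiable_bound[of UNIV "%s. w (x + s *: ?e)" "%s. w' (x + s *: ?e)"]) (use d bound in auto)
  then show ?thesis by simp
 qed
 define h where "h k = inverse (real (Suc k))" for k
 have h: "0 < h k" "h k <= 1" for k by (auto simp: h_def field_simps)
 have hl: "h ----> 0" unfolding h_def by (rule LIMSEQ_inverse_real_of_nat)
 have wi: "integrable lebesgue w" by (rule intble_cont_compact[OF w])
 have wm: "w \<in> lmeas" by (rule borel_measurable_integrable[OF wi])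
 have sub: "integrable lebesgue (%x. w (x + y))" for y by (rule intble_transl[OF wi])
 have zero: "(LIN x. (w (x + h k *: ?e) - w x) / h k) = 0" for k
  by (simp add: Bochner_Integration.integral_diff[OF sub wi] int_transl[OF wm])
 have "(%k. LIN x. (w (x + h k *: ?e) - w x) / h k) ----> (LIN x. w' x)"
 proof (rule integral_dominated_convergence)
  show "w' \<in> lmeas" by (rule borel_measurable_integrable[OF intble_cont_compact[OF w']])
  show "(%x. (w (x + h k *: ?e) - w x) / h k) \<in> lmeas" for k
  by (rule borel_measurable_integrable) (intro integrable_divide_zero Bochner_Integration.integrable_diff sub wi)
  have "integrable lebesgue (indicator (cball 0 (R + 1)) :: real ^ 'n => real)"
  using lmeasurable_cball[of "0 :: real ^ 'n" "R + 1"] by (simp add: fmeasurable_def integrable_indicator_iff)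
  then show "integrable lebesgue (%x. K * indicator (cball (0 :: real ^ 'n) (R + 1)) x)" by simp
  show "AEL x. (%k. (w (x + h k *: ?e) - w x) / h k) ----> w' x"
  proof (rule AE_I2)
  fix x
  have "((%s. (w (x + (0 + s) *: ?e) - w (x + 0 *: ?e)) / s) ---> w' (x + 0 *: ?e)) (at 0)"
  using d[of x 0] unfolding DERIV_def .
  then have lim: "((%s. (w (x + s *: ?e) - w x) / s) ---> w' x) (at 0)" by simp
  have "filterlim h (at 0) sequentially"
  unfolding filterlim_at using hl h(1) by (auto intro!: always_eventually simp: less_imp_neq[THEN not_sym])
  from filterlim_compose[OF lim this] show "(%k. (w (x + h k *: ?e) - w x) / h k) ----> w' x" .
  qed
  show "AEL x. norm ((w (x + h k *: ?e) - w x) / h k) <= K * indicator (cball 0 (R + 1)) x" for k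
  proof (rule AE_I2)
  fix x
  show "norm ((w (x + h k *: ?e) - w x) / h k) <= K * indicator (cball 0 (R + 1)) x"
  proof (cases "norm x <= R + 1")
  case True
  then show ?thesis using lip[of x "h k"] h[of k] by (simp add: abs_divide divide_le_eq)
  next
  case False
  moreover have "R < norm (x + h k *: ?e)" using False norm_diff_ineq[of x "h k *: ?e"] h[of k] ne by simp
  ultimately show ?thesis using w(2)[of x] w(2)[of "x + h k *: ?e"] by simp
  qed
  qed
 qed
 then show ?thesis unfolding zero by (simp add: LIMSEQ_const_iff)
qed

lemma int_pd_test:
 assumes "ph \<in> TF"
 shows "(LIN x. inner c (pd j ph x)) = 0"
proof -
 obtain R1 where R1: "0 < R1" "!!x. R1 < norm x ==> ph x = 0" using test_supp[OF assms] by blast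
 obtain R2 where R2: "0 < R2" "!!x. R2 < norm x ==> pd j ph x = 0" using test_supp[OF test_pd[OF assms]] by blast
 show ?thesis
 proof (rule int_dir_der[of "%x. inner c (ph x)" "max R1 R2"])
  show "((%s. inner c (ph (x + s *: axis j 1))) has_real_derivative inner c (pd j ph (x + s *: axis j 1))) (at s)" for x s
  unfolding has_real_derivative_iff_has_vector_derivative
  by (rule bounded_linear.has_vector_derivative[OF bounded_linear_inner_right smooth_dir[OF test_smooth[OF assms]]])
 qed (use R1 R2 in \<open>auto intro!: continuous_intros test_cont test_pd assms\<close>)
qed

lemma intble_test_inner_shift:
 fixes et :: "('n::finite) cfun"
 assumes "et \<in> TF"
 shows "integrable lebesgue (%y. Re (et y) * inner u (L2_shift y (g :: 'n scal)))"
proof -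
 obtain R where R: "0 < R" "!!x. R < norm x ==> et x = 0" using test_supp[OF assms] by blast
 show ?thesis
  by (rule intble_cont_compact[of _ R])
  (use R in \<open>auto intro!: continuous_on_mult continuous_on_Re test_cont[OF assms] inner_shift_cont\<close>)
qed

lemma weak_deriv_int:
 fixes et :: "('n::finite) cfun"
 assumes et: "et \<in> TF" and g: "weak_deriv g j G"
 shows "(LIN y. Re (pd j et y) * inner u (L2_shift y g)) = - (LIN y. Re (et y) * inner u (L2_shift y G))"
proof -
 let ?d = "pd j et"
 obtain R1 where R1: "0 < R1" "!!x. R1 < norm x ==> et x = 0" using test_supp[OF et] by blast
 obtain R2 where R2: "0 < R2" "!!x. R2 < norm x ==> ?d x = 0" using test_supp[OF test_pd[OF et]] by blast
 have "(LIN y. Re (?d y) * inner u (L2_shift y g) + Re (et y) * inner u (L2_shift y G)) = 0"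
 proof (rule int_dir_der[of "%y. Re (et y) * inner u (L2_shift y g)" "max R1 R2"])
  fix x :: "real ^ 'n" and s :: real
  have 1: "((%s. Re (et (x + s *: axis j 1))) has_real_derivative Re (?d (x + s *: axis j 1))) (at s)"
  unfolding has_real_derivative_iff_has_vector_derivative
  by (rule bounded_linear.has_vector_derivative[OF bounded_linear_Re smooth_dir[OF test_smooth[OF et]]])
  have eq: "inner u (L2_shift (x + s *: axis j 1) k) = inner (L2_shift (- x) u) (L2_shift (s *: axis j 1) k)" for s k
  by (simp add: L2_shift_inner_left L2_shift_shift)
  have 2: "((%s. inner u (L2_shift (x + s *: axis j 1) g)) has_real_derivative inner u (L2_shift (x + s *: axis j 1) G)) (at s)"
  unfolding eq by (rule weak_deriv_der[OF g])
  show "((%s. Re (et (x + s *: axis j 1)) * inner u (L2_shift (x + s *: axis j 1) g)) has_real_derivative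
  Re (?d (x + s *: axis j 1)) * inner u (L2_shift (x + s *: axis j 1) g) + Re (et (x + s *: axis j 1)) * inner u (L2_shift (x + s *: axis j 1) G)) (at s)"
  using DERIV_mult[OF 1 2] by (simp add: mult.commute add.commute)
 qed (use R1 R2 in \<open>auto intro!: continuous_on_add continuous_on_mult continuous_on_Re inner_shift_cont test_cont test_pd et\<close>)
 then show ?thesis
  by (simp add: Bochner_Integration.integral_add intble_test_inner_shift test_pd et)
qed

lemma shift_fun_bl:
 fixes et :: "('n::finite) cfun" and u :: "'n scal"
 assumes et: "et \<in> TF"
 shows "bounded_linear (%g. LIN y. Re (et y) * inner u (L2_shift y g))"
proof (rule bounded_linear_intro[where K="(LIN y. \<bar>Re (et y)\<bar>) * norm u"])
 note int = intble_test_inner_shift[OF et]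
 show "(LIN y. Re (et y) * inner u (L2_shift y (g + h))) =
  (LIN y. Re (et y) * inner u (L2_shift y g)) + (LIN y. Re (et y) * inner u (L2_shift y h))" for g h
  by (simp add: L2_shift_add inner_add_right distrib_left int)
 show "(LIN y. Re (et y) * inner u (L2_shift y (c *: g))) = c *: (LIN y. Re (et y) * inner u (L2_shift y g))" for c g
  by (simp add: L2_shift_scaleR mult.left_commute)
 fix g
 obtain R where R: "0 < R" "!!x. R < norm x ==> et x = 0" using test_supp[OF et] by blast
 have i: "integrable lebesgue (%y. \<bar>Re (et y)\<bar>)"
  by (rule intble_cont_compact[of _ R]) (use R in \<open>auto intro!: continuous_intros test_cont et\<close>)
 have "norm (LIN y. Re (et y) * inner u (L2_shift y g)) <= (LIN y. \<bar>Re (et y)\<bar> * (norm u * norm g))"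
 proof (rule order_trans[OF integral_norm_bound], rule Bochner_Integration.integral_mono)
  show "norm (Re (et y) * inner u (L2_shift y g)) <= \<bar>Re (et y)\<bar> * (norm u * norm g)" for y
  using Cauchy_Schwarz_ineq2[of u "L2_shift y g"] by (simp add: abs_mult L2_shift_norm mult_left_mono)
 qed (use int i in auto)
 then show "norm (LIN y. Re (et y) * inner u (L2_shift y g)) <= norm g * ((LIN y. \<bar>Re (et y)\<bar>) * norm u)"
  by (simp add: mult_ac)
qed

text \<open>The function vanishes almost everywhere, so its nonzero set is open and negligible,
  hence empty.\<close>

lemma cont_bump_orth_zero:
 fixes S :: "real ^ 'n::finite => real"
 assumes c: "continuous_on UNIV S"
  and z: "!!m a b. 0 < m ==> (LIN x. real_bump m a b x * S x) = 0"
 shows "S x = 0"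
proof -
 have m: "S \<in> lmeas" by (intro measurable_completion) (simp add: borel_measurable_continuous_onI[OF c])
 have "AEL x. S x = 0"
 proof (rule AE_zero_of_bump_ints[OF m _ z])
  fix a b :: "real ^ 'n"
  have "integrable lborel (%x. indicator (cbox a b) x *: S x)"
  by (rule borel_integrable_compact) (auto intro: continuous_on_subset[OF c])
  then have j: "integrable lborel (%x. indicator (box a b) x *: (indicator (cbox a b) x *: S x))"
  by (rule integrable_mult_indicator[rotated]) simp
  have eq: "(%x. indicator (box a b) x *: (indicator (cbox a b) x *: S x)) = (%x. indicator (box a b) x * S x)"
  using box_subset_cbox[of a b] by (auto simp: fun_eq_iff indicator_def)
  have i: "integrable lborel (%x. indicator (box a b) x * S x)" using j unfolding eq .
  then show "integrable lebesgue (%x. indicator (box a b) x * S x)"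
  using integrable_completion[OF borel_measurable_integrable[OF i]] by simp
 qed
 moreover have o: "open {x. S x ~= 0}" by (intro open_Collect_neq c continuous_on_const)
 ultimately have neg: "negligible {x. S x ~= 0}"
  unfolding negligible_iff_null_sets using sets_completionI_sets[of _ lborel] borel_open[OF o]
  by (subst AE_iff_null_sets) auto
 then show ?thesis using open_not_negligible[OF o] by blast
qed

text \<open>
 Averaging over translations against \<open>et\<close> moves the derivatives from \<open>g\<close> to \<open>et\<close>; this gives a
 bounded functional of \<open>g\<close>, to which density of the test functions applies.
\<close>

lemma L2_div_gradient:
 fixes V :: "('n::finite) vect"
 assumes V: "L2_div V d" and g: "!!j. weak_deriv g j (G j)"
 shows "(\<Sum>j\<in>UNIV. inner (L2_nth V j) (G j)) = - inner d g"
proof -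
 note int = intble_test_inner_shift
 have test: "(\<Sum>j\<in>UNIV. LIN y. Re (pd j et y) * inner (L2_nth V j) (L2_shift y (tf h))) =
  (LIN y. Re (et y) * inner d (L2_shift y (tf h)))"
  if et: "et \<in> TF" and h: "h \<in> TF" for et h
 proof -
  have S: "(\<Sum>j\<in>UNIV. inner (L2_nth V j) (L2_shift y (tf (pd j h)))) = - inner d (L2_shift y (tf h))" for y
  using V[unfolded L2_div_def, rule_format, OF test_shift[OF h, of y]]
  by (simp add: tf_shift h test_pd pd_shift test_smooth)
  have "(\<Sum>j\<in>UNIV. LIN y. Re (pd j et y) * inner (L2_nth V j) (L2_shift y (tf h))) =
  - (\<Sum>j\<in>UNIV. LIN y. Re (et y) * inner (L2_nth V j) (L2_shift y (tf (pd j h))))"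
  unfolding weak_deriv_int[OF et weak_deriv_tf[OF h]] by (rule sum_negf)
  also have "\<dots> = - (LIN y. (\<Sum>j\<in>UNIV. Re (et y) * inner (L2_nth V j) (L2_shift y (tf (pd j h)))))"
  by (subst Bochner_Integration.integral_sum) (use int[OF et] in auto)
  also have "\<dots> = (LIN y. Re (et y) * inner d (L2_shift y (tf h)))"
  by (simp add: sum_distrib_left[symmetric] S)
  finally show ?thesis .
 qed
 have all: "(\<Sum>j\<in>UNIV. LIN y. Re (pd j et y) * inner (L2_nth V j) (L2_shift y g)) =
  (LIN y. Re (et y) * inner d (L2_shift y g))" if et: "et \<in> TF" for et
 proof -
  obtain h where h: "!!n::nat. h n \<in> TF" "(%n. tf (h n)) ----> g" using tf_sequence by blast
  have "(%n. \<Sum>j\<in>UNIV. LIN y. Re (pd j et y) * inner (L2_nth V j) (L2_shift y (tf (h n)))) ---->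
  (\<Sum>j\<in>UNIV. LIN y. Re (pd j et y) * inner (L2_nth V j) (L2_shift y g))"
  by (intro tendsto_sum bounded_linear.tendsto[OF shift_fun_bl[OF test_pd[OF et]] h(2)])
  moreover have "(%n. LIN y. Re (et y) * inner d (L2_shift y (tf (h n)))) ----> (LIN y. Re (et y) * inner d (L2_shift y g))"
  by (rule bounded_linear.tendsto[OF shift_fun_bl[OF et] h(2)])
  ultimately show ?thesis unfolding test[OF et h(1)] by (rule LIMSEQ_unique)
 qed
 \<comment> \<open>The claim for all translates at once. Integrated against bumps it is known, and
   continuity in \<open>y\<close> recovers the value at 0.\<close>
 define S where "S y = (\<Sum>j\<in>UNIV. inner (L2_nth V j) (L2_shift y (G j))) + inner d (L2_shift y g)" for y
 have "S 0 = 0"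
 proof (rule cont_bump_orth_zero)
  show "continuous_on UNIV S" unfolding S_def by (intro continuous_on_add continuous_on_sum inner_shift_cont)
  fix m :: real and a b :: "real ^ 'n" assume m: "0 < m"
  define et where "et x = complex_of_real (real_bump m a b x)" for x
  have et: "et \<in> TF" unfolding et_def by (rule bump_test[OF m])
  have "(LIN x. real_bump m a b x * S x) =
  (LIN y. (\<Sum>j\<in>UNIV. Re (et y) * inner (L2_nth V j) (L2_shift y (G j))) + Re (et y) * inner d (L2_shift y g))"
  by (simp add: S_def et_def distrib_left sum_distrib_left)
  also have "\<dots> = (\<Sum>j\<in>UNIV. LIN y. Re (et y) * inner (L2_nth V j) (L2_shift y (G j))) + (LIN y. Re (et y) * inner d (L2_shift y g))"
  by (subst Bochner_Integration.integral_add, intro Bochner_Integration.integrable_sum int[OF et], rule int[OF et],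
  subst Bochner_Integration.integral_sum) (use int[OF et] in auto)
  also have "\<dots> = 0"
  using all[OF et] unfolding weak_deriv_int[OF et g] by (simp add: sum_negf)
  finally show "(LIN x. real_bump m a b x * S x) = 0" .
 qed
 then show ?thesis by (simp add: S_def L2_shift_0)
qed

section \<open>The space of curl-free fields\<close>

lemma L2_nth_0: "L2_nth 0 j = 0"
 by (rule linear_0[OF bounded_linear.linear[OF L2_nth_bl]])

lemma L2_nth_add: "L2_nth (V + W) j = L2_nth V j + L2_nth W j"
 by (rule linear_add[OF bounded_linear.linear[OF L2_nth_bl]])

lemma L2_nth_minus: "L2_nth (- V) j = - L2_nth V j"
 by (rule linear_neg[OF bounded_linear.linear[OF L2_nth_bl]])

lemma L2_nth_scaleR: "L2_nth (c *: V) j = c *: L2_nth V j"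
 by (rule linear_cmul[OF bounded_linear.linear[OF L2_nth_bl]])

lemma L2_curl_free_0: "L2_curl_free 0"
 by (simp add: L2_curl_free_def L2_nth_0)

lemma L2_curl_free_add: "L2_curl_free V ==> L2_curl_free W ==> L2_curl_free (V + W)"
 by (simp add: L2_curl_free_def L2_nth_add inner_add_left)

lemma L2_curl_free_scaleR: "L2_curl_free V ==> L2_curl_free (c *: V)"
 by (simp add: L2_curl_free_def L2_nth_scaleR)

lemma L2_curl_free_minus: "L2_curl_free V ==> L2_curl_free (- V)"
 by (simp add: L2_curl_free_def L2_nth_minus inner_minus_left)

lemma L2_curl_free_diff: "L2_curl_free V ==> L2_curl_free W ==> L2_curl_free (V - W)"
 using L2_curl_free_add[OF _ L2_curl_free_minus, of V W] by simp

lemma L2_curl_free_limit: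
 assumes "!!n::nat. L2_curl_free (V n)" "V ----> W"
 shows "L2_curl_free W"
 unfolding L2_curl_free_def
proof (intro ballI allI)
 fix ph :: "'a cfun" and i j assume ph: "ph \<in> TF"
 have lim: "(%n. inner (L2_nth (V n) i) u) ----> inner (L2_nth W i) u" for i u
  by (intro tendsto_inner tendsto_const bounded_linear.tendsto[OF L2_nth_bl assms(2)])
 have "inner (L2_nth (V n) i) (tf (pd j ph)) = inner (L2_nth (V n) j) (tf (pd i ph))" for n
  using assms(1)[of n] ph by (simp add: L2_curl_free_def)
 then show "inner (L2_nth W i) (tf (pd j ph)) = inner (L2_nth W j) (tf (pd i ph))"
  using lim[of i "tf (pd j ph)"] lim[of j "tf (pd i ph)"] by (simp add: LIMSEQ_unique)
qed

text \<open>The closed subspace of curl-free fields becomes a Hilbert space in its own right, so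
  that traces live in a product of two Hilbert spaces, as the abstract duality requires.\<close>

typedef (overloaded) 'n gfield = "{V :: ('n::finite) vect. L2_curl_free V}"
 morphisms L2_of_field field_of_L2
 using L2_curl_free_0 by blast

setup_lifting type_definition_gfield

lemma L2_of_field_curl_free: "L2_curl_free (L2_of_field V)"
 using L2_of_field[of V] by simp

lemma L2_of_field_of_L2: "L2_curl_free V ==> L2_of_field (field_of_L2 V) = V"
 by (rule field_of_L2_inverse) simp

instantiation gfield :: (finite) real_vector
begin

lift_definition zero_gfield :: "'a gfield" is 0 by (rule L2_curl_free_0)
lift_definition plus_gfield :: "'a gfield => 'a gfield => 'a gfield" is "(+)" by (rule L2_curl_free_add)
lift_definition uminus_gfield :: "'a gfield => 'a gfield" is uminus by (rule L2_curl_free_minus)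
lift_definition minus_gfield :: "'a gfield => 'a gfield => 'a gfield" is "(-)" by (rule L2_curl_free_diff)
lift_definition scaleR_gfield :: "real => 'a gfield => 'a gfield" is scaleR by (rule L2_curl_free_scaleR)

instance
 by standard (transfer; simp add: algebra_simps)+

end

instantiation gfield :: (finite) real_inner
begin

lift_definition inner_gfield :: "'a gfield => 'a gfield => real" is inner .

definition norm_gfield :: "'a gfield => real" where
 "norm_gfield f = sqrt (inner f f)"

definition sgn_gfield :: "'a gfield => 'a gfield" where
 "sgn_gfield f = f /\<^sub>R norm f"

definition dist_gfield :: "'a gfield => 'a gfield => real" where
 "dist_gfield f g = norm (f - g)"

definition uniformity_gfield :: "('a gfield \<times> 'a gfield) filter" where
 "uniformity_gfield = (INF e\<in>{0 <..}. principal {(x, y). dist x y < e})"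

definition open_gfield :: "'a gfield set => bool" where
 "open_gfield U = (\<forall>x\<in>U. \<forall>\<^sub>F (x', y) in uniformity. x' = x --> y \<in> U)"

instance
proof
 fix f g h :: "'a gfield" and r :: real
 show "inner f g = inner g f" by transfer (rule inner_commute)
 show "inner (f + g) h = inner f h + inner g h" by transfer (rule inner_add_left)
 show "inner (r *: f) g = r * inner f g" by transfer simp
 show "0 <= inner f f" by transfer simp
 show "inner f f = 0 \<longleftrightarrow> f = 0" by transfer simp
qed (rule norm_gfield_def sgn_gfield_def dist_gfield_def uniformity_gfield_def open_gfield_def)+

end

lemma norm_L2_of_field: "norm (L2_of_field V) = norm V"
 unfolding norm_gfield_def inner_gfield.rep_eq by (rule norm_eq_sqrt_inner)

lemma L2_of_field_bl: "bounded_linear L2_of_field"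
 by (rule bounded_linear_intro[where K=1])
  (auto simp: plus_gfield.rep_eq scaleR_gfield.rep_eq norm_L2_of_field)

instance gfield :: (finite) banach
proof
 fix X :: "nat => 'a gfield" assume X: "Cauchy X"
 have "Cauchy (%n. L2_of_field (X n))" by (rule bounded_linear.Cauchy[OF L2_of_field_bl X])
 then obtain W where W: "(%n. L2_of_field (X n)) ----> W" using Cauchy_convergent convergent_def by blast
 have cW: "L2_curl_free W" by (rule L2_curl_free_limit[OF L2_of_field_curl_free W])
 have "norm (X n - field_of_L2 W) = norm (L2_of_field (X n) - W)" for n
  by (simp add: norm_L2_of_field[symmetric] minus_gfield.rep_eq L2_of_field_of_L2[OF cW])
 then have "X ----> field_of_L2 W" using W by (simp add: LIMSEQ_iff)
 then show "convergent X" by (auto simp: convergent_def)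
qed

text \<open>The adjoint of the isometric inclusion, i.e. the orthogonal projection onto curl-free
  fields.\<close>

definition field_proj :: "('n::finite) vect => 'n gfield" where
 "field_proj = (SOME P. bounded_linear P \<and> (\<forall>V W. inner (L2_of_field V) W = inner V (P W)))"

lemma field_proj_adj:
 "bounded_linear (field_proj :: _ => 'n::finite gfield) \<and> (\<forall>(V :: 'n gfield) W. inner (L2_of_field V) W = inner V (field_proj W))"
proof -
 obtain P :: "'n vect => 'n gfield"
  where "bounded_linear P" "!!V W. inner (L2_of_field V) W = inner V (P W)"
  by (rule adj_exists[OF L2_of_field_bl]) blast
 then have "\<exists>P. bounded_linear P \<and> (\<forall>(V :: 'n gfield) W. inner (L2_of_field V) W = inner V (P W))" by blast
 from someI_ex[OF this] show ?thesis unfolding field_proj_def .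
qed

lemmas field_proj_bl = field_proj_adj[THEN conjunct1]

lemma inner_field_proj_right: "inner V (field_proj W) = inner (L2_of_field V) W"
 by (rule field_proj_adj[THEN conjunct2, rule_format, symmetric])

lemma inner_field_proj_left: "inner (field_proj W) V = inner W (L2_of_field V)"
 using inner_field_proj_right[of V W] by (simp add: inner_commute)

lemma field_proj_L2_of_field: "field_proj (L2_of_field V) = V"
 by (rule inner_ext) (subst inner_field_proj_left, rule inner_gfield.rep_eq[symmetric])

lemma L2_nth_sum_axis: "L2_nth (\<Sum>j\<in>UNIV. L2_axis j (u j)) k = u k"
proof -
 have "L2_nth (\<Sum>j\<in>UNIV. L2_axis j (u j)) k = (\<Sum>j\<in>UNIV. L2_nth (L2_axis j (u j)) k)"
  by (rule linear_sum[OF bounded_linear.linear[OF L2_nth_bl]])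
 also have "\<dots> = u k" by (simp add: L2_nth_axis sum.delta)
 finally show ?thesis .
qed

definition test_gradient :: "(real ^ 'n::finite => complex) => 'n gfield" where
 "test_gradient ph = field_of_L2 (\<Sum>j\<in>UNIV. L2_axis j (tf (pd j ph)))"

lemma L2_nth_test_gradient:
 fixes ph :: "('n::finite) cfun"
 assumes ph: "ph \<in> TF"
 shows "L2_nth (L2_of_field (test_gradient ph)) k = tf (pd k ph)"
proof -
 have "L2_curl_free (\<Sum>j\<in>UNIV. L2_axis j (tf (pd j ph)))"
  unfolding L2_curl_free_def L2_nth_sum_axis
 proof (intro ballI allI)
  fix et :: "'n cfun" and i j assume et: "et \<in> TF"
  show "inner (tf (pd i ph)) (tf (pd j et)) = inner (tf (pd j ph)) (tf (pd i et))"
  using tf_int_by_parts[OF test_pd[OF ph] et, of i j] tf_int_by_parts[OF test_pd[OF ph] et, of j i]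
  tf_pd_commute[OF ph, of i j] by simp
 qed
 from L2_of_field_of_L2[OF this] show ?thesis by (simp add: test_gradient_def L2_nth_sum_axis)
qed

section \<open>The self-adjoint differential operator\<close>

text \<open>The graph of (a, V) \<mapsto> (div V, - grad a); the minus sign makes the block operator
  symmetric, since div is minus the formal adjoint of grad.\<close>

definition div_grad :: "((('n::finite) scal \<times> 'n gfield) \<times> ('n scal \<times> 'n gfield)) set" where
 "div_grad = {((a, V), (d, G)). L2_div (L2_of_field V) d \<and> (\<forall>j. weak_deriv a j (- L2_nth (L2_of_field G) j))}"

lemma test_gradient_div_grad: "ph \<in> TF ==> ((tf ph, 0), (0, - test_gradient ph)) \<in> div_grad"
 unfolding div_grad_def
 by (simp add: L2_div_def zero_gfield.rep_eq uminus_gfield.rep_eq L2_nth_0 L2_nth_minus L2_nth_test_gradient weak_deriv_tf)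

lemma proj_axis_div_grad:
 assumes ph: "ph \<in> TF"
 shows "((0, field_proj (L2_axis j (tf ph))), (tf (pd j ph), 0)) \<in> div_grad"
proof -
 have "L2_div (L2_of_field (field_proj (L2_axis j (tf ph)))) (tf (pd j ph))"
  unfolding L2_div_def
 proof
  fix et :: "'a cfun" assume et: "et \<in> TF"
  have "(\<Sum>k\<in>UNIV. inner (L2_nth (L2_of_field (field_proj (L2_axis j (tf ph)))) k) (tf (pd k et))) =
  inner (field_proj (L2_axis j (tf ph))) (test_gradient et)"
  unfolding inner_gfield.rep_eq inner_L2_nth L2_nth_test_gradient[OF et] ..
  also have "\<dots> = inner (L2_of_field (test_gradient et)) (L2_axis j (tf ph))"
  unfolding inner_field_proj_left by (rule inner_commute)
  also have "\<dots> = inner (tf (pd j et)) (tf ph)" by (simp add: inner_L2_axis L2_nth_test_gradient[OF et])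
  also have "\<dots> = - inner (tf (pd j ph)) (tf et)"
  using tf_int_by_parts[OF et ph] by (simp add: inner_commute)
  finally show "(\<Sum>k\<in>UNIV. inner (L2_nth (L2_of_field (field_proj (L2_axis j (tf ph)))) k) (tf (pd k et))) =
  - inner (tf (pd j ph)) (tf et)" .
 qed
 then show ?thesis by (simp add: div_grad_def weak_deriv_def zero_gfield.rep_eq L2_nth_0)
qed

lemma div_grad_duality:
 assumes "L2_div (L2_of_field V) d" "!!j. weak_deriv a j (- L2_nth (L2_of_field G) j)"
 shows "inner V G = inner d a"
 using L2_div_gradient[OF assms] by (simp add: inner_gfield.rep_eq inner_L2_nth inner_minus_right sum_negf)

text \<open>Symmetry is \<open>L2_div_gradient\<close>. Conversely, pairing with (ph, 0) yields the
  weak divergence, and pairing with the projected coordinate fields (0, ph e_j) yields each weak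
  partial derivative.\<close>

lemma div_grad_self_adj: "(p, q) \<in> div_grad \<longleftrightarrow> (\<forall>x y. (x, y) \<in> div_grad --> inner y p = inner x q)"
proof -
 obtain a V d G where pq: "p = (a, V)" "q = (d, G)" by (cases p, cases q)
 show ?thesis
 proof
  assume D: "(p, q) \<in> div_grad"
  show "\<forall>x y. (x, y) \<in> div_grad --> inner y p = inner x q"
  proof (intro allI impI)
  fix x y assume xy: "(x, y) \<in> (div_grad :: (('a scal \<times> 'a gfield) \<times> ('a scal \<times> 'a gfield)) set)"
  obtain a' V' d' G' where e: "x = (a', V')" "y = (d', G')" by (cases x, cases y)
  have "inner V G' = inner d a'" "inner V' G = inner d' a"
  using D xy unfolding pq e div_grad_def by (auto intro!: div_grad_duality)
  then show "inner y p = inner x q" by (simp add: pq e inner_commute)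
  qed
 next
  assume D: "\<forall>x y. (x, y) \<in> div_grad --> inner y p = inner x q"
  have "L2_div (L2_of_field V) d" unfolding L2_div_def
  proof
  fix ph :: "'a cfun" assume ph: "ph \<in> TF"
  have "inner (- test_gradient ph) V = inner (tf ph) d"
  using D[rule_format, OF test_gradient_div_grad[OF ph]] by (simp add: pq)
  then show "(\<Sum>j\<in>UNIV. inner (L2_nth (L2_of_field V) j) (tf (pd j ph))) = - inner d (tf ph)"
  using inner_L2_nth[of "L2_of_field V" "L2_of_field (test_gradient ph)"]
  by (simp add: L2_nth_test_gradient[OF ph] inner_gfield.rep_eq uminus_gfield.rep_eq inner_commute)
  qed
  moreover have "weak_deriv a j (- L2_nth (L2_of_field G) j)" for j unfolding weak_deriv_def
  proof
  fix ph :: "'a cfun" assume ph: "ph \<in> TF"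
  have "inner (tf (pd j ph)) a = inner (field_proj (L2_axis j (tf ph))) G"
  using D[rule_format, OF proj_axis_div_grad[OF ph, of j]] by (simp add: pq)
  also have "\<dots> = inner (L2_of_field G) (L2_axis j (tf ph))" unfolding inner_field_proj_left by (rule inner_commute)
  also have "\<dots> = inner (L2_nth (L2_of_field G) j) (tf ph)" by (rule inner_L2_axis)
  finally show "inner a (tf (pd j ph)) = - inner (- L2_nth (L2_of_field G) j) (tf ph)"
  by (simp add: inner_commute)
  qed
  ultimately show "(p, q) \<in> div_grad" by (simp add: pq div_grad_def)
 qed
qed

lemma div_grad_single_valued:
 assumes "(0, q) \<in> div_grad"
 shows "q = 0"
proof -
 obtain d G where q: "q = (d, G)" by (cases q)
 have D: "L2_div 0 d" "!!j. weak_deriv 0 j (- L2_nth (L2_of_field G) j)"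
  using assms by (auto simp: q div_grad_def zero_prod_def zero_gfield.rep_eq)
 have "d = 0" by (rule test_orth_zero) (use D(1) in \<open>simp add: L2_div_def L2_nth_0\<close>)
 moreover have "L2_nth (L2_of_field G) j = 0" for j
  by (rule test_orth_zero) (use D(2)[of j] in \<open>simp add: weak_deriv_def\<close>)
 then have "L2_of_field G = 0" by (intro L2_nth_eqI) (simp add: L2_nth_0)
 then have "G = 0" using L2_of_field_inject[of G 0] by (simp add: zero_gfield.rep_eq)
 ultimately show ?thesis by (simp add: q zero_prod_def)
qed

section \<open>Potentials of curl-free fields\<close>

lemma int_res:
 fixes f :: "'a::euclidean_space => real"
 assumes "integrable lebesgue f" "!!x. x \<notin> S ==> f x = 0"
 shows "(LIN x. f x) = integral S f"
proof -
 have "(%x. if x \<in> S then f x else 0) = f" using assms(2) by (auto simp: fun_eq_iff)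
 then have "integral UNIV f = integral S f" using Henstock_Kurzweil_Integration.integral_restrict_UNIV[of S f] by simp
 then show ?thesis using integral_lebesgue[OF assms(1)] by simp
qed

definition cube :: "(real ^ 'n::finite) set" where
 "cube = cbox 0 One"

lemma cube_component: "y \<in> cube ==> \<bar>y $ j\<bar> <= 1"
proof -
 assume "y \<in> cube"
 then have "0 <= y \<bullet> axis j 1" "y \<bullet> axis j 1 <= 1" unfolding cube_def mem_box by (auto simp: axis_in_Basis_iff)
 then show ?thesis by (simp add: cart_eq_inner_axis)
qed

lemma content_cube: "measure lborel (cube :: (real ^ 'n::finite) set) = 1"
 unfolding cube_def by (rule content_unit)

definition cube_L2 :: "complex => ('n::finite) scal" where
 "cube_L2 c = abs_L2 (%x. indicator cube x *: c)"

lemma sqi_cube: "square_integrable (%x :: real ^ 'n::finite. indicator cube x *: (c :: complex))"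
 unfolding square_integrable_def
proof
 have i: "integrable lebesgue (indicator cube :: real ^ 'n => real)"
  by (simp add: integrable_indicator_iff cube_def emeasure_lborel_cbox_eq)
 have "(%x. (norm (indicator cube x *: c))^2) = (%x :: real ^ 'n. (norm c)\<^sup>2 * indicator cube x)"
  by (auto simp: fun_eq_iff indicator_def)
 then show "integrable lebesgue (%x :: real ^ 'n. (norm (indicator cube x *: c))\<^sup>2)" using i by simp
 show "(%x :: real ^ 'n. indicator cube x *: c) \<in> lmeas"
  using borel_measurable_integrable[OF i] by measurable
qed

text \<open>The average of \<open>g\<close> over the unit cube translated by the argument, with real
  and imaginary part read off by pairing with 1 and i. It has point values, unlike \<open>g\<close>
  itself.\<close>

definition cube_mean :: "('n::finite) scal => real ^ 'n => complex" where
 "cube_mean g x = of_real (inner (cube_L2 1) (L2_shift x g)) + \<i> * of_real (inner (cube_L2 \<i>) (L2_shift x g))"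

text \<open>The same average formed as an L2-valued integral of translates;
  \<open>int_cube_mean\<close> shows that both represent one distribution.\<close>

definition mean_L2 :: "('n::finite) scal => 'n scal" where
 "mean_L2 g = integral cube (%y. L2_shift y g)"

lemma shift_intble: "(%y. L2_shift y (g :: ('n::finite) scal)) integrable_on cube"
 unfolding cube_def
 by (rule integrable_continuous) (intro continuous_at_imp_continuous_on ballI L2_shift_cont)

lemma mean_L2_bl: "bounded_linear mean_L2"
proof (rule bounded_linear_intro[where K=1])
 show "mean_L2 (g + h) = mean_L2 g + mean_L2 h" for g h :: "'a scal"
  unfolding mean_L2_def L2_shift_add by (rule Henstock_Kurzweil_Integration.integral_add[OF shift_intble shift_intble])
 show "mean_L2 (c *: g) = c *: mean_L2 g" for c and g :: "'a scal"
  unfolding mean_L2_def L2_shift_scaleR by (rule integral_cmul)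
 show "norm (mean_L2 g) <= norm g * 1" for g :: "'a scal"
  using has_integral_bound[OF norm_ge_zero integrable_integral[OF shift_intble[unfolded cube_def], of g], of g]
  content_cube[where 'n='a] by (simp add: L2_shift_norm mean_L2_def cube_def)
qed

lemma inner_mean_L2: "inner (mean_L2 g) u = integral cube (%y. inner (L2_shift y g) u)"
 unfolding mean_L2_def
 using integral_linear[OF shift_intble bounded_linear_inner_left, of u g] by (simp add: comp_def)

text \<open>Shifts by points of the unit cube move \<open>g\<close> by at most the sum of the norms
  of its derivatives. The norm of \<open>g\<close> does not enter, which is vital because functions
  with convergent gradients may have unbounded L2 norms.\<close>

lemma diff_mean_L2_bound:
 assumes g: "!!j. weak_deriv g j (G j)"
 shows "norm (g - mean_L2 g) <= (\<Sum>j\<in>UNIV. norm (G j))"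
proof -
 let ?C = "\<Sum>j\<in>UNIV. norm (G j)"
 have "((%y. g - L2_shift y g) has_integral (measure lborel (cube :: (real ^ 'a) set) *: g - mean_L2 g)) cube"
  unfolding mean_L2_def using has_integral_const[of g 0 "One :: real ^ 'a"]
  by (intro Henstock_Kurzweil_Integration.has_integral_diff integrable_integral shift_intble) (simp add: cube_def)
 then have "((%y. g - L2_shift y g) has_integral (g - mean_L2 g)) (cbox 0 One)" by (simp add: content_cube) (simp add: cube_def)
 note bound = has_integral_bound[OF _ this, of ?C]
 have "norm (g - mean_L2 g) <= ?C * measure lborel (cbox 0 One :: (real ^ 'a) set)"
 proof (rule bound)
  show "0 <= ?C" by (simp add: sum_nonneg)
  show "norm (g - L2_shift y g) <= ?C" if y: "y \<in> cbox 0 One" for y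
  proof -
  have "norm (L2_shift y g - g) <= (\<Sum>j\<in>UNIV. \<bar>y $ j\<bar> * norm (G j))" by (rule weak_gradient_shift_bound[OF g])
  also have "\<dots> <= ?C"
  using cube_component[of y] y by (intro sum_mono) (simp add: cube_def mult_left_le_one_le)
  finally show ?thesis by (simp add: norm_minus_commute)
  qed
 qed
 then show ?thesis using content_cube[where 'n='a] by (simp add: cube_def)
qed

lemma cube_mean_diff: "cube_mean (g - h) x = cube_mean g x - cube_mean h x"
 by (simp add: cube_mean_def L2_shift_diff inner_diff_right algebra_simps)

lemma cube_mean_osc:
 fixes g :: "('n::finite) scal"
 shows "norm (cube_mean g x - cube_mean g 0) \<le>
  (norm (cube_L2 1 :: 'n scal) + norm (cube_L2 \<i> :: 'n scal)) * norm (L2_shift x g - g)"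
proof -
 have "cube_mean g x - cube_mean g 0 = of_real (inner (cube_L2 1) (L2_shift x g - g)) + \<i> * of_real (inner (cube_L2 \<i>) (L2_shift x g - g))"
  by (simp add: cube_mean_def L2_shift_0 inner_diff_right algebra_simps)
 also have "norm \<dots> <= \<bar>inner (cube_L2 1) (L2_shift x g - g)\<bar> + \<bar>inner (cube_L2 \<i>) (L2_shift x g - g)\<bar>"
  by (rule order_trans[OF norm_triangle_ineq]) (simp add: norm_mult)
 also have "\<dots> <= norm (cube_L2 1 :: 'n scal) * norm (L2_shift x g - g) + norm (cube_L2 \<i> :: 'n scal) * norm (L2_shift x g - g)"
  by (intro add_mono Cauchy_Schwarz_ineq2)
 finally show ?thesis by (simp add: distrib_right)
qed

lemma cube_mean_cont: "continuous_on UNIV (cube_mean g)"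
 unfolding cube_mean_def[abs_def]
 by (intro continuous_on_add continuous_on_mult continuous_on_const continuous_on_of_real inner_shift_cont)

lemma cube_mean_test:
 assumes "ph \<in> TF"
 shows "inner (cube_L2 c) (L2_shift x (tf ph)) = integral cube (%y. inner c (ph (y + x)))"
proof -
 note sq = sqi_cube test_sqi[OF test_shift[OF assms]]
 have "inner (cube_L2 c) (L2_shift x (tf ph)) = (LIN y. inner (indicator cube y *: c) (ph (y + x)))"
  unfolding tf_shift[OF assms] unfolding cube_L2_def tf_def by (rule inner_abs_L2[OF sq])
 also have "\<dots> = integral cube (%y. inner (indicator cube y *: c) (ph (y + x)))"
  by (rule int_res[OF integrable_inner_square_integrable[OF sq]]) simp
 also have "\<dots> = integral cube (%y. inner c (ph (y + x)))"
  by (rule Henstock_Kurzweil_Integration.integral_cong) simp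
 finally show ?thesis .
qed

lemma int_cube_mean_test:
 fixes ph et :: "('n::finite) cfun"
 assumes ph: "ph \<in> TF" and et: "et \<in> TF"
 shows "(LIN x. inner (cube_mean (tf ph) x) (et x)) = inner (mean_L2 (tf ph)) (tf et)"
proof -
 obtain R where R: "0 < R" "!!x. R < norm x ==> et x = 0" using test_supp[OF et] by blast
 define b :: "real ^ 'n" where "b = R *: One"
 have out: "et x = 0" if "x \<notin> cbox (- b) b" for x
 proof (rule ccontr)
  assume "et x ~= 0"
  then have "norm x <= R" using R(2) by force
  then have "\<bar>x \<bullet> i\<bar> <= R" if "i \<in> Basis" for i using Basis_le_norm[OF that, of x] by linarith
  then have "x \<in> cbox (- b) b" unfolding b_def mem_box by (auto simp: abs_le_iff minus_le_iff)
  then show False using that by blast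
 qed
 have cc: "continuous_on S (%z. inner (ph (snd z + fst z)) (et (fst z)))" for S
  by (intro continuous_on_inner continuous_on_compose2[OF test_cont[OF ph, of UNIV]]
  continuous_on_compose2[OF test_cont[OF et, of UNIV]] continuous_intros) auto
 have icn: "(%y. inner c (ph (y + x))) integrable_on cube" for x c
  unfolding cube_def by (intro integrable_continuous continuous_on_inner continuous_on_const continuous_on_compose2[OF test_cont[OF ph, of UNIV]] continuous_intros) auto
 have pt: "inner (cube_mean (tf ph) x) (et x) = integral cube (%y. inner (ph (y + x)) (et x))" for x
 proof -
  have "integral cube (%y. inner (ph (y + x)) (et x)) =
  integral cube (%y. inner 1 (ph (y + x)) * Re (et x) + inner \<i> (ph (y + x)) * Im (et x))"
  by (simp add: inner_complex_def)
  also have "\<dots> = integral cube (%y. inner 1 (ph (y + x))) * Re (et x) + integral cube (%y. inner \<i> (ph (y + x))) * Im (et x)"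
  by (subst Henstock_Kurzweil_Integration.integral_add[OF integrable_on_mult_left[OF icn] integrable_on_mult_left[OF icn]])
  (simp only: Henstock_Kurzweil_Integration.integral_mult_left)
  finally show ?thesis by (simp add: cube_mean_def cube_mean_test[OF ph] inner_complex_def)
 qed
 have R': "R < norm x ==> inner (f x) (et x) = 0" for f :: "'n cfun" and x using R(2) by simp
 have "(LIN x. inner (cube_mean (tf ph) x) (et x)) = integral (cbox (- b) b) (%x. inner (cube_mean (tf ph) x) (et x))"
  by (rule int_res[OF intble_cont_compact[of _ R]])
  (auto intro!: continuous_on_inner cube_mean_cont test_cont et R' simp: out)
 also have "\<dots> = integral (cbox (- b) b) (%x. integral (cbox 0 One) (%y. inner (ph (y + x)) (et x)))"
  by (simp add: pt cube_def)
 also have "\<dots> = integral (cbox 0 One) (%y. integral (cbox (- b) b) (%x. inner (ph (y + x)) (et x)))"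
  by (rule integral_swap_continuous) (use cc in \<open>simp add: case_prod_unfold\<close>)
 also have "\<dots> = integral cube (%y. inner (L2_shift y (tf ph)) (tf et))"
  unfolding cube_def
 proof (rule Henstock_Kurzweil_Integration.integral_cong)
  fix y :: "real ^ 'n"
  have "inner (L2_shift y (tf ph)) (tf et) = (LIN x. inner (ph (x + y)) (et x))"
  unfolding tf_shift[OF ph] unfolding tf_def by (rule inner_abs_L2[OF test_sqi[OF test_shift[OF ph]] test_sqi[OF et]])
  also have "\<dots> = integral (cbox (- b) b) (%x. inner (ph (x + y)) (et x))"
  by (rule int_res[OF intble_cont_compact[of _ R]])
  (auto intro!: continuous_on_inner test_cont test_shift ph et R' simp: out)
  finally show "integral (cbox (- b) b) (%x. inner (ph (y + x)) (et x)) = inner (L2_shift y (tf ph)) (tf et)"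
  by (simp add: add.commute)
 qed
 also have "\<dots> = inner (mean_L2 (tf ph)) (tf et)" by (rule inner_mean_L2[symmetric])
 finally show ?thesis .
qed

lemma int_cube_mean:
 assumes et: "et \<in> TF"
 shows "(LIN x. inner (cube_mean g x) (et x)) = inner (mean_L2 g) (tf et)"
proof -
 have et': "(%x. (- \<i>) * et x) \<in> TF" by (rule test_lin[OF et bounded_linear_mult_right])
 note int = intble_test_inner_shift
 have split: "(LIN x. inner (cube_mean g x) (et x)) =
  (LIN x. Re (et x) * inner (cube_L2 1) (L2_shift x g)) + (LIN x. Re ((- \<i>) * et x) * inner (cube_L2 \<i>) (L2_shift x g))" for g
  by (subst Bochner_Integration.integral_add[symmetric, OF int[OF et] int[OF et']])
  (rule Bochner_Integration.integral_cong[OF refl], simp add: cube_mean_def inner_complex_def)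
 obtain ph where ph: "!!n::nat. ph n \<in> TF" "(%n. tf (ph n)) ----> g" using tf_sequence by blast
 have "(%n. LIN x. inner (cube_mean (tf (ph n)) x) (et x)) ----> (LIN x. inner (cube_mean g x) (et x))"
  unfolding split
  by (intro tendsto_add bounded_linear.tendsto[OF shift_fun_bl[OF et] ph(2)]
  bounded_linear.tendsto[OF shift_fun_bl[OF et'] ph(2)])
 moreover have "(%n. inner (mean_L2 (tf (ph n))) (tf et)) ----> inner (mean_L2 g) (tf et)"
  by (intro tendsto_inner tendsto_const bounded_linear.tendsto[OF mean_L2_bl ph(2)])
 ultimately show ?thesis unfolding int_cube_mean_test[OF ph(1) et] by (rule LIMSEQ_unique)
qed

lemma weak_deriv_diff: "weak_deriv a j b ==> weak_deriv a' j b' ==> weak_deriv (a - a') j (b - b')"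
 by (simp add: weak_deriv_def inner_diff_left)

lemma norm_L2_nth_le: "norm (L2_nth V j) <= norm V"
 unfolding L2_nth_def using L2_map_norm[OF pw_nth[of j], where K=1 and f=V] by (simp add: Finite_Cartesian_Product.norm_nth_le)

lemma L2_nth_diff: "L2_nth (V - W) j = L2_nth V j - L2_nth W j"
 by (rule linear_diff[OF bounded_linear.linear[OF L2_nth_bl]])

lemma Cauchy_comp:
 fixes X :: "nat => 'a::real_normed_vector" and Y :: "nat => 'b::real_normed_vector"
 assumes "!!m n. norm (X m - X n) <= C * norm (Y m - Y n)" "Cauchy Y"
 shows "Cauchy X"
proof (rule CauchyI)
 fix e :: real assume e: "0 < e"
 define C' where "C' = \<bar>C\<bar> + 1"
 have C': "0 < C'" "C <= C'" by (auto simp: C'_def)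
 obtain N where N: "\<forall>m\<ge>N. \<forall>n\<ge>N. norm (Y m - Y n) < e / C'"
  using CauchyD[OF assms(2), of "e / C'"] e C' by (meson divide_pos_pos)
 have "norm (X m - X n) < e" if "m >= N" "n >= N" for m n
 proof -
  have "norm (X m - X n) <= C' * norm (Y m - Y n)"
  using assms(1)[of m n] mult_right_mono[OF C'(2) norm_ge_zero[of "Y m - Y n"]] by linarith
  also have "\<dots> < C' * (e / C')" using N that C' by (intro mult_strict_left_mono) auto
  finally show ?thesis using C' by simp
 qed
 then show "\<exists>M. \<forall>m\<ge>M. \<forall>n\<ge>M. norm (X m - X n) < e" by blast
qed

lemma test_intble_add: "test_intble f ==> test_intble g ==> test_intble (%x. f x + g x)"
 by (simp add: test_intble_def distrib_right)

lemma test_intble_inner: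
 assumes "test_intble f" "ph \<in> TF"
 shows "integrable lebesgue (%x. inner (f x) (ph x))"
proof -
 have "integrable lebesgue (%x. f x * cnj (ph x))" by (rule assms(1)[unfolded test_intble_def, rule_format, OF test_cnj[OF assms(2)]])
 from integrable_Re[OF this] show ?thesis by (simp add: inner_complex_def)
qed

text \<open>
 The potential is the limit of \<open>ph k - cube_mean (ph k) 0\<close>. It splits into the \<open>L\<^sub>2\<close> limit of
 \<open>ph k - mean_L2 (ph k)\<close> and the locally uniform limit of \<open>cube_mean (ph k) x - cube_mean (ph k) 0\<close>;
 both are controlled by the gradients alone.
\<close>

lemma potential_of_limit:
 fixes h :: "('n::finite) vect"
 assumes d: "!!k::nat. !!j. weak_deriv (ph k) j (L2_nth (H k) j)" and H: "H ----> h"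
 obtains ps where "!!K. compact K ==> ps absolutely_integrable_on K" "weak_gradient ps (rep_L2 h)"
proof -
 have CH: "Cauchy H" using H LIMSEQ_imp_Cauchy by blast
 define N where "N = real CARD('n)"
 have N0: "0 <= N" by (simp add: N_def)
 define c0 where "c0 = norm (cube_L2 1 :: 'n scal) + norm (cube_L2 \<i> :: 'n scal)"
 have c0: "0 <= c0" by (simp add: c0_def)
 have sumN: "(\<Sum>j\<in>UNIV. norm (L2_nth V j)) <= N * norm V" for V :: "'n vect"
  using sum_mono[of UNIV "%j. norm (L2_nth V j)" "%_. norm V"] norm_L2_nth_le[of V] by (simp add: N_def)
 have dd: "weak_deriv (ph k - ph l) j (L2_nth (H k - H l) j)" for k l j
  unfolding L2_nth_diff by (rule weak_deriv_diff[OF d d])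
 define e where "e k = ph k - mean_L2 (ph k)" for k
 have "norm (e k - e l) <= N * norm (H k - H l)" for k l
 proof -
  have "e k - e l = (ph k - ph l) - mean_L2 (ph k - ph l)"
  by (simp add: e_def linear_diff[OF bounded_linear.linear[OF mean_L2_bl]])
  then show ?thesis using order_trans[OF diff_mean_L2_bound[OF dd[of k l]] sumN] by simp
 qed
 then have "Cauchy e" by (rule Cauchy_comp[OF _ CH])
 then obtain E where E: "e ----> E" using Cauchy_convergent convergent_def by blast
 define a where "a k x = cube_mean (ph k) x - cube_mean (ph k) 0" for k x
 have osc: "norm (cube_mean g x - cube_mean g 0) <= c0 * (norm x * (N * norm V))"
  if "!!j. weak_deriv g j (L2_nth V j)" for g V and x :: "real ^ 'n"
 proof -
  have "norm (cube_mean g x - cube_mean g 0) <= c0 * norm (L2_shift x g - g)"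
  unfolding c0_def by (rule cube_mean_osc)
  also have "norm (L2_shift x g - g) <= (\<Sum>j\<in>UNIV. \<bar>x $ j\<bar> * norm (L2_nth V j))" by (rule weak_gradient_shift_bound[OF that])
  also have "\<dots> <= (\<Sum>j\<in>UNIV. norm x * norm (L2_nth V j))" by (intro sum_mono mult_right_mono component_le_norm_cart norm_ge_zero)
  also have "\<dots> <= norm x * (N * norm V)" unfolding sum_distrib_left[symmetric] by (intro mult_left_mono sumN norm_ge_zero)
  finally show ?thesis using c0 by (simp add: mult_left_mono)
 qed
 \<comment> \<open>The bound grows only linearly in \<open>x\<close>, which yields convergence
   locally uniformly and a limit of linear growth.\<close>
 have a_diff: "norm (a k x - a l x) <= (c0 * norm x * N) * norm (H k - H l)" for k l x
  using osc[OF dd, of k l x] by (simp add: a_def cube_mean_diff algebra_simps)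
 have "Cauchy (%k. a k x)" for x by (rule Cauchy_comp[OF a_diff CH])
 then have "\<exists>z. (%k. a k x) ----> z" for x using Cauchy_convergent convergent_def by blast
 then obtain c where c: "!!x. (%k. a k x) ----> c x" by metis
 obtain B where B: "0 < B" "!!k. norm (H k) <= B" using Cauchy_Bseq[OF CH] unfolding Bseq_def by blast
 define C where "C = c0 * (N * B)"
 have C0: "0 <= C" using c0 N0 B by (simp add: C_def)
 have a_le: "norm (a k x) <= C * norm x" for k x
 proof -
  have "norm (a k x) <= c0 * (norm x * (N * norm (H k)))" unfolding a_def by (rule osc[OF d])
  also have "\<dots> <= c0 * (norm x * (N * B))" using c0 N0 B by (intro mult_left_mono) auto
  finally show ?thesis by (simp add: C_def mult_ac)
 qed
 have c_le: "norm (c x) <= C * norm x" for x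
  by (rule LIMSEQ_le_const2[OF tendsto_norm[OF c]]) (use a_le in blast)
 have am: "a k \<in> lmeas" for k
  unfolding a_def[abs_def] using borel_measurable_continuous_onI[OF cube_mean_cont[of "ph k"]]
  by (intro measurable_completion borel_measurable_diff) auto
 have cm: "c \<in> lmeas" by (rule borel_measurable_LIMSEQ_metric[OF am c])
 have dom: "integrable lebesgue (%x. (C * norm x) * norm (et x))" if et: "et \<in> TF" for et :: "'n cfun"
 proof -
  obtain R where R: "0 < R" "!!x. R < norm x ==> et x = 0" using test_supp[OF et] by blast
  show ?thesis by (rule intble_cont_compact[of _ R]) (use R in \<open>auto intro!: continuous_intros test_cont et\<close>)
 qed
 have etm: "et \<in> lmeas" if "et \<in> TF" for et :: "'n cfun"
  using test_sqi[OF that] by (simp add: square_integrable_def)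
 have tc: "test_intble c" unfolding test_intble_def
 proof
  fix et :: "'n cfun" assume et: "et \<in> TF"
  show "integrable lebesgue (%x. c x * et x)"
  by (rule Bochner_Integration.integrable_bound[OF dom[OF et]])
  (use cm etm[OF et] c_le C0 in \<open>auto simp: norm_mult intro!: mult_right_mono\<close>)
 qed
 have tE: "test_intble (rep_L2 E)" by (rule test_intble_L2) simp
 define ps where "ps x = rep_L2 E x + c x" for x
 have tps: "test_intble ps" unfolding ps_def[abs_def] by (rule test_intble_add[OF tE tc])
 have th: "test_intble (%x. rep_L2 h x $ j)" for j
  by (rule test_intble_L2[OF pw_bdd_sqi[OF pw_nth]]) simp
 have "weak_gradient ps (rep_L2 h)" unfolding weak_gradient_iff_inner[OF tps th]
 proof (intro ballI allI)
  fix et :: "'n cfun" and j assume et: "et \<in> TF"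
  let ?d = "pd j et"
  have et': "?d \<in> TF" by (rule test_pd[OF et])
  have lim: "(%k. LIN x. inner (a k x) (?d x)) ----> (LIN x. inner (c x) (?d x))"
  proof (rule integral_dominated_convergence[OF _ _ dom[OF et']])
  show "(%x. inner (c x) (?d x)) \<in> lmeas" by (intro borel_measurable_inner cm etm et')
  show "(%x. inner (a k x) (?d x)) \<in> lmeas" for k by (intro borel_measurable_inner am etm et')
  show "AEL x. (%k. inner (a k x) (?d x)) ----> inner (c x) (?d x)"
  by (intro AE_I2 tendsto_inner c tendsto_const)
  show "AEL x. norm (inner (a k x) (?d x)) <= C * norm x * norm (?d x)" for k
  proof (rule AE_I2)
  fix x
  show "norm (inner (a k x) (?d x)) <= C * norm x * norm (?d x)"
  using Cauchy_Schwarz_ineq2[of "a k x" "?d x"] mult_right_mono[OF a_le[of k x] norm_ge_zero[of "?d x"]] by simp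
  qed
  qed
  have k: "inner (e k) (tf ?d) + (LIN x. inner (a k x) (?d x)) = - inner (L2_nth (H k) j) (tf et)" for k
  proof -
  obtain R where R: "0 < R" "!!x. R < norm x ==> ?d x = 0" using test_supp[OF et'] by blast
  have i: "integrable lebesgue (%x. inner (f x) (?d x))" if "continuous_on UNIV f" for f
  by (rule intble_cont_compact[of _ R]) (use R that in \<open>auto intro!: continuous_on_inner test_cont et'\<close>)
  \<comment> \<open>The subtracted constant \<open>cube_mean (ph k) 0\<close> is invisible here,
    because a derivative of a test function has integral 0.\<close>
  have "(LIN x. inner (a k x) (?d x)) = (LIN x. inner (cube_mean (ph k) x) (?d x)) - (LIN x. inner (cube_mean (ph k) 0) (?d x))"
  unfolding a_def inner_diff_left
  by (rule Bochner_Integration.integral_diff[OF i[OF cube_mean_cont] i[OF continuous_on_const]])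
  also have "\<dots> = inner (mean_L2 (ph k)) (tf ?d)"
  by (simp add: int_cube_mean[OF et'] int_pd_test[OF et])
  finally have "inner (e k) (tf ?d) + (LIN x. inner (a k x) (?d x)) = inner (ph k) (tf ?d)"
  by (simp add: e_def inner_diff_left)
  also have "\<dots> = - inner (L2_nth (H k) j) (tf et)" using d[of k j] et by (simp add: weak_deriv_def)
  finally show ?thesis .
  qed
  have "(%k. - inner (L2_nth (H k) j) (tf et)) ----> inner E (tf ?d) + (LIN x. inner (c x) (?d x))"
  unfolding k[symmetric] by (intro tendsto_add tendsto_inner E tendsto_const lim)
  moreover have "(%k. - inner (L2_nth (H k) j) (tf et)) ----> - inner (L2_nth h j) (tf et)"
  by (intro tendsto_minus tendsto_inner tendsto_const bounded_linear.tendsto[OF L2_nth_bl H])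
  ultimately have eq: "inner E (tf ?d) + (LIN x. inner (c x) (?d x)) = - inner (L2_nth h j) (tf et)"
  by (rule LIMSEQ_unique)
  have "(LIN x. inner (ps x) (?d x)) = (LIN x. inner (rep_L2 E x) (?d x)) + (LIN x. inner (c x) (?d x))"
  unfolding ps_def inner_add_left
  by (rule Bochner_Integration.integral_add[OF test_intble_inner[OF tE et'] test_intble_inner[OF tc et']])
  also have "(LIN x. inner (rep_L2 E x) (?d x)) = inner E (tf ?d)" by (rule int_inner_test[OF _ _ et']) auto
  also have "inner E (tf ?d) + (LIN x. inner (c x) (?d x)) = - inner (L2_nth h j) (tf et)" by (rule eq)
  also have "inner (L2_nth h j) (tf et) = (LIN x. inner (rep_L2 h x $ j) (et x))"
  by (rule int_inner_test[OF nth_AE[OF rep_L2_meas AE_I2[OF refl]] et, symmetric])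
  finally show "(LIN x. inner (ps x) (?d x)) = - (LIN x. inner (rep_L2 h x $ j) (et x))" .
 qed
 moreover have "ps absolutely_integrable_on K" if K: "compact K" for K
 proof -
  obtain R where R: "!!x. x \<in> K ==> norm x <= R" using compact_imp_bounded[OF K] unfolding bounded_iff by blast
  have Km: "K \<in> sets lebesgue" using K by (simp add: compact_imp_closed lmeasurable_compact fmeasurableD)
  have iK: "integrable lebesgue (indicator K :: real ^ 'n => real)"
  using lmeasurable_compact[OF K] by (simp only: lmeasurable_iff_integrable)
  have sK: "square_integrable (indicator K :: real ^ 'n => real)"
  proof -
  have "(%x. (norm (indicator K x :: real))^2) = (indicator K :: real ^ 'n => real)" by (auto simp: fun_eq_iff indicator_def)
  then show ?thesis unfolding square_integrable_def using iK borel_measurable_integrable[OF iK] by simp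
  qed
  have nE: "square_integrable (%x. norm (rep_L2 E x))" using sqi_rep[of E] by (auto simp: square_integrable_def)
  have "set_integrable lebesgue K (rep_L2 E)" unfolding set_integrable_def
  by (rule Bochner_Integration.integrable_bound[OF integrable_inner_square_integrable[OF sK nE]]) (use Km in auto)
  moreover have "set_integrable lebesgue K c" unfolding set_integrable_def
  proof (rule Bochner_Integration.integrable_bound[of _ "%x. (C * R) * indicator K x"])
  show "integrable lebesgue (%x. (C * R) * indicator K x)" using iK by simp
  show "(%x. indicator K x *: c x) \<in> lmeas" using Km cm by (intro borel_measurable_scaleR) auto
  show "AEL x. norm (indicator K x *: c x) <= norm ((C * R) * indicator K x)"
  proof (rule AE_I2)
  fix x
  have "norm (c x) <= \<bar>C * R\<bar>" if "x \<in> K"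
  using c_le[of x] mult_left_mono[OF R[OF that] C0] by linarith
  then show "norm (indicator K x *: c x) <= norm ((C * R) * indicator K x)" by (auto simp: indicator_def)
  qed
  qed
  ultimately show ?thesis unfolding ps_def[abs_def] by (rule set_integral_add(1))
 qed
 ultimately show thesis using that by blast
qed

section \<open>Normal and tangential parts\<close>

definition L2_lift :: "('b::euclidean_space => 'c::euclidean_space) => ('a::euclidean_space, 'b) L2 => ('a, 'c) L2" where
 "L2_lift L = L2_map (%_. L)"

lemma rep_L2_lift: "linear L ==> AEL x. rep_L2 (L2_lift L f) x = L (rep_L2 f x)"
 unfolding L2_lift_def by (rule rep_L2_map[OF pw_bdd_const])

lemma L2_lift_bl: "linear L ==> bounded_linear (L2_lift L)"
 unfolding L2_lift_def by (rule L2_map_bl[OF pw_bdd_const])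

lemma L2_lift_lift:
 assumes "linear L" "linear M"
 shows "L2_lift L (L2_lift M f) = L2_lift (%v. L (M v)) f"
proof (rule L2_eqI)
 have "linear (%v. L (M v))" using linear_compose[OF assms(2,1)] by (simp add: comp_def)
 from rep_L2_lift[OF this, of f] rep_L2_lift[OF assms(1), of "L2_lift M f"] rep_L2_lift[OF assms(2), of f]
 show "AEL x. rep_L2 (L2_lift L (L2_lift M f)) x = rep_L2 (L2_lift (%v. L (M v)) f) x"
  by eventually_elim simp
qed

lemma L2_lift_id: "L2_lift (%v. v) f = f"
 by (rule L2_eqI) (rule rep_L2_lift[OF linear_ident])

lemma L2_lift_0: "L2_lift (%v. 0) f = 0"
 unfolding L2_lift_def L2_map_def by (simp add: zero_L2.abs_eq)

lemma L2_lift_add: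
 assumes "linear L" "linear M"
 shows "L2_lift L f + L2_lift M f = L2_lift (%v. L v + M v) f"
proof (rule L2_eqI)
 from rep_L2_lift[OF linear_compose_add[OF assms], of f] rep_L2_lift[OF assms(1), of f] rep_L2_lift[OF assms(2), of f]
  rep_L2_add[of "L2_lift L f" "L2_lift M f"]
 show "AEL x. rep_L2 (L2_lift L f + L2_lift M f) x = rep_L2 (L2_lift (%v. L v + M v) f) x"
  by eventually_elim simp
qed

lemma inner_L2_map_adj:
 assumes P: "pw_bdd Ph" "pw_bdd Ps"
  and adj: "!!x v w. inner (Ph x v) w = inner v (Ps x w)"
 shows "inner (L2_map Ph f) g = inner f (L2_map Ps g)"
proof -
 have "AEL x. inner (rep_L2 (L2_map Ph f) x) (rep_L2 g x) = inner (rep_L2 f x) (rep_L2 (L2_map Ps g) x)"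
  using rep_L2_map[OF P(1), of f] rep_L2_map[OF P(2), of g] by eventually_elim (simp add: adj)
 then show ?thesis unfolding inner_L2 by (intro integral_cong_AE) auto
qed

definition inject_nor :: "complex => ('n::finite) cvec" where
 "inject_nor z = axis None z"

definition inject_tan :: "complex ^ 'n::finite => 'n cvec" where
 "inject_tan v = (\<chi> k. case k of None => 0 | Some j => v $ j)"

lemma lin_parts:
 "linear (normal_part :: ('n::finite) cvec => _)" "linear (tangential_part :: 'n cvec => _)"
 "linear (inject_nor :: _ => 'n cvec)" "linear (inject_tan :: _ => 'n cvec)"
 by (auto intro!: linearI simp: normal_part_def tangential_part_def inject_nor_def inject_tan_def
  vec_eq_iff axis_def split: option.split)

lemma parts_inject [simp]:
 "normal_part (inject_nor z) = z" "normal_part (inject_tan v) = 0"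
 "tangential_part (inject_nor z) = 0" "tangential_part (inject_tan v) = v"
 "inject_nor (normal_part w) + inject_tan (tangential_part w) = w"
 by (auto simp: normal_part_def tangential_part_def inject_nor_def inject_tan_def vec_eq_iff axis_def split: option.split)

lemma inner_cvec: "inner v w = inner (normal_part v) (normal_part w) + inner (tangential_part v) (tangential_part w)"
 for v w :: "('n::finite) cvec"
 by (simp add: inner_vec_def normal_part_def tangential_part_def UNIV_option_conv sum.reindex)

abbreviation L2_normal :: "('n::finite) full => 'n scal" where
 "L2_normal \<equiv> L2_lift normal_part"

abbreviation L2_tangential :: "('n::finite) full => 'n vect" where
 "L2_tangential \<equiv> L2_lift tangential_part"

lemma inner_L2_parts: "inner f g = inner (L2_normal f) (L2_normal g) + inner (L2_tangential f) (L2_tangential g)"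
proof -
 have "inner f g = (LIN x. inner (rep_L2 (L2_normal f) x) (rep_L2 (L2_normal g) x) + inner (rep_L2 (L2_tangential f) x) (rep_L2 (L2_tangential g) x))"
  unfolding inner_L2[of f g]
 proof (rule integral_cong_AE)
  show "AEL x. inner (rep_L2 f x) (rep_L2 g x) =
  inner (rep_L2 (L2_normal f) x) (rep_L2 (L2_normal g) x) + inner (rep_L2 (L2_tangential f) x) (rep_L2 (L2_tangential g) x)"
  using rep_L2_lift[OF lin_parts(1), of f] rep_L2_lift[OF lin_parts(1), of g]
  rep_L2_lift[OF lin_parts(2), of f] rep_L2_lift[OF lin_parts(2), of g]
  by eventually_elim (simp add: inner_cvec)
 qed auto
 also have "\<dots> = inner (L2_normal f) (L2_normal g) + inner (L2_tangential f) (L2_tangential g)"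
  unfolding inner_L2[of "L2_normal f"] inner_L2[of "L2_tangential f"]
  by (rule Bochner_Integration.integral_add) (rule integrable_inner_square_integrable; simp)+
 finally show ?thesis .
qed

type_synonym 'n trace_space = "'n scal \<times> 'n gfield"

definition L2_join :: "('n::finite) trace_space => 'n full" where
 "L2_join h = L2_lift inject_nor (fst h) + L2_lift inject_tan (L2_of_field (snd h))"

lemma L2_lift_plus: "linear L ==> L2_lift L (f + g) = L2_lift L f + L2_lift L g"
 by (rule linear_add[OF bounded_linear.linear[OF L2_lift_bl]])

lemma L2_nor_join [simp]: "L2_normal (L2_join h) = fst h"
 and L2_tan_join [simp]: "L2_tangential (L2_join h) = L2_of_field (snd h)"
 by (simp_all add: L2_join_def L2_lift_plus lin_parts L2_lift_lift L2_lift_id L2_lift_0)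

lemma L2_join_bl: "bounded_linear L2_join"
 unfolding L2_join_def
 by (intro bounded_linear_add bounded_linear_compose[OF L2_lift_bl[OF lin_parts(3)] bounded_linear_fst]
  bounded_linear_compose[OF L2_lift_bl[OF lin_parts(4)] bounded_linear_compose[OF L2_of_field_bl bounded_linear_snd]])

lemma inner_join: "inner (L2_join h) (L2_join k) = inner h k"
 by (simp add: inner_L2_parts inner_prod_def inner_gfield.rep_eq)

lemma norm_join: "norm (L2_join h) = norm h"
 by (simp add: norm_eq_sqrt_inner inner_join)

lemma L2_parts_eqI:
 fixes f g :: "('n::finite) full"
 shows "L2_normal f = L2_normal g ==> L2_tangential f = L2_tangential g ==> f = g"
proof -
 have rec: "L2_lift inject_nor (L2_normal f) + L2_lift inject_tan (L2_tangential f) = f" for f :: "'n full"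
 proof -
  have lin: "linear (%v. inject_nor (normal_part v :: complex) :: 'n cvec)" "linear (%v. inject_tan (tangential_part v) :: 'n cvec)"
  using linear_compose[OF lin_parts(1,3)] linear_compose[OF lin_parts(2,4)] by (simp_all add: comp_def)
  show ?thesis by (simp add: L2_lift_lift lin_parts L2_lift_add[OF lin] L2_lift_id)
 qed
 assume "L2_normal f = L2_normal g" "L2_tangential f = L2_tangential g"
 then have "L2_lift inject_nor (L2_normal f) + L2_lift inject_tan (L2_tangential f) =
  L2_lift inject_nor (L2_normal g) + L2_lift inject_tan (L2_tangential g)" by (simp only:)
 then show "f = g" by (simp only: rec)
qed

lemma range_join: "f \<in> range L2_join \<longleftrightarrow> L2_curl_free (L2_tangential f)"
proof
 assume c: "L2_curl_free (L2_tangential f)"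
 have "f = L2_join (L2_normal f, field_of_L2 (L2_tangential f))"
  by (rule L2_parts_eqI) (simp_all add: L2_of_field_of_L2[OF c])
 then show "f \<in> range L2_join" by blast
qed (auto simp: L2_of_field_curl_free)

lemma inj_join: "L2_join h = L2_join k \<longleftrightarrow> h = k"
proof
 assume "L2_join h = L2_join k"
 then have "norm (L2_join (h - k)) = 0" by (simp add: linear_diff[OF bounded_linear.linear[OF L2_join_bl]])
 then show "h = k" by (simp add: norm_join)
qed simp

lemma rep_part:
 fixes f :: "('n::finite) full"
 shows "(%x. normal_part (rep_L2 f x)) \<in> lmeas"
  "AEL x. normal_part (rep_L2 f x) = rep_L2 (L2_normal f) x"
  "(%x. tangential_part (rep_L2 f x)) \<in> lmeas"
  "AEL x. tangential_part (rep_L2 f x) = rep_L2 (L2_tangential f) x"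
proof -
 show "(%x. normal_part (rep_L2 f x)) \<in> lmeas" "(%x. tangential_part (rep_L2 f x)) \<in> lmeas"
  using pw_bdd_const[OF lin_parts(1)] pw_bdd_const[OF lin_parts(2)] rep_L2_meas[of f]
  unfolding pw_bdd_def by blast+
 show "AEL x. normal_part (rep_L2 f x) = rep_L2 (L2_normal f) x"
  using rep_L2_lift[OF lin_parts(1), of f] by eventually_elim simp
 show "AEL x. tangential_part (rep_L2 f x) = rep_L2 (L2_tangential f) x"
  using rep_L2_lift[OF lin_parts(2), of f] by eventually_elim simp
qed

lemma H1_hat_eq: "H1_hat = range L2_join"
 unfolding H1_hat_def using weak_curl_free_L2[OF rep_part(3,4)] range_join by blast

section \<open>Coefficients as operators\<close>

lemma inner_eq_hermitian: "Re (hermitian_inner v w) = inner v w"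
 by (simp add: hermitian_inner_def inner_vec_def inner_complex_def)

lemma lin_matrix: "linear (%v :: complex ^ 'm::finite. M *v v)"
 by (rule linearI) (auto simp: vec_eq_iff matrix_vector_mult_def distrib_left sum.distrib scaleR_sum_right)

lemma norm_matrix_le:
 fixes M :: "complex ^ 'm::finite ^ 'm"
 shows "norm (M *v v) <= (real CARD('m) * real CARD('m)) * norm M * norm v"
proof -
 have "norm (M *v v) <= (\<Sum>i\<in>UNIV. norm ((M *v v) $ i))"
  unfolding norm_vec_def by (rule L2_set_le_sum) simp
 also have "\<dots> <= (\<Sum>i\<in>(UNIV :: 'm set). \<Sum>j\<in>(UNIV :: 'm set). norm M * norm v)"
 proof (rule sum_mono)
  fix i
  have "norm ((M *v v) $ i) <= (\<Sum>j\<in>UNIV. norm (M $ i $ j * v $ j))"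
  by (simp add: matrix_vector_mult_def) (rule norm_sum)
  also have "\<dots> <= (\<Sum>j\<in>(UNIV :: 'm set). norm M * norm v)"
  unfolding norm_mult
  by (intro sum_mono mult_mono order_trans[OF Finite_Cartesian_Product.norm_nth_le Finite_Cartesian_Product.norm_nth_le] Finite_Cartesian_Product.norm_nth_le norm_ge_zero)
  finally show "norm ((M *v v) $ i) <= (\<Sum>j\<in>(UNIV :: 'm set). norm M * norm v)" .
 qed
 also have "\<dots> = (real CARD('m) * real CARD('m)) * norm M * norm v" by simp
 finally show ?thesis .
qed

lemma matrix_pw_bdd:
 fixes A :: "('n::finite) coeff"
 assumes "ess_bounded A"
 shows "pw_bdd (%x v. A x *v v)"
 unfolding pw_bdd_def
proof (intro conjI allI impI lin_matrix)
 obtain C where C: "AEL x. norm (A x) <= C" and m: "A \<in> lmeas"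
  using assms by (auto simp: ess_bounded_def)
 let ?N = "real CARD('n option) * real CARD('n option)"
 have "AEL x. \<forall>v. norm (A x *v v) <= (?N * C) * norm v"
  using C
 proof eventually_elim
  case (elim x)
  show ?case
  proof
  fix v :: "'n cvec"
  have "?N * norm (A x) * norm v <= ?N * C * norm v" using elim by (intro mult_right_mono mult_left_mono) auto
  then show "norm (A x *v v) <= (?N * C) * norm v" using norm_matrix_le[of "A x" v] by linarith
  qed
 qed
 then show "\<exists>K. AEL x. \<forall>v. norm (A x *v v) <= K * norm v" by blast
 fix f :: "real ^ 'n => 'n cvec" assume f: "f \<in> lmeas"
 show "(%x. A x *v f x) \<in> lmeas"
 proof (rule borel_measurable_continuous_Pair[OF m f])
  show "continuous_on UNIV (%x :: (complex ^ ('n option) ^ ('n option)) \<times> 'n cvec. fst x *v snd x)"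
  unfolding matrix_vector_mult_def by (intro continuous_intros)
 qed
qed

lemma inner_adj: "inner (A x *v v) w = inner v (adjoint_coeff A x *v w)"
proof -
 have c: "inner (a * z) u = inner z (cnj a * u)" for a z u :: complex by (simp add: inner_complex_def algebra_simps)
 have "inner (A x *v v) w = (\<Sum>i\<in>UNIV. \<Sum>j\<in>UNIV. inner (v $ j) (cnj (A x $ i $ j) * w $ i))"
  by (simp add: inner_vec_def matrix_vector_mult_def inner_sum_left c)
 also have "\<dots> = (\<Sum>j\<in>UNIV. \<Sum>i\<in>UNIV. inner (v $ j) (cnj (A x $ i $ j) * w $ i))" by (rule sum.swap)
 also have "\<dots> = inner v (adjoint_coeff A x *v w)"
  by (simp add: inner_vec_def matrix_vector_mult_def inner_sum_right adjoint_coeff_def)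
 finally show ?thesis .
qed

lemma ess_bdd_adj:
 fixes A :: "('n::finite) coeff"
 assumes "ess_bounded A"
 shows "ess_bounded (adjoint_coeff A)"
proof -
 let ?L = "%M :: complex ^ ('n option) ^ ('n option). (\<chi> i j. cnj (M $ j $ i)) :: complex ^ ('n option) ^ ('n option)"
 have "linear ?L" by (rule linearI) (auto simp: vec_eq_iff)
 then have P: "pw_bdd (%_ :: real ^ 'n. ?L)" by (rule pw_bdd_const)
 obtain K where K: "AE x :: real ^ 'n in lebesgue. \<forall>M. norm (?L M) <= K * norm M"
  using P by (auto simp: pw_bdd_def)
 obtain C where C: "AEL x. norm (A x) <= C" and m: "A \<in> lmeas"
  using assms by (auto simp: ess_bounded_def)
 have "AEL x. norm (adjoint_coeff A x) <= \<bar>K\<bar> * C"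
  using K C
 proof eventually_elim
  case (elim x)
  have "norm (adjoint_coeff A x) <= K * norm (A x)" using elim(1) by (simp add: adjoint_coeff_def)
  also have "\<dots> <= \<bar>K\<bar> * C" using elim(2) by (intro mult_mono) auto
  finally show ?case .
 qed
 moreover have "adjoint_coeff A \<in> lmeas"
  using P m unfolding pw_bdd_def adjoint_coeff_def by blast
 ultimately show ?thesis unfolding ess_bounded_def by blast
qed

definition coeff_op :: "('n::finite) coeff => 'n full => 'n full" where
 "coeff_op A = L2_map (%x v. A x *v v)"

text \<open>
 In the coordinates \<open>conormal\<close>, i.e. \<open>f \<mapsto> ((A f)\<^sub>0, f\<^sub>\<parallel>)\<close>, the operator \<open>T\<^sub>A\<close> becomes \<open>div_grad\<close> composed
 with the coercive operator \<open>conorm_op\<close>, which sends \<open>((A f)\<^sub>0, f\<^sub>\<parallel>)\<close> to \<open>(f\<^sub>0, (A f)\<^sub>\<parallel>)\<close>.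
\<close>

definition conormal :: "('n::finite) coeff => 'n full => 'n trace_space" where
 "conormal A f = (L2_normal (coeff_op A f), field_proj (L2_tangential f))"

definition cotan :: "('n::finite) coeff => 'n full => 'n trace_space" where
 "cotan A f = (L2_normal f, field_proj (L2_tangential (coeff_op A f)))"

text \<open>Multiplication by the entry A_00; it inherits coercivity from \<open>A\<close> by
  testing with purely normal vectors and is therefore invertible.\<close>

definition normal_op :: "('n::finite) coeff => 'n scal => 'n scal" where
 "normal_op A a = L2_normal (coeff_op A (L2_lift inject_nor a))"

text \<open>Inverts \<open>conormal\<close> on fields with curl-free tangential part: that part is
  kept, and the prescribed normal component of A f is solved for f_0 by inverting A_00.\<close>

definition unconorm :: "('n::finite) coeff => 'n trace_space => 'n trace_space" where
 "unconorm A y =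
  (inv (normal_op A) (fst y - L2_normal (coeff_op A (L2_lift inject_tan (L2_of_field (snd y))))), snd y)"

definition conorm_op :: "('n::finite) coeff => 'n trace_space => 'n trace_space" where
 "conorm_op A y = cotan A (L2_join (unconorm A y))"

lemma L2_div_sum:
 "ph \<in> TF ==> (\<Sum>j\<in>UNIV. inner (L2_nth V j) (tf (pd j ph))) = inner V (L2_of_field (test_gradient ph))"
 by (simp add: inner_L2_nth L2_nth_test_gradient)

text \<open>Divergence is tested against gradients only, and these are curl-free, so the projection
  does not change it.\<close>

lemma L2_div_proj: "L2_div (L2_of_field (field_proj V)) d \<longleftrightarrow> L2_div V d"
 by (simp add: L2_div_def L2_div_sum inner_gfield.rep_eq[symmetric] inner_field_proj_left)

lemma weak_gradient_curl_free:
 assumes "!!j. weak_deriv a j (L2_nth g j)"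
 shows "L2_curl_free g"
 unfolding L2_curl_free_def
proof (intro ballI allI)
 fix ph :: "'a cfun" and i j assume ph: "ph \<in> TF"
 show "inner (L2_nth g i) (tf (pd j ph)) = inner (L2_nth g j) (tf (pd i ph))"
  using assms[of i, unfolded weak_deriv_def, rule_format, OF test_pd[OF ph], of j]
  assms[of j, unfolded weak_deriv_def, rule_format, OF test_pd[OF ph], of i]
  tf_pd_commute[OF ph, of i j] by simp
qed

lemma C1_bl:
 assumes L: "bounded_linear L" and F: "F C1_differentiable_on {0<..}"
 shows "(%t. L (F t)) C1_differentiable_on {0<..}"
  and "0 < t ==> vector_derivative (%t. L (F t)) (at t) = L (vector_derivative F (at t))"
proof -
 obtain D where D: "!!t. 0 < t ==> (F has_vector_derivative D t) (at t)" "continuous_on {0<..} D"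
  using F unfolding C1_differentiable_on_def by auto
 have d: "((%t. L (F t)) has_vector_derivative L (D t)) (at t)" if "0 < t" for t
  by (rule bounded_linear.has_vector_derivative[OF L D(1)[OF that]])
 show "(%t. L (F t)) C1_differentiable_on {0<..}" unfolding C1_differentiable_on_def
  by (rule exI[of _ "%t. L (D t)"]) (use d bounded_linear.continuous_on[OF L D(2)] in auto)
 show "0 < t ==> vector_derivative (%t. L (F t)) (at t) = L (vector_derivative F (at t))"
  using vector_derivative_at[OF d] vector_derivative_at[OF D(1)] by simp
qed

locale coefficient =
 fixes A :: "('n::finite) coeff" and ka :: real
 assumes ess: "ess_bounded A" and ka_pos: "0 < ka"
  and coercive: "AEL x. \<forall>v. ka * (norm v)^2 <= inner (A x *v v) v"
begin

lemma coeff_op_bl: "bounded_linear (coeff_op A)"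
 unfolding coeff_op_def by (rule L2_map_bl[OF matrix_pw_bdd[OF ess]])

lemma rep_coeff_op: "AEL x. rep_L2 (coeff_op A f) x = A x *v rep_L2 f x"
 unfolding coeff_op_def by (rule rep_L2_map[OF matrix_pw_bdd[OF ess]])

lemma coeff_meas: "(%x. A x *v rep_L2 f x) \<in> lmeas"
 using matrix_pw_bdd[OF ess] rep_L2_meas[of f] unfolding pw_bdd_def by blast

lemma inner_coeff_op_adj: "inner (coeff_op A f) g = inner f (coeff_op (adjoint_coeff A) g)"
 unfolding coeff_op_def
 by (rule inner_L2_map_adj[OF matrix_pw_bdd[OF ess] matrix_pw_bdd[OF ess_bdd_adj[OF ess]] inner_adj])

lemma coeff_op_coercive: "ka * (norm f)^2 <= inner (coeff_op A f) f"
proof -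
 have "ka * (norm f)^2 = (LIN x. ka * (norm (rep_L2 f x))^2)" by (simp add: norm_L2_sq)
 also have "\<dots> <= (LIN x. inner (rep_L2 (coeff_op A f) x) (rep_L2 f x))"
 proof (rule integral_mono_AE)
  show "integrable lebesgue (%x. ka * (norm (rep_L2 f x))^2)"
  using sqi_rep[of f] by (simp add: square_integrable_def)
  show "AEL x. ka * (norm (rep_L2 f x))^2 <= inner (rep_L2 (coeff_op A f) x) (rep_L2 f x)"
  using coercive rep_coeff_op[of f] by eventually_elim simp
 qed (rule integrable_inner_square_integrable; simp)
 also have "\<dots> = inner (coeff_op A f) f" by (rule inner_L2[symmetric])
 finally show ?thesis .
qed

lemma adj_coeff: "coefficient (adjoint_coeff A) ka"
proof
 show "AEL x. \<forall>v. ka * (norm v)^2 <= inner (adjoint_coeff A x *v v) v"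
  using coercive by eventually_elim (simp add: inner_commute[of "adjoint_coeff A _ *v _"] inner_adj[symmetric])
qed (rule ess_bdd_adj[OF ess] ka_pos)+

lemma nor_op_bl: "bounded_linear (normal_op A)"
 unfolding normal_op_def
 by (rule bounded_linear_compose[OF L2_lift_bl[OF lin_parts(1)]
  bounded_linear_compose[OF coeff_op_bl L2_lift_bl[OF lin_parts(3)]]])

lemma nor_op_coercive: "ka * (norm a)^2 <= inner (normal_op A a) a"
proof -
 have j: "L2_lift inject_nor a = L2_join (a, 0)"
  by (simp add: L2_join_def zero_gfield.rep_eq linear_0[OF bounded_linear.linear[OF L2_lift_bl]] lin_parts)
 have "norm (L2_join (a, 0 :: 'n gfield)) = norm a" by (simp add: norm_join norm_Pair)
 then have "ka * (norm a)^2 <= inner (coeff_op A (L2_join (a, 0))) (L2_join (a, 0))" using coeff_op_coercive[of "L2_join (a, 0)"] by simp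
 also have "\<dots> = inner (normal_op A a) a"
  by (simp add: normal_op_def j inner_L2_parts zero_gfield.rep_eq)
 finally show ?thesis .
qed

lemmas nor_op_bij = coercive_bij(1)[OF nor_op_bl ka_pos nor_op_coercive]
lemmas nor_op_inv_bl = coercive_inv_bl[OF nor_op_bl ka_pos nor_op_coercive]

lemma conorm_bl: "bounded_linear (conormal A)"
 unfolding conormal_def
 by (intro bounded_linear_Pair bounded_linear_compose[OF L2_lift_bl[OF lin_parts(1)] coeff_op_bl]
  bounded_linear_compose[OF field_proj_bl L2_lift_bl[OF lin_parts(2)]])

lemma cotan_bl: "bounded_linear (cotan A)"
 unfolding cotan_def
 by (intro bounded_linear_Pair L2_lift_bl lin_parts
  bounded_linear_compose[OF field_proj_bl bounded_linear_compose[OF L2_lift_bl[OF lin_parts(2)] coeff_op_bl]])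

lemma unconorm_bl: "bounded_linear (unconorm A)"
proof -
 have "bounded_linear (%y :: 'n trace_space. L2_normal (coeff_op A (L2_lift inject_tan (L2_of_field (snd y)))))"
  by (intro bounded_linear_compose[OF L2_lift_bl[OF lin_parts(1)]] bounded_linear_compose[OF coeff_op_bl]
  bounded_linear_compose[OF L2_lift_bl[OF lin_parts(4)]] bounded_linear_compose[OF L2_of_field_bl bounded_linear_snd])
 then show ?thesis unfolding unconorm_def
  by (intro bounded_linear_Pair bounded_linear_compose[OF nor_op_inv_bl] bounded_linear_sub bounded_linear_fst bounded_linear_snd)
qed

lemma conorm_op_bl: "bounded_linear (conorm_op A)"
 unfolding conorm_op_def
 by (rule bounded_linear_compose[OF cotan_bl bounded_linear_compose[OF L2_join_bl unconorm_bl]])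

lemma conorm_join: "conormal A (L2_join h) =
  (normal_op A (fst h) + L2_normal (coeff_op A (L2_lift inject_tan (L2_of_field (snd h)))), snd h)"
 by (simp add: conormal_def field_proj_L2_of_field normal_op_def)
  (simp add: L2_join_def linear_add[OF bounded_linear.linear[OF coeff_op_bl]] L2_lift_plus lin_parts)

lemma unconorm_conorm [simp]: "unconorm A (conormal A (L2_join h)) = h"
 using nor_op_bij by (simp add: conorm_join unconorm_def bij_is_inj)

lemma conorm_unconorm [simp]: "conormal A (L2_join (unconorm A y)) = y"
 using nor_op_bij by (simp add: conorm_join unconorm_def bij_is_surj surj_f_inv_f)

lemma conorm_op_conorm: "conorm_op A (conormal A (L2_join h)) = cotan A (L2_join h)"
 by (simp add: conorm_op_def)

text \<open>The two vectors are \<open>f\<close> and \<open>A f\<close> with their normal components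
  exchanged, so their pairing is that of \<open>A f\<close> with \<open>f\<close>; this is the
  source of coercivity of \<open>conorm_op A\<close>.\<close>

lemma inner_cotan_conorm: "inner (cotan A (L2_join h)) (conormal A (L2_join h)) = inner (coeff_op A (L2_join h)) (L2_join h)"
 unfolding cotan_def conormal_def inner_prod_def inner_L2_parts[of "coeff_op A (L2_join h)"]
 by (simp add: field_proj_L2_of_field inner_field_proj_left) (rule inner_commute)

lemma conorm_op_coercive: "\<exists>ka'>0. \<forall>y. ka' * (norm y)^2 <= inner (conorm_op A y) y"
proof -
 obtain K where K: "0 < K" "!!h. norm (conormal A (L2_join h)) <= norm h * K"
  using bounded_linear.pos_bounded[OF bounded_linear_compose[OF conorm_bl L2_join_bl]] by blast
 have "ka / K^2 * (norm y)^2 <= inner (conorm_op A y) y" for y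
 proof -
  define h where "h = unconorm A y"
  have y: "y = conormal A (L2_join h)" by (simp add: h_def)
  have "(norm y)^2 <= (norm h * K)^2" unfolding y by (rule power_mono[OF K(2)]) simp
  then have "ka / K^2 * (norm y)^2 <= ka * (norm h)^2"
  using K(1) ka_pos by (simp add: power_mult_distrib divide_le_eq mult.assoc)
  also have "\<dots> <= inner (conorm_op A y) y"
  using coeff_op_coercive[of "L2_join h"] unfolding y conorm_op_conorm inner_cotan_conorm by (simp add: norm_join)
  finally show ?thesis .
 qed
 then show ?thesis using K(1) ka_pos by (intro exI[of _ "ka / K^2"]) simp
qed

definition ka\<^sub>c :: real where "ka\<^sub>c = (SOME ka'. 0 < ka' \<and> (\<forall>y. ka' * (norm y)^2 <= inner (conorm_op A y) y))"

lemma ka\<^sub>c: "0 < ka\<^sub>c" "ka\<^sub>c * (norm y)^2 <= inner (conorm_op A y) y"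
 using someI_ex[OF conorm_op_coercive, folded ka\<^sub>c_def] by blast+

lemma coercive_sa_conorm: "coercive_sa div_grad (conorm_op A) ka\<^sub>c"
 by (rule coercive_sa.intro[OF div_grad_self_adj div_grad_single_valued conorm_op_bl ka\<^sub>c])

subsection \<open>The differential equation in conormal coordinates\<close>

sublocale co: coercive_sa div_grad "conorm_op A" ka\<^sub>c
 by (rule coercive_sa_conorm)

lemma div_grad_iff:
 "(cotan A (L2_join h), (d, k)) \<in> div_grad \<longleftrightarrow>
  L2_div (L2_tangential (coeff_op A (L2_join h))) d \<and> (\<forall>j. weak_deriv (fst h) j (- L2_nth (L2_of_field k) j))"
 by (simp add: div_grad_def cotan_def L2_div_proj)

lemma rep_coeff_parts:
 "(%x. normal_part (A x *v rep_L2 f x)) \<in> lmeas"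
 "AEL x. normal_part (A x *v rep_L2 f x) = rep_L2 (L2_normal (coeff_op A f)) x"
 "(%x. tangential_part (A x *v rep_L2 f x)) \<in> lmeas"
 "AEL x. tangential_part (A x *v rep_L2 f x) = rep_L2 (L2_tangential (coeff_op A f)) x"
proof -
 show "(%x. normal_part (A x *v rep_L2 f x)) \<in> lmeas" "(%x. tangential_part (A x *v rep_L2 f x)) \<in> lmeas"
  using pw_bdd_const[OF lin_parts(1)] pw_bdd_const[OF lin_parts(2)] coeff_meas[of f]
  unfolding pw_bdd_def by blast+
 show "AEL x. normal_part (A x *v rep_L2 f x) = rep_L2 (L2_normal (coeff_op A f)) x"
  using rep_part(2)[of "coeff_op A f"] rep_coeff_op[of f] by eventually_elim simp
 show "AEL x. tangential_part (A x *v rep_L2 f x) = rep_L2 (L2_tangential (coeff_op A f)) x"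
  using rep_part(4)[of "coeff_op A f"] rep_coeff_op[of f] by eventually_elim simp
qed

text \<open>The divergence and gradient equations together say that \<open>div_grad\<close> maps
  (f_0, (A f)_par) to minus the conormal vector of the time derivative.\<close>

lemma system_iff:
 "weak_divergence (%x. tangential_part (A x *v rep_L2 F x)) (%x. - normal_part (A x *v rep_L2 F' x)) \<and>
  weak_gradient (%x. normal_part (rep_L2 F x)) (%x. tangential_part (rep_L2 F' x)) \<and>
  weak_curl_free (%x. tangential_part (rep_L2 F x)) \<longleftrightarrow>
  (\<exists>h h'. F = L2_join h \<and> F' = L2_join h' \<and> (cotan A (L2_join h), - conormal A (L2_join h')) \<in> div_grad)"
proof -
 have neg: "(%x. - normal_part (A x *v rep_L2 F' x)) \<in> lmeas"
  "AEL x. - normal_part (A x *v rep_L2 F' x) = rep_L2 (- L2_normal (coeff_op A F')) x"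
 proof -
  show "(%x. - normal_part (A x *v rep_L2 F' x)) \<in> lmeas"
  by (intro borel_measurable_uminus rep_coeff_parts(1))
  show "AEL x. - normal_part (A x *v rep_L2 F' x) = rep_L2 (- L2_normal (coeff_op A F')) x"
  using rep_coeff_parts(2)[of F'] rep_L2_minus[of "L2_normal (coeff_op A F')"] by eventually_elim simp
 qed
 have D: "(cotan A (L2_join h), - conormal A (L2_join h')) \<in> div_grad \<longleftrightarrow>
  L2_div (L2_tangential (coeff_op A (L2_join h))) (- L2_normal (coeff_op A (L2_join h'))) \<and>
  (\<forall>j. weak_deriv (fst h) j (L2_nth (L2_of_field (snd h')) j))" for h h'
  by (simp add: conormal_def div_grad_iff field_proj_L2_of_field uminus_gfield.rep_eq L2_nth_minus)
 show ?thesis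
  unfolding weak_divergence_L2[OF rep_coeff_parts(3,4) neg] weak_gradient_L2[OF rep_part] weak_curl_free_L2[OF rep_part(3,4)]
 proof safe
  assume S: "L2_div (L2_tangential (coeff_op A F)) (- L2_normal (coeff_op A F'))"
  "\<forall>j. weak_deriv (L2_normal F) j (L2_nth (L2_tangential F') j)" "L2_curl_free (L2_tangential F)"
  obtain h where h: "F = L2_join h" using S(3) range_join by blast
  \<comment> \<open>The tangential part of \<open>F'\<close> is a weak gradient and hence curl-free,
    so the derivative too lies in the range of \<open>L2_join\<close>.\<close>
  obtain h' where h': "F' = L2_join h'" using weak_gradient_curl_free S(2) range_join by blast
  have "(cotan A (L2_join h), - conormal A (L2_join h')) \<in> div_grad"
  unfolding D using S(1,2) by (simp add: h h')
  then show "\<exists>h h'. F = L2_join h \<and> F' = L2_join h' \<and> (cotan A (L2_join h), - conormal A (L2_join h')) \<in> div_grad"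
  using h h' by blast
 qed (auto simp: D L2_of_field_curl_free)
qed

lemma nor_coeff_nonzero: "AEL x. A x $ None $ None ~= 0"
 using coercive
proof eventually_elim
 case (elim x)
 have "0 < ka * (norm (axis None 1 :: 'n cvec))^2" using ka_pos by (simp add: norm_axis_1)
 also have "\<dots> <= inner (A x *v axis None 1) (axis None 1)" using elim by blast
 also have "\<dots> = inner (A x $ None $ None) 1"
 proof -
  have "(A x *v axis None 1) $ None = A x $ None $ None"
  by (simp add: matrix_vector_mult_def axis_def if_distrib cong: if_cong)
  then show ?thesis by (simp add: inner_axis)
 qed
 finally show ?case by auto
qed

lemma nor_part_matrix:
 "normal_part (M *v v) = M $ None $ None * normal_part v + (\<Sum>j\<in>UNIV. M $ None $ Some j * tangential_part v $ j)"
 for v :: "'n cvec"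
 by (simp add: normal_part_def tangential_part_def matrix_vector_mult_def UNIV_option_conv sum.reindex)

lemma T_op_cond:
 "(AEL x. normal_part (rep_L2 G x) = inverse (A x $ None $ None) * ((\<Sum>j\<in>UNIV. A x $ None $ Some j * rep_L2 g x $ j) + rep_L2 d x) \<and>
  tangential_part (rep_L2 G x) = - rep_L2 g x) \<longleftrightarrow>
  g = - L2_tangential G \<and> d = L2_normal (coeff_op A G)"
proof
 assume ae: "AEL x. normal_part (rep_L2 G x) = inverse (A x $ None $ None) * ((\<Sum>j\<in>UNIV. A x $ None $ Some j * rep_L2 g x $ j) + rep_L2 d x) \<and>
  tangential_part (rep_L2 G x) = - rep_L2 g x"
 show "g = - L2_tangential G \<and> d = L2_normal (coeff_op A G)"
 proof
  show "g = - L2_tangential G"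
  proof (rule L2_eqI)
  show "AEL x. rep_L2 g x = rep_L2 (- L2_tangential G) x"
  using ae rep_part(4)[of G] rep_L2_minus[of "L2_tangential G"] by eventually_elim simp
  qed
  show "d = L2_normal (coeff_op A G)"
  proof (rule L2_eqI)
  show "AEL x. rep_L2 d x = rep_L2 (L2_normal (coeff_op A G)) x"
  using ae rep_coeff_parts(2)[of G] nor_coeff_nonzero
  by eventually_elim (auto simp: nor_part_matrix sum_negf mult.assoc[symmetric])
  qed
 qed
next
 assume eq: "g = - L2_tangential G \<and> d = L2_normal (coeff_op A G)"
 show "AEL x. normal_part (rep_L2 G x) = inverse (A x $ None $ None) * ((\<Sum>j\<in>UNIV. A x $ None $ Some j * rep_L2 g x $ j) + rep_L2 d x) \<and>
  tangential_part (rep_L2 G x) = - rep_L2 g x"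
  using rep_coeff_parts(2)[of G] nor_coeff_nonzero rep_part(4)[of G] rep_L2_minus[of "L2_tangential G"]
 proof eventually_elim
  case (elim x)
  have t: "rep_L2 g x = - tangential_part (rep_L2 G x)" using elim(3,4) eq by simp
  have d: "rep_L2 d x = normal_part (A x *v rep_L2 G x)" using elim(1) eq by simp
  show ?case using elim(2) unfolding t d nor_part_matrix by (simp add: sum_negf)
 qed
qed

lemma T_op_iff:
 "(F, G) \<in> T_op A \<longleftrightarrow> (\<exists>h k. F = L2_join h \<and> G = L2_join k \<and> (cotan A (L2_join h), conormal A (L2_join k)) \<in> div_grad)"
proof -
 have wd: "weak_gradient (%x. normal_part (rep_L2 F x)) (rep_L2 g) \<longleftrightarrow> (\<forall>j. weak_deriv (L2_normal F) j (L2_nth g j))" for g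
  by (rule weak_gradient_L2[OF rep_part(1,2) rep_L2_meas AE_I2[OF refl]])
 have dd: "weak_divergence (%x. tangential_part (A x *v rep_L2 F x)) (rep_L2 d) \<longleftrightarrow> L2_div (L2_tangential (coeff_op A F)) d" for d
  by (rule weak_divergence_L2[OF rep_coeff_parts(3,4) rep_L2_meas AE_I2[OF refl]])
 have "(F, G) \<in> T_op A \<longleftrightarrow> F \<in> H1_hat \<and> (\<forall>j. weak_deriv (L2_normal F) j (- L2_nth (L2_tangential G) j)) \<and>
  L2_div (L2_tangential (coeff_op A F)) (L2_normal (coeff_op A G))"
  unfolding T_op_def T_op_cond by (auto simp: wd dd L2_nth_minus)
 also have "\<dots> \<longleftrightarrow> (\<exists>h k. F = L2_join h \<and> G = L2_join k \<and> (cotan A (L2_join h), conormal A (L2_join k)) \<in> div_grad)"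
 proof safe
  assume S: "F \<in> H1_hat" "\<forall>j. weak_deriv (L2_normal F) j (- L2_nth (L2_tangential G) j)"
  "L2_div (L2_tangential (coeff_op A F)) (L2_normal (coeff_op A G))"
  obtain h where h: "F = L2_join h" using S(1) H1_hat_eq by blast
  have "L2_curl_free (- L2_tangential G)" by (rule weak_gradient_curl_free[of "L2_normal F"]) (use S(2) in \<open>simp add: L2_nth_minus\<close>)
  then have "L2_curl_free (L2_tangential G)" using L2_curl_free_minus[of "- L2_tangential G"] by simp
  then obtain k where k: "G = L2_join k" using range_join by blast
  have "(cotan A (L2_join h), conormal A (L2_join k)) \<in> div_grad"
  using S(2,3) by (simp add: conormal_def div_grad_iff field_proj_L2_of_field h k)
  then show "\<exists>h k. F = L2_join h \<and> G = L2_join k \<and> (cotan A (L2_join h), conormal A (L2_join k)) \<in> div_grad" using h k by blast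
 qed (auto simp: conormal_def div_grad_iff field_proj_L2_of_field H1_hat_eq)
 finally show ?thesis .
qed

lemma conorm_lin: "linear (%h. conormal A (L2_join h))"
 by (rule bounded_linear.linear[OF bounded_linear_compose[OF conorm_bl L2_join_bl]])

text \<open>\<open>conormal\<close> carries the resolvent system of the graph \<open>T_op A\<close>
  to that of \<open>div_grad\<close> composed with \<open>conorm_op A\<close>;
  \<open>co.PQ_unique\<close> makes the definite description well defined.\<close>

lemma Q_op_eq:
 assumes t: "0 < t"
 shows "Q_op A t (L2_join h) = L2_join (unconorm A (co.Q t (conormal A (L2_join h))))"
proof -
 let ?M = "%h. conormal A (L2_join h)"
 let ?f = "?M h"
 let ?w = "L2_join (unconorm A (co.Q t ?f))"
 note M_lin = linear_add[OF conorm_lin] linear_cmul[OF conorm_lin]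
 note J_lin = linear_add[OF bounded_linear.linear[OF L2_join_bl], symmetric] linear_cmul[OF bounded_linear.linear[OF L2_join_bl], symmetric]
 have N: "(cotan A (L2_join h), y) \<in> div_grad \<longleftrightarrow> (conorm_op A (?M h), y) \<in> div_grad" for h y
  by (simp add: conorm_op_conorm)
 have ex: "\<exists>u v z. (u, v) \<in> T_op A \<and> (v, z) \<in> T_op A \<and> u + t^2 *: z = L2_join h \<and> ?w = t *: v"
 proof -
  define u v z where "u = unconorm A (co.P t ?f)" and "v = (1/t) *: unconorm A (co.Q t ?f)"
  and "z = (1/t\<^sup>2) *: (h - u)"
  have Mu: "?M u = co.P t ?f" by (simp add: u_def)
  have Mv: "?M v = (1/t) *: co.Q t ?f" by (simp add: v_def M_lin)
  have Mz: "?M z = (1/t\<^sup>2) *: (?f - co.P t ?f)"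
  by (simp add: z_def M_lin linear_diff[OF conorm_lin] Mu)
  have "(conorm_op A (?M u), ?M v) \<in> div_grad"
  using co.D_scale[OF co.PQ_D(1)[OF t, of ?f], of "1/t"] t by (simp add: Mu Mv)
  moreover have "(conorm_op A (?M v), ?M z) \<in> div_grad"
  using co.D_scale[OF co.PQ_D(2)[OF t, of ?f], of "1/t\<^sup>2"] t
  by (simp add: Mv Mz linear_cmul[OF bounded_linear.linear[OF conorm_op_bl]] power2_eq_square)
  ultimately have "(L2_join u, L2_join v) \<in> T_op A" "(L2_join v, L2_join z) \<in> T_op A"
  unfolding T_op_iff N[symmetric] by blast+
  moreover have "L2_join u + t^2 *: L2_join z = L2_join h" using t by (simp add: J_lin z_def)
  moreover have "?w = t *: L2_join v" using t by (simp add: J_lin v_def)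
  ultimately show ?thesis by blast
 qed
 have un: "w = ?w" if w: "\<exists>u v z. (u, v) \<in> T_op A \<and> (v, z) \<in> T_op A \<and> u + t^2 *: z = L2_join h \<and> w = t *: v" for w
 proof -
  obtain u v z where uvz: "(u, v) \<in> T_op A" "(v, z) \<in> T_op A" "u + t^2 *: z = L2_join h" "w = t *: v" using w by blast
  obtain u' v' where 1: "u = L2_join u'" "v = L2_join v'" "(conorm_op A (?M u'), ?M v') \<in> div_grad"
  using uvz(1) unfolding T_op_iff N by blast
  obtain v'' z' where 2: "v = L2_join v''" "z = L2_join z'" "(conorm_op A (?M v''), ?M z') \<in> div_grad"
  using uvz(2) unfolding T_op_iff N by blast
  have v'': "v'' = v'" using 2(1) unfolding 1(2) inj_join by (rule sym)
  have "h = u' + t^2 *: z'" using uvz(3) unfolding 1(1) 2(2) J_lin inj_join by simp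
  then have F: "?f - ?M u' = t^2 *: ?M z'" by (simp add: M_lin)
  have "co.Q t ?f = t *: ?M v'"
  proof (rule co.PQ_unique(2)[OF t])
  show "(t *: conorm_op A (?M u'), t *: ?M v') \<in> div_grad" by (rule co.D_scale[OF 1(3)])
  show "(t *: conorm_op A (t *: ?M v'), ?f - ?M u') \<in> div_grad"
  using co.D_scale[OF 2(3), of "t^2"] unfolding F v''
  by (simp add: linear_cmul[OF bounded_linear.linear[OF conorm_op_bl]] power2_eq_square)
  qed
  then have "unconorm A (co.Q t ?f) = unconorm A (?M (t *: v'))" by (simp add: M_lin)
  then show ?thesis by (simp add: uvz(4) 1(2) J_lin)
 qed
 show ?thesis unfolding Q_op_def by (rule the_equality, rule ex, rule un)
qed

text \<open>The change of coordinates and its inverse are bounded, so both estimates carry over with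
  constants altered by the squares of the two norms.\<close>

lemma quadratic_sa_conorm:
 assumes "quadratic_estimates A"
 shows "quadratic_sa div_grad (conorm_op A) ka\<^sub>c"
proof -
 obtain c C where cC: "0 < c" "0 < C"
  and lo: "!!f. f \<in> H1_hat ==> ennreal (c * (norm f)^2) <= (\<integral>\<^sup>+t\<in>{0<..}. ennreal ((norm (Q_op A t f))^2 / t) \<partial>lborel)"
  and hi: "!!f. f \<in> H1_hat ==> (\<integral>\<^sup>+t\<in>{0<..}. ennreal ((norm (Q_op A t f))^2 / t) \<partial>lborel) <= ennreal (C * (norm f)^2)"
  using assms unfolding quadratic_estimates_def by blast
 obtain K where K: "0 < K" "!!h. norm (conormal A (L2_join h)) <= norm h * K"
  using bounded_linear.pos_bounded[OF bounded_linear_compose[OF conorm_bl L2_join_bl]] by blast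
 obtain L where L: "0 < L" "!!y. norm (unconorm A y) <= norm y * L"
  using bounded_linear.pos_bounded[OF unconorm_bl] by blast
 have K': "norm y <= norm (unconorm A y) * K" for y using K(2)[of "unconorm A y"] by simp
 define q where "q F t = ennreal ((norm (unconorm A (co.Q t F)))^2 / t)" for F t
 define p where "p F t = ennreal ((norm (co.Q t F))^2 / t)" for F t
 have pm: "p F \<in> borel_measurable halfline" for F
  unfolding p_def[abs_def]
  by (rule measurable_compose[OF meas_half_cont measurable_ennreal])
  (intro continuous_intros co.Q_cont, auto)
 have int: "(\<integral>\<^sup>+t\<in>{0<..}. ennreal ((norm (Q_op A t (L2_join (unconorm A F))))^2 / t) \<partial>lborel) = (HI t. q F t)" for F
  by (subst nn_integral_restrict_space) (auto simp: q_def Q_op_eq norm_join indicator_def intro!: nn_integral_cong)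
 have q_le: "(HI t. q F t) <= ennreal (L^2) * (HI t. p F t)" for F
  unfolding nn_integral_cmult[OF pm, symmetric]
 proof (rule nn_integral_mono)
  fix t assume "t \<in> space halfline"
  then have t: "0 < t" by simp
  have "(norm (unconorm A (co.Q t F)))^2 <= (norm (co.Q t F) * L)^2" by (rule power_mono[OF L(2)]) simp
  then have "(norm (unconorm A (co.Q t F)))^2 / t <= L^2 * ((norm (co.Q t F))^2 / t)"
  using t by (simp add: power_mult_distrib mult.commute divide_right_mono)
  then show "q F t <= ennreal (L^2) * p F t" unfolding q_def p_def using t by (subst ennreal_mult[symmetric]) (auto intro: ennreal_leI)
 qed
 have p_le: "(HI t. p F t) <= ennreal (K^2) * (HI t. q F t)" for F
 proof -
  have "ennreal (1 / K^2) * (HI t. p F t) <= (HI t. q F t)"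
  unfolding nn_integral_cmult[OF pm, symmetric]
  proof (rule nn_integral_mono)
  fix t assume "t \<in> space halfline"
  then have t: "0 < t" by simp
  have "(norm (co.Q t F))^2 <= (norm (unconorm A (co.Q t F)) * K)^2" by (rule power_mono[OF K']) simp
  then have "1 / K^2 * (norm (co.Q t F))^2 <= (norm (unconorm A (co.Q t F)))^2"
  using K(1) by (simp add: power_mult_distrib divide_le_eq)
  from divide_right_mono[OF this less_imp_le[OF t]]
  have "1 / K^2 * ((norm (co.Q t F))^2 / t) <= (norm (unconorm A (co.Q t F)))^2 / t" by simp
  then show "ennreal (1 / K^2) * p F t <= q F t" unfolding q_def p_def using t by (subst ennreal_mult[symmetric]) (auto intro: ennreal_leI)
  qed
  then have "ennreal (K^2) * (ennreal (1 / K^2) * (HI t. p F t)) <= ennreal (K^2) * (HI t. q F t)"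
  by (rule mult_left_mono) simp
  then show ?thesis using K(1) by (simp add: mult.assoc[symmetric] ennreal_mult[symmetric])
 qed
 have hat: "L2_join h \<in> H1_hat" for h by (simp add: H1_hat_eq)
 show ?thesis
 proof (unfold_locales, intro exI conjI allI)
  fix F
  let ?h = "unconorm A F"
  have "ennreal (c / (K^2 * L^2) * (norm F)^2) <= ennreal (1 / L^2) * ennreal (c * (norm ?h)^2)"
  proof (subst ennreal_mult[symmetric])
  have "(norm F)^2 <= (norm ?h * K)^2" by (rule power_mono[OF K']) simp
  then have "c / (K^2 * L^2) * (norm F)^2 <= c / (K^2 * L^2) * ((norm ?h)^2 * K^2)"
  using cC by (intro mult_left_mono) (auto simp: power_mult_distrib)
  also have "\<dots> = 1 / L^2 * (c * (norm ?h)^2)" using K(1) by simp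
  finally show "ennreal (c / (K^2 * L^2) * (norm F)^2) <= ennreal (1 / L^2 * (c * (norm ?h)^2))" by (rule ennreal_leI)
  qed (use cC in auto)
  also have "\<dots> <= ennreal (1 / L^2) * (HI t. q F t)"
  using lo[OF hat, of ?h] unfolding int norm_join by (intro mult_left_mono) auto
  also have "\<dots> <= ennreal (1 / L^2) * (ennreal (L^2) * (HI t. p F t))"
  by (intro mult_left_mono q_le) simp
  also have "\<dots> = (HI t. p F t)"
  using L(1) by (simp add: mult.assoc[symmetric] ennreal_mult[symmetric])
  finally show "ennreal (c / (K^2 * L^2) * (norm F)^2) <= (HI t. ennreal ((norm (co.Q t F))^2 / t))"
  by (simp add: p_def)
  have "(HI t. p F t) <= ennreal (K^2) * (HI t. q F t)" by (rule p_le)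
  also have "\<dots> <= ennreal (K^2) * ennreal (C * (norm ?h)^2)"
  using hi[OF hat, of ?h] unfolding int norm_join by (intro mult_left_mono) auto
  also have "\<dots> <= ennreal ((K^2 * C * L^2) * (norm F)^2)"
  proof (subst ennreal_mult[symmetric])
  have "(norm ?h)^2 <= (norm F * L)^2" by (rule power_mono[OF L(2)]) simp
  then have "K^2 * C * (norm ?h)^2 <= K^2 * C * ((norm F)^2 * L^2)"
  using cC by (intro mult_left_mono) (auto simp: power_mult_distrib)
  then show "ennreal (K^2 * (C * (norm ?h)^2)) <= ennreal ((K^2 * C * L^2) * (norm F)^2)"
  by (intro ennreal_leI) (simp add: mult_ac)
  qed (use cC in auto)
  finally show "(HI t. ennreal ((norm (co.Q t F))^2 / t)) <= ennreal ((K^2 * C * L^2) * (norm F)^2)"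
  by (simp add: p_def)
 qed (use cC K L in auto)
qed

subsection \<open>Boundary value problems\<close>

text \<open>For positive times curl-freeness belongs to the system; the trace inherits it as an L2
  limit.\<close>

lemma solves_res:
 assumes S: "solves_with_trace A F f"
 shows "0 < t ==> \<exists>h. F t = L2_join h" "\<exists>h. f = L2_join h"
proof -
 have sys: "\<exists>h h'. F t = L2_join h \<and> vector_derivative F (at t) = L2_join h' \<and> (cotan A (L2_join h), - conormal A (L2_join h')) \<in> div_grad"
  if "0 < t" for t
  unfolding system_iff[symmetric] using S that by (simp add: solves_with_trace_def)
 then show F: "0 < t ==> \<exists>h. F t = L2_join h" for t by blast
 have seq: "filterlim (%n. inverse (real (Suc n))) (at_right 0) sequentially"
  unfolding filterlim_at using LIMSEQ_inverse_real_of_nat by simp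
 have "(F ---> f) (at_right 0)" using S by (simp add: solves_with_trace_def)
 from filterlim_compose[OF this seq] have lim: "(%n. F (inverse (real (Suc n)))) ----> f" .
 have "L2_curl_free (L2_tangential f)"
 proof (rule L2_curl_free_limit)
  show "(%n. L2_tangential (F (inverse (real (Suc n))))) ----> L2_tangential f"
  by (rule bounded_linear.tendsto[OF L2_lift_bl[OF lin_parts(2)] lim])
  show "L2_curl_free (L2_tangential (F (inverse (real (Suc n)))))" for n
  using F[of "inverse (real (Suc n))"] by (auto simp: L2_of_field_curl_free)
 qed
 then show "\<exists>h. f = L2_join h" using range_join by blast
qed

lemma solves_imp_trace:
 assumes S: "solves_with_trace A F f"
 shows "trsol div_grad (conorm_op A) (%t. conormal A (F t)) (conormal A f)"
 unfolding trsol_def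
proof (intro conjI allI impI)
 have F: "F C1_differentiable_on {0<..}" using S by (simp add: solves_with_trace_def)
 show "(%t. conormal A (F t)) C1_differentiable_on {0<..}" by (rule C1_bl(1)[OF conorm_bl F])
 fix t :: real assume t: "0 < t"
 have "\<exists>h h'. F t = L2_join h \<and> vector_derivative F (at t) = L2_join h' \<and> (cotan A (L2_join h), - conormal A (L2_join h')) \<in> div_grad"
  unfolding system_iff[symmetric] using S t by (simp add: solves_with_trace_def)
 then show "(conorm_op A (conormal A (F t)), - vector_derivative (%t. conormal A (F t)) (at t)) \<in> div_grad"
  unfolding C1_bl(2)[OF conorm_bl F t] by (auto simp: conorm_op_conorm)
next
 have "(F ---> 0) at_top" "(F ---> f) (at_right 0)" using S by (auto simp: solves_with_trace_def)
 from this[THEN bounded_linear.tendsto[OF conorm_bl]]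
 show "((%t. conormal A (F t)) ---> 0) at_top" "((%t. conormal A (F t)) ---> conormal A f) (at_right 0)"
  by (simp_all add: linear_0[OF bounded_linear.linear[OF conorm_bl]])
qed

lemma trace_imp_solves:
 assumes S: "trsol div_grad (conorm_op A) X x"
 shows "solves_with_trace A (%t. L2_join (unconorm A (X t))) (L2_join (unconorm A x))"
proof -
 have bl: "bounded_linear (%y. L2_join (unconorm A y))"
  by (rule bounded_linear_compose[OF L2_join_bl unconorm_bl])
 have X: "X C1_differentiable_on {0<..}" using S by (simp add: trsol_def)
 have "\<exists>h h'. L2_join (unconorm A (X t)) = L2_join h \<and> vector_derivative (%t. L2_join (unconorm A (X t))) (at t) = L2_join h' \<and>
  (cotan A (L2_join h), - conormal A (L2_join h')) \<in> div_grad" if t: "0 < t" for t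
  unfolding C1_bl(2)[OF bl X t]
 proof -
  have "(conorm_op A (X t), - vector_derivative X (at t)) \<in> div_grad" using S t by (simp add: trsol_def)
  then have "(cotan A (L2_join (unconorm A (X t))), - conormal A (L2_join (unconorm A (vector_derivative X (at t))))) \<in> div_grad"
  by (simp add: conorm_op_def)
  then show "\<exists>h h'. L2_join (unconorm A (X t)) = L2_join h \<and> L2_join (unconorm A (vector_derivative X (at t))) = L2_join h' \<and>
  (cotan A (L2_join h), - conormal A (L2_join h')) \<in> div_grad" by blast
 qed
 moreover have "((%t. L2_join (unconorm A (X t))) ---> 0) at_top" "((%t. L2_join (unconorm A (X t))) ---> L2_join (unconorm A x)) (at_right 0)"
 proof -
  have "(X ---> 0) at_top" "(X ---> x) (at_right 0)" using S by (auto simp: trsol_def)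
  from this[THEN bounded_linear.tendsto[OF bl]]
  show "((%t. L2_join (unconorm A (X t))) ---> 0) at_top" "((%t. L2_join (unconorm A (X t))) ---> L2_join (unconorm A x)) (at_right 0)"
  by (simp_all add: linear_0[OF bounded_linear.linear[OF bl]])
 qed
 ultimately show ?thesis unfolding solves_with_trace_def system_iff
  using C1_bl(1)[OF bl X] by blast
qed

text \<open>Translates uniqueness of the evolution on t > 0 into uniqueness of the trace and back:
  equal evolutions have equal limits at 0, and equal traces have equal evolutions by
  \<open>uniq\<close>.\<close>

lemma uniquely_solvable_iff:
 assumes uniq: "!!X Y x t. trsol div_grad (conorm_op A) X x ==> trsol div_grad (conorm_op A) Y x ==> 0 < t ==> X t = Y t"
  and PR: "!!h. P (L2_join h) \<longleftrightarrow> R (conormal A (L2_join h))"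
 shows "uniquely_solvable (%F. \<exists>f. solves_with_trace A F f \<and> P f) \<longleftrightarrow>
  (\<exists>!x. (\<exists>X. trsol div_grad (conorm_op A) X x) \<and> R x)"
proof
 assume U: "uniquely_solvable (%F. \<exists>f. solves_with_trace A F f \<and> P f)"
 then obtain F f where F: "solves_with_trace A F f" "P f" unfolding uniquely_solvable_def by blast
 obtain h where h: "f = L2_join h" using solves_res(2)[OF F(1)] by blast
 show "\<exists>!x. (\<exists>X. trsol div_grad (conorm_op A) X x) \<and> R x"
 proof (rule ex1I[of _ "conormal A f"])
  show "(\<exists>X. trsol div_grad (conorm_op A) X (conormal A f)) \<and> R (conormal A f)"
  using solves_imp_trace[OF F(1)] F(2) PR[of h] by (auto simp: h)
  fix x assume "(\<exists>X. trsol div_grad (conorm_op A) X x) \<and> R x"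
  then obtain X where X: "trsol div_grad (conorm_op A) X x" "R x" by blast
  have "P (L2_join (unconorm A x))" using PR[of "unconorm A x"] X(2) by simp
  then have eq: "F t = L2_join (unconorm A (X t))" if "0 < t" for t
  using U F trace_imp_solves[OF X(1)] that unfolding uniquely_solvable_def by blast
  have "\<forall>\<^sub>F t in at_right 0. conormal A (F t) = X t"
  using eventually_at_right_less[of 0] by eventually_elim (simp add: eq)
  note cong = tendsto_cong[OF this]
  have lim: "((%t. conormal A (F t)) ---> conormal A f) (at_right 0)" "(X ---> x) (at_right 0)"
  using solves_imp_trace[OF F(1)] X(1) by (auto simp: trsol_def)
  show "x = conormal A f" by (rule tendsto_unique[OF trivial_limit_at_right_real lim(2) lim(1)[unfolded cong]])
 qed
next
 assume U: "\<exists>!x. (\<exists>X. trsol div_grad (conorm_op A) X x) \<and> R x"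
 then obtain x X where X: "trsol div_grad (conorm_op A) X x" "R x" by blast
 have "P (L2_join (unconorm A x))" using PR[of "unconorm A x"] X(2) by simp
 then have ex: "\<exists>F f. solves_with_trace A F f \<and> P f" using trace_imp_solves[OF X(1)] by blast
 have "F t = G t" if F: "solves_with_trace A F f" "P f" and G: "solves_with_trace A G g" "P g" and t: "0 < t" for F f G g t
 proof -
  obtain h k where hk: "f = L2_join h" "g = L2_join k" using solves_res(2)[OF F(1)] solves_res(2)[OF G(1)] by blast
  have R: "R (conormal A f)" "R (conormal A g)" using F(2) G(2) PR by (auto simp: hk)
  have "conormal A f = conormal A g"
  by (rule ex1E[OF U]) (use solves_imp_trace[OF F(1)] solves_imp_trace[OF G(1)] R in blast)
  then have "conormal A (F t) = conormal A (G t)"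
  using uniq[OF solves_imp_trace[OF F(1)] _ t] solves_imp_trace[OF G(1)] by simp
  then have eq: "unconorm A (conormal A (F t)) = unconorm A (conormal A (G t))" by (rule arg_cong)
  obtain h where h: "F t = L2_join h" using solves_res(1)[OF F(1) t] by blast
  obtain k where k: "G t = L2_join k" using solves_res(1)[OF G(1) t] by blast
  show ?thesis using eq unfolding h k unconorm_conorm by (rule arg_cong)
 qed
 note un = this
 show "uniquely_solvable (%F. \<exists>f. solves_with_trace A F f \<and> P f)"
  unfolding uniquely_solvable_def
 proof (intro conjI ex allI impI)
  fix F G :: "real => 'n full" and t :: real
  assume "\<exists>f. solves_with_trace A F f \<and> P f" "\<exists>f. solves_with_trace A G f \<and> P f" and t: "0 < t"
  then obtain f g where "solves_with_trace A F f" "P f" "solves_with_trace A G g" "P g" by (elim exE conjE)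
  then show "F t = G t" using t by (rule un)
 qed
qed

end

subsection \<open>Duality\<close>

definition flip :: "'a \<times> 'b::ab_group_add => 'a \<times> 'b" where
 "flip x = (fst x, - snd x)"

lemma flip_flip [simp]: "flip (flip x) = x"
 by (simp add: flip_def)

lemma fst_flip [simp]: "fst (flip x) = fst x"
 by (simp add: flip_def)

lemma flip_minus: "flip (- x) = - flip x" for x :: "'a::ab_group_add \<times> 'b::ab_group_add"
 by (simp add: flip_def)

lemma flip_bl: "bounded_linear (flip :: 'a::real_normed_vector \<times> 'b::real_normed_vector => _)"
 unfolding flip_def by (intro bounded_linear_Pair bounded_linear_fst bounded_linear_minus bounded_linear_snd)

lemma inner_flip: "inner (flip x) y = inner x (flip y)" for x y :: "'a::real_inner \<times> 'b::real_inner"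
 by (simp add: flip_def inner_prod_def)

lemma norm_flip: "norm (flip x) = norm x" for x :: "'a::real_inner \<times> 'b::real_inner"
 by (simp add: norm_eq_sqrt_inner inner_flip)

text \<open>Conjugation by the sign change of tangential parts turns \<open>div_grad\<close> into
  its negative, so it reverses the direction of the evolution.\<close>

lemma div_grad_flip: "(p, q) \<in> div_grad \<longleftrightarrow> (flip p, - flip q) \<in> div_grad"
proof -
 obtain a V d G where "p = (a, V)" "q = (d, G)" by (cases p, cases q)
 then show ?thesis
  by (simp add: div_grad_def flip_def L2_div_def uminus_gfield.rep_eq L2_nth_minus sum_negf)
qed

lemma trsol_flip:
 fixes B :: "'n::finite trace_space => 'n trace_space"
 shows "trsol div_grad B X x ==> trsol (neg_graph div_grad) (%y. flip (B (flip y))) (%t. flip (X t)) (flip x)"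
  and "trsol (neg_graph div_grad) (%y. flip (B (flip y))) X x ==> trsol div_grad B (%t. flip (X t)) (flip x)"
proof -
 have lim: "((%t. flip (X t)) ---> flip y) F" if "(X ---> y) F" for y F
  by (rule bounded_linear.tendsto[OF flip_bl that])
 have f0: "flip (0 :: 'n trace_space) = 0" by (simp add: flip_def zero_prod_def)
 {
  assume S: "trsol div_grad B X x"
  then have X: "X C1_differentiable_on {0<..}" by (simp add: trsol_def)
  have "(flip (B (X t)), flip (vector_derivative X (at t))) \<in> div_grad" if "0 < t" for t
  using S that div_grad_flip[of "B (X t)" "- vector_derivative X (at t)"] by (simp add: trsol_def flip_minus)
  then show "trsol (neg_graph div_grad) (%y. flip (B (flip y))) (%t. flip (X t)) (flip x)"
  using S lim[of 0 at_top] lim[of x "at_right 0"] C1_bl[OF flip_bl X] f0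
  by (simp add: trsol_def neg_graph_def)
 next
  assume S: "trsol (neg_graph div_grad) (%y. flip (B (flip y))) X x"
  then have X: "X C1_differentiable_on {0<..}" by (simp add: trsol_def)
  have "(B (flip (X t)), - flip (vector_derivative X (at t))) \<in> div_grad" if "0 < t" for t
  using S that div_grad_flip[of "flip (B (flip (X t)))" "vector_derivative X (at t)"] by (simp add: trsol_def neg_graph_def)
  then show "trsol div_grad B (%t. flip (X t)) (flip x)"
  using S lim[of 0 at_top] lim[of x "at_right 0"] C1_bl[OF flip_bl X] f0
  by (simp add: trsol_def)
 }
qed

text \<open>In conormal coordinates both pairings are rearrangements of <A f, g> = <f, adjoint_coeff
  A g>. Moving the normal terms across reverses the relative sign of the tangential ones, which
  explains the flips.\<close>

lemma (in coefficient) dual_pair_conorm: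
 "dual_pair div_grad (conorm_op A) ka\<^sub>c (%y. flip (conorm_op (adjoint_coeff A) (flip y))) (coefficient.ka\<^sub>c (adjoint_coeff A))"
proof -
 interpret s: coefficient "adjoint_coeff A" ka by (rule adj_coeff)
 have "coercive_sa div_grad (%y. flip (conorm_op (adjoint_coeff A) (flip y))) s.ka\<^sub>c"
 proof (rule coercive_sa.intro[OF div_grad_self_adj div_grad_single_valued _ s.ka\<^sub>c(1)])
  show "bounded_linear (%y. flip (conorm_op (adjoint_coeff A) (flip y)))"
  by (rule bounded_linear_compose[OF flip_bl bounded_linear_compose[OF s.conorm_op_bl flip_bl]])
  show "s.ka\<^sub>c * (norm y)^2 <= inner (flip (conorm_op (adjoint_coeff A) (flip y))) y" for y
  using s.ka\<^sub>c(2)[of "flip y"] by (simp add: inner_flip norm_flip)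
 qed
 moreover have "inner (conorm_op A x) y = inner x (flip (conorm_op (adjoint_coeff A) (flip y)))" for x y
 proof -
  define f g where "f = unconorm A x" and "g = unconorm (adjoint_coeff A) (flip y)"
  have x: "x = conormal A (L2_join f)" by (simp add: f_def)
  have "flip y = conormal (adjoint_coeff A) (L2_join g)" by (simp add: g_def)
  then have y: "y = flip (conormal (adjoint_coeff A) (L2_join g))" by (metis flip_flip)
  have "inner (L2_normal (coeff_op A (L2_join f))) (fst g) + inner (L2_tangential (coeff_op A (L2_join f))) (L2_of_field (snd g)) =
  inner (fst f) (L2_normal (coeff_op (adjoint_coeff A) (L2_join g))) + inner (L2_of_field (snd f)) (L2_tangential (coeff_op (adjoint_coeff A) (L2_join g)))"
  using inner_coeff_op_adj[of "L2_join f" "L2_join g"]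
  unfolding inner_L2_parts[of "coeff_op A (L2_join f)"] inner_L2_parts[of "L2_join f"] by simp
  moreover have "inner (cotan A (L2_join f)) (flip (conormal (adjoint_coeff A) (L2_join g))) =
  inner (fst f) (L2_normal (coeff_op (adjoint_coeff A) (L2_join g))) - inner (L2_tangential (coeff_op A (L2_join f))) (L2_of_field (snd g))"
  by (simp add: cotan_def conormal_def flip_def inner_prod_def inner_minus_right inner_field_proj_left field_proj_L2_of_field)
  moreover have "inner (conormal A (L2_join f)) (flip (cotan (adjoint_coeff A) (L2_join g))) =
  inner (L2_normal (coeff_op A (L2_join f))) (fst g) - inner (L2_of_field (snd f)) (L2_tangential (coeff_op (adjoint_coeff A) (L2_join g)))"
  by (simp add: cotan_def conormal_def flip_def inner_prod_def inner_minus_right inner_field_proj_right field_proj_L2_of_field)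
  ultimately show ?thesis unfolding x y flip_flip conorm_op_conorm s.conorm_op_conorm by simp
 qed
 ultimately show ?thesis
  unfolding dual_pair_def dual_pair_axioms_def using coercive_sa_conorm by blast
qed

subsection \<open>Boundary data\<close>

lemma test_intble_locally:
 fixes ps :: "('n::finite) cfun"
 assumes "!!K. compact K ==> ps absolutely_integrable_on K"
 shows "test_intble ps"
 unfolding test_intble_def
proof
 fix ph :: "'n cfun" assume ph: "ph \<in> TF"
 obtain R where R: "0 < R" "!!x. R < norm x ==> ph x = 0" using test_supp[OF ph] by blast
 let ?f = "%x. indicator (cball 0 R) x *: ps x"
 have i: "integrable lebesgue ?f" using assms[of "cball 0 R"] by (simp add: set_integrable_def)
 have "bounded (ph ` cball 0 R)" by (intro compact_imp_bounded compact_continuous_image test_cont ph) simp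
 then obtain M where M: "0 < M" "!!x. x \<in> cball 0 R ==> norm (ph x) <= M" unfolding bounded_pos by blast
 have Ml: "norm (ph x) <= M" for x using M R(2)[of x] by (cases "norm x <= R") auto
 have eq: "(%x. ps x * ph x) = (%x. ?f x * ph x)" using R(2) by (auto simp: fun_eq_iff indicator_def)
 have m: "ph \<in> lmeas" using test_sqi[OF ph] by (simp add: square_integrable_def)
 show "integrable lebesgue (%x. ps x * ph x)" unfolding eq
 proof (rule Bochner_Integration.integrable_bound[of _ "%x. M *: ?f x"])
  show "integrable lebesgue (%x. M *: ?f x)" by (rule integrable_scaleR_right[OF i])
  show "(%x. ?f x * ph x) \<in> lmeas" by (rule borel_measurable_times[OF borel_measurable_integrable[OF i] m])
  show "AEL x. norm (?f x * ph x) <= norm (M *: ?f x)"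
  proof (rule AE_I2)
  fix x
  have "norm (?f x) * norm (ph x) <= norm (?f x) * M" by (intro mult_left_mono Ml norm_ge_zero)
  then show "norm (?f x * ph x) <= norm (M *: ?f x)" using M(1) unfolding norm_mult norm_scaleR by (simp add: mult.commute)
  qed
 qed
qed

lemma weak_gradient_test_intble:
 fixes f :: "real ^ 'n::finite => complex ^ 'n"
 assumes ps: "test_intble ps" and f: "f \<in> lmeas" "AEL x. f x = rep_L2 g x"
 shows "weak_gradient ps f \<longleftrightarrow> (\<forall>ph\<in>TF. \<forall>j. (LIN x. inner (ps x) (pd j ph x)) = - inner (L2_nth g j) (tf ph))"
proof -
 have "test_intble (%x. f x $ j)" for j
  by (rule test_intble_L2[OF sqi_AE[OF nth_AE[OF f]]])
 note iff = weak_gradient_iff_inner[OF ps this]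
 show ?thesis unfolding iff by (simp add: int_inner_test[OF nth_AE[OF f]])
qed

lemma weak_gradient_unique:
 fixes f :: "real ^ 'n::finite => complex ^ 'n"
 assumes ps: "test_intble ps" and g: "weak_gradient ps (rep_L2 g)"
  and f: "f \<in> lmeas" "AEL x. f x = rep_L2 k x"
 shows "weak_gradient ps f \<longleftrightarrow> k = g"
proof
 note G = g[unfolded weak_gradient_test_intble[OF ps rep_L2_meas AE_I2[OF refl]]]
 note F = weak_gradient_test_intble[OF ps f]
 show "weak_gradient ps f" if "k = g" using G unfolding F that .
 assume w: "weak_gradient ps f"
 have "L2_nth k j - L2_nth g j = 0" for j
 proof (rule test_orth_zero)
  fix ph :: "'n cfun" assume ph: "ph \<in> TF"
  show "inner (L2_nth k j - L2_nth g j) (tf ph) = 0"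
  using w[unfolded F, rule_format, OF ph, of j] G[rule_format, OF ph, of j] by (simp add: inner_diff_left)
 qed
 then show "k = g" by (intro L2_nth_eqI) simp
qed

lemma weak_gradient_L2_curl_free:
 fixes g :: "('n::finite) vect"
 assumes ps: "test_intble ps" and g: "weak_gradient ps (rep_L2 g)"
 shows "L2_curl_free g"
 unfolding L2_curl_free_def
proof (intro ballI allI)
 note G = g[unfolded weak_gradient_test_intble[OF ps rep_L2_meas AE_I2[OF refl]], rule_format]
 fix ph :: "'n cfun" and i j assume ph: "ph \<in> TF"
 note t = test_pd[OF test_pd[OF ph]]
 have ae: "AEL x. pd i (pd j ph) x = pd j (pd i ph) x"
  using tf_pd_commute[OF ph, of i j] unfolding tf_def abs_L2_eq_iff[OF test_sqi[OF t] test_sqi[OF t]] .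
 have "(LIN x. inner (ps x) (pd i (pd j ph) x)) = (LIN x. inner (ps x) (pd j (pd i ph) x))"
  by (rule integral_cong_AE) (use ae in \<open>auto intro!: borel_measurable_integrable test_intble_inner ps t elim: eventually_mono\<close>)
 then show "inner (L2_nth g i) (tf (pd j ph)) = inner (L2_nth g j) (tf (pd i ph))"
  using G[OF test_pd[OF ph], of i j] G[OF test_pd[OF ph], of j i] by simp
qed

text \<open>Quadratic estimates make \<open>div_grad\<close> injective, so the range of
  \<open>T\<close> is dense. The second components of range elements are gradients of L2 functions,
  hence every curl-free field is a limit of such gradients and \<open>potential_of_limit\<close>
  applies.\<close>

lemma (in coefficient) potential_exists:
 assumes "quadratic_estimates A"
 shows "\<exists>ps :: real ^ 'n => complex. (\<forall>K. compact K --> ps absolutely_integrable_on K) \<and> weak_gradient ps (rep_L2 (L2_of_field (k :: 'n gfield)))"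
proof -
 interpret q: quadratic_sa div_grad "conorm_op A" ka\<^sub>c by (rule quadratic_sa_conorm[OF assms])
 have "(0, - (k :: 'n gfield)) \<in> closure {y. \<exists>x. (x, y) \<in> co.T}" using q.T_range_dense by blast
 then obtain y where y: "!!n::nat. \<exists>x. (x, y n) \<in> co.T" "y ----> (0, - k)"
  unfolding closure_sequential by blast
 from y(1) obtain x where x: "!!n. (x n, y n) \<in> co.T" by metis
 define a where "a n = fst (conorm_op A (x n))" for n
 define H where "H n = L2_of_field (- snd (y n))" for n
 have "weak_deriv (a n) j (L2_nth (H n) j)" for n j
 proof -
  have "(conorm_op A (x n), y n) \<in> div_grad" using x[of n] by (simp add: co.T_iff)
  then show ?thesis by (cases "conorm_op A (x n)", cases "y n")
  (simp add: div_grad_def a_def H_def uminus_gfield.rep_eq L2_nth_minus)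
 qed
 moreover have "H ----> L2_of_field k"
 proof -
  have "(%n. - snd (y n)) ----> - snd (0 :: 'n scal, - k)" by (intro tendsto_minus tendsto_snd y(2))
  from bounded_linear.tendsto[OF L2_of_field_bl this] show ?thesis by (simp add: H_def[abs_def])
 qed
 ultimately obtain ps where "!!K. compact K ==> ps absolutely_integrable_on K" "weak_gradient ps (rep_L2 (L2_of_field k))"
  by (rule potential_of_limit) blast
 then show ?thesis by blast
qed

text \<open>Gradients of admissible potentials are curl-free, and \<open>potential_exists\<close>
  shows that all curl-free fields occur; so quantifying over potentials amounts to quantifying over
  \<open>gfield\<close>.\<close>

lemma (in coefficient) Reg_well_posed_iff:
 assumes q: "quadratic_estimates A"
  and uniq: "!!X Y x t. trsol div_grad (conorm_op A) X x ==> trsol div_grad (conorm_op A) Y x ==> 0 < t ==> X t = Y t"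
 shows "Reg_well_posed A \<longleftrightarrow> (\<forall>k. \<exists>!x. (\<exists>X. trsol div_grad (conorm_op A) X x) \<and> snd x = k)"
proof -
 have iff: "uniquely_solvable (Reg_solution A ps) \<longleftrightarrow> (\<exists>!x. (\<exists>X. trsol div_grad (conorm_op A) X x) \<and> snd x = k)"
  if ps: "test_intble ps" and k: "weak_gradient ps (rep_L2 (L2_of_field k))" for ps k
 proof -
  have P: "weak_gradient ps (%x. tangential_part (rep_L2 (L2_join h) x)) \<longleftrightarrow> snd (conormal A (L2_join h)) = k" for h
  unfolding weak_gradient_unique[OF ps k rep_part(3,4)]
  by (simp add: conormal_def field_proj_L2_of_field L2_of_field_inject)
  have eq: "Reg_solution A ps = (%F. \<exists>f. solves_with_trace A F f \<and> weak_gradient ps (%x. tangential_part (rep_L2 f x)))"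
  by (simp add: fun_eq_iff Reg_solution_def)
  show ?thesis unfolding eq
  proof (rule uniquely_solvable_iff)
  show "X t = Y t" if "trsol div_grad (conorm_op A) X x" "trsol div_grad (conorm_op A) Y x" "0 < t" for X Y x t
  by (rule uniq[OF that])
  qed (rule P)
 qed
 show ?thesis
 proof
  assume W: "Reg_well_posed A"
  show "\<forall>k. \<exists>!x. (\<exists>X. trsol div_grad (conorm_op A) X x) \<and> snd x = k"
  proof
  fix k :: "'n gfield"
  obtain ps where ps: "\<forall>K. compact K --> ps absolutely_integrable_on K" "weak_gradient ps (rep_L2 (L2_of_field k))"
  using potential_exists[OF q, of k] by (elim exE conjE)
  have "Reg_datum ps" unfolding Reg_datum_def by (intro conjI ps(1) exI[of _ "L2_of_field k"] ps(2))
  with W have "uniquely_solvable (Reg_solution A ps)" by (simp add: Reg_well_posed_def)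
  moreover have "uniquely_solvable (Reg_solution A ps) \<longleftrightarrow> (\<exists>!x. (\<exists>X. trsol div_grad (conorm_op A) X x) \<and> snd x = k)"
  proof (rule iff)
  show "test_intble ps" by (rule test_intble_locally) (use ps(1) in blast)
  show "weak_gradient ps (rep_L2 (L2_of_field k))" by (rule ps(2))
  qed
  ultimately show "\<exists>!x. (\<exists>X. trsol div_grad (conorm_op A) X x) \<and> snd x = k" by (rule rev_iffD1)
  qed
 next
  assume U: "\<forall>k. \<exists>!x. (\<exists>X. trsol div_grad (conorm_op A) X x) \<and> snd x = k"
  show "Reg_well_posed A" unfolding Reg_well_posed_def
  proof (intro allI impI)
  fix ps :: "'n cfun" assume "Reg_datum ps"
  then obtain g where g: "\<forall>K. compact K --> ps absolutely_integrable_on K" "weak_gradient ps (rep_L2 g)"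
  unfolding Reg_datum_def by (elim exE conjE)
  have ps: "test_intble ps" by (rule test_intble_locally[OF g(1)[rule_format]])
  define k where "k = field_of_L2 g"
  have "weak_gradient ps (rep_L2 (L2_of_field k))"
  unfolding k_def L2_of_field_of_L2[OF weak_gradient_L2_curl_free[OF ps g(2)]] by (rule g(2))
  from iff[OF ps this] show "uniquely_solvable (Reg_solution A ps)" using U[rule_format, of k] by (rule iffD2)
  qed
 qed
qed

text \<open>At a trace x = conormal f the operator gives (f_0, (A f)_par). The datum f_0 is thus the
  first coordinate of the image under \<open>conorm_op A\<close>, the component appearing in
  \<open>split_pair_duality\<close>.\<close>

lemma (in coefficient) Neu_perp_well_posed_iff:
 assumes uniq: "!!X Y x t. trsol div_grad (conorm_op A) X x ==> trsol div_grad (conorm_op A) Y x ==> 0 < t ==> X t = Y t"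
 shows "Neu_perp_well_posed A \<longleftrightarrow> (\<forall>h. \<exists>!x. (\<exists>X. trsol div_grad (conorm_op A) X x) \<and> fst (conorm_op A x) = h)"
proof -
 have "uniquely_solvable (Neu_solution A ph) \<longleftrightarrow> (\<exists>!x. (\<exists>X. trsol div_grad (conorm_op A) X x) \<and> fst (conorm_op A x) = ph)" for ph
 proof -
  have N: "(AEL x. normal_part (rep_L2 f x) = rep_L2 ph x) \<longleftrightarrow> L2_normal f = ph" for f
  proof
  assume "AEL x. normal_part (rep_L2 f x) = rep_L2 ph x"
  then have "AEL x. rep_L2 (L2_normal f) x = rep_L2 ph x" using rep_part(2)[of f] by eventually_elim simp
  then show "L2_normal f = ph" by (rule L2_eqI)
  qed (use rep_part(2)[of f] in simp)
  have P: "L2_normal (L2_join h) = ph \<longleftrightarrow> fst (conorm_op A (conormal A (L2_join h))) = ph" for h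
  by (simp add: conorm_op_conorm cotan_def)
  have eq: "Neu_solution A ph = (%F. \<exists>f. solves_with_trace A F f \<and> L2_normal f = ph)"
  by (simp add: fun_eq_iff Neu_solution_def N)
  show ?thesis unfolding eq
  proof (rule uniquely_solvable_iff)
  show "X t = Y t" if "trsol div_grad (conorm_op A) X x" "trsol div_grad (conorm_op A) Y x" "0 < t" for X Y x t
  by (rule uniq[OF that])
  qed (rule P)
 qed
 then show ?thesis unfolding Neu_perp_well_posed_def by simp
qed

lemma (in coefficient) ex1_flip:
 "(\<exists>!x. (\<exists>X. trsol div_grad (conorm_op A) X x) \<and> fst (conorm_op A x) = h) \<longleftrightarrow>
  (\<exists>!y. (\<exists>Y. trsol (neg_graph div_grad) (%y. flip (conorm_op A (flip y))) Y y) \<and> fst (flip (conorm_op A (flip y))) = h)"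
 (is "(\<exists>!x. ?R x) \<longleftrightarrow> (\<exists>!y. ?S y)")
proof -
 have 1: "?S (flip x)" if "?R x" for x using that trsol_flip(1)[of "conorm_op A" _ x] by auto
 have 2: "?R (flip y)" if "?S y" for y using that trsol_flip(2)[of "conorm_op A" _ y] by auto
 show ?thesis
 proof
  assume "\<exists>!x. ?R x"
  then obtain x where x: "?R x" "!!z. ?R z ==> z = x" by (rule ex1E) blast
  show "\<exists>!y. ?S y"
  proof (rule ex1I[of _ "flip x"])
  fix y assume "?S y"
  from x(2)[OF 2[OF this]] show "y = flip x" by (metis flip_flip)
  qed (rule 1[OF x(1)])
 next
  assume "\<exists>!y. ?S y"
  then obtain y where y: "?S y" "!!z. ?S z ==> z = y" by (rule ex1E) blast
  show "\<exists>!x. ?R x"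
  proof (rule ex1I[of _ "flip y"])
  fix x assume "?R x"
  from y(2)[OF 1[OF this]] show "x = flip y" by (metis flip_flip)
  qed (rule 2[OF y(1)])
 qed
qed

theorem proposition2p52:
  fixes A :: "('n::finite) coeff"
  assumes "ess_bounded A"
    and "accretive A"
    and "quadratic_estimates A"
  shows "Reg_well_posed A \<longleftrightarrow> Neu_perp_well_posed (adjoint_coeff A)"
proof -
 obtain ka where ka: "0 < ka" "AEL x. \<forall>v. ka * (norm v)^2 <= inner (A x *v v) v"
  using assms(2) unfolding accretive_def inner_eq_hermitian by blast
 interpret a: coefficient A ka by (rule coefficient.intro[OF assms(1) ka])
 interpret s: coefficient "adjoint_coeff A" ka by (rule a.adj_coeff)
 interpret q: quadratic_sa div_grad "conorm_op A" a.ka\<^sub>c by (rule a.quadratic_sa_conorm[OF assms(3)])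
 let ?B' = "%y. flip (conorm_op (adjoint_coeff A) (flip y))"
 have sp: "split_pair div_grad (conorm_op A) a.ka\<^sub>c ?B' s.ka\<^sub>c"
  by (rule dual_pair_split_pair[OF a.dual_pair_conorm q.weak_square_sa_axioms])
 \<comment> \<open>Uniqueness for the adjoint coefficients is the statement on
   \<open>traces'\<close>, carried over by \<open>flip\<close>.\<close>
 have uniq: "X t = Y t" if "trsol div_grad (conorm_op (adjoint_coeff A)) X x"
  "trsol div_grad (conorm_op (adjoint_coeff A)) Y x" "0 < t" for X Y x t
 proof -
  have "flip (X t) = flip (Y t)"
  by (rule split_pair.trsol_unique'[OF sp trsol_flip(1)[OF that(1)] trsol_flip(1)[OF that(2)] that(3)])
  then show ?thesis by (metis flip_flip)
 qed
 have "Reg_well_posed A \<longleftrightarrow> (\<forall>k. \<exists>!f. (\<exists>F. trsol div_grad (conorm_op A) F f) \<and> snd f = k)"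
 proof (rule a.Reg_well_posed_iff[OF assms(3)])
  show "X t = Y t" if "trsol div_grad (conorm_op A) X x" "trsol div_grad (conorm_op A) Y x" "0 < t" for X Y x t
  by (rule split_pair.trsol_unique[OF sp that])
 qed
 also have "\<dots> \<longleftrightarrow> (\<forall>h. \<exists>!g. (\<exists>G. trsol (neg_graph div_grad) ?B' G g) \<and> fst (?B' g) = h)"
  by (rule split_pair_duality[OF sp])
 also have "\<dots> \<longleftrightarrow> Neu_perp_well_posed (adjoint_coeff A)"
  unfolding s.ex1_flip[symmetric]
 proof (rule s.Neu_perp_well_posed_iff[symmetric])
  show "X t = Y t" if "trsol div_grad (conorm_op (adjoint_coeff A)) X x"
  "trsol div_grad (conorm_op (adjoint_coeff A)) Y x" "0 < t" for X Y x t
  by (rule uniq[OF that])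
 qed
 finally show ?thesis .
qed

end
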